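(* Let $Q=1$ be a quadratic equation in a free group $F_A$, where $Q\in F_{A\cup X}$ is a quadratic word. Then every parametric solution of $Q=1$ has a generalization $\eta$ such that for every variable $x$ occurring in $Q$, $$ |x^\eta| \le \begin{cases} 40\, n(Q)\,\bigl(c(Q)+2n(Q)\bigr) & \text{if } Q \text{ is orientable},\\ 150\, n(Q)^2\,\bigl(c(Q)+2n(Q)\bigr) & \text{if } Q \text{ is non-orientable}; \end{cases} $$ and if $Q$ is standard orientable, respectively semi-standard non-orientable, then every parametric solution of $Q=1$ has a generalization $\eta$ such that for every variable $x$ occurring in $Q$, $$ |x^\eta| \le 8\,\bigl(c(Q)+2n(Q)\bigr),\qquad\text{respectively}\qquad |x^\eta|\le 36\, n(Q)\,\bigl(c(Q)+2n(Q)\bigr). $$ In particular, there is a finite set of basic parametric solutions of $Q=1$ satisfying this bound.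
   Context: $F_Y$ denotes the free group on a set $Y$. $A$ is the alphabet of constants, $X$ a countable (infinite) set of variables, $T$ an infinite alphabet of parameters; $A,X,T$ are pairwise disjoint. A quadratic word is a (freely reduced) word $Q\in F_{A\cup X}$ such that every variable occurring in $Q$ (as $x$ or $x^{-1}$) occurs precisely twice. It is orientable if every variable occurring in $Q$ occurs once as $x$ and once as $x^{-1}$, and non-orientable otherwise. $\mathrm{Var}(Q)$ is the set of variables occurring in $Q$, $n(Q)=|\mathrm{Var}(Q)|$, and $c(Q)$ is the total length of the coefficients of $Q$ (number of occurrences of letters of $A^{\pm1}$ in $Q$). $[a,b]=a^{-1}b^{-1}ab$. Standard orientable words: $[x_1,y_1]\cdots[x_g,y_g]$ $(g\ge 0)$ or $[x_1,y_1]\cdots[x_g,y_g]\,c_1 z_2^{-1}c_2z_2\cdots z_m^{-1}c_mz_m$ $(g\ge 0,m\ge 1)$. Semi-standard non-orientable words: $x_1^2\cdots x_k^2[x_{k+1},y_{k+1}]\cdots[x_n,y_n]$ or $x_1^2\cdots x_k^2[x_{k+1},y_{k+1}]\cdots[x_n,y_n]\,c_1z_2^{-1}c_2z_2\cdots z_m^{-1}c_mz_m$ with $k\ge1$, $m\ge 1$, where the commutator factors need not be present. Here $x_i,y_i,z_i$ are distinct variables and $1\ne c_i\in F_A$. An $F_A$-homomorphism is a homomorphism which is the identity on $F_A$. Maps are written as exponents and composed from left to right: $x^{\phi\eta}=(x^\phi)^\eta$. A solution of $Q=1$ is here an $F_A$-homomorphism $F_{A\cup\mathrm{Var}(Q)}\to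 F_A$ sending $Q$ to $1$. A parametric solution of $Q=1$ is an $F_A$-homomorphism $\eta:F_{A\cup\mathrm{Var}(Q)}\to F_{A\cup T}$ with $Q^\eta=1$. $\mathrm{Stab}(Q)$ is the group of all $F_A$-automorphisms $\phi$ of $F_{A\cup\mathrm{Var}(Q)}$ such that $Q^\phi$ is conjugate to $Q$. A parametric solution $\eta$ is a generalization of a parametric solution $\theta$ of the same equation if $\theta=\phi\eta\omega$ for some $\phi\in\mathrm{Stab}(Q)$ and some $F_A$-endomorphism $\omega$ of $F_{A\cup T}$. Put $\mathrm{Sol}(\eta)=\{\phi\eta\omega \mid \phi\in\mathrm{Stab}(Q),\ \omega:F_{A\cup T}\to F_A \text{ an } F_A\text{-homomorphism}\}$. A set $\{\eta_i\}$ of parametric solutions is a set of basic parametric solutions if the set of all solutions of $Q=1$ equals $\bigcup_i\mathrm{Sol}(\eta_i)$. $|x^\eta|$ is the length of the freely reduced word over $A\cup T$ representing $x^\eta$. *)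

theory Defs
  imports "HOL-Algebra.Bij" "HOL-Library.Countable_Set"
begin

section \<open>Free groups\<close>

text \<open>The letter \<open>(a, True)\<close> stands for \<open>a\<close> and \<open>(a, False)\<close> for \<open>a\<^sup>-\<^sup>1\<close>. The free group on a set \<open>Y\<close>
  is modelled by the freely reduced words over \<open>Y\<close>, so that \<open>length\<close> is the length of a group
  element and \<open>F\<^sub>Y\<close> is literally a subset of \<open>F\<^sub>Z\<close> whenever \<open>Y \<subseteq> Z\<close>.\<close>

type_synonym 's word = "('s \<times> bool) list"

definition letter_inv :: "'s \<times> bool \<Rightarrow> 's \<times> bool" where
  "letter_inv l = (fst l, \<not> snd l)"

definition freely_reduced :: "'s word \<Rightarrow> bool" where
  "freely_reduced w \<longleftrightarrow> successively (\<lambda>l m. m \<noteq> letter_inv l) w"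

fun cons_red :: "'s \<times> bool \<Rightarrow> 's word \<Rightarrow> 's word" where
  "cons_red l [] = [l]"
| "cons_red l (m # w) = (if m = letter_inv l then w else l # m # w)"

definition free_group :: "'s set \<Rightarrow> 's word monoid" where
  "free_group Y = \<lparr>carrier = {w. freely_reduced w \<and> fst ` set w \<subseteq> Y},
                   mult = (\<lambda>u v. foldr cons_red u v), one = []\<rparr>"

lemma letter_inv_inv [simp]: "letter_inv (letter_inv l) = l"
  by (simp add: letter_inv_def)

lemma fst_letter_inv [simp]: "fst (letter_inv l) = fst l"
  by (simp add: letter_inv_def)

lemma letter_inv_neq [simp]: "letter_inv l \<noteq> l" "l \<noteq> letter_inv l"
  by (cases l; simp add: letter_inv_def)+

lemma freely_reduced_Nil [simp]: "freely_reduced []"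
  by (simp add: freely_reduced_def)

lemma freely_reduced_ConsD: "freely_reduced (l # w) \<Longrightarrow> freely_reduced w"
  by (cases w) (auto simp: freely_reduced_def)

lemma freely_reduced_cons_red: "freely_reduced w \<Longrightarrow> freely_reduced (cons_red l w)"
  by (cases w) (auto simp: freely_reduced_def dest: freely_reduced_ConsD[unfolded freely_reduced_def])

lemma freely_reduced_foldr: "freely_reduced v \<Longrightarrow> freely_reduced (foldr cons_red u v)"
  by (induction u) (auto intro: freely_reduced_cons_red)

lemma letters_cons_red: "fst ` set (cons_red l w) \<subseteq> insert (fst l) (fst ` set w)"
  by (cases w) auto

lemma letters_foldr: "fst ` set (foldr cons_red u v) \<subseteq> fst ` set u \<union> fst ` set v"
proof (induction u)
  case (Cons l u)
  have "fst ` set (foldr cons_red (l # u) v) \<subseteq> insert (fst l) (fst ` set (foldr cons_red u v))"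
    using letters_cons_red by simp
  also have "\<dots> \<subseteq> insert (fst l) (fst ` set u \<union> fst ` set v)"
    by (rule insert_mono[OF Cons.IH])
  finally show ?case by simp
qed simp

lemma cons_red_cancel: "freely_reduced w \<Longrightarrow> cons_red l (cons_red (letter_inv l) w) = w"
proof (cases w)
  case (Cons m v)
  moreover assume "freely_reduced w"
  ultimately show ?thesis
    by (cases v) (auto simp: freely_reduced_def)
qed simp

lemma foldr_cons_red:
  "freely_reduced w \<Longrightarrow> foldr cons_red (cons_red l u) w = cons_red l (foldr cons_red u w)"
proof (cases u)
  case (Cons m v)
  assume w: "freely_reduced w"
  show ?thesis
    using Cons cons_red_cancel[OF freely_reduced_foldr[OF w, of v], of l] by auto
qed simp

lemma foldr_cons_red_assoc:
  "freely_reduced w \<Longrightarrow> foldr cons_red (foldr cons_red u v) w = foldr cons_red u (foldr cons_red v w)"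
  by (induction u) (auto simp: foldr_cons_red)

lemma foldr_cons_red_inverse: "foldr cons_red (map letter_inv (rev w)) w = []"
proof -
  have "foldr cons_red (map letter_inv (rev w)) (w @ v) = v" for v
    by (induction w) auto
  from this[of "[]"] show ?thesis by simp
qed

lemma group_free_group: "group (free_group Y)"
proof (rule groupI)
  fix x assume x: "x \<in> carrier (free_group Y)"
  let ?y = "foldr cons_red (map letter_inv (rev x)) []"
  have "fst ` set ?y \<subseteq> Y"
    using subset_trans[OF letters_foldr[of "map letter_inv (rev x)" "[]"], of Y] x
    by (simp add: free_group_def image_image)
  moreover have "foldr cons_red ?y x = []"
    using x foldr_cons_red_assoc[of x "map letter_inv (rev x)" "[]"] foldr_cons_red_inverse[of x]
    by (simp add: free_group_def)
  ultimately show "\<exists>y\<in>carrier (free_group Y). y \<otimes>\<^bsub>free_group Y\<^esub> x = \<one>\<^bsub>free_group Y\<^esub>"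
    by (intro bexI[of _ ?y]) (auto simp: free_group_def freely_reduced_foldr)
next
  fix x y assume "x \<in> carrier (free_group Y)" "y \<in> carrier (free_group Y)"
  then show "x \<otimes>\<^bsub>free_group Y\<^esub> y \<in> carrier (free_group Y)"
    using subset_trans[OF letters_foldr[of x y], of Y]
    by (simp add: free_group_def freely_reduced_foldr)
qed (auto simp: free_group_def foldr_cons_red_assoc)

text \<open>Homomorphisms are extensional functions on the carrier, as in \<^const>\<open>auto\<close>, so that equality
  of homomorphisms is equality of functions.\<close>

definition FA_homs :: "'s set \<Rightarrow> 's set \<Rightarrow> 's set \<Rightarrow> ('s word \<Rightarrow> 's word) set" where
  "FA_homs A Y Z = {\<phi> \<in> hom (free_group Y) (free_group Z) \<inter> extensional (carrier (free_group Y)).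
                      \<forall>w \<in> carrier (free_group A). \<phi> w = w}"

definition FA_auts :: "'s set \<Rightarrow> 's set \<Rightarrow> ('s word \<Rightarrow> 's word) set" where
  "FA_auts A Y = {\<phi> \<in> auto (free_group Y). \<forall>w \<in> carrier (free_group A). \<phi> w = w}"

definition conjugate_in :: "('a, 'b) monoid_scheme \<Rightarrow> 'a \<Rightarrow> 'a \<Rightarrow> bool" where
  "conjugate_in G u v \<longleftrightarrow> (\<exists>g \<in> carrier G. u = inv\<^bsub>G\<^esub> g \<otimes>\<^bsub>G\<^esub> v \<otimes>\<^bsub>G\<^esub> g)"


section \<open>Quadratic words\<close>

definition Vars :: "'s set \<Rightarrow> 's word \<Rightarrow> 's set" where
  "Vars X Q = {x \<in> X. x \<in> fst ` set Q}"

definition nvars :: "'s set \<Rightarrow> 's word \<Rightarrow> nat" where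
  "nvars X Q = card (Vars X Q)"

definition coeff_length :: "'s set \<Rightarrow> 's word \<Rightarrow> nat" where
  "coeff_length A Q = length (filter (\<lambda>l. fst l \<in> A) Q)"

definition quadratic_word :: "'s set \<Rightarrow> 's set \<Rightarrow> 's word \<Rightarrow> bool" where
  "quadratic_word A X Q \<longleftrightarrow> Q \<in> carrier (free_group (A \<union> X)) \<and>
     (\<forall>x \<in> Vars X Q. count_list Q (x, True) + count_list Q (x, False) = 2)"

definition orientable :: "'s set \<Rightarrow> 's word \<Rightarrow> bool" where
  "orientable X Q \<longleftrightarrow>
     (\<forall>x \<in> Vars X Q. count_list Q (x, True) = 1 \<and> count_list Q (x, False) = 1)"

text \<open>The word \<open>[x\<^sub>1,y\<^sub>1]\<dots>[x\<^sub>g,y\<^sub>g]\<close> for a list of pairs of variables, where \<open>[a,b] = a\<^sup>-\<^sup>1 b\<^sup>-\<^sup>1 a b\<close>.\<close>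
definition commutators :: "('s \<times> 's) list \<Rightarrow> 's word" where
  "commutators ps = concat (map (\<lambda>(x, y). [(x, False), (y, False), (x, True), (y, True)]) ps)"

definition squares :: "'s list \<Rightarrow> 's word" where
  "squares xs = concat (map (\<lambda>x. [(x, True), (x, True)]) xs)"

text \<open>The word \<open>c\<^sub>1 z\<^sub>2\<^sup>-\<^sup>1 c\<^sub>2 z\<^sub>2 \<dots> z\<^sub>m\<^sup>-\<^sup>1 c\<^sub>m z\<^sub>m\<close>, given \<open>c\<^sub>1\<close> and the list of pairs \<open>(z\<^sub>i, c\<^sub>i)\<close> for \<open>i \<ge> 2\<close>.\<close>
definition coeff_part :: "'s word \<Rightarrow> ('s \<times> 's word) list \<Rightarrow> 's word" where
  "coeff_part c1 zcs = c1 @ concat (map (\<lambda>(z, c). [(z, False)] @ c @ [(z, True)]) zcs)"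

definition nontrivial_coeff :: "'s set \<Rightarrow> 's word \<Rightarrow> bool" where
  "nontrivial_coeff A c \<longleftrightarrow> c \<in> carrier (free_group A) \<and> c \<noteq> \<one>\<^bsub>free_group A\<^esub>"

text \<open>In the following two definitions the concatenations are freely reduced as they stand, so they
  coincide with the products in the free group.\<close>

definition standard_orientable :: "'s set \<Rightarrow> 's set \<Rightarrow> 's word \<Rightarrow> bool" where
  "standard_orientable A X Q \<longleftrightarrow>
     (\<exists>ps. distinct (map fst ps @ map snd ps) \<and> set (map fst ps @ map snd ps) \<subseteq> X \<and>
           Q = commutators ps) \<or>
     (\<exists>ps c1 zcs. distinct (map fst ps @ map snd ps @ map fst zcs) \<and>
           set (map fst ps @ map snd ps @ map fst zcs) \<subseteq> X \<and>
           (\<forall>c \<in> insert c1 (snd ` set zcs). nontrivial_coeff A c) \<and>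
           Q = commutators ps @ coeff_part c1 zcs)"

definition semistandard_nonorientable :: "'s set \<Rightarrow> 's set \<Rightarrow> 's word \<Rightarrow> bool" where
  "semistandard_nonorientable A X Q \<longleftrightarrow>
     (\<exists>xs ps. xs \<noteq> [] \<and> distinct (xs @ map fst ps @ map snd ps) \<and>
           set (xs @ map fst ps @ map snd ps) \<subseteq> X \<and>
           Q = squares xs @ commutators ps) \<or>
     (\<exists>xs ps c1 zcs. xs \<noteq> [] \<and> distinct (xs @ map fst ps @ map snd ps @ map fst zcs) \<and>
           set (xs @ map fst ps @ map snd ps @ map fst zcs) \<subseteq> X \<and>
           (\<forall>c \<in> insert c1 (snd ` set zcs). nontrivial_coeff A c) \<and>
           Q = squares xs @ commutators ps @ coeff_part c1 zcs)"


section \<open>Solutions and parametric solutions\<close>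

definition solutions :: "'s set \<Rightarrow> 's set \<Rightarrow> 's word \<Rightarrow> ('s word \<Rightarrow> 's word) set" where
  "solutions A X Q = {\<alpha> \<in> FA_homs A (A \<union> Vars X Q) A. \<alpha> Q = \<one>\<^bsub>free_group A\<^esub>}"

definition param_solutions ::
    "'s set \<Rightarrow> 's set \<Rightarrow> 's set \<Rightarrow> 's word \<Rightarrow> ('s word \<Rightarrow> 's word) set" where
  "param_solutions A X T Q =
     {\<eta> \<in> FA_homs A (A \<union> Vars X Q) (A \<union> T). \<eta> Q = \<one>\<^bsub>free_group (A \<union> T)\<^esub>}"

definition Stab :: "'s set \<Rightarrow> 's set \<Rightarrow> 's word \<Rightarrow> ('s word \<Rightarrow> 's word) set" where
  "Stab A X Q = {\<phi> \<in> FA_auts A (A \<union> Vars X Q). conjugate_in (free_group (A \<union> Vars X Q)) (\<phi> Q) Q}"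

text \<open>The left-to-right composition \<open>\<phi>\<eta>\<omega>\<close>: first \<open>\<phi>\<close>, then \<open>\<eta>\<close>, then \<open>\<omega>\<close>.\<close>
definition comp3 :: "'s set \<Rightarrow> ('s word \<Rightarrow> 's word) \<Rightarrow> ('s word \<Rightarrow> 's word) \<Rightarrow>
    ('s word \<Rightarrow> 's word) \<Rightarrow> 's word \<Rightarrow> 's word" where
  "comp3 Y \<phi> \<eta> \<omega> = (\<lambda>w \<in> carrier (free_group Y). \<omega> (\<eta> (\<phi> w)))"

definition is_generalization :: "'s set \<Rightarrow> 's set \<Rightarrow> 's set \<Rightarrow> 's word \<Rightarrow>
    ('s word \<Rightarrow> 's word) \<Rightarrow> ('s word \<Rightarrow> 's word) \<Rightarrow> bool" where
  "is_generalization A X T Q \<eta> \<theta> \<longleftrightarrow>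
     \<eta> \<in> param_solutions A X T Q \<and> \<theta> \<in> param_solutions A X T Q \<and>
     (\<exists>\<phi> \<in> Stab A X Q. \<exists>\<omega> \<in> FA_homs A (A \<union> T) (A \<union> T). \<theta> = comp3 (A \<union> Vars X Q) \<phi> \<eta> \<omega>)"

definition Sol :: "'s set \<Rightarrow> 's set \<Rightarrow> 's set \<Rightarrow> 's word \<Rightarrow>
    ('s word \<Rightarrow> 's word) \<Rightarrow> ('s word \<Rightarrow> 's word) set" where
  "Sol A X T Q \<eta> =
     {comp3 (A \<union> Vars X Q) \<phi> \<eta> \<omega> | \<phi> \<omega>. \<phi> \<in> Stab A X Q \<and> \<omega> \<in> FA_homs A (A \<union> T) A}"

definition basic_param_solutions :: "'s set \<Rightarrow> 's set \<Rightarrow> 's set \<Rightarrow> 's word \<Rightarrow>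
    ('s word \<Rightarrow> 's word) set \<Rightarrow> bool" where
  "basic_param_solutions A X T Q B \<longleftrightarrow>
     B \<subseteq> param_solutions A X T Q \<and> solutions A X Q = (\<Union>\<eta> \<in> B. Sol A X T Q \<eta>)"

definition bounded_on_vars :: "'s set \<Rightarrow> 's word \<Rightarrow> nat \<Rightarrow> ('s word \<Rightarrow> 's word) \<Rightarrow> bool" where
  "bounded_on_vars X Q N \<eta> \<longleftrightarrow> (\<forall>x \<in> Vars X Q. length (\<eta> [(x, True)]) \<le> N)"

end

(* By an automorphism the equation is brought to a normal form: a product of squares, commutators and
   conjugates of coefficients. Every occurrence of a coefficient letter becomes a symbol of its own, and
   Nielsen moves slide the symbols until the solution of the resulting quadratic word W factors through
   the map eta that sends each variable to 1 or to a parameter of its own. So eta is short on the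
   variables of W, and it remains to bound an automorphism that takes the original normal form to W.

   W is brought back to a normal form with linear control of the automorphism. To see that this is the
   original normal form, colour the ends of the symbols such that W is a closed path; in the normal form
   each coefficient is a cycle of colours, and the other colours are then forced. Existence and uniqueness
   of the colouring survive all moves, so the holes of the new normal form are the old coefficients up to
   cyclic rotation, inversion and order, and the number of handles and squares is determined up to
   trading one handle for two squares. Undoing inversions and trades costs a factor n, and both
   occur only in the non-orientable case. *)

theory Submission
  imports Defs "HOL-Library.Multiset"
begin

section \<open>Reduced words as a type-class group, and evaluation of unreduced words in
  groups\<close>

section \<open>Free groups as an additive type\<close>

text \<open>The chain of Nielsen moves has no bounded length, so the automorphism that it yields is
  never estimated. A generalization may absorb any element of the stabilizer, so this automorphism
  is followed by the inverse of a short one, which makes it stabilize the normal form, and the short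
  one is put in front of the trivial-or-parameter map; only that second half is measured. The short
  automorphism exists only if the word reached has the same coefficients as the given normal form.
  Words alone do not show this, because coefficients may share letters; with one symbol per
  occurrence and colours at its ends, the boundary cycles become rigid. Constants: the normal form
  has weight N = c + 2n. Returning to a normal form costs at most 4N per variable, trades and sign
  changes raise this to at most 35nN, and passing to the given word multiplies by 4n (a variable is
  a quotient of two prefixes) and adds 2c. For standard words this last step adds only the length of
  one coefficient. The stated bounds leave some room.\<close>

definition winv :: "'a word \<Rightarrow> 'a word" where
  "winv w = map letter_inv (rev w)"

lemma winv_simps [simp]:
  "winv [] = []" "winv (u @ v) = winv v @ winv u" "winv [l] = [letter_inv l]"
  "winv (winv w) = w" "length (winv w) = length w" "winv w = [] \<longleftrightarrow> w = []"
  by (auto simp: winv_def rev_map comp_def)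

lemma winv_Cons: "winv (l # w) = winv w @ [letter_inv l]"
  by (simp add: winv_def)

lemma mset_fst_winv [simp]: "mset (map fst (winv w)) = mset (map fst w)"
  by (induction w) (auto simp: winv_Cons)

lemma fst_set_winv [simp]: "fst ` set (winv w) = fst ` set w"
  by (auto simp: winv_def image_image)

lemma letter_inv_eq_iff: "letter_inv l = m \<longleftrightarrow> l = letter_inv m"
  by (metis letter_inv_inv)

lemma freely_reduced_append:
  "freely_reduced (u @ v) \<longleftrightarrow> freely_reduced u \<and> freely_reduced v \<and>
     (u \<noteq> [] \<longrightarrow> v \<noteq> [] \<longrightarrow> hd v \<noteq> letter_inv (last u))"
  by (auto simp: freely_reduced_def successively_append_iff)

lemma freely_reduced_winv [simp]: "freely_reduced (winv w) \<longleftrightarrow> freely_reduced w"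
proof -
  have *: "freely_reduced w \<Longrightarrow> freely_reduced (winv w)" for w :: "'a word"
  proof (induction w)
    case (Cons l w)
    then have "freely_reduced w" by (auto dest: freely_reduced_ConsD)
    moreover have "w \<noteq> [] \<Longrightarrow> hd w \<noteq> letter_inv l"
      using Cons.prems by (cases w) (auto simp: freely_reduced_def)
    ultimately show ?case
      using Cons.IH
      by (auto simp: winv_Cons freely_reduced_append letter_inv_eq_iff winv_def last_map last_rev
            freely_reduced_def[of "[_]"])
  qed simp
  from *[of w] *[of "winv w"] show ?thesis by auto
qed

text \<open>A type of reduced words over all symbols makes the free group a member of
  \<open>group_add\<close>, a class without commutativity, so identities between products of words
  become simplifier problems free of carrier conditions. The alphabets return only at the
  end.\<close>

typedef 'a fgrp = "{w :: 'a word. freely_reduced w}" morphisms rep Fg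
  by (rule exI[of _ "[]"]) simp

lemma freely_reduced_rep [simp]: "freely_reduced (rep g)"
  using rep[of g] by simp

lemma rep_Fg: "freely_reduced w \<Longrightarrow> rep (Fg w) = w"
  by (simp add: Fg_inverse)

lemma foldr_cons_red_winv: "freely_reduced w \<Longrightarrow> foldr cons_red (winv w) w = []"
  by (simp add: winv_def foldr_cons_red_inverse)

lemma foldr_cons_red_reduced: "freely_reduced (u @ v) \<Longrightarrow> foldr cons_red u v = u @ v"
proof (induction u)
  case (Cons l u)
  then show ?case
    by (cases "u @ v") (auto simp: freely_reduced_def)
qed simp

lemma foldr_cons_red_Nil: "freely_reduced u \<Longrightarrow> foldr cons_red u [] = u"
  using foldr_cons_red_reduced[of u "[]"] by simp

instantiation fgrp :: (type) group_add
begin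
definition zero_fgrp :: "'a fgrp" where "zero_fgrp = Fg []"
definition plus_fgrp :: "'a fgrp \<Rightarrow> 'a fgrp \<Rightarrow> 'a fgrp" where
  "plus_fgrp g h = Fg (foldr cons_red (rep g) (rep h))"
definition uminus_fgrp :: "'a fgrp \<Rightarrow> 'a fgrp" where "uminus_fgrp g = Fg (winv (rep g))"
definition minus_fgrp :: "'a fgrp \<Rightarrow> 'a fgrp \<Rightarrow> 'a fgrp" where "minus_fgrp g h = g + - h"
instance
proof
  fix a b c :: "'a fgrp"
  show "a + b + c = a + (b + c)"
    by (simp add: plus_fgrp_def rep_Fg freely_reduced_foldr foldr_cons_red_assoc)
  show "0 + a = a" "a + 0 = a"
    by (simp_all add: plus_fgrp_def zero_fgrp_def rep_Fg rep_inverse foldr_cons_red_Nil)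
  show "- a + a = 0"
    by (simp add: plus_fgrp_def zero_fgrp_def uminus_fgrp_def rep_Fg foldr_cons_red_winv)
  show "a + - b = a - b"
    by (simp only: minus_fgrp_def)
qed
end

lemma rep_plus: "rep (g + h) = foldr cons_red (rep g) (rep h)"
  by (simp add: plus_fgrp_def rep_Fg freely_reduced_foldr)

lemma rep_zero [simp]: "rep 0 = []"
  by (simp add: zero_fgrp_def rep_Fg)

lemma rep_uminus: "rep (- g) = winv (rep g)"
  by (simp add: uminus_fgrp_def rep_Fg)

lemma rep_eq_Nil_iff [simp]: "rep g = [] \<longleftrightarrow> g = 0"
  using rep_inject[of g 0] by simp

definition gen :: "'a \<Rightarrow> 'a fgrp" where "gen x = Fg [(x, True)]"

lemma rep_gen: "rep (gen x) = [(x, True)]"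
  by (simp add: gen_def rep_Fg freely_reduced_def)

lemma gen_neq_0 [simp]: "gen x \<noteq> 0"
  using rep_gen[of x] rep_zero by (metis list.distinct(1))

lemma gen_inj [simp]: "gen x = gen y \<longleftrightarrow> x = y"
  by (metis rep_gen list.inject prod.inject)

definition sgn_of :: "('a \<Rightarrow> 'g::group_add) \<Rightarrow> 'a \<times> bool \<Rightarrow> 'g" where
  "sgn_of f l = (if snd l then f (fst l) else - f (fst l))"

text \<open>Words are deliberately left unreduced in what follows: occurrences of symbols must stay
  countable and must survive substitutions. Only their values live in a group, and
  \<open>cls\<close> is the value in the free group itself.\<close>

primrec ev :: "('a \<Rightarrow> 'g::group_add) \<Rightarrow> 'a word \<Rightarrow> 'g" where
  "ev f [] = 0"
| "ev f (l # w) = sgn_of f l + ev f w"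

lemma sgn_of_simps [simp]:
  "sgn_of f (x, True) = f x" "sgn_of f (x, False) = - f x" "sgn_of f (letter_inv l) = - sgn_of f l"
  by (auto simp: sgn_of_def letter_inv_def)

lemma ev_append [simp]: "ev f (u @ v) = ev f u + ev f v"
  by (induction u) (auto simp: add.assoc)

lemma ev_winv [simp]: "ev f (winv w) = - ev f w"
  by (induction w) (auto simp: winv_Cons minus_add)

lemma ev_cons_red: "ev f (cons_red l w) = sgn_of f l + ev f w"
  by (cases w) (auto simp: add.assoc[symmetric])

lemma ev_foldr_cons_red: "ev f (foldr cons_red u v) = ev f u + ev f v"
  by (induction u) (auto simp: ev_cons_red add.assoc)

lemma ev_cong: "(\<And>x. x \<in> fst ` set w \<Longrightarrow> f x = g x) \<Longrightarrow> ev f w = ev g w"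
  by (induction w) (auto simp: sgn_of_def)

abbreviation cls :: "'a word \<Rightarrow> 'a fgrp" where "cls \<equiv> ev gen"

lemma cls_reduced: "freely_reduced w \<Longrightarrow> cls w = Fg w"
proof (induction w)
  case Nil
  then show ?case by (simp add: zero_fgrp_def)
next
  case (Cons l w)
  have w: "freely_reduced w" using Cons.prems by (rule freely_reduced_ConsD)
  have l: "rep (sgn_of gen l) = [l]"
    by (cases l; cases "snd l")
      (auto simp: rep_uminus rep_gen letter_inv_def winv_def)
  have "sgn_of gen l + Fg w = Fg (l # w)"
    unfolding plus_fgrp_def l using w Cons.prems
    by (cases w) (auto simp: rep_Fg freely_reduced_def)
  with Cons.IH[OF w] show ?case by simp
qed

lemma cls_rep [simp]: "cls (rep g) = g"
  by (simp add: cls_reduced rep_inverse)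

lemma rep_cls: "freely_reduced w \<Longrightarrow> rep (cls w) = w"
  by (simp add: cls_reduced rep_Fg)

text \<open>The universal property of the free group: the homomorphic extension of a map on
  generators.\<close>

definition lift :: "('a \<Rightarrow> 'g::group_add) \<Rightarrow> 'a fgrp \<Rightarrow> 'g" where "lift f g = ev f (rep g)"

lemma lift_plus [simp]: "lift f (g + h) = lift f g + lift f h"
  by (simp add: lift_def rep_plus ev_foldr_cons_red)

lemma lift_zero [simp]: "lift f 0 = 0"
  by (simp add: lift_def)

lemma lift_uminus [simp]: "lift f (- g) = - lift f g"
  by (simp add: lift_def rep_uminus)

lemma lift_gen [simp]: "lift f (gen x) = f x"
  by (simp add: lift_def rep_gen)

lemma lift_sgn [simp]: "lift f (sgn_of gen l) = sgn_of f l"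
  by (simp add: sgn_of_def)

lemma lift_ev: "lift f (ev g w) = ev (\<lambda>x. lift f (g x)) w"
  by (induction w) (auto simp: sgn_of_def)

lemma lift_cls [simp]: "lift f (cls w) = ev f w"
  by (simp add: lift_ev)

lemma lift_gen_id [simp]: "lift gen g = g"
  by (simp add: lift_def)

lemma lift_lift: "lift f (lift g a) = lift (\<lambda>x. lift f (g x)) a"
  by (simp add: lift_def[of g] lift_ev lift_def[of "\<lambda>x. lift f (g x)"])

lemma cls_letters: "fst ` set (rep (cls w)) \<subseteq> fst ` set w"
proof (induction w)
  case (Cons l w)
  have l: "rep (sgn_of gen l) = [l]"
    by (cases l; cases "snd l") (auto simp: rep_uminus rep_gen letter_inv_def winv_def)
  have "fst ` set (rep (cls (l # w))) \<subseteq> insert (fst l) (fst ` set (rep (cls w)))"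
    using letters_cons_red by (simp add: rep_plus l)
  also have "\<dots> \<subseteq> insert (fst l) (fst ` set w)"
    by (rule insert_mono[OF Cons.IH])
  finally show ?case by simp
qed simp

section \<open>Lengths of products and maximal cancellation between two factors\<close>

section \<open>Lengths and cancellation\<close>

definition len :: "'a fgrp \<Rightarrow> nat" where "len g = length (rep g)"

lemma len_zero [simp]: "len 0 = 0" by (simp add: len_def)
lemma len_eq_0 [simp]: "len g = 0 \<longleftrightarrow> g = 0" by (simp add: len_def)
lemma len_uminus [simp]: "len (- g) = len g" by (simp add: len_def rep_uminus)
lemma len_gen [simp]: "len (gen x) = 1" by (simp add: len_def rep_gen)

lemma length_cons_red: "length (cons_red l w) \<le> Suc (length w)"
  by (cases w) auto

lemma len_plus: "len (g + h) \<le> len g + len h"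
proof -
  have "length (foldr cons_red u v) \<le> length u + length v" for u v :: "'a word"
  proof (induction u)
    case (Cons l u)
    show ?case using length_cons_red[of l "foldr cons_red u v"] Cons.IH by simp
  qed simp
  then show ?thesis by (simp add: len_def rep_plus)
qed

lemma len_sgn [simp]: "len (sgn_of f l) = len (f (fst l))"
  by (simp add: sgn_of_def)

lemma len_ev: "len (ev f w) \<le> sum_list (map (\<lambda>l. len (f (fst l))) w)"
proof (induction w)
  case (Cons l w)
  then show ?case using len_plus[of "sgn_of f l" "ev f w"] by simp
qed simp

lemma cancellation:
  assumes "freely_reduced u" "freely_reduced v"
  obtains a c b where "u = a @ c" "v = winv c @ b" "freely_reduced (a @ b)"
  using assms
proof (induction u arbitrary: thesis v rule: rev_induct)
  case Nil
  from Nil(1)[of "[]" "[]" v] Nil(3) show ?case by simp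
next
  case (snoc l u)
  show ?case
  proof (cases "v \<noteq> [] \<and> hd v = letter_inv l")
    case True
    then obtain v' where v: "v = letter_inv l # v'" by (cases v) auto
    have "freely_reduced u" "freely_reduced v'"
      using snoc.prems v by (auto simp: freely_reduced_append dest: freely_reduced_ConsD)
    from snoc.IH[OF _ this] obtain a c b where "u = a @ c" "v' = winv c @ b" "freely_reduced (a @ b)"
      by metis
    with v show ?thesis by (intro snoc.prems(1)[of a "c @ [l]" b]) auto
  next
    case False
    then have "freely_reduced ((u @ [l]) @ v)"
      using snoc.prems(2,3) by (subst freely_reduced_append) auto
    then show ?thesis by (intro snoc.prems(1)[of "u @ [l]" "[]" v]) auto
  qed
qed

text \<open>The letters around the middle of \<open>u\<close> would be inverse to each other otherwise.\<close>
lemma self_cancellation: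
  assumes "freely_reduced u" "u \<noteq> []" "u = a @ c" "u = winv c @ b"
  shows "length c < length a"
proof (rule ccontr)
  assume "\<not> length c < length a"
  then have le: "length a \<le> length c" by simp
  have ab: "length a = length b" using assms(3,4) by (metis add.commute add_right_cancel length_append winv_simps(5))
  let ?n = "length u" and ?k = "length c"
  have nk: "?n = length a + ?k" using assms(3) by simp
  have sym: "u ! i = letter_inv (u ! (?n - 1 - i))" if "i < ?k" for i
  proof -
    have "u ! i = winv c ! i" using that by (subst assms(4)) (simp add: nth_append)
    also have "\<dots> = letter_inv (c ! (?k - 1 - i))"
      using that by (simp add: winv_def rev_nth)
    also have "c ! (?k - 1 - i) = (a @ c) ! (length a + (?k - 1 - i))"
      by simp
    also have "\<dots> = u ! (?n - 1 - i)"
      using that nk assms(3) by (intro arg_cong2[of _ _ _ _ nth]) auto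
    finally show ?thesis .
  qed
  have n0: "0 < ?n" using assms(2) by simp
  show False
  proof (cases "odd ?n")
    case True
    then obtain i where i: "?n = 2 * i + 1" by (elim oddE)
    then have "i < ?k" using le nk by linarith
    from sym[OF this] i show False by (simp add: mult_2)
  next
    case False
    then obtain j where j: "?n = 2 * j" by (auto elim: evenE)
    define i where "i = j - 1"
    have i: "?n = 2 * i + 2" using j n0 unfolding i_def by (cases j) auto
    then have "i < ?k" using le nk by linarith
    from sym[OF this] i have e: "u ! i = letter_inv (u ! Suc i)" by simp
    have "Suc i < length u" using i by simp
    then have "u ! Suc i \<noteq> letter_inv (u ! i)"
      using assms(1) unfolding freely_reduced_def successively_conv_nth by auto
    with e show False by simp
  qed
qed

text \<open>Identities in a non-commutative group are decided by reassociating sums of summands and negated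
  summands, hence differences are unfolded.\<close>

declare add_uminus_conv_diff [simp del] diff_conv_add_uminus [simp]
lemmas group_simps = add.assoc minus_add

lemma snd_letter_inv [simp]: "snd (letter_inv l) = (\<not> snd l)"
  by (simp add: letter_inv_def)

section \<open>Automorphisms given by their values on generators, and elementary moves\<close>

section \<open>Automorphisms fixing the constants\<close>

text \<open>The inverse belongs to the definition and is again given on generators, so bijectivity
  of a substitution is always shown by exhibiting the inverse substitution.\<close>

definition aut_on :: "'a set \<Rightarrow> ('a \<Rightarrow> 'a fgrp) \<Rightarrow> bool" where
  "aut_on V f \<longleftrightarrow> (\<forall>x. x \<notin> V \<longrightarrow> f x = gen x) \<and>
     (\<exists>g. (\<forall>x. x \<notin> V \<longrightarrow> g x = gen x) \<and> (\<forall>x. lift f (g x) = gen x) \<and> (\<forall>x. lift g (f x) = gen x))"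

lemma aut_onI:
  assumes "\<And>x. x \<notin> V \<Longrightarrow> f x = gen x" "\<And>x. x \<notin> V \<Longrightarrow> g x = gen x"
    "\<And>x. lift f (g x) = gen x" "\<And>x. lift g (f x) = gen x"
  shows "aut_on V f"
  using assms unfolding aut_on_def by blast

lemma aut_on_fix: "aut_on V f \<Longrightarrow> x \<notin> V \<Longrightarrow> f x = gen x"
  by (auto simp: aut_on_def)

lemma lift_cancel:
  assumes "\<And>x. lift f (g x) = gen x"
  shows "lift f (lift g a) = a"
  by (simp add: lift_lift assms)

lemma aut_on_inverse:
  assumes "aut_on V f"
  obtains g where "aut_on V g" "\<And>a. lift f (lift g a) = a" "\<And>a. lift g (lift f a) = a"
proof -
  from assms obtain g where g: "\<forall>x. x \<notin> V \<longrightarrow> g x = gen x" "\<forall>x. lift f (g x) = gen x"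
    "\<forall>x. lift g (f x) = gen x" and f: "\<forall>x. x \<notin> V \<longrightarrow> f x = gen x"
    unfolding aut_on_def by blast
  then have "aut_on V g" unfolding aut_on_def by blast
  with g show thesis by (intro that[of g] lift_cancel) auto
qed

lemma aut_on_gen [simp]: "aut_on V gen"
  by (rule aut_onI[where g = gen]) auto

lemma aut_on_comp:
  assumes "aut_on V f" "aut_on V e"
  shows "aut_on V (\<lambda>x. lift f (e x))"
proof -
  obtain f' where f': "aut_on V f'" "\<And>a. lift f (lift f' a) = a" "\<And>a. lift f' (lift f a) = a"
    using assms(1) by (rule aut_on_inverse) blast
  obtain e' where e': "aut_on V e'" "\<And>a. lift e (lift e' a) = a" "\<And>a. lift e' (lift e a) = a"
    using assms(2) by (rule aut_on_inverse) blast
  have *: "lift (\<lambda>x. lift f (e x)) a = lift f (lift e a)" for f e :: "'a \<Rightarrow> 'a fgrp" and a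
    by (simp add: lift_lift)
  have fx: "f x = gen x" "e x = gen x" "f' x = gen x" "e' x = gen x" if "x \<notin> V" for x
    using that assms f'(1) e'(1) by (auto dest: aut_on_fix)
  have inv: "lift f (f' x) = gen x" "lift f' (f x) = gen x" "lift e (e' x) = gen x" "lift e' (e x) = gen x" for x
    using f'(2,3)[of "gen x"] e'(2,3)[of "gen x"] by simp_all
  show ?thesis
    by (rule aut_onI[where g = "\<lambda>x. lift e' (f' x)"]) (simp_all add: fx * f'(2,3) e'(2,3) inv)
qed

text \<open>The letter may be negative: then the generator x goes to u x^-1 v, so an inversion of
  the generator is included in the same elementary move.\<close>

definition elem :: "'a \<times> bool \<Rightarrow> 'a word \<Rightarrow> 'a word \<Rightarrow> 'a \<Rightarrow> 'a fgrp" where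
  "elem l u v y = (if y = fst l then cls u + sgn_of gen l + cls v else gen y)"

lemma ev_avoid: "fst ` set u \<inter> E = {} \<Longrightarrow> (\<And>v. v \<notin> E \<Longrightarrow> f v = gen v) \<Longrightarrow> ev f u = cls u"
  by (rule ev_cong) auto

lemma aut_on_elem:
  assumes "fst l \<in> V" "fst l \<notin> fst ` set u" "fst l \<notin> fst ` set v"
  shows "aut_on V (elem l u v)"
proof -
  \<comment> \<open>For x going to u x v the inverse is x to u^-1 x v^-1; for x going to u x^-1 v it
    is x to v x^-1 u.\<close>
  define g where "g = (if snd l then elem l (winv u) (winv v) else elem l v u)"
  have "ev (elem l u' v') u = cls u" "ev (elem l u' v') v = cls v" for u' v'
    using assms(2,3) by (metis (mono_tags, lifting) elem_def ev_cong)+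
  then show ?thesis
    using assms(1)
    by (intro aut_onI[where g = g])
      (auto simp: elem_def g_def sgn_of_def group_simps)
qed

lemma aut_on_perm:
  assumes "bij_betw p V V"
  shows "aut_on V (\<lambda>x. if x \<in> V then gen (p x) else gen x)"
proof (rule aut_onI[where g = "\<lambda>x. if x \<in> V then gen (inv_into V p x) else gen x"])
  fix x
  show "lift (\<lambda>x. if x \<in> V then gen (p x) else gen x)
         (if x \<in> V then gen (inv_into V p x) else gen x) = gen x"
    using assms bij_betw_inv_into[OF assms] bij_betwE[OF bij_betw_inv_into[OF assms]]
    by (auto simp: bij_betw_inv_into_right)
  show "lift (\<lambda>x. if x \<in> V then gen (inv_into V p x) else gen x)
         (if x \<in> V then gen (p x) else gen x) = gen x"
    using assms bij_betwE[OF assms] by (auto simp: bij_betw_inv_into_left)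
qed auto


section \<open>Cut-and-paste moves that bring squares, handles and holes to the front\<close>

section \<open>Squares, handles and holes\<close>

text \<open>Conjugators stand on the left as in z b z^-1, opposite to \<open>coeff_part\<close>:
  this is the shape that pulling letters to the front produces. A single automorphism restores the
  other convention in \<open>generalizable_standard\<close>.\<close>

definition conjs :: "('a \<times> 'a word) list \<Rightarrow> 'a word" where
  "conjs zs = concat (map (\<lambda>(z, b). [(z, True)] @ b @ [(z, False)]) zs)"

lemma normal_simps [simp]:
  "squares [] = []" "squares (x # xs) = [(x, True), (x, True)] @ squares xs"
  "commutators [] = []"
  "commutators ((x, y) # ps) = [(x, False), (y, False), (x, True), (y, True)] @ commutators ps"
  "conjs [] = []" "conjs ((z, b) # zs) = [(z, True)] @ b @ [(z, False)] @ conjs zs"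
  by (auto simp: squares_def commutators_def conjs_def)

lemma normal_append [simp]:
  "squares (xs @ ys) = squares xs @ squares ys" "commutators (ps @ qs) = commutators ps @ commutators qs"
  "conjs (zs @ ws) = conjs zs @ conjs ws"
  by (auto simp: squares_def commutators_def conjs_def)

text \<open>These are the moves of the classification of surfaces. The lists required to be empty in
  \<open>ext_handle\<close> and \<open>ext_hole\<close> force squares to leave before handles and
  handles before holes. Extracting a square inverts the factor between its two letters; the other
  moves keep the sign of every remaining letter.\<close>

inductive ext :: "'a set \<Rightarrow> 'a word \<Rightarrow> 'a list \<Rightarrow> ('a \<times> 'a) list \<Rightarrow> ('a \<times> 'a word) list \<Rightarrow> 'a word \<Rightarrow> bool"
  for V where
  ext_refl: "ext V w [] [] [] w"
| ext_square: "fst l \<in> V \<Longrightarrow> ext V (u @ winv p @ s) xs ps zs w' \<Longrightarrow>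
    ext V (u @ [l] @ p @ [l] @ s) (fst l # xs) ps zs w'"
| ext_handle: "fst l \<in> V \<Longrightarrow> fst m \<in> V \<Longrightarrow> ext V (u @ r @ q @ p @ s) [] ps zs w' \<Longrightarrow>
    ext V (u @ [l] @ p @ [m] @ q @ [letter_inv l] @ r @ [letter_inv m] @ s) [] ((fst l, fst m) # ps) zs w'"
| ext_hole: "fst l \<in> V \<Longrightarrow> fst ` set b \<inter> V = {} \<Longrightarrow> ext V (u @ s) [] [] zs w' \<Longrightarrow>
    ext V (u @ [l] @ b @ [letter_inv l] @ s) [] [] ((fst l, b) # zs) w'"

abbreviation symbols :: "'a word \<Rightarrow> 'a multiset" where "symbols w \<equiv> mset (map fst w)"

lemma ext_symbols: "ext V w xs ps zs w' \<Longrightarrow> symbols w = symbols (squares xs @ commutators ps @ conjs zs @ w')"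
proof (induction rule: ext.induct)
  case (ext_square l u p s xs ps zs w')
  then show ?case using mset_fst_winv[of p] by (simp add: ac_simps)
qed (auto simp: ac_simps)

definition quad :: "'a set \<Rightarrow> 'a word \<Rightarrow> bool" where
  "quad V w \<longleftrightarrow> (\<forall>x\<in>V. count (symbols w) x \<in> {0, 2})"

definition wsum :: "('a \<Rightarrow> nat) \<Rightarrow> 'a word \<Rightarrow> nat" where
  "wsum wt w = sum_list (map (\<lambda>l. wt (fst l)) w)"

lemma wsum_simps [simp]:
  "wsum wt [] = 0" "wsum wt (l # w) = wt (fst l) + wsum wt w" "wsum wt (u @ v) = wsum wt u + wsum wt v"
  "wsum wt (winv w) = wsum wt w"
  by (auto simp: wsum_def winv_def rev_map[symmetric] sum_list_rev comp_def)

lemma wsum_symbols: "wsum wt w = sum_mset (image_mset wt (symbols w))"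
  by (induction w) auto

text \<open>Variables and constants are counted separately: later a variable is replaced by a long
  value, a constant by at most one letter.\<close>

definition vcount :: "'a set \<Rightarrow> 'a word \<Rightarrow> nat" where
  "vcount V w = length (filter (\<lambda>l. fst l \<in> V) w)"
definition ccount :: "'a set \<Rightarrow> 'a word \<Rightarrow> nat" where
  "ccount V w = length (filter (\<lambda>l. fst l \<notin> V) w)"

lemma vcount_simps [simp]:
  "vcount V [] = 0" "vcount V (l # w) = of_bool (fst l \<in> V) + vcount V w"
  "vcount V (u @ v) = vcount V u + vcount V v" "vcount V (winv w) = vcount V w"
  "ccount V [] = 0" "ccount V (l # w) = of_bool (fst l \<notin> V) + ccount V w"
  "ccount V (u @ v) = ccount V u + ccount V v" "ccount V (winv w) = ccount V w"
  by (auto simp: vcount_def ccount_def winv_def filter_map rev_filter[symmetric] comp_def)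

lemma ex3I: "R a b c \<Longrightarrow> \<exists>a b c. R a b c"
  by blast

text \<open>\<open>S @ w'\<close> is the result of moving \<open>S\<close> out of \<open>w\<close>. The clause on prefixes controls the inverse of
  the automorphism: a variable of \<open>w\<close> is a quotient of two prefixes of \<open>w\<close>. Lengths are bounded for all
  weights of the symbols at once, so that the bounds survive substitutions.\<close>

definition reducing :: "'a set \<Rightarrow> 'a word \<Rightarrow> 'a set \<Rightarrow> 'a word \<Rightarrow> 'a word \<Rightarrow> nat \<Rightarrow> ('a \<Rightarrow> 'a fgrp) \<Rightarrow> bool" where
  "reducing V w E S w' N f \<longleftrightarrow> aut_on V f \<and> E \<subseteq> V \<and> (\<forall>v. v \<notin> E \<longrightarrow> f v = gen v) \<and> ev f (S @ w') = cls w \<and>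
     (\<forall>v\<in>E. \<exists>k. f v = cls k \<and> fst ` set k \<subseteq> fst ` set w \<and> (\<forall>wt. wsum wt k \<le> 2 * wsum wt w)) \<and>
     (\<forall>P Q. w = P @ Q \<longrightarrow> (\<exists>s p q. w' = p @ q \<and> cls P = ev f (s @ p) \<and>
        fst ` set s \<subseteq> E \<union> (fst ` set w - V) \<and> vcount V s \<le> N \<and> ccount V s + ccount V w' \<le> ccount V w))"

lemma reducingD:
  assumes "reducing V w E S w' N f"
  shows "aut_on V f" "E \<subseteq> V" "\<And>v. v \<notin> E \<Longrightarrow> f v = gen v" "ev f (S @ w') = cls w"
    "\<And>v. v \<in> E \<Longrightarrow> \<exists>k. f v = cls k \<and> fst ` set k \<subseteq> fst ` set w \<and> (\<forall>wt. wsum wt k \<le> 2 * wsum wt w)"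
    "\<And>P Q. w = P @ Q \<Longrightarrow> \<exists>s p q. w' = p @ q \<and> cls P = ev f (s @ p) \<and>
        fst ` set s \<subseteq> E \<union> (fst ` set w - V) \<and> vcount V s \<le> N \<and> ccount V s + ccount V w' \<le> ccount V w"
proof -
  note a = assms[unfolded reducing_def]
  show "aut_on V f" by (rule a[THEN conjunct1])
  note a = a[THEN conjunct2]
  show "E \<subseteq> V" by (rule a[THEN conjunct1])
  note a = a[THEN conjunct2]
  show "f v = gen v" if "v \<notin> E" for v by (rule a[THEN conjunct1, rule_format, OF that])
  note a = a[THEN conjunct2]
  show "ev f (S @ w') = cls w" by (rule a[THEN conjunct1])
  note a = a[THEN conjunct2]
  show "\<exists>k. f v = cls k \<and> fst ` set k \<subseteq> fst ` set w \<and> (\<forall>wt. wsum wt k \<le> 2 * wsum wt w)" if "v \<in> E" for v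
    by (rule a[THEN conjunct1, rule_format, OF that])
  show "\<exists>s p q. w' = p @ q \<and> cls P = ev f (s @ p) \<and>
        fst ` set s \<subseteq> E \<union> (fst ` set w - V) \<and> vcount V s \<le> N \<and> ccount V s + ccount V w' \<le> ccount V w"
    if "w = P @ Q" for P Q
    by (rule a[THEN conjunct2, rule_format, OF that])
qed

lemma reducingI:
  assumes "aut_on V f" "E \<subseteq> V" "\<And>v. v \<notin> E \<Longrightarrow> f v = gen v" "ev f (S @ w') = cls w"
    "\<And>v. v \<in> E \<Longrightarrow> \<exists>k. f v = cls k \<and> fst ` set k \<subseteq> fst ` set w \<and> (\<forall>wt. wsum wt k \<le> 2 * wsum wt w)"
    "\<And>P Q. w = P @ Q \<Longrightarrow> \<exists>s p q. w' = p @ q \<and> cls P = ev f (s @ p) \<and>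
        fst ` set s \<subseteq> E \<union> (fst ` set w - V) \<and> vcount V s \<le> N \<and> ccount V s + ccount V w' \<le> ccount V w"
  shows "reducing V w E S w' N f"
  unfolding reducing_def using assms by (intro conjI allI impI ballI)

lemma reducing_refl: "reducing V w {} [] w 0 gen"
proof (rule reducingI)
  fix P Q assume "w = P @ Q"
  then show "\<exists>s p q. w = p @ q \<and> cls P = cls (s @ p) \<and>
        fst ` set s \<subseteq> {} \<union> (fst ` set w - V) \<and> vcount V s \<le> 0 \<and> ccount V s + ccount V w \<le> ccount V w"
    by (intro ex3I[of _ "[]" P Q]) simp
qed simp_all

text \<open>The value bounds do not multiply: the symbols in E have left w1, so e is the identity on
  the words over w1 that describe the values of f, and f is the identity on the part S already moved
  out. Hence the factor 2 persists through any number of moves, and only the prefix counts N add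
  up.\<close>

lemma reducing_trans:
  assumes e: "reducing V w E S w1 N e" and f: "reducing V w1 E' S' w' N' f"
    and disj: "E \<inter> fst ` set w1 = {}" "E' \<subseteq> fst ` set w1" "fst ` set S \<subseteq> E \<union> - V"
    and sub: "fst ` set w1 \<subseteq> fst ` set w" "\<And>wt. wsum wt w1 \<le> wsum wt w"
  shows "reducing V w (E \<union> E') (S @ S') w' (N + N') (\<lambda>v. lift e (f v))"
proof -
  note e = reducingD[OF e] and f = reducingD[OF f]
  let ?g = "\<lambda>v. lift e (f v)"
  have ew1: "ev e u = cls u" if "fst ` set u \<subseteq> fst ` set w1" for u
  proof (rule ev_avoid[of _ E])
    show "fst ` set u \<inter> E = {}" using that disj(1) by blast
  qed (rule e(3))
  have fS: "ev f u = cls u" if "fst ` set u \<subseteq> E \<union> - V" for u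
  proof (rule ev_avoid[of _ E'])
    show "fst ` set u \<inter> E' = {}" using that disj(1,2) f(2) by blast
  qed (rule f(3))
  have g: "ev ?g u = lift e (ev f u)" for u
    by (rule lift_ev[symmetric])
  have "aut_on V ?g" by (rule aut_on_comp[OF e(1) f(1)])
  moreover have "?g v = gen v" if "v \<notin> E \<union> E'" for v
    using that e(3) f(3) by simp
  moreover have "ev ?g ((S @ S') @ w') = cls w"
  proof -
    have "ev ?g ((S @ S') @ w') = lift e (ev f S + ev f (S' @ w'))" by (simp add: g add.assoc)
    also have "\<dots> = ev e S + cls w1" using ew1[of w1] unfolding f(4) by (simp add: fS disj(3))
    also have "\<dots> = cls w" using e(4) ew1[of w1] by simp
    finally show ?thesis .
  qed
  moreover have "\<exists>k. ?g v = cls k \<and> fst ` set k \<subseteq> fst ` set w \<and> (\<forall>wt. wsum wt k \<le> 2 * wsum wt w)"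
    if v: "v \<in> E \<union> E'" for v
  proof (cases "v \<in> E'")
    case True
    from f(5)[OF this] obtain k where k: "f v = cls k" "fst ` set k \<subseteq> fst ` set w1"
      "\<And>wt. wsum wt k \<le> 2 * wsum wt w1" by blast
    have "wsum wt k \<le> 2 * wsum wt w" for wt
      using k(3)[of wt] sub(2)[of wt] by linarith
    with k ew1[of k] sub(1) show ?thesis by (intro exI[of _ k]) auto
  next
    case False
    with v e(5)[of v] f(3)[of v] show ?thesis by simp
  qed
  moreover have "\<exists>s p q. w' = p @ q \<and> cls P = ev ?g (s @ p) \<and> fst ` set s \<subseteq> (E \<union> E') \<union> (fst ` set w - V) \<and>
      vcount V s \<le> N + N' \<and> ccount V s + ccount V w' \<le> ccount V w" if "w = P @ Q" for P Q
  proof -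
    from e(6)[OF that] obtain s p q where s: "w1 = p @ q" "cls P = ev e (s @ p)"
      "fst ` set s \<subseteq> E \<union> (fst ` set w - V)" "vcount V s \<le> N" "ccount V s + ccount V w1 \<le> ccount V w"
      by blast
    from f(6)[OF s(1)] obtain t p' q' where t: "w' = p' @ q'" "cls p = ev f (t @ p')"
      "fst ` set t \<subseteq> E' \<union> (fst ` set w1 - V)" "vcount V t \<le> N'" "ccount V t + ccount V w' \<le> ccount V w1"
      by blast
    have "ev ?g ((s @ t) @ p') = lift e (ev f s + ev f (t @ p'))" by (simp add: g add.assoc)
    also have "\<dots> = lift e (cls s + cls p)"
    proof -
      have "fst ` set s \<subseteq> E \<union> - V" using s(3) by blast
      then show ?thesis unfolding t(2) by (simp add: fS)
    qed
    finally have "cls P = ev ?g ((s @ t) @ p')" using s(2) by simp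
    moreover have "fst ` set (s @ t) \<subseteq> (E \<union> E') \<union> (fst ` set w - V)"
      using s(3) t(3) sub(1) by (simp add: image_Un) blast
    ultimately show ?thesis
      using s(4,5) t(1,4,5) by (intro ex3I[of _ "s @ t" p' q']) simp
  qed
  ultimately show ?thesis
    using e(2) f(2) by (intro reducingI) simp_all
qed

lemma prefix_append_cases:
  assumes "P @ Q = A @ B"
  obtains A' where "A = P @ A'" | B' where "P = A @ B'" "B = B' @ Q"
  using assms by (auto simp: append_eq_append_conv2)

lemma prefix_Cons_cases:
  assumes "P @ Q = [l] @ B"
  obtains "P = []" | B' where "P = l # B'" "B = B' @ Q"
  using assms by (cases P) auto

lemma quad_count: "quad V w \<Longrightarrow> x \<in> V \<Longrightarrow> count (symbols w) x \<le> 2"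
  unfolding quad_def by fastforce

lemma count_symbols_pos: "x \<in> fst ` set w \<longleftrightarrow> 0 < count (symbols w) x"
  by (simp add: count_greater_zero_iff image_image[symmetric])

text \<open>With x sent to u l p u^-1, the word x^2 u p^-1 s evaluates to u l p u^-1 u l p u^-1 u
  p^-1 s, which is u l p l s. If p = p1 p2, the prefix u l p1 is the value of x u p2^-1, so a cut
  inside p becomes a cut inside p^-1.\<close>

lemma reducing_square:
  assumes l: "fst l \<in> V" and q: "quad V (u @ [l] @ p @ [l] @ s)"
  defines "e \<equiv> elem l u (p @ winv u)"
  shows "reducing V (u @ [l] @ p @ [l] @ s) {fst l} [(fst l, True), (fst l, True)] (u @ winv p @ s) 2 e"
proof (rule reducingI)

  have nin: "fst l \<notin> fst ` set u" "fst l \<notin> fst ` set p" "fst l \<notin> fst ` set s"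
    using quad_count[OF q l] unfolding count_symbols_pos by auto
  show "aut_on V e" using nin unfolding e_def by (intro aut_on_elem l) (auto simp: image_Un)
  have av: "ev e k = cls k" if "fst l \<notin> fst ` set k" for k
    using that by (intro ev_avoid[of _ "{fst l}"]) (auto simp: elem_def e_def)
  have el: "e (fst l) = cls u + sgn_of gen l + cls p - cls u"
    by (simp add: elem_def e_def add.assoc)
  show "ev e ([(fst l, True), (fst l, True)] @ u @ winv p @ s) = cls (u @ [l] @ p @ [l] @ s)"
    using nin by (simp add: el av group_simps)
  show "\<exists>k. e v = cls k \<and> fst ` set k \<subseteq> fst ` set (u @ [l] @ p @ [l] @ s) \<and>
      (\<forall>wt. wsum wt k \<le> 2 * wsum wt (u @ [l] @ p @ [l] @ s))" if "v \<in> {fst l}" for v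
    using that by (intro exI[of _ "u @ [l] @ p @ winv u"]) (simp add: el add.assoc image_Un; auto)
  fix P Q assume PQ: "u @ [l] @ p @ [l] @ s = P @ Q"
  show "\<exists>t p' q. u @ winv p @ s = p' @ q \<and> cls P = ev e (t @ p') \<and>
     fst ` set t \<subseteq> {fst l} \<union> (fst ` set (u @ [l] @ p @ [l] @ s) - V) \<and> vcount V t \<le> 2 \<and>
     ccount V t + ccount V (u @ winv p @ s) \<le> ccount V (u @ [l] @ p @ [l] @ s)"
    using PQ[symmetric]
  proof (cases rule: prefix_append_cases)
    case (1 A')
    then show ?thesis using nin
      by (intro ex3I[of _ "[]" P "A' @ winv p @ s"]) (simp add: av image_Un)
  next
    case (2 B1)
    from 2(2)[symmetric] show ?thesis
    proof (cases rule: prefix_Cons_cases)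
      case 1
      with 2(1) nin show ?thesis
        by (intro ex3I[of _ "[]" u "winv p @ s"]) (simp add: av image_Un)
    next
      case (2 B2)
      note B1 = \<open>P = u @ B1\<close> \<open>B1 = l # B2\<close>
      from 2(2)[symmetric] show ?thesis
      proof (cases rule: prefix_append_cases)
        case (1 p2)
        with B1 nin show ?thesis
          by (intro ex3I[of _ "[(fst l, True)]" "u @ winv p2" "winv B2 @ s"])
            (simp add: av image_Un el group_simps)
      next
        case (2 B3)
        note B2 = \<open>B2 = p @ B3\<close>
        from 2(2)[symmetric] show ?thesis
        proof (cases rule: prefix_Cons_cases)
          case 1
          with B1 B2 nin show ?thesis
            by (intro ex3I[of _ "[(fst l, True)]" "u" "winv p @ s"])
              (simp add: av image_Un el group_simps)
        next
          case (2 s1)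
          with B1 B2 nin show ?thesis
            by (intro ex3I[of _ "[(fst l, True), (fst l, True)]" "u @ winv p @ s1" Q])
              (simp add: av image_Un el group_simps)
        qed
      qed
    qed
  qed
qed (use l in \<open>auto simp: elem_def e_def\<close>)

text \<open>Sending x to u l turns x b x^-1 u s into u l b l^-1 s. A prefix ending inside b is not a
  prefix of the shortened word, so letters of b enter the correction factor; they are paid for by
  the letters that b has taken out of the word.\<close>

lemma reducing_hole:
  assumes l: "fst l \<in> V" and b: "fst ` set b \<inter> V = {}" and q: "quad V (u @ [l] @ b @ [letter_inv l] @ s)"
  defines "e \<equiv> elem l u []"
  shows "reducing V (u @ [l] @ b @ [letter_inv l] @ s) {fst l} ([(fst l, True)] @ b @ [(fst l, False)]) (u @ s) 2 e"
proof (rule reducingI)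
  let ?w = "u @ [l] @ b @ [letter_inv l] @ s"
  have nin: "fst l \<notin> fst ` set u" "fst l \<notin> fst ` set b" "fst l \<notin> fst ` set s"
    using quad_count[OF q l] unfolding count_symbols_pos by auto
  show "aut_on V e" using nin unfolding e_def by (intro aut_on_elem l) (auto simp: image_Un)
  have av: "ev e k = cls k" if "fst l \<notin> fst ` set k" for k
    using that by (intro ev_avoid[of _ "{fst l}"]) (auto simp: elem_def e_def)
  have el: "e (fst l) = cls u + sgn_of gen l"
    by (simp add: elem_def e_def add.assoc)
  show "ev e (([(fst l, True)] @ b @ [(fst l, False)]) @ u @ s) = cls ?w"
    using nin by (simp add: el av group_simps)
  show "\<exists>k. e v = cls k \<and> fst ` set k \<subseteq> fst ` set ?w \<and> (\<forall>wt. wsum wt k \<le> 2 * wsum wt ?w)" if "v \<in> {fst l}" for v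
    using that by (intro exI[of _ "u @ [l]"]) (auto simp: el add.assoc)
  have b0: "vcount V b = 0" using b by (auto simp: vcount_def filter_empty_conv)
  let ?goal = "\<lambda>P. \<exists>t p' q. u @ s = p' @ q \<and> cls P = ev e (t @ p') \<and>
     fst ` set t \<subseteq> {fst l} \<union> (fst ` set ?w - V) \<and> vcount V t \<le> 2 \<and>
     ccount V t + ccount V (u @ s) \<le> ccount V ?w"
  have G: "?goal P" if "u @ s = p' @ q" "cls P = ev e (t @ p')" "fst ` set t \<subseteq> insert (fst l) (fst ` set b)"
    "vcount V t \<le> 2" "ccount V t \<le> ccount V b" for P p' q t
  proof -
    have "fst ` set t \<subseteq> {fst l} \<union> (fst ` set ?w - V)" using that(3) b by auto
    moreover have "ccount V t + ccount V (u @ s) \<le> ccount V ?w" using that(5) l by simp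
    ultimately show ?thesis using that by (intro ex3I[of _ t p' q]) blast
  qed
  fix P Q assume PQ: "?w = P @ Q"
  show "?goal P"
    using PQ[symmetric]
  proof (cases rule: prefix_append_cases)
    case (1 A')
    then show ?thesis using nin
      by (intro G[of P "A' @ s" _ "[]"]) (simp_all add: av image_Un)
  next
    case (2 B1)
    from 2(2)[symmetric] show ?thesis
    proof (cases rule: prefix_Cons_cases)
      case 1
      with 2(1) nin show ?thesis
        by (intro G[of u s _ "[]"]) (simp_all add: av image_Un)
    next
      case (2 B2)
      note B1 = \<open>P = u @ B1\<close> \<open>B1 = l # B2\<close>
      from 2(2)[symmetric] show ?thesis
      proof (cases rule: prefix_append_cases)
        case (1 b2)
        moreover have "vcount V B2 = 0" using 1 b by (auto simp: vcount_def filter_empty_conv)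
        ultimately show ?thesis using B1 nin l
          by (intro G[of "[]" "u @ s" _ "[(fst l, True)] @ B2"])
            (simp_all add: av image_Un el group_simps subset_insertI2)
      next
        case (2 B3)
        note B2 = \<open>B2 = b @ B3\<close>
        from 2(2)[symmetric] show ?thesis
        proof (cases rule: prefix_Cons_cases)
          case 1
          with B1 B2 nin l b0 show ?thesis
            by (intro G[of "[]" "u @ s" _ "[(fst l, True)] @ b"])
              (simp_all add: av image_Un el group_simps subset_insertI2)
        next
          case (2 s1)
          with B1 B2 nin l b0 show ?thesis
            by (intro G[of "u @ s1" Q _ "[(fst l, True)] @ b @ [(fst l, False)]"])
              (simp_all add: av image_Un el group_simps subset_insertI2)
        qed
      qed
    qed
  qed
qed (use l in \<open>auto simp: elem_def e_def\<close>)

text \<open>With x sent to u r q l^-1 u^-1 and y to u r m^-1 (u r q p)^-1, the partial products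
  x^-1, x^-1 y^-1, x^-1 y^-1 x and x^-1 y^-1 x y carry suitable prefixes of u r q p s to the
  prefixes of the given word that end within p, q, r and s.\<close>

lemma reducing_handle:
  assumes l: "fst l \<in> V" and m: "fst m \<in> V"
    and q: "quad V (u @ [l] @ p @ [m] @ q @ [letter_inv l] @ r @ [letter_inv m] @ s)" (is "quad V ?w")
  shows "\<exists>e. reducing V ?w {fst l, fst m} [(fst l, False), (fst m, False), (fst l, True), (fst m, True)]
    (u @ r @ q @ p @ s) 4 e"
proof -
  have "fst l \<noteq> fst m"
    using quad_count[OF q l] by auto
  then have nin: "fst l \<notin> fst ` set u" "fst l \<notin> fst ` set p" "fst l \<notin> fst ` set q" "fst l \<notin> fst ` set r"
      "fst l \<notin> fst ` set s" "fst m \<notin> fst ` set u" "fst m \<notin> fst ` set p" "fst m \<notin> fst ` set q"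
      "fst m \<notin> fst ` set r" "fst m \<notin> fst ` set s"
    using quad_count[OF q l] quad_count[OF q m] unfolding count_symbols_pos by auto
  \<comment> \<open>The substitution changes two generators. It is a composite of two elementary
    moves, since the value of either generator involves neither the other one nor, apart from its
    own letter, itself.\<close>
  define e1 where "e1 = elem (letter_inv l) (u @ r @ q) (winv u)"
  define e2 where "e2 = elem (letter_inv m) (u @ r) (winv p @ winv q @ winv r @ winv u)"
  define e where "e = (\<lambda>y. lift e1 (e2 y))"
  have aut: "aut_on V e" unfolding e_def e1_def e2_def
    using nin l m by (intro aut_on_comp aut_on_elem) (auto simp: image_Un)
  have av1: "ev e1 k = cls k" if "fst l \<notin> fst ` set k" for k
    using that by (intro ev_avoid[of _ "{fst l}"]) (auto simp: elem_def e1_def)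
  have el: "e (fst l) = cls (u @ r @ q) - sgn_of gen l - cls u"
    using \<open>fst l \<noteq> fst m\<close> by (simp add: e_def e2_def e1_def elem_def add.assoc)
  have em: "e (fst m) = cls (u @ r) - sgn_of gen m - cls (u @ r @ q @ p)"
    using \<open>fst l \<noteq> fst m\<close> nin
    by (simp add: e_def e2_def elem_def av1 sgn_of_def group_simps)
      (simp add: e1_def elem_def)
  have e0: "e v = gen v" if "v \<notin> {fst l, fst m}" for v
    using that by (simp add: e_def e2_def e1_def elem_def)
  have av: "ev e k = cls k" if "fst l \<notin> fst ` set k" "fst m \<notin> fst ` set k" for k
    using that by (intro ev_avoid[of _ "{fst l, fst m}"] e0) auto
  have "reducing V ?w {fst l, fst m} [(fst l, False), (fst m, False), (fst l, True), (fst m, True)]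
    (u @ r @ q @ p @ s) 4 e"
  proof (rule reducingI)
    show "ev e ([(fst l, False), (fst m, False), (fst l, True), (fst m, True)] @ u @ r @ q @ p @ s) = cls ?w"
      using nin by (simp add: el em av group_simps)
    show "\<exists>k. e v = cls k \<and> fst ` set k \<subseteq> fst ` set ?w \<and> (\<forall>wt. wsum wt k \<le> 2 * wsum wt ?w)"
      if "v \<in> {fst l, fst m}" for v
    proof (cases "v = fst l")
      case True
      then show ?thesis
        by (intro exI[of _ "u @ r @ q @ [letter_inv l] @ winv u"]) (simp add: el group_simps image_Un; auto)
    next
      case False
      then show ?thesis using that
        by (intro exI[of _ "u @ r @ [letter_inv m] @ winv p @ winv q @ winv r @ winv u"])
          (simp add: em group_simps image_Un; auto)
    qed
    let ?goal = "\<lambda>P. \<exists>t p' q'. u @ r @ q @ p @ s = p' @ q' \<and> cls P = ev e (t @ p') \<and>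
       fst ` set t \<subseteq> {fst l, fst m} \<union> (fst ` set ?w - V) \<and> vcount V t \<le> 4 \<and>
       ccount V t + ccount V (u @ r @ q @ p @ s) \<le> ccount V ?w"
    have G: "?goal P" if "u @ r @ q @ p @ s = p' @ q'" "cls P = ev e (t @ p')" "length t \<le> 4"
      "fst ` set t \<subseteq> {fst l, fst m}" for P p' q' t
    proof -
      have "vcount V t \<le> 4" unfolding vcount_def using that(3) by (meson length_filter_le order_trans)
      moreover have "ccount V t = 0" using that(4) l m by (auto simp: ccount_def filter_empty_conv)
      moreover have "ccount V (u @ r @ q @ p @ s) \<le> ccount V ?w" by simp
      ultimately have "ccount V t + ccount V (u @ r @ q @ p @ s) \<le> ccount V ?w" "vcount V t \<le> 4" by linarith+
      moreover have "fst ` set t \<subseteq> {fst l, fst m} \<union> (fst ` set ?w - V)" using that(4) by (rule le_supI1)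
      ultimately show ?thesis using that by (intro ex3I[of _ t p' q']) blast
    qed
    let ?x = "fst l" and ?y = "fst m"
    note S = av el em image_Un group_simps
    fix P Q assume "?w = P @ Q"
    from this[symmetric] show "?goal P"
    proof (cases rule: prefix_append_cases)
      case (1 A')
      then show ?thesis using nin
        by (intro G[of P "A' @ r @ q @ p @ s" _ "[]"]) (simp_all add: av image_Un)
    next
      case (2 B1)
      note P1 = this(1)
      from 2(2)[symmetric] show ?thesis
      proof (cases rule: prefix_Cons_cases)
        case 1
        with P1 nin show ?thesis by (intro G[of u "r @ q @ p @ s" _ "[]"]) (simp_all add: av)
      next
        case (2 B2)
        note P2 = P1 this(1)
        from 2(2)[symmetric] show ?thesis
        proof (cases rule: prefix_append_cases)
          case (1 p2)
          with P2 nin show ?thesis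
            by (intro G[of "u @ r @ q @ B2" "p2 @ s" _ "[(?x, False)]"])
              (simp_all add: S)
        next
          case (2 B3)
          note P3 = P2 this(1)
          from 2(2)[symmetric] show ?thesis
          proof (cases rule: prefix_Cons_cases)
            case 1
            with P3 nin show ?thesis
              by (intro G[of "u @ r @ q @ p" "s" _ "[(?x, False)]"])
                (simp_all add: S)
          next
            case (2 B4)
            note P4 = P3 this(1)
            from 2(2)[symmetric] show ?thesis
            proof (cases rule: prefix_append_cases)
              case (1 q2)
              with P4 nin show ?thesis
                by (intro G[of "u @ r @ B4" "q2 @ p @ s" _ "[(?x, False), (?y, False)]"])
                  (simp_all add: S)
            next
              case (2 B5)
              note P5 = P4 this(1)
              from 2(2)[symmetric] show ?thesis
              proof (cases rule: prefix_Cons_cases)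
                case 1
                with P5 nin show ?thesis
                  by (intro G[of "u @ r @ q" "p @ s" _ "[(?x, False), (?y, False)]"])
                    (simp_all add: S)
              next
                case (2 B6)
                note P6 = P5 this(1)
                from 2(2)[symmetric] show ?thesis
                proof (cases rule: prefix_append_cases)
                  case (1 r2)
                  with P6 nin show ?thesis
                    by (intro G[of "u @ B6" "r2 @ q @ p @ s" _ "[(?x, False), (?y, False), (?x, True)]"])
                      (simp_all add: S)
                next
                  case (2 B7)
                  note P7 = P6 this(1)
                  from 2(2)[symmetric] show ?thesis
                  proof (cases rule: prefix_Cons_cases)
                    case 1
                    with P7 nin show ?thesis
                      by (intro G[of "u @ r" "q @ p @ s" _ "[(?x, False), (?y, False), (?x, True)]"])
                        (simp_all add: S)
                  next
                    case (2 B8)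
                    with P7 nin show ?thesis
                      by (intro G[of "u @ r @ q @ p @ B8" Q _ "[(?x, False), (?y, False), (?x, True), (?y, True)]"])
                        (simp_all add: S)
                  qed
                qed
              qed
            qed
          qed
        qed
      qed
    qed
  qed (use l m aut e0 in auto)
  then show ?thesis by blast
qed

definition moved_vars :: "'a list \<Rightarrow> ('a \<times> 'a) list \<Rightarrow> ('a \<times> 'a word) list \<Rightarrow> 'a set" where
  "moved_vars xs ps zs = set xs \<union> fst ` set ps \<union> snd ` set ps \<union> fst ` set zs"

lemma moved_vars_simps [simp]:
  "moved_vars [] [] [] = {}" "moved_vars (x # xs) ps zs = insert x (moved_vars xs ps zs)"
  "moved_vars [] ((x, y) # ps) zs = {x, y} \<union> moved_vars [] ps zs"
  "moved_vars [] [] ((z, b) # zs) = insert z (moved_vars [] [] zs)"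
  by (auto simp: moved_vars_def)

lemma ext_vars: "ext V w xs ps zs w' \<Longrightarrow> moved_vars xs ps zs \<subseteq> V \<inter> fst ` set w"
proof (induction rule: ext.induct)
  case (ext_square l u p s xs ps zs w')
  then show ?case by (auto simp: image_Un)
qed (auto simp: image_Un)

lemma quad_diff:
  assumes "quad V w" "symbols w = symbols w1 + M" "\<And>x. x \<in> V \<Longrightarrow> count M x \<in> {0, 2}"
  shows "quad V w1"
  unfolding quad_def
proof
  fix x assume x: "x \<in> V"
  have "count (symbols w) x = count (symbols w1) x + count M x" by (simp only: assms(2) count_union)
  moreover have "count (symbols w) x \<in> {0, 2}" using assms(1) x unfolding quad_def by blast
  ultimately show "count (symbols w1) x \<in> {0, 2}" using assms(3)[OF x] by auto
qed

text \<open>A correction factor for a prefix uses at most the letters of the part moved out: two for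
  a square or a hole, four for a handle, whence the count.\<close>

lemma ext_reducing:
  assumes "ext V w xs ps zs w'" "quad V w"
  shows "\<exists>f. reducing V w (moved_vars xs ps zs) (squares xs @ commutators ps @ conjs zs) w'
    (2 * (length xs + 2 * length ps + length zs)) f"
  using assms
proof (induction rule: ext.induct)
  case (ext_refl w)
  then show ?case using reducing_refl by auto
next
  case (ext_square l u p s xs ps zs w')
  let ?w = "u @ [l] @ p @ [l] @ s" and ?w1 = "u @ winv p @ s"
  have "quad V ?w1"
    by (rule quad_diff[OF ext_square.prems, of _ "{#fst l, fst l#}"]) (auto simp: mset_fst_winv[unfolded mset_map])
  then obtain f where f: "reducing V ?w1 (moved_vars xs ps zs) (squares xs @ commutators ps @ conjs zs) w'
    (2 * (length xs + 2 * length ps + length zs)) f" using ext_square.IH by blast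
  have "count (symbols ?w1) (fst l) = 0"
    using quad_count[OF ext_square.prems ext_square.hyps(1)] mset_fst_winv[of p] by auto
  then have "fst l \<notin> fst ` set ?w1" unfolding count_symbols_pos by simp
  then have "reducing V ?w ({fst l} \<union> moved_vars xs ps zs)
      ([(fst l, True), (fst l, True)] @ squares xs @ commutators ps @ conjs zs) w'
      (2 + 2 * (length xs + 2 * length ps + length zs)) (\<lambda>v. lift (elem l u (p @ winv u)) (f v))"
    using ext_vars[OF ext_square.hyps(2)]
    by (intro reducing_trans[OF reducing_square[OF ext_square.hyps(1) ext_square.prems] f]) (auto simp: image_Un)
  then show ?case by auto
next
  case (ext_handle l m u r q p s ps zs w')
  let ?w = "u @ [l] @ p @ [m] @ q @ [letter_inv l] @ r @ [letter_inv m] @ s" and ?w1 = "u @ r @ q @ p @ s"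
  have lm: "fst l \<noteq> fst m"
    using quad_count[OF ext_handle.prems ext_handle.hyps(1)] by auto
  have "quad V ?w1"
    by (rule quad_diff[OF ext_handle.prems, of _ "{#fst l, fst l, fst m, fst m#}"])
      (use lm in \<open>auto simp: ac_simps\<close>)
  then obtain f where f: "reducing V ?w1 (moved_vars [] ps zs) (squares [] @ commutators ps @ conjs zs) w'
    (2 * (length ([] :: 'a list) + 2 * length ps + length zs)) f" using ext_handle.IH by blast
  have "count (symbols ?w1) (fst l) = 0" "count (symbols ?w1) (fst m) = 0"
    using quad_count[OF ext_handle.prems ext_handle.hyps(1)] quad_count[OF ext_handle.prems ext_handle.hyps(2)] lm
    by simp_all
  then have nin: "fst l \<notin> fst ` set ?w1" "fst m \<notin> fst ` set ?w1" unfolding count_symbols_pos by simp_all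
  obtain e where e: "reducing V ?w {fst l, fst m} [(fst l, False), (fst m, False), (fst l, True), (fst m, True)] ?w1 4 e"
    using reducing_handle[OF ext_handle.hyps(1,2) ext_handle.prems] by blast
  have "reducing V ?w ({fst l, fst m} \<union> moved_vars [] ps zs)
      ([(fst l, False), (fst m, False), (fst l, True), (fst m, True)] @ squares [] @ commutators ps @ conjs zs) w'
      (4 + 2 * (length ([] :: 'a list) + 2 * length ps + length zs)) (\<lambda>v. lift e (f v))"
    using ext_vars[OF ext_handle.hyps(3)] nin
    by (intro reducing_trans[OF e f]) (auto simp: image_Un)
  then show ?case by (auto simp: numeral_eq_Suc)
next
  case (ext_hole l b u s zs w')
  let ?w = "u @ [l] @ b @ [letter_inv l] @ s" and ?w1 = "u @ s"
  have "quad V ?w1"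
    by (rule quad_diff[OF ext_hole.prems, of _ "{#fst l, fst l#} + symbols b"])
      (use ext_hole.hyps(2) count_symbols_pos[of _ b] ext_hole.hyps(1) in auto)
  then obtain f where f: "reducing V ?w1 (moved_vars [] [] zs) (squares [] @ commutators [] @ conjs zs) w'
    (2 * (length ([] :: 'a list) + 2 * length ([] :: ('a \<times> 'a) list) + length zs)) f" using ext_hole.IH by blast
  have "count (symbols ?w1) (fst l) = 0"
    using quad_count[OF ext_hole.prems ext_hole.hyps(1)] by auto
  then have "fst l \<notin> fst ` set ?w1" unfolding count_symbols_pos by simp
  then have "reducing V ?w ({fst l} \<union> moved_vars [] [] zs)
      (([(fst l, True)] @ b @ [(fst l, False)]) @ squares [] @ commutators [] @ conjs zs) w'
      (2 + 2 * (length ([] :: 'a list) + 2 * length ([] :: ('a \<times> 'a) list) + length zs)) (\<lambda>v. lift (elem l u []) (f v))"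
    using ext_vars[OF ext_hole.hyps(3)] ext_hole.hyps(2)
    by (intro reducing_trans[OF reducing_hole[OF ext_hole.hyps(1,2) ext_hole.prems] f]) (auto simp: image_Un)
  then show ?case by auto
qed

section \<open>Words without interlaced pairs of variables as bracketings\<close>

section \<open>Forests\<close>

text \<open>Once squares and handles have been moved out, the two occurrences of the remaining variables are
  nested like brackets: \<open>FB l u w\<close> stands for \<open>l u l\<^sup>-\<^sup>1 w\<close>.\<close>

datatype 'a forest = FNil | FK "'a \<times> bool" "'a forest" | FB "'a \<times> bool" "'a forest" "'a forest"

primrec flat :: "'a forest \<Rightarrow> 'a word" where
  "flat FNil = []"
| "flat (FK c w) = c # flat w"
| "flat (FB l u w) = [l] @ flat u @ [letter_inv l] @ flat w"

primrec level :: "'a forest \<Rightarrow> 'a word" where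
  "level FNil = []"
| "level (FK c w) = c # level w"
| "level (FB l u w) = level w"

text \<open>For each bracket, what remains inside it after all inner brackets are erased. These
  words become the holes.\<close>

primrec branches :: "'a forest \<Rightarrow> (('a \<times> bool) \<times> 'a word) list" where
  "branches FNil = []"
| "branches (FK c w) = branches w"
| "branches (FB l u w) = (l, level u) # branches u @ branches w"

primrec wf_forest :: "'a set \<Rightarrow> 'a forest \<Rightarrow> bool" where
  "wf_forest V FNil = True"
| "wf_forest V (FK c w) = (fst c \<notin> V \<and> wf_forest V w)"
| "wf_forest V (FB l u w) = (fst l \<in> V \<and> wf_forest V u \<and> wf_forest V w)"

text \<open>For words in which every variable of V occurs twice this is orientability; allowing zero
  occurrences lets the notion survive the removal of variables.\<close>

definition oriented :: "'a set \<Rightarrow> 'a word \<Rightarrow> bool" where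
  "oriented V w \<longleftrightarrow> (\<forall>x\<in>V. count (mset w) (x, True) = count (mset w) (x, False) \<and> count (mset w) (x, True) \<le> 1)"

lemma count_symbols: "count (symbols w) x = count (mset w) (x, True) + count (mset w) (x, False)"
  by (induction w) (auto split: prod.splits)

lemma oriented_letter: "oriented V w \<Longrightarrow> fst l \<in> V \<Longrightarrow> count (mset w) l \<le> 1 \<and> count (mset w) (letter_inv l) = count (mset w) l"
  unfolding oriented_def by (cases l; cases "snd l") (auto simp: letter_inv_def)

lemma orientedI:
  assumes "\<And>l. fst l \<in> V \<Longrightarrow> count (mset w) l \<le> 1 \<and> count (mset w) (letter_inv l) = count (mset w) l"
  shows "oriented V w"
  unfolding oriented_def
proof
  fix x assume "x \<in> V"
  then show "count (mset w) (x, True) = count (mset w) (x, False) \<and> count (mset w) (x, True) \<le> 1"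
    using assms[of "(x, True)"] by (simp add: letter_inv_def)
qed

text \<open>If the first letter is a variable, split the rest at its partner. Either some letter
  between the two has its partner beyond, and the two pairs interlace, or both pieces are oriented
  on their own and the bracketing is built recursively.\<close>

lemma linked_or_forest:
  assumes "oriented V w"
  obtains F where "flat F = w" "wf_forest V F"
  | u l p m q r s where "fst l \<in> V" "fst m \<in> V"
      "w = u @ [l] @ p @ [m] @ q @ [letter_inv l] @ r @ [letter_inv m] @ s"
proof -
  have "(\<exists>F. flat F = w \<and> wf_forest V F) \<or> (\<exists>u l p m q r s. fst l \<in> V \<and> fst m \<in> V \<and>
      w = u @ [l] @ p @ [m] @ q @ [letter_inv l] @ r @ [letter_inv m] @ s)" (is "?F w \<or> ?L w")
    using assms
  proof (induction w rule: length_induct)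
    case (1 w)
    note IH = 1(1)[rule_format]
    have LI: "?L x" if "fst l \<in> V" "fst m \<in> V"
      "x = u @ [l] @ p @ [m] @ q @ [letter_inv l] @ r @ [letter_inv m] @ s" for x l m u p q r s
      using that by blast
    have L: "?L (a @ v @ b)" if v: "?L v" for a v b
    proof -
      from v obtain u l p m q r s where "fst l \<in> V" "fst m \<in> V"
        "v = u @ [l] @ p @ [m] @ q @ [letter_inv l] @ r @ [letter_inv m] @ s" by blast
      then show ?thesis by (intro LI[of l m _ "a @ u" p q r "s @ b"]) simp_all
    qed
    show ?case
    proof (cases w)
      case Nil
      then show ?thesis by (auto intro: exI[of _ FNil])
    next
      case (Cons l v)
      show ?thesis
      proof (cases "fst l \<in> V")
        case False
        then have "oriented V v"
          using 1(2) unfolding Cons oriented_def by (fastforce split: if_splits)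
        from IH[OF _ this] Cons have "?F v \<or> ?L v" by simp
        then show ?thesis
        proof
          assume "?F v"
          then obtain F where "flat F = v" "wf_forest V F" by blast
          then have "flat (FK l F) = w" "wf_forest V (FK l F)" using False Cons by auto
          then show ?thesis by blast
        next
          assume "?L v"
          from L[OF this, of "[l]" "[]"] Cons show ?thesis by simp
        qed
      next
        case True
        have "count (mset w) (letter_inv l) = count (mset w) l" using oriented_letter[OF 1(2) True] by simp
        then have "0 < count (mset w) (letter_inv l)" using Cons by simp
        then have "letter_inv l \<in> set w" by (metis count_greater_zero_iff set_mset_mset)
        then have "letter_inv l \<in> set v" using Cons by simp
        then obtain u r where v: "v = u @ [letter_inv l] @ r" by (auto dest: split_list)
        show ?thesis
        proof (cases "\<exists>m\<in>set u. fst m \<in> V \<and> letter_inv m \<in> set r")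
          case True
          then obtain m where m: "m \<in> set u" "fst m \<in> V" "letter_inv m \<in> set r" by blast
          then obtain p q r' s where "u = p @ [m] @ q" "r = r' @ [letter_inv m] @ s"
            by (metis split_list append_Cons append_Nil)
          then have "w = [] @ [l] @ p @ [m] @ q @ [letter_inv l] @ r' @ [letter_inv m] @ s"
            using Cons v by simp
          then show ?thesis using m(2) \<open>fst l \<in> V\<close> by blast
        next
          case False
          have sep: "count (mset u) m = 0 \<or> count (mset r) (letter_inv m) = 0" if "fst m \<in> V" for m
            using False that by (auto simp: count_eq_zero_iff)
          have c: "count (mset u) m \<le> 1 \<and> count (mset r) m \<le> 1 \<and>
              count (mset u) (letter_inv m) = count (mset u) m \<and> count (mset r) (letter_inv m) = count (mset r) m"
            if m: "fst m \<in> V" for m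
          proof -
            define t where "t = (if m = l \<or> m = letter_inv l then 1 else (0 :: nat))"
            have "count (mset w) m = count (mset u) m + count (mset r) m + t"
              "count (mset w) (letter_inv m) = count (mset u) (letter_inv m) + count (mset r) (letter_inv m) + t"
              unfolding Cons v t_def by (auto simp: letter_inv_eq_iff)
            moreover have "count (mset w) m \<le> 1" "count (mset w) (letter_inv m) = count (mset w) m"
              using oriented_letter[OF 1(2) m] by auto
            moreover have "count (mset u) m = 0 \<or> count (mset r) (letter_inv m) = 0"
              "count (mset u) (letter_inv m) = 0 \<or> count (mset r) m = 0"
              using sep[of m] sep[of "letter_inv m"] m by auto
            ultimately show ?thesis by arith
          qed
          have "oriented V u" "oriented V r" by (rule orientedI, use c in blast)+
          then have "?F u \<or> ?L u" "?F r \<or> ?L r" using IH[of u] IH[of r] Cons v by auto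
          moreover have "?L w" if "?L u" using L[OF that, of "[l]" "[letter_inv l] @ r"] Cons v by simp
          moreover have "?L w" if "?L r" using L[OF that, of "[l] @ u @ [letter_inv l]" "[]"] Cons v by simp
          moreover have "?F w" if "?F u" "?F r"
          proof -
            from that obtain F G where "flat F = u" "wf_forest V F" "flat G = r" "wf_forest V G" by blast
            then have "flat (FB l F G) = w" "wf_forest V (FB l F G)" using \<open>fst l \<in> V\<close> Cons v by auto
            then show ?thesis by blast
          qed
          ultimately show ?thesis by blast
        qed
      qed
    qed
  qed
  with that show thesis by blast
qed

lemma not_oriented_square:
  assumes "quad V w" "\<not> oriented V w"
  obtains u l p s where "fst l \<in> V" "w = u @ [l] @ p @ [l] @ s"
proof -
  from assms(2) obtain x where x: "x \<in> V"
    "count (mset w) (x, True) \<noteq> count (mset w) (x, False) \<or> count (mset w) (x, True) > 1"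
    unfolding oriented_def by force
  have "count (mset w) (x, True) + count (mset w) (x, False) \<in> {0, 2}"
    using assms(1) x(1) unfolding quad_def count_symbols by blast
  with x(2) have "count (mset w) (x, True) = 2 \<or> count (mset w) (x, False) = 2"
    unfolding insert_iff empty_iff by arith
  then obtain b where b: "count (mset w) (x, b) = 2" by blast
  then have "(x, b) \<in> set w" by (metis count_eq_zero_iff set_mset_mset zero_neq_numeral)
  then obtain u v where w: "w = u @ (x, b) # v" "(x, b) \<notin> set u" by (metis split_list_first)
  have "count (mset u) (x, b) = 0" by (metis count_eq_zero_iff set_mset_mset w(2))
  with b w(1) have "count (mset v) (x, b) = 1" by simp
  then have "(x, b) \<in> set v" by (metis count_eq_zero_iff set_mset_mset zero_neq_one)
  then obtain p s where "v = p @ (x, b) # s" by (metis split_list)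
  with w x(1) show thesis by (intro that[of "(x, b)" u p s]) auto
qed

text \<open>Every move shortens the word. A square is taken exactly while the word is not oriented,
  and removing an interlaced pair keeps it oriented, so squares appear only for words that were not
  oriented at the start.\<close>

lemma ext_forest_exists:
  assumes "quad V w"
  shows "\<exists>xs ps F. ext V w xs ps [] (flat F) \<and> wf_forest V F \<and> (xs = [] \<longleftrightarrow> oriented V w)"
  using assms
proof (induction w rule: length_induct)
  case (1 w)
  note IH = 1(1)[rule_format]
  show ?case
  proof (cases "oriented V w")
    case False
    obtain u l p s where l: "fst l \<in> V" and w: "w = u @ [l] @ p @ [l] @ s"
      using not_oriented_square[OF 1(2) False] .
    have "quad V (u @ winv p @ s)"
      by (rule quad_diff[OF 1(2), of _ "{#fst l, fst l#}"]) (auto simp: w mset_fst_winv[unfolded mset_map])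
    then obtain xs ps F where "ext V (u @ winv p @ s) xs ps [] (flat F)" "wf_forest V F"
      using IH[of "u @ winv p @ s"] w by auto
    then show ?thesis using ext_square[OF l, of u p s xs ps] False unfolding w by blast
  next
    case True
    show ?thesis
      using True
    proof (cases rule: linked_or_forest)
      case (1 F)
      then show ?thesis using True ext_refl by blast
    next
      case (2 u l p m q r s)
      have "quad V (u @ r @ q @ p @ s)"
      proof (rule quad_diff[OF 1(2), of _ "{#fst l, fst l, fst m, fst m#}"])
        have "fst l \<noteq> fst m" using quad_count[OF 1(2) 2(1)] 2(3) by auto
        then show "count {#fst l, fst l, fst m, fst m#} x \<in> {0, 2}" for x by auto
      qed (simp add: 2 ac_simps)
      moreover have o: "oriented V (u @ r @ q @ p @ s)"
      proof (rule orientedI)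
        fix n :: "'a \<times> bool" assume n: "fst n \<in> V"
        show "count (mset (u @ r @ q @ p @ s)) n \<le> 1 \<and>
          count (mset (u @ r @ q @ p @ s)) (letter_inv n) = count (mset (u @ r @ q @ p @ s)) n"
        proof -
          define t where "t k = of_bool (k = l) + of_bool (k = letter_inv l) + of_bool (k = m) + (of_bool (k = letter_inv m) :: nat)"
            for k
          have "count (mset w) k = count (mset (u @ r @ q @ p @ s)) k + t k" for k
            unfolding 2(3) t_def by auto
          moreover have "t (letter_inv n) = t n" unfolding t_def by (auto simp: letter_inv_eq_iff)
          ultimately show ?thesis using oriented_letter[OF True n] by simp
        qed
      qed
      ultimately obtain ps F where "ext V (u @ r @ q @ p @ s) [] ps [] (flat F)" "wf_forest V F"
        using IH[of "u @ r @ q @ p @ s"] 2(3) by auto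
      then show ?thesis using ext_handle[OF 2(1,2)] True unfolding 2(3) by blast
    qed
  qed
qed

text \<open>An innermost bracket contains constants only, and erasing it leaves a forest; this
  drives the recursion in \<open>ext_holes_exist\<close>.\<close>

lemma forest_leaf:
  assumes "wf_forest V F"
  shows "fst ` set (flat F) \<inter> V = {} \<or> (\<exists>u l b s F'. flat F = u @ [l] @ b @ [letter_inv l] @ s \<and>
     fst l \<in> V \<and> fst ` set b \<inter> V = {} \<and> flat F' = u @ s \<and> wf_forest V F')"
  using assms
proof (induction F)
  case (FK c w)
  then have "fst ` set (flat w) \<inter> V = {} \<or> (\<exists>u l b s F'. flat w = u @ [l] @ b @ [letter_inv l] @ s \<and>
     fst l \<in> V \<and> fst ` set b \<inter> V = {} \<and> flat F' = u @ s \<and> wf_forest V F')" by simp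
  then show ?case
  proof (elim disjE exE conjE)
    fix u l b s F'
    assume "flat w = u @ [l] @ b @ [letter_inv l] @ s" "fst l \<in> V" "fst ` set b \<inter> V = {}" "flat F' = u @ s" "wf_forest V F'"
    moreover from this have "flat (FK c w) = (c # u) @ [l] @ b @ [letter_inv l] @ s" "flat (FK c F') = (c # u) @ s"
      "wf_forest V (FK c F')" using FK.prems by auto
    ultimately show ?thesis by blast
  qed (use FK.prems in auto)
next
  case (FB m v w)
  then have "fst ` set (flat v) \<inter> V = {} \<or> (\<exists>u l b s F'. flat v = u @ [l] @ b @ [letter_inv l] @ s \<and>
     fst l \<in> V \<and> fst ` set b \<inter> V = {} \<and> flat F' = u @ s \<and> wf_forest V F')" by simp
  then show ?case
  proof (elim disjE exE conjE)
    assume "fst ` set (flat v) \<inter> V = {}"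
    moreover have "flat (FB m v w) = [] @ [m] @ flat v @ [letter_inv m] @ flat w" by simp
    moreover have "flat w = [] @ flat w" "wf_forest V w" "fst m \<in> V" using FB.prems by auto
    ultimately show ?thesis by blast
  next
    fix u l b s F'
    assume "flat v = u @ [l] @ b @ [letter_inv l] @ s" "fst l \<in> V" "fst ` set b \<inter> V = {}" "flat F' = u @ s" "wf_forest V F'"
    moreover from this have "flat (FB m v w) = (m # u) @ [l] @ b @ [letter_inv l] @ (s @ [letter_inv m] @ flat w)"
      "flat (FB m F' w) = (m # u) @ (s @ [letter_inv m] @ flat w)" "wf_forest V (FB m F' w)" using FB.prems by auto
    ultimately show ?thesis by blast
  qed
qed simp

lemma ext_holes_exist:
  assumes "wf_forest V F"
  shows "\<exists>zs b. ext V (flat F) [] [] zs b \<and> fst ` set b \<inter> V = {}"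
  using assms
proof (induction F rule: measure_induct_rule[of "\<lambda>F. length (flat F)"])
  case (less F)
  from forest_leaf[OF less.prems] show ?case
  proof (elim disjE exE conjE)
    assume "fst ` set (flat F) \<inter> V = {}"
    then show ?thesis using ext_refl by blast
  next
    fix u l b s F'
    assume l: "flat F = u @ [l] @ b @ [letter_inv l] @ s" "fst l \<in> V" "fst ` set b \<inter> V = {}" "flat F' = u @ s" "wf_forest V F'"
    then obtain zs c where "ext V (u @ s) [] [] zs c" "fst ` set c \<inter> V = {}" using less.IH[of F'] by auto
    then show ?thesis using ext_hole[OF l(2,3)] l(1) by metis
  qed
qed

lemma ext_append:
  assumes "ext V w xs ps zs w1" "zs = []" "ext V w1 [] [] zs' w'"
  shows "ext V w xs ps zs' w'"
  using assms by (induction rule: ext.induct) (auto intro: ext.intros simp del: append_Cons append_Nil)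

lemma ext_full_exists:
  assumes "quad V w"
  shows "\<exists>xs ps zs b. ext V w xs ps zs b \<and> fst ` set b \<inter> V = {} \<and> (xs = [] \<longleftrightarrow> oriented V w)"
  using ext_forest_exists[OF assms] ext_holes_exist ext_append by metis

lemma ext_hole_consts: "ext V w xs ps zs w' \<Longrightarrow> (z, b) \<in> set zs \<Longrightarrow> fst ` set b \<inter> V = {}"
  by (induction rule: ext.induct) auto

section \<open>Colours at the ends of symbols and their behaviour under cut and paste\<close>

section \<open>Colourings\<close>

text \<open>A colouring assigns a source and a target to every symbol. A word is compatible with it if it is
  a path; on the surface of a quadratic word, colours are the vertices of the boundary.\<close>

definition source :: "('a \<Rightarrow> 'i) \<Rightarrow> ('a \<Rightarrow> 'i) \<Rightarrow> 'a \<times> bool \<Rightarrow> 'i" where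
  "source s t l = (if snd l then s (fst l) else t (fst l))"
definition target :: "('a \<Rightarrow> 'i) \<Rightarrow> ('a \<Rightarrow> 'i) \<Rightarrow> 'a \<times> bool \<Rightarrow> 'i" where
  "target s t l = (if snd l then t (fst l) else s (fst l))"

primrec path :: "('a \<Rightarrow> 'i) \<Rightarrow> ('a \<Rightarrow> 'i) \<Rightarrow> 'i \<Rightarrow> 'a word \<Rightarrow> 'i \<Rightarrow> bool" where
  "path s t b [] c = (b = c)"
| "path s t b (l # w) c = (source s t l = b \<and> path s t (target s t l) w c)"

lemma source_target_simps [simp]:
  "source s t (letter_inv l) = target s t l" "target s t (letter_inv l) = source s t l"
  "source s t (x, True) = s x" "source s t (x, False) = t x" "target s t (x, True) = t x" "target s t (x, False) = s x"
  by (auto simp: source_def target_def)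

lemma path_append [simp]: "path s t b (u @ v) c \<longleftrightarrow> (\<exists>d. path s t b u d \<and> path s t d v c)"
  by (induction u arbitrary: b) auto

lemma path_winv [simp]: "path s t b (winv w) c \<longleftrightarrow> path s t c w b"
  by (induction w arbitrary: b c) (auto simp: winv_Cons)

lemma path_cong:
  "(\<And>x. x \<in> fst ` set w \<Longrightarrow> s x = s' x \<and> t x = t' x) \<Longrightarrow> path s t b w c \<longleftrightarrow> path s' t' b w c"
  by (induction w arbitrary: b) (auto simp: source_def target_def)

lemma path_cong2:
  "path s t b w c \<Longrightarrow> (\<And>x. x \<in> fst ` set w \<Longrightarrow> s' x = s x \<and> t' x = t x) \<Longrightarrow> path s' t' b w c"
  using path_cong[of w s s' t t'] by metis

lemma path_end: "path s t b w c \<Longrightarrow> path s t b w c' \<Longrightarrow> c = c'"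
  by (induction w arbitrary: b) auto

text \<open>A letter fixes the colours at its two ends, which is why a nonempty coefficient pins
  down the colour at which it is read.\<close>

lemma path_det: "w \<noteq> [] \<Longrightarrow> path s t b w c \<Longrightarrow> path s t b' w c' \<Longrightarrow> b = b' \<and> c = c'"
  by (cases w) (auto dest: path_end)

definition recolour :: "'a \<times> bool \<Rightarrow> 'i \<Rightarrow> 'i \<Rightarrow> ('a \<Rightarrow> 'i) \<times> ('a \<Rightarrow> 'i) \<Rightarrow> ('a \<Rightarrow> 'i) \<times> ('a \<Rightarrow> 'i)" where
  "recolour l p q st = (if snd l then ((fst st)(fst l := p), (snd st)(fst l := q))
     else ((fst st)(fst l := q), (snd st)(fst l := p)))"

lemma recolour_cases:
  obtains s' t' where "source s' t' l = p" "target s' t' l = q" "\<And>x. x \<noteq> fst l \<Longrightarrow> s' x = s x \<and> t' x = t x"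
proof -
  have "source (fst (recolour l p q (s, t))) (snd (recolour l p q (s, t))) l = p"
    "target (fst (recolour l p q (s, t))) (snd (recolour l p q (s, t))) l = q"
    "\<And>x. x \<noteq> fst l \<Longrightarrow> fst (recolour l p q (s, t)) x = s x \<and> snd (recolour l p q (s, t)) x = t x"
    by (auto simp: recolour_def source_def target_def)
  then show thesis by (rule that)
qed

text \<open>The two occurrences of a letter make the colours at the cut points agree, so the pieces
  still fit together after they have been permuted or inverted.\<close>

lemma ext_path: "ext V w xs ps zs w' \<Longrightarrow> zs = [] \<Longrightarrow> path s t b w c \<Longrightarrow> path s t b w' c"
proof (induction arbitrary: b c rule: ext.induct)
  case (ext_handle l m u r q p v ps zs w')
  then obtain d e f g where "path s t b u d" "path s t d r e" "path s t e q f" "path s t f p g" "path s t g v c"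
    by auto
  then have "path s t b (u @ r @ q @ p @ v) c" by auto
  then show ?case using ext_handle by blast
qed auto

lemma quad_square:
  assumes "quad V (u @ [l] @ p @ [l] @ s)" "fst l \<in> V"
  shows "quad V (u @ winv p @ s)" "fst l \<notin> fst ` set u" "fst l \<notin> fst ` set p" "fst l \<notin> fst ` set s"
proof -
  show "quad V (u @ winv p @ s)"
    by (rule quad_diff[OF assms(1), of _ "{#fst l, fst l#}"]) (auto simp: mset_fst_winv[unfolded mset_map])
  show "fst l \<notin> fst ` set u" "fst l \<notin> fst ` set p" "fst l \<notin> fst ` set s"
    using quad_count[OF assms] unfolding count_symbols_pos by auto
qed

lemma quad_handle:
  assumes "quad V (u @ [l] @ p @ [m] @ q @ [letter_inv l] @ r @ [letter_inv m] @ s)" (is "quad V ?w") "fst l \<in> V" "fst m \<in> V"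
  shows "quad V (u @ r @ q @ p @ s)" "fst l \<noteq> fst m" "fst l \<notin> fst ` set (u @ r @ q @ p @ s)"
    "fst m \<notin> fst ` set (u @ r @ q @ p @ s)"
proof -
  show lm: "fst l \<noteq> fst m"
    using quad_count[OF assms(1,2)] by auto
  then show "quad V (u @ r @ q @ p @ s)"
    by (intro quad_diff[OF assms(1), of _ "{#fst l, fst l, fst m, fst m#}"])
      (auto simp: ac_simps)
  have "count (symbols (u @ r @ q @ p @ s)) (fst l) = 0" "count (symbols (u @ r @ q @ p @ s)) (fst m) = 0"
    using quad_count[OF assms(1,2)] quad_count[OF assms(1,3)] lm by simp_all
  then show "fst l \<notin> fst ` set (u @ r @ q @ p @ s)" "fst m \<notin> fst ` set (u @ r @ q @ p @ s)"
    unfolding count_symbols_pos by simp_all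
qed

text \<open>The converse of \<open>ext_path\<close>: an extracted letter is coloured by the cut
  points between which it is put back, and no other symbol is affected. This lets a second colouring
  of the forest become a second colouring of the word.\<close>

lemma ext_path_extend:
  assumes "ext V w xs ps zs w'" "zs = []" "quad V w" "path s t b w' c"
  shows "\<exists>s' t'. (\<forall>x. x \<notin> moved_vars xs ps zs \<longrightarrow> s' x = s x \<and> t' x = t x) \<and> path s' t' b w c"
  using assms
proof (induction arbitrary: b c rule: ext.induct)
  case (ext_refl w)
  then show ?case by blast
next
  case (ext_square l u p r xs ps zs w')
  note q = quad_square[OF ext_square.prems(2) ext_square.hyps(1)]
  from ext_square.IH[OF ext_square.prems(1) q(1) ext_square.prems(3)] obtain s1 t1
    where st: "\<And>x. x \<notin> moved_vars xs ps zs \<Longrightarrow> s1 x = s x \<and> t1 x = t x" "path s1 t1 b (u @ winv p @ r) c" by blast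
  then obtain d e where de: "path s1 t1 b u d" "path s1 t1 e p d" "path s1 t1 e r c" by auto
  obtain s' t' where st': "source s' t' l = d" "target s' t' l = e" "\<And>x. x \<noteq> fst l \<Longrightarrow> s' x = s1 x \<and> t' x = t1 x"
    by (rule recolour_cases[of l d "e" s1 t1]) blast
  have "path s' t' b' v c' \<longleftrightarrow> path s1 t1 b' v c'" if "fst l \<notin> fst ` set v" for v b' c'
    using that by (intro path_cong st'(3)) blast
  then have "path s' t' b u d" "path s' t' e p d" "path s' t' e r c" using de q by blast+
  then have "path s' t' b (u @ [l] @ p @ [l] @ r) c" using st'(1,2) by auto
  moreover have "s' x = s x \<and> t' x = t x" if "x \<notin> moved_vars (fst l # xs) ps zs" for x
    using that st(1)[of x] st'(3)[of x] by simp
  ultimately show ?case by blast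
next
  case (ext_handle l m u r q p v ps zs w')
  note q = quad_handle[OF ext_handle.prems(2) ext_handle.hyps(1,2)]
  from ext_handle.IH[OF ext_handle.prems(1) q(1) ext_handle.prems(3)] obtain s1 t1
    where st: "\<And>x. x \<notin> moved_vars [] ps zs \<Longrightarrow> s1 x = s x \<and> t1 x = t x" "path s1 t1 b (u @ r @ q @ p @ v) c" by blast
  then obtain d e f g where de: "path s1 t1 b u d" "path s1 t1 d r e" "path s1 t1 e q f" "path s1 t1 f p g" "path s1 t1 g v c" by auto
  \<comment> \<open>The cut points are d, e, f, g in the order of u, r, q, p, s. For the original
    order to be a path, l must run from d to f and m from g to e.\<close>
  obtain s2 t2 where st2: "source s2 t2 l = d" "target s2 t2 l = f" "\<And>x. x \<noteq> fst l \<Longrightarrow> s2 x = s1 x \<and> t2 x = t1 x"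
    by (rule recolour_cases[of l d "f" s1 t1]) blast
  obtain s' t' where st': "source s' t' m = g" "target s' t' m = e" "\<And>x. x \<noteq> fst m \<Longrightarrow> s' x = s2 x \<and> t' x = t2 x"
    by (rule recolour_cases[of m g "e" s2 t2]) blast
  have l: "source s' t' l = d" "target s' t' l = f" using st2(1,2) st'(3)[of "fst l"] q(2) by (auto simp: source_def target_def)
  have "path s' t' b' v c' \<longleftrightarrow> path s1 t1 b' v c'" if "fst l \<notin> fst ` set v" "fst m \<notin> fst ` set v" for v b' c'
    using that st2(3) st'(3) by (intro path_cong) metis
  then have "path s' t' b u d" "path s' t' d r e" "path s' t' e q f" "path s' t' f p g" "path s' t' g v c"
    using de q(3,4) by (simp_all add: image_Un)
  then have "path s' t' b (u @ [l] @ p @ [m] @ q @ [letter_inv l] @ r @ [letter_inv m] @ v) c" using l st'(1,2) by auto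
  moreover have "s' x = s x \<and> t' x = t x" if "x \<notin> moved_vars [] ((fst l, fst m) # ps) zs" for x
    using that st(1)[of x] st'(3)[of x] st2(3)[of x] by simp
  ultimately show ?case by blast
qed simp

section \<open>Pulling the holes of a forest out in any prescribed order\<close>

section \<open>Forests and the order of their holes\<close>

abbreviation branch_vars :: "'a forest \<Rightarrow> 'a list" where "branch_vars F \<equiv> map (\<lambda>p. fst (fst p)) (branches F)"

lemma forest_vars: "wf_forest V F \<Longrightarrow> fst ` set (flat F) \<inter> V = set (branch_vars F)"
proof (induction F)
  case (FB l u w)
  then have "fst ` set (flat u) \<inter> V = set (branch_vars u)" "fst ` set (flat w) \<inter> V = set (branch_vars w)" "fst l \<in> V" by auto
  then show ?case by (simp add: image_Un Int_Un_distrib2)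
qed auto

lemma forest_vars_sub: "wf_forest V F \<Longrightarrow> x \<in> fst ` set (flat F) \<Longrightarrow> x \<in> V \<Longrightarrow> x \<in> set (branch_vars F)"
  using forest_vars by blast

lemma branch_vars_V: "wf_forest V F \<Longrightarrow> set (branch_vars F) \<subseteq> V"
  using forest_vars by blast

lemma forest_path:
  "path s t b (flat F) c \<Longrightarrow> path s t b (level F) c \<and> (\<forall>(l, v)\<in>set (branches F). path s t (target s t l) v (target s t l))"
proof (induction F arbitrary: b c)
  case (FB l u w)
  then obtain d where d: "source s t l = b" "path s t (target s t l) (flat u) d" "target s t l = d" "path s t b (flat w) c"
    by auto
  with FB.IH show ?case by fastforce
qed auto

text \<open>Without a constant at the top level, the root colour is carried only by the outer ends
  of the top brackets, and these may be changed together.\<close>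

lemma forest_recolor_root:
  assumes "wf_forest V F" "distinct (branch_vars F)" "path s t b (flat F) c" "level F = []"
  shows "\<exists>s' t'. (\<forall>x. x \<notin> set (branch_vars F) \<longrightarrow> s' x = s x \<and> t' x = t x) \<and> path s' t' z (flat F) z"
  using assms
proof (induction F arbitrary: b c)
  case FNil
  then show ?case by auto
next
  case (FB l u w)
  have d: "source s t l = b" "path s t (target s t l) (flat u) (target s t l)" "path s t b (flat w) c"
    using FB.prems(3) by auto
  from FB.IH(2)[OF _ _ d(3)] FB.prems obtain s1 t1
    where st: "\<And>x. x \<notin> set (branch_vars w) \<Longrightarrow> s1 x = s x \<and> t1 x = t x" "path s1 t1 z (flat w) z" by auto
  obtain s' t' where st': "source s' t' l = z" "target s' t' l = target s t l" "\<And>x. x \<noteq> fst l \<Longrightarrow> s' x = s1 x \<and> t' x = t1 x"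
    by (rule recolour_cases[of l z "target s t l" s1 t1]) blast
  have lV: "fst l \<in> V" using FB.prems(1) by simp
  have nl: "fst l \<notin> fst ` set (flat u)" "fst l \<notin> fst ` set (flat w)"
    using forest_vars_sub[of V u "fst l"] forest_vars_sub[of V w "fst l"] FB.prems(1,2) lV by auto
  have "path s' t' (target s t l) (flat u) (target s t l)"
  proof (subst path_cong[of _ _ s _ t])
    fix x assume x: "x \<in> fst ` set (flat u)"
    have "x \<notin> set (branch_vars w)"
    proof
      assume w: "x \<in> set (branch_vars w)"
      then have "x \<in> V" using branch_vars_V[of V w] FB.prems(1) by auto
      then have "x \<in> set (branch_vars u)" using forest_vars_sub[of V u, OF _ x] FB.prems(1) by simp
      with w FB.prems(2) show False by auto
    qed
    moreover have "x \<noteq> fst l" using x nl(1) by blast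
    ultimately show "s' x = s x \<and> t' x = t x" using st(1)[of x] st'(3)[of x] by simp
  qed (rule d(2))
  moreover have "path s' t' z (flat w) z"
    by (rule path_cong2[OF st(2)]) (use nl(2) st'(3) in metis)
  ultimately have "path s' t' z (flat (FB l u w)) z" using st'(1,2) by auto
  moreover have "s' x = s x \<and> t' x = t x" if "x \<notin> set (branch_vars (FB l u w))" for x
    using that st(1)[of x] st'(3)[of x] by auto
  ultimately show ?case by blast
qed simp

text \<open>An empty level inside a bracket carries a colour that no constant determines. This will
  show that a word with a unique colouring has no empty hole.\<close>

lemma forest_recolor:
  assumes "wf_forest V F" "distinct (branch_vars F)" "path s t b (flat F) c" "(l0, []) \<in> set (branches F)"
  shows "\<exists>s' t'. (\<forall>x. x \<notin> set (branch_vars F) \<longrightarrow> s' x = s x \<and> t' x = t x) \<and> path s' t' b (flat F) c \<and> target s' t' l0 = z"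
  using assms
proof (induction F arbitrary: b c)
  case (FK k w)
  then have "path s t (target s t k) (flat w) c" by simp
  from FK.IH[OF _ _ this] FK.prems obtain s' t' where
    st: "\<And>x. x \<notin> set (branch_vars w) \<Longrightarrow> s' x = s x \<and> t' x = t x" "path s' t' (target s t k) (flat w) c" "target s' t' l0 = z" by auto
  have "fst k \<notin> set (branch_vars w)" using FK.prems(1) branch_vars_V[of V w] by auto
  then have "source s' t' k = source s t k" "target s' t' k = target s t k" using st(1)[of "fst k"] by (auto simp: source_def target_def)
  then have "path s' t' b (flat (FK k w)) c" using st(2) FK.prems(3) by auto
  then show ?case using st by auto
next
  case (FB l u w)
  have d: "source s t l = b" "path s t (target s t l) (flat u) (target s t l)" "path s t b (flat w) c"
    using FB.prems(3) by auto
  have lV: "fst l \<in> V" using FB.prems(1) by simp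
  have wf: "wf_forest V u" "wf_forest V w" and dis: "distinct (branch_vars u)" "distinct (branch_vars w)" using FB.prems by auto
  have nl: "fst l \<notin> fst ` set (flat u)" "fst l \<notin> fst ` set (flat w)" "fst l \<notin> set (branch_vars u)" "fst l \<notin> set (branch_vars w)"
    using forest_vars_sub[of V u "fst l"] forest_vars_sub[of V w "fst l"] FB.prems(1,2) lV by auto
  have uw: "fst ` set (flat w) \<inter> set (branch_vars u) = {}" "fst ` set (flat u) \<inter> set (branch_vars w) = {}"
  proof -
    have "set (branch_vars u) \<inter> set (branch_vars w) = {}" using FB.prems(2) by auto
    then show "fst ` set (flat w) \<inter> set (branch_vars u) = {}" "fst ` set (flat u) \<inter> set (branch_vars w) = {}"
      using forest_vars[OF wf(1)] forest_vars[OF wf(2)] by blast+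
  qed
  have lev0: "(l0 = l \<and> level u = []) \<or> (l0, []) \<in> set (branches u) \<or> (l0, []) \<in> set (branches w)"
    using FB.prems(4) by auto
  then consider "l0 = l" "level u = []" | "(l0, []) \<in> set (branches u)" | "(l0, []) \<in> set (branches w)" by blast
  then show ?case
  proof cases
    case 1
    obtain s1 t1 where st: "\<And>x. x \<notin> set (branch_vars u) \<Longrightarrow> s1 x = s x \<and> t1 x = t x" "path s1 t1 z (flat u) z"
      using forest_recolor_root[OF wf(1) dis(1) d(2) 1(2)] by blast
    obtain s' t' where st': "source s' t' l = b" "target s' t' l = z" "\<And>x. x \<noteq> fst l \<Longrightarrow> s' x = s1 x \<and> t' x = t1 x"
      by (rule recolour_cases[of l b "z" s1 t1]) blast
    have "path s' t' z (flat u) z"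
      by (rule path_cong2[OF st(2)]) (use nl(1) st'(3) in metis)
    moreover have "path s' t' b (flat w) c"
    proof (subst path_cong[of _ _ s _ t])
      fix x assume "x \<in> fst ` set (flat w)"
      then have "x \<noteq> fst l" "x \<notin> set (branch_vars u)" using nl(2) uw(1) by blast+
      then show "s' x = s x \<and> t' x = t x" using st(1)[of x] st'(3)[of x] by simp
    qed (rule d(3))
    ultimately have "path s' t' b (flat (FB l u w)) c" using st'(1,2) by auto
    moreover have "s' x = s x \<and> t' x = t x" if "x \<notin> set (branch_vars (FB l u w))" for x
      using that st(1)[of x] st'(3)[of x] by auto
    ultimately show ?thesis using 1 st'(2) by blast
  next
    case 2
    from FB.IH(1)[OF wf(1) dis(1) d(2) 2] obtain s' t' where
      st: "\<And>x. x \<notin> set (branch_vars u) \<Longrightarrow> s' x = s x \<and> t' x = t x" "path s' t' (target s t l) (flat u) (target s t l)" "target s' t' l0 = z" by blast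
    have "source s' t' l = source s t l" "target s' t' l = target s t l" using st(1)[OF nl(3)] by (auto simp: source_def target_def)
    moreover have "path s' t' b (flat w) c"
      by (rule path_cong2[OF d(3)]) (use st(1) uw(1) in \<open>metis IntI empty_iff\<close>)
    ultimately have "path s' t' b (flat (FB l u w)) c" using d(1) st(2) by auto
    then show ?thesis using st by (intro exI[of _ s'] exI[of _ t']) auto
  next
    case 3
    from FB.IH(2)[OF wf(2) dis(2) d(3) 3] obtain s' t' where
      st: "\<And>x. x \<notin> set (branch_vars w) \<Longrightarrow> s' x = s x \<and> t' x = t x" "path s' t' b (flat w) c" "target s' t' l0 = z" by blast
    have "source s' t' l = source s t l" "target s' t' l = target s t l" using st(1)[OF nl(4)] by (auto simp: source_def target_def)
    moreover have "path s' t' (target s t l) (flat u) (target s t l)"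
      by (rule path_cong2[OF d(2)]) (use st(1) uw(2) in \<open>metis IntI empty_iff\<close>)
    ultimately have "path s' t' b (flat (FB l u w)) c" using d(1) st(2) by auto
    then show ?thesis using st by (intro exI[of _ s'] exI[of _ t']) auto
  qed
qed simp

text \<open>\<open>ins X F\<close> is what remains of \<open>flat F\<close> after the holes in \<open>X\<close> have been extracted to the left; \<open>pre X l F\<close>
  is its prefix up to the letter \<open>l\<close>. Inserting inverses instead of deleting holes keeps the prefixes short
  for every order of extraction.\<close>

primrec ins :: "('a \<times> bool) set \<Rightarrow> 'a forest \<Rightarrow> 'a word" where
  "ins X FNil = []"
| "ins X (FK c w) = c # ins X w"
| "ins X (FB l u w) = [l] @ (if l \<in> X then winv (level u) else []) @ ins X u @ [letter_inv l] @ ins X w"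

primrec pre :: "('a \<times> bool) set \<Rightarrow> 'a \<times> bool \<Rightarrow> 'a forest \<Rightarrow> 'a word" where
  "pre X l0 FNil = []"
| "pre X l0 (FK c w) = c # pre X l0 w"
| "pre X l0 (FB l u w) = [l] @ (if l = l0 then [] else (if l \<in> X then winv (level u) else []) @
     (if l0 \<in> fst ` set (branches u) then pre X l0 u else ins X u @ [letter_inv l] @ pre X l0 w))"

lemma ins_insert: "l0 \<notin> fst ` set (branches F) \<Longrightarrow> ins (insert l0 X) F = ins X F"
  by (induction F) (auto simp: image_Un)

text \<open>If the word is P r with P ending in l0, then P r = (P v P^-1)(P v^-1 r). The inverse of
  v is inserted, since v itself may be scattered among inner brackets.\<close>

lemma ins_step:
  assumes "distinct (map fst (branches F))" "(l0, v) \<in> set (branches F)" "l0 \<notin> X"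
  shows "cls (ins X F) = cls (pre X l0 F) + cls v - cls (pre X l0 F) + cls (ins (insert l0 X) F)"
  using assms
proof (induction F)
  case (FK c w)
  then have "cls (ins X w) = cls (pre X l0 w) + cls v - cls (pre X l0 w) + cls (ins (insert l0 X) w)" by simp
  then show ?case by (simp add: group_simps)
next
  case (FB l u w)
  have M: "l0 \<in> fst ` set (branches z)" if "(l0, v) \<in> set (branches z)" for z
    using that by (metis fst_conv image_eqI)
  have D: "l \<notin> fst ` set (branches u)" "l \<notin> fst ` set (branches w)" "fst ` set (branches u) \<inter> fst ` set (branches w) = {}"
    using FB.prems(1) by auto
  have "(l0 = l \<and> v = level u) \<or> (l0, v) \<in> set (branches u) \<or> (l0, v) \<in> set (branches w)" using FB.prems(2) by auto
  then consider "l0 = l" "v = level u" "l0 \<notin> fst ` set (branches u)" "l0 \<notin> fst ` set (branches w)"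
    | "l0 \<noteq> l" "(l0, v) \<in> set (branches u)" "l0 \<notin> fst ` set (branches w)"
    | "l0 \<noteq> l" "(l0, v) \<in> set (branches w)" "l0 \<notin> fst ` set (branches u)"
    using D M by (metis IntI empty_iff)
  then show ?case
  proof cases
    case 1
    with FB.prems(3) show ?thesis by (simp add: group_simps ins_insert)
  next
    case 2
    then have "cls (ins X u) = cls (pre X l0 u) + cls v - cls (pre X l0 u) + cls (ins (insert l0 X) u)"
      using FB by simp
    then show ?thesis using 2 M[OF 2(2)] by (simp add: group_simps ins_insert)
  next
    case 3
    then have "cls (ins X w) = cls (pre X l0 w) + cls v - cls (pre X l0 w) + cls (ins (insert l0 X) w)"
      using FB by simp
    then show ?thesis using 3 by (simp add: group_simps ins_insert)
  qed
qed simp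

text \<open>From the innermost bracket outwards, every l v^-1 v l^-1 cancels.\<close>

lemma ins_all: "fst ` set (branches F) \<subseteq> X \<Longrightarrow> cls (ins X F) = cls (level F)"
  by (induction F) (auto simp: group_simps image_Un)

lemma ins_empty: "ins {} F = flat F"
  by (induction F) auto

lemma wsum_ins: "wsum wt (ins X F) \<le> wsum wt (flat F) + (\<Sum>(l, v)\<leftarrow>branches F. wsum wt v)"
  by (induction F) auto

lemma wsum_pre: "wsum wt (pre X l0 F) \<le> wsum wt (ins X F)"
  by (induction F) auto

lemma ins_letters: "fst ` set (ins X F) \<subseteq> fst ` set (flat F)"
proof (induction F)
  case (FB l u w)
  have "fst ` set (level v) \<subseteq> fst ` set (flat v)" for v :: "'a forest" by (induction v) auto
  then have "fst ` set (winv (level u)) \<subseteq> fst ` set (flat u)" by simp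
  with FB show ?case by (cases "l \<in> X") (simp_all add: image_Un subset_insertI2 le_supI1 le_supI2)
qed auto

lemma pre_letters: "fst ` set (pre X l0 F) \<subseteq> fst ` set (flat F)"
proof (induction F)
  case (FB l u w)
  have "fst ` set (level v) \<subseteq> fst ` set (flat v)" for v :: "'a forest" by (induction v) auto
  then have "fst ` set (winv (level u)) \<subseteq> fst ` set (flat u)" by simp
  with FB ins_letters[of X u] show ?case
    by (cases "l \<in> X"; cases "l0 \<in> fst ` set (branches u)") (simp_all add: image_Un subset_insertI2 le_supI1 le_supI2)
qed auto

lemma mset_levels:
  "wf_forest V F \<Longrightarrow> mset (level F @ concat (map snd (branches F))) = filter_mset (\<lambda>l. fst l \<notin> V) (mset (flat F))"
proof (induction F)
  case (FB l u w)
  then have "filter_mset (\<lambda>l. fst l \<notin> V) (mset (flat u)) = mset (level u @ concat (map snd (branches u)))"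
    "filter_mset (\<lambda>l. fst l \<notin> V) (mset (flat w)) = mset (level w @ concat (map snd (branches w)))" by auto
  then show ?case using FB.prems by (simp add: ac_simps)
qed auto

lemma level_vars: "wf_forest V u \<Longrightarrow> fst ` set (level u) \<inter> V = {}"
  by (induction u) auto

lemma branches_consts: "wf_forest V F \<Longrightarrow> (l, v) \<in> set (branches F) \<Longrightarrow> fst ` set v \<inter> V = {}"
proof (induction F)
  case (FB m u w)
  then consider "v = level u" | "(l, v) \<in> set (branches u)" | "(l, v) \<in> set (branches w)" by auto
  then show ?case using FB level_vars[of V u] by cases auto
qed auto

lemma Int_cover_subset:
  "S \<subseteq> insert a (L \<union> M \<union> N) \<Longrightarrow> L \<inter> V = {} \<Longrightarrow> M \<inter> V \<subseteq> B \<Longrightarrow> N \<inter> V \<subseteq> C \<Longrightarrow> S \<inter> V \<subseteq> insert a (B \<union> C)"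
  by blast

lemma ins_vars: "wf_forest V F \<Longrightarrow> fst ` set (ins X F) \<inter> V \<subseteq> set (branch_vars F)"
proof (induction F)
  case (FB l u w)
  have "fst ` set (ins X (FB l u w)) \<subseteq> insert (fst l) (fst ` set (level u) \<union> fst ` set (ins X u) \<union> fst ` set (ins X w))"
    by (cases "l \<in> X") (simp_all add: image_Un subset_insertI2 le_supI1 le_supI2)
  moreover have "fst ` set (level u) \<inter> V = {}" using level_vars FB.prems by auto
  moreover have "fst ` set (ins X u) \<inter> V \<subseteq> set (branch_vars u)" "fst ` set (ins X w) \<inter> V \<subseteq> set (branch_vars w)"
    using FB by auto
  ultimately have "fst ` set (ins X (FB l u w)) \<inter> V \<subseteq> insert (fst l) (set (branch_vars u) \<union> set (branch_vars w))"
    by (rule Int_cover_subset)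
  then show ?case by simp
qed auto

text \<open>Whatever has been extracted before, a prefix contains only variables met earlier in the
  traversal of the forest, because the insertions consist of constants. This makes the substitution
  triangular for every order of extraction.\<close>

lemma pre_vars:
  assumes "wf_forest V F" "distinct (branch_vars F)" "l0 \<in> fst ` set (branches F)"
  shows "\<exists>q. pre X l0 F = q @ [l0] \<and> fst ` set q \<inter> V \<subseteq> set (takeWhile (\<lambda>x. x \<noteq> fst l0) (branch_vars F))"
  using assms
proof (induction F)
  case (FK c w)
  then obtain q where "pre X l0 w = q @ [l0]" "fst ` set q \<inter> V \<subseteq> set (takeWhile (\<lambda>x. x \<noteq> fst l0) (branch_vars w))" by auto
  with FK.prems(1) show ?case by (intro exI[of _ "c # q"]) auto
next
  case (FB l u w)
  have lu: "fst ` set (level u) \<inter> V = {}" using level_vars FB.prems(1) by auto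
  consider "l0 = l" | "l0 \<noteq> l" "l0 \<in> fst ` set (branches u)" | "l0 \<noteq> l" "l0 \<notin> fst ` set (branches u)" "l0 \<in> fst ` set (branches w)"
    using FB.prems(3) by auto
  then show ?case
  proof cases
    case 1
    then show ?thesis by (intro exI[of _ "[]"]) auto
  next
    case 2
    then obtain q where q: "pre X l0 u = q @ [l0]" "fst ` set q \<inter> V \<subseteq> set (takeWhile (\<lambda>x. x \<noteq> fst l0) (branch_vars u))"
      using FB by auto
    have m: "fst l0 \<in> set (branch_vars u)" using 2(2) by force
    then have "fst l \<noteq> fst l0" 
    proof -
      have "fst l \<notin> set (branch_vars u)" using FB.prems(2) by auto
      with m show ?thesis by metis
    qed
    moreover have "takeWhile (\<lambda>x. x \<noteq> fst l0) (branch_vars u @ branch_vars w) = takeWhile (\<lambda>x. x \<noteq> fst l0) (branch_vars u)"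
      using m by (rule takeWhile_append1) simp
    ultimately have tw: "takeWhile (\<lambda>x. x \<noteq> fst l0) (branch_vars (FB l u w)) = fst l # takeWhile (\<lambda>x. x \<noteq> fst l0) (branch_vars u)" by simp
    let ?q = "[l] @ (if l \<in> X then winv (level u) else []) @ q"
    have "fst ` set ?q \<subseteq> insert (fst l) (fst ` set (level u) \<union> fst ` set q \<union> {})"
      by (cases "l \<in> X") (simp_all add: image_Un subset_insertI2 le_supI1 le_supI2)
    then have "fst ` set ?q \<inter> V \<subseteq> insert (fst l) (set (takeWhile (\<lambda>x. x \<noteq> fst l0) (branch_vars u)) \<union> {})"
      by (rule Int_cover_subset[OF _ lu q(2)]) simp
    then have "fst ` set ?q \<inter> V \<subseteq> set (takeWhile (\<lambda>x. x \<noteq> fst l0) (branch_vars (FB l u w)))"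
      unfolding tw by simp
    moreover have "pre X l0 (FB l u w) = ?q @ [l0]" using 2 q(1) by simp
    ultimately show ?thesis by blast
  next
    case 3
    then obtain q where q: "pre X l0 w = q @ [l0]" "fst ` set q \<inter> V \<subseteq> set (takeWhile (\<lambda>x. x \<noteq> fst l0) (branch_vars w))"
      using FB by auto
    have m: "fst l0 \<in> set (branch_vars w)" using 3(3) by force
    moreover have "fst l \<notin> set (branch_vars w)" "set (branch_vars u) \<inter> set (branch_vars w) = {}" using FB.prems(2) by auto
    ultimately have "fst l \<noteq> fst l0" "fst l0 \<notin> set (branch_vars u)" by (metis, blast)
    moreover from this(2) have "takeWhile (\<lambda>x. x \<noteq> fst l0) (branch_vars u @ branch_vars w) = branch_vars u @ takeWhile (\<lambda>x. x \<noteq> fst l0) (branch_vars w)"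
      by (intro takeWhile_append2) metis
    ultimately have tw: "takeWhile (\<lambda>x. x \<noteq> fst l0) (branch_vars (FB l u w)) =
      fst l # branch_vars u @ takeWhile (\<lambda>x. x \<noteq> fst l0) (branch_vars w)" by simp
    let ?q = "[l] @ (if l \<in> X then winv (level u) else []) @ ins X u @ [letter_inv l] @ q"
    have "fst ` set ?q \<subseteq> insert (fst l) (fst ` set (level u) \<union> fst ` set (ins X u) \<union> fst ` set q)"
      by (cases "l \<in> X") (simp_all add: image_Un subset_insertI2 le_supI1 le_supI2)
    then have "fst ` set ?q \<inter> V \<subseteq> insert (fst l) (set (branch_vars u) \<union> set (takeWhile (\<lambda>x. x \<noteq> fst l0) (branch_vars w)))"
      by (rule Int_cover_subset[OF _ lu ins_vars q(2)]) (use FB.prems(1) in simp)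
    then have "fst ` set ?q \<inter> V \<subseteq> set (takeWhile (\<lambda>x. x \<noteq> fst l0) (branch_vars (FB l u w)))"
      unfolding tw by simp
    moreover have "pre X l0 (FB l u w) = ?q @ [l0]" using 3 q(1) by simp
    ultimately show ?thesis by blast
  qed
qed simp

text \<open>The last variable does not occur in the values of the others, so its elementary move
  composes with the automorphism built for them.\<close>

lemma aut_on_triangular:
  assumes "distinct xs" "set xs \<subseteq> V" "\<And>x. x \<in> set xs \<Longrightarrow> fst ` set (U x) \<inter> V \<subseteq> set (takeWhile (\<lambda>y. y \<noteq> x) xs)"
  shows "aut_on V (\<lambda>v. if v \<in> set xs then cls (U v) + sgn_of gen (v, B v) else gen v)"
  using assms
proof (induction xs rule: rev_induct)
  case (snoc x xs)
  let ?f = "\<lambda>v. if v \<in> set xs then cls (U v) + sgn_of gen (v, B v) else gen v"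
  have tw: "takeWhile (\<lambda>y. y \<noteq> z) (xs @ [x]) = takeWhile (\<lambda>y. y \<noteq> z) xs" if "z \<in> set xs" for z
    using that by (rule takeWhile_append1) simp
  have U: "fst ` set (U z) \<inter> V \<subseteq> set (takeWhile (\<lambda>y. y \<noteq> z) xs)" if "z \<in> set xs" for z
    using snoc.prems(3)[of z] that tw[OF that] by auto
  have f: "aut_on V ?f" using snoc.prems U by (intro snoc.IH) auto
  have x: "x \<in> V" "x \<notin> set xs" using snoc.prems by auto
  have nx: "x \<notin> fst ` set (U z)" if "z \<in> set (xs @ [x])" for z
  proof
    assume "x \<in> fst ` set (U z)"
    then have "x \<in> set (takeWhile (\<lambda>y. y \<noteq> z) (xs @ [x]))" using snoc.prems(3)[OF that] x by blast
    then show False using that x(2) tw[of z] set_takeWhileD[of x "\<lambda>y. y \<noteq> z"] by (cases "z = x") fastforce+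
  qed
  let ?e = "elem (x, B x) (U x) []"
  have e: "aut_on V ?e" using x nx[of x] by (intro aut_on_elem) auto
  have "(\<lambda>v. lift ?e (?f v)) = (\<lambda>v. if v \<in> set (xs @ [x]) then cls (U v) + sgn_of gen (v, B v) else gen v)"
  proof
    fix v
    have "ev ?e (U v) = cls (U v)" if "v \<in> set xs"
      using nx[of v] that by (intro ev_avoid[of _ "{x}"]) (auto simp: elem_def)
    then show "lift ?e (?f v) = (if v \<in> set (xs @ [x]) then cls (U v) + sgn_of gen (v, B v) else gen v)"
      using x by (auto simp: elem_def sgn_of_def)
  qed
  with aut_on_comp[OF e f] show ?case by simp
qed simp

text \<open>The conjugator of the hole at l becomes \<open>pre (X l) l F\<close>, where
  \<open>X l\<close> collects the holes extracted before it. The order \<open>os\<close> is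
  arbitrary, but triangularity refers to the traversal order of the forest, and the length bound is
  the same for every \<open>os\<close>.\<close>

lemma forest_order:
  assumes F: "wf_forest V F" "distinct (branch_vars F)" and os: "distinct os" "set os = fst ` set (branches F)"
  shows "\<exists>f. aut_on V f \<and> (\<forall>x. x \<notin> set (branch_vars F) \<longrightarrow> f x = gen x) \<and>
    ev f (conjs (map (\<lambda>l. (fst l, the (map_of (branches F) l))) os) @ level F) = cls (flat F) \<and>
    (\<forall>x\<in>set (branch_vars F). \<exists>k. f x = cls k \<and> fst ` set k \<subseteq> fst ` set (flat F) \<and> (\<forall>wt. wsum wt k \<le> wsum wt (flat F) + (\<Sum>(l, v)\<leftarrow>branches F. wsum wt v)))"
proof -
  define X where "X l = set (takeWhile (\<lambda>m. m \<noteq> l) os)" for l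
  define P where "P l = pre (X l) l F" for l
  have dl: "distinct (map fst (branches F))"
    using F(2) by (auto simp: distinct_map split_def inj_on_def dest: arg_cong[of _ _ fst])
  have inj: "l = m" if "l \<in> set os" "m \<in> set os" "fst l = fst m" for l m
    using that F(2) unfolding os(2) by (auto simp: distinct_map inj_on_def split_def) 
  define L where "L x = (THE l. l \<in> set os \<and> fst l = x)" for x
  have L: "L (fst l) = l" if "l \<in> set os" for l
    unfolding L_def using that inj by (intro the_equality) auto
  have bv: "set (branch_vars F) = fst ` set os" unfolding os(2) by (auto simp: split_def image_image)
  have ex: "\<exists>q. P l = q @ [l] \<and> fst ` set q \<inter> V \<subseteq> set (takeWhile (\<lambda>x. x \<noteq> fst l) (branch_vars F))" if "l \<in> set os" for l
    unfolding P_def using that os(2) by (intro pre_vars F) auto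
  define q where "q l = butlast (P l)" for l
  have q: "P l = q l @ [l]" "fst ` set (q l) \<inter> V \<subseteq> set (takeWhile (\<lambda>x. x \<noteq> fst l) (branch_vars F))" if "l \<in> set os" for l
  proof -
    from ex[OF that] obtain q0 where "P l = q0 @ [l]" "fst ` set q0 \<inter> V \<subseteq> set (takeWhile (\<lambda>x. x \<noteq> fst l) (branch_vars F))"
      by blast
    moreover from this have "q l = q0" by (simp add: q_def)
    ultimately show "P l = q l @ [l]" "fst ` set (q l) \<inter> V \<subseteq> set (takeWhile (\<lambda>x. x \<noteq> fst l) (branch_vars F))" by simp_all
  qed
  define f where "f v = (if v \<in> set (branch_vars F) then cls (q (L v)) + sgn_of gen (v, snd (L v)) else gen v)" for v
  have aut: "aut_on V f" unfolding f_def
  proof (rule aut_on_triangular[OF F(2) branch_vars_V[OF F(1)]])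
    fix x assume "x \<in> set (branch_vars F)"
    then obtain l where "l \<in> set os" "x = fst l" using bv by auto
    then show "fst ` set (q (L x)) \<inter> V \<subseteq> set (takeWhile (\<lambda>y. y \<noteq> x) (branch_vars F))"
      using q(2)[of l] L[of l] by simp
  qed
  have fP: "f (fst l) = cls (P l)" if "l \<in> set os" for l
    using that q(1)[OF that] L[OF that] bv by (simp add: f_def)
  have fc: "ev f k = cls k" if "fst ` set k \<inter> V = {}" for k
    using that branch_vars_V[OF F(1)] by (intro ev_cong) (auto simp: f_def)
  note brsV = branches_consts[OF F(1)]
  \<comment> \<open>Induction over the holes still inside; \<open>ds\<close> are those already
    extracted.\<close>
  have main: "cls (ins (set ds) F) = ev f (conjs (map (\<lambda>l. (fst l, the (map_of (branches F) l))) es) @ level F)" if "os = ds @ es" for ds es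
    using that
  proof (induction es arbitrary: ds)
    case Nil
    then have "fst ` set (branches F) \<subseteq> set ds" using os(2) by simp
    then show ?case using fc[OF level_vars[OF F(1)]] by (simp add: ins_all)
  next
    case (Cons l es)
    have l: "l \<in> set os" "l \<notin> set ds" using Cons.prems os(1) by auto
    then obtain v where v: "(l, v) \<in> set (branches F)" using os(2) by auto
    then have mv: "the (map_of (branches F) l) = v" using dl by simp
    have "takeWhile (\<lambda>m. m \<noteq> l) os = ds" unfolding Cons.prems using l(2) by (subst takeWhile_append2) auto
    then have X: "X l = set ds" by (simp add: X_def)
    have "cls (ins (set ds) F) = cls (P l) + cls v - cls (P l) + cls (ins (set (ds @ [l])) F)"
      using ins_step[OF dl v l(2)] by (simp add: P_def X)
    also have "cls (ins (set (ds @ [l])) F) = ev f (conjs (map (\<lambda>l. (fst l, the (map_of (branches F) l))) es) @ level F)"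
      using Cons.prems by (intro Cons.IH) simp
    finally show ?case
      using fP[OF l(1)] fc[OF brsV[OF v]] by (simp add: mv group_simps)
  qed
  have "\<exists>k. f x = cls k \<and> fst ` set k \<subseteq> fst ` set (flat F) \<and> (\<forall>wt. wsum wt k \<le> wsum wt (flat F) + (\<Sum>(l, v)\<leftarrow>branches F. wsum wt v))" if "x \<in> set (branch_vars F)" for x
  proof -
    from that obtain l where l: "l \<in> set os" "x = fst l" using bv by auto
    have "wsum wt (P l) \<le> wsum wt (flat F) + (\<Sum>(l, v)\<leftarrow>branches F. wsum wt v)" for wt
      unfolding P_def by (rule order_trans[OF wsum_pre wsum_ins])
    moreover have "fst ` set (P l) \<subseteq> fst ` set (flat F)" unfolding P_def by (rule pre_letters)
    ultimately show ?thesis using fP[OF l(1)] l(2) by blast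
  qed
  moreover have "f x = gen x" if "x \<notin> set (branch_vars F)" for x using that by (simp add: f_def)
  ultimately show ?thesis using aut main[of "[]" os] by (intro exI[of _ f]) (auto simp: ins_empty)
qed

section \<open>Nielsen's cancellation criterion for products\<close>

section \<open>Nielsen reduced products\<close>

text \<open>The number of letter pairs lost in the product; by \<open>cancelled_obtain\<close> the
  division by 2 is exact.\<close>

definition cancelled :: "'a fgrp \<Rightarrow> 'a fgrp \<Rightarrow> nat" where
  "cancelled g h = (len g + len h - len (g + h)) div 2"

lemma cancelled_obtain:
  obtains a c b where "rep g = a @ c" "rep h = winv c @ b" "rep (g + h) = a @ b" "cancelled g h = length c"
proof -
  obtain a c b where acb: "rep g = a @ c" "rep h = winv c @ b" "freely_reduced (a @ b)"
    using cancellation[OF freely_reduced_rep freely_reduced_rep] by metis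
  have "g + h = cls (a @ c) + cls (winv c @ b)" by (metis acb(1,2) cls_rep)
  also have "\<dots> = cls (a @ b)" by (simp add: group_simps)
  finally have "rep (g + h) = a @ b" using acb(3) by (simp only: rep_cls)
  with acb show thesis by (intro that[of a c b]) (auto simp: cancelled_def len_def)
qed

text \<open>At most half of a factor cancels against either neighbour, and the two cancelled parts
  never exhaust it, so each factor leaves a nonempty middle piece. The product therefore begins with
  the part of the first factor that its right neighbour spares.\<close>

lemma nielsen_prefix:
  assumes "bs \<noteq> []" "\<And>p. p \<in> set bs \<Longrightarrow> f p \<noteq> 0"
    "\<And>xs p q ys. bs = xs @ [p, q] @ ys \<Longrightarrow> 2 * cancelled (f p) (f q) \<le> len (f p) \<and> 2 * cancelled (f p) (f q) \<le> len (f q)"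
    "\<And>xs p q r ys. bs = xs @ [p, q, r] @ ys \<Longrightarrow> cancelled (f p) (f q) + cancelled (f q) (f r) < len (f q)"
  shows "\<exists>t. rep (sum_list (map f bs)) =
    take (len (f (hd bs)) - (if tl bs = [] then 0 else cancelled (f (hd bs)) (f (hd (tl bs))))) (rep (f (hd bs))) @ t"
  using assms
proof (induction bs rule: induct_list012)
  case (2 p)
  then show ?case by (auto simp: len_def)
next
  case (3 p q bs)
  let ?m = "len (f q) - (if bs = [] then 0 else cancelled (f q) (f (hd bs)))"
  have sp: "p # q # bs = [] @ [p, q] @ bs" by simp
  have n1: "2 * cancelled (f p) (f q) \<le> len (f p)" "2 * cancelled (f p) (f q) \<le> len (f q)"
    using 3(5)[OF sp] by auto
  have "\<exists>t. rep (sum_list (map f (q # bs))) = take ?m (rep (f q)) @ t"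
    using 3(2)[OF _ 3(4)] 3(5)[of "p # _"] 3(6)[of "p # _"] by auto
  then obtain t where t: "rep (sum_list (map f (q # bs))) = take ?m (rep (f q)) @ t" by blast
  \<comment> \<open>Here the strict inequality for three consecutive factors keeps a letter of
    \<open>f q\<close> between its two cancellations.\<close>
  have m: "cancelled (f p) (f q) < ?m"
  proof (cases bs)
    case Nil
    have "len (f q) \<noteq> 0" using 3(4)[of q] by simp
    then have "cancelled (f p) (f q) < len (f q)" using n1(2) by linarith
    then show ?thesis using Nil by simp
  next
    case (Cons r rs)
    then have "cancelled (f p) (f q) + cancelled (f q) (f r) < len (f q)" using 3(6)[of "[]" p q r rs] by simp
    then show ?thesis using Cons by simp
  qed
  obtain a c b where acb: "rep (f p) = a @ c" "rep (f q) = winv c @ b" "rep (f p + f q) = a @ b" "cancelled (f p) (f q) = length c"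
    by (rule cancelled_obtain)
  define b1 where "b1 = take (?m - length c) b"
  have tk: "take ?m (rep (f q)) = winv c @ b1" unfolding acb(2) b1_def using m acb(4) by simp
  have "len (f q) = length c + length b" using acb(2) by (simp add: len_def)
  then have "b \<noteq> []" using m acb(4) by (auto split: if_splits)
  then have b1: "b1 \<noteq> []" "hd b1 = hd b" unfolding b1_def using m acb(4) by auto
  have red: "freely_reduced (a @ b1 @ t)"
  proof -
    have "freely_reduced (winv c @ b1 @ t)" using freely_reduced_rep[of "sum_list (map f (q # bs))"] unfolding t tk by simp
    then have "freely_reduced (b1 @ t)" using freely_reduced_append[of "winv c" "b1 @ t"] by blast
    moreover have "freely_reduced (a @ b)" using acb(3) freely_reduced_rep by metis
    ultimately show ?thesis
      using b1 \<open>b \<noteq> []\<close> by (subst freely_reduced_append) (auto simp only: freely_reduced_append hd_append2)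
  qed
  have "sum_list (map f (p # q # bs)) = cls (a @ c) + cls (winv c @ b1 @ t)"
    using t[unfolded tk] acb(1) by (metis append_assoc cls_rep list.simps(9) sum_list.Cons)
  also have "\<dots> = cls (a @ b1 @ t)" by (simp add: group_simps)
  finally have "rep (sum_list (map f (p # q # bs))) = a @ b1 @ t" using red by (simp only: rep_cls)
  moreover have "take (len (f p) - cancelled (f p) (f q)) (rep (f p)) = a"
    unfolding acb by (simp add: len_def acb)
  ultimately show ?case by (intro exI[of _ "b1 @ t"]) simp
qed simp

lemma nielsen_nonzero:
  assumes "bs \<noteq> []" "\<And>p. p \<in> set bs \<Longrightarrow> f p \<noteq> 0"
    "\<And>xs p q ys. bs = xs @ [p, q] @ ys \<Longrightarrow> 2 * cancelled (f p) (f q) \<le> len (f p) \<and> 2 * cancelled (f p) (f q) \<le> len (f q)"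
    "\<And>xs p q r ys. bs = xs @ [p, q, r] @ ys \<Longrightarrow> cancelled (f p) (f q) + cancelled (f q) (f r) < len (f q)"
  shows "sum_list (map f bs) \<noteq> 0"
proof
  assume z: "sum_list (map f bs) = 0"
  define k where "k = (if tl bs = [] then 0 else cancelled (f (hd bs)) (f (hd (tl bs))))"
  have "\<exists>t. rep (sum_list (map f bs)) = take (len (f (hd bs)) - k) (rep (f (hd bs))) @ t"
    unfolding k_def by (rule nielsen_prefix[OF assms(1)]) (erule assms)+
  then obtain t where t: "rep (sum_list (map f bs)) = take (len (f (hd bs)) - k) (rep (f (hd bs))) @ t"
    by blast
  then have "len (f (hd bs)) - k = 0" unfolding z by (auto simp: len_def)
  moreover have "len (f (hd bs)) \<noteq> 0" using assms(1,2) by simp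
  moreover have "2 * k \<le> len (f (hd bs))"
  proof (cases "tl bs = []")
    case False
    then obtain p q ys where bs: "bs = [] @ [p, q] @ ys" by (cases bs; cases "tl bs") auto
    have "2 * cancelled (f p) (f q) \<le> len (f p)" using assms(3)[OF bs] by blast
    then show ?thesis unfolding k_def using bs by simp
  qed (simp add: k_def)
  ultimately show False by linarith
qed

section \<open>The tie-breaking order of Nielsen's method\<close>

section \<open>A weight for words of equal length\<close>

text \<open>The word read as a number in base B with digits \<open>cd\<close>; if all digits are
  below B, this orders words of equal length lexicographically.\<close>

primrec rank :: "('l \<Rightarrow> nat) \<Rightarrow> nat \<Rightarrow> 'l list \<Rightarrow> nat" where
  "rank cd B [] = 0"
| "rank cd B (l # w) = cd l * B ^ length w + rank cd B w"

lemma rank_append: "rank cd B (u @ v) = rank cd B u * B ^ length v + rank cd B v"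
  by (induction u) (auto simp: algebra_simps power_add)

lemma rank_less: "(\<And>l. l \<in> set w \<Longrightarrow> cd l < B) \<Longrightarrow> rank cd B w < B ^ length w"
proof (induction w)
  case (Cons l w)
  then have "rank cd B w < B ^ length w" "Suc (cd l) \<le> B" by (auto simp: Suc_le_eq)
  then have "rank cd B (l # w) < Suc (cd l) * B ^ length w" by simp
  also have "\<dots> \<le> B * B ^ length w" using \<open>Suc (cd l) \<le> B\<close> by (rule mult_le_mono1)
  finally show ?case by simp
qed simp

lemma rank_inj:
  assumes "inj_on cd L" "\<And>l. l \<in> L \<Longrightarrow> cd l < B" "set u \<subseteq> L" "set w \<subseteq> L" "length u = length w"
    "rank cd B u = rank cd B w"
  shows "u = w"
  using assms(5,3,4,6)
proof (induction u w rule: list_induct2)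
  case (Cons l u m w)
  have r: "rank cd B u < B ^ length w" "rank cd B w < B ^ length w"
    using rank_less[of u cd B] rank_less[of w cd B] Cons assms(2) by auto
  have e: "cd l * B ^ length w + rank cd B u = cd m * B ^ length w + rank cd B w" using Cons by simp
  have "0 < B" using assms(2)[of l] Cons.prems by auto
  then have "cd l = (cd l * B ^ length w + rank cd B u) div B ^ length w" using r(1) by (subst div_mult_self3) auto
  also have "\<dots> = cd m" unfolding e using r(2) \<open>0 < B\<close> by (subst div_mult_self3) auto
  finally have "cd l = cd m" .
  with e have "rank cd B u = rank cd B w" by simp
  with Cons \<open>cd l = cd m\<close> assms(1) show ?case by (auto dest: inj_onD)
qed simp

text \<open>Nielsen's tie-breaker looks at the left half of an element and at the left half of its
  inverse. It is symmetric under inversion, so the sign with which a symbol occurs does not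
  matter.\<close>

definition halves :: "('a \<times> bool \<Rightarrow> nat) \<Rightarrow> nat \<Rightarrow> 'a word \<Rightarrow> nat" where
  "halves cd B w = rank cd B (take (length w div 2) w) + rank cd B (take (length w div 2) (winv w))"

lemma halves_winv [simp]: "halves cd B (winv w) = halves cd B w"
  by (simp add: halves_def)

text \<open>The replaced initial segment is at most half of the word, so it lies in the left half,
  and the left half of the inverse does not see it.\<close>

lemma halves_less:
  assumes "length w = length u" "length u \<le> length b" "rank cd B w < rank cd B u" "0 < B"
  shows "halves cd B (w @ b) < halves cd B (u @ b)"
proof -
  define k where "k = (length u + length b) div 2"
  have k: "length u \<le> k" "k \<le> length b" using assms(2) unfolding k_def by auto
  have "rank cd B (w @ take (k - length u) b) < rank cd B (u @ take (k - length u) b)"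
    using assms(3,4) by (simp add: rank_append)
  then show ?thesis using k assms(1) by (simp add: halves_def k_def[symmetric])
qed

section \<open>Sliding a symbol across a word, and what this preserves\<close>

section \<open>Slides\<close>

primrec sub :: "'a \<times> bool \<Rightarrow> 'a word \<Rightarrow> 'a word \<Rightarrow> 'a word" where
  "sub l u [] = []"
| "sub l u (m # w) = (if m = l then u else if m = letter_inv l then winv u else [m]) @ sub l u w"

lemma ev_sub:
  assumes "\<And>x. x \<noteq> fst l \<Longrightarrow> f x = gen x" "sgn_of f l = cls u"
  shows "ev f w = cls (sub l u w)"
proof (induction w)
  case (Cons m w)
  have "sgn_of f m = sgn_of gen m" if "m \<noteq> l" "m \<noteq> letter_inv l"
  proof -
    have "fst m \<noteq> fst l" using that by (cases m; cases l) (auto simp: letter_inv_def)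
    then show ?thesis using assms(1) by (simp add: sgn_of_def)
  qed
  with Cons assms(2) show ?case by auto
qed simp

lemma symbols_sub:
  assumes "symbols u = add_mset (fst l) M"
  shows "symbols (sub l u w) = symbols w + repeat_mset (count (symbols w) (fst l)) M"
proof (induction w)
  case (Cons m w)
  have "fst m \<noteq> fst l" if "m \<noteq> l" "m \<noteq> letter_inv l"
    using that by (cases m; cases l) (auto simp: letter_inv_def)
  moreover have "symbols (winv u) = add_mset (fst l) M" using assms by (simp only: mset_fst_winv)
  ultimately show ?case using Cons assms by auto
qed simp

lemma mset_sub:
  assumes "mset (winv u) = add_mset (letter_inv l) M" "l \<notin> set w"
  shows "mset (sub l u w) = mset w + repeat_mset (count (mset w) (letter_inv l)) M"
  using assms(2)
proof (induction w)
  case (Cons m w)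
  then show ?case using assms(1) by auto
qed simp

lemma path_sub:
  assumes "\<And>x. x \<noteq> fst l \<Longrightarrow> s' x = s x \<and> t' x = t x" "path s' t' (source s t l) u (target s t l)"
  shows "path s t b w c \<Longrightarrow> path s' t' b (sub l u w) c"
proof (induction w arbitrary: b)
  case (Cons m w)
  then have m: "source s t m = b" "path s' t' (target s t m) (sub l u w) c" by auto
  have "source s' t' m = source s t m" "target s' t' m = target s t m" if "m \<noteq> l" "m \<noteq> letter_inv l"
  proof -
    have "fst m \<noteq> fst l" using that by (cases m; cases l) (auto simp: letter_inv_def)
    then show "source s' t' m = source s t m" "target s' t' m = target s t m" using assms(1) by (simp_all add: source_def target_def)
  qed
  with m assms(2) show ?case by auto
qed simp

lemma path_sub_rev:
  assumes "\<And>x. x \<noteq> fst l \<Longrightarrow> s' x = s x \<and> t' x = t x"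
    "\<And>d e. path s' t' d u e \<Longrightarrow> d = source s t l \<and> e = target s t l"
  shows "path s' t' b (sub l u w) c \<Longrightarrow> path s t b w c"
proof (induction w arbitrary: b)
  case (Cons m w)
  have "source s' t' m = source s t m" "target s' t' m = target s t m" if "m \<noteq> l" "m \<noteq> letter_inv l"
  proof -
    have "fst m \<noteq> fst l" using that by (cases m; cases l) (auto simp: letter_inv_def)
    then show "source s' t' m = source s t m" "target s' t' m = target s t m" using assms(1) by (simp_all add: source_def target_def)
  qed
  with Cons assms(2) show ?case by (auto split: if_splits)
qed simp

lemma path_sub_occurs:
  assumes "path s' t' b (sub l u w) c" "fst l \<in> fst ` set w"
  shows "\<exists>d e. path s' t' d u e"
  using assms
proof (induction w arbitrary: b)
  case (Cons m w)
  consider "m = l" | "m = letter_inv l" | "m \<noteq> l" "m \<noteq> letter_inv l" by blast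
  then show ?case
  proof cases
    case 3
    then have "fst m \<noteq> fst l" by (cases m; cases l) (auto simp: letter_inv_def)
    with Cons 3 show ?thesis by auto
  next
    case 2
    with Cons.prems(1) show ?thesis by (cases "m = l") auto
  qed (use Cons.prems(1) in auto)
qed simp

datatype colour = Col nat nat

text \<open>The colours of the constants are prescribed, while the base colour of the closed path is
  free: the variables must receive the same colours whatever the base colours of the two paths
  are.\<close>

definition uniq_col :: "'a set \<Rightarrow> ('a \<Rightarrow> colour) \<Rightarrow> ('a \<Rightarrow> colour) \<Rightarrow> 'a word \<Rightarrow> bool" where
  "uniq_col V s0 t0 w \<longleftrightarrow> (\<forall>s1 t1 s2 t2 b1 b2. (\<forall>x. x \<notin> V \<longrightarrow> s1 x = s0 x \<and> t1 x = t0 x \<and> s2 x = s0 x \<and> t2 x = t0 x) \<longrightarrow>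
     path s1 t1 b1 w b1 \<longrightarrow> path s2 t2 b2 w b2 \<longrightarrow> (\<forall>x\<in>V. s1 x = s2 x \<and> t1 x = t2 x))"

definition has_col :: "'a set \<Rightarrow> ('a \<Rightarrow> colour) \<Rightarrow> ('a \<Rightarrow> colour) \<Rightarrow> 'a word \<Rightarrow> bool" where
  "has_col V s0 t0 w \<longleftrightarrow> (\<exists>s t b. (\<forall>x. x \<notin> V \<longrightarrow> s x = s0 x \<and> t x = t0 x) \<and> path s t b w b)"

text \<open>What is stable under the moves and used after them. The size of the automorphism is left
  out on purpose, since it grows without control.\<close>

definition slid :: "'a set \<Rightarrow> 'a word \<Rightarrow> ('a \<Rightarrow> 'b fgrp) \<Rightarrow> 'a word \<Rightarrow> ('a \<Rightarrow> 'b fgrp) \<Rightarrow> bool" where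
  "slid V w \<theta> w' \<theta>' \<longleftrightarrow> (\<exists>f. aut_on V f \<and> ev f w = cls w' \<and> (\<forall>v. \<theta> v = lift \<theta>' (f v))) \<and>
     symbols w' = symbols w \<and> (oriented V w \<longrightarrow> mset w' = mset w) \<and> (\<forall>v. v \<notin> V \<longrightarrow> \<theta>' v = \<theta> v) \<and>
     (\<forall>s0 t0. has_col V s0 t0 w \<longrightarrow> has_col V s0 t0 w') \<and> (\<forall>s0 t0. uniq_col V s0 t0 w \<longrightarrow> uniq_col V s0 t0 w')"

lemma slid_refl: "slid V w \<theta> w \<theta>"
  unfolding slid_def by (auto intro!: exI[of _ gen])

lemma oriented_mset: "mset w' = mset w \<Longrightarrow> oriented V w' = oriented V w"
  by (simp add: oriented_def)

lemma slid_trans: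
  assumes "slid V w \<theta> w1 \<theta>1" "slid V w1 \<theta>1 w2 \<theta>2"
  shows "slid V w \<theta> w2 \<theta>2"
proof -
  from assms obtain f g where f: "aut_on V f" "ev f w = cls w1" "\<And>v. \<theta> v = lift \<theta>1 (f v)"
    and g: "aut_on V g" "ev g w1 = cls w2" "\<And>v. \<theta>1 v = lift \<theta>2 (g v)" unfolding slid_def by blast
  let ?h = "\<lambda>x. lift g (f x)"
  have "ev ?h w = lift g (ev f w)" by (rule lift_ev[symmetric])
  then have "ev ?h w = cls w2" using f(2) g(2) by simp
  moreover have "\<theta> v = lift \<theta>2 (?h v)" for v
  proof -
    have "\<theta>1 = (\<lambda>x. lift \<theta>2 (g x))" using g(3) by auto
    then show ?thesis using f(3)[of v] by (simp add: lift_lift)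
  qed
  ultimately have "\<exists>f. aut_on V f \<and> ev f w = cls w2 \<and> (\<forall>v. \<theta> v = lift \<theta>2 (f v))"
    using aut_on_comp[OF g(1) f(1)] by blast
  then show ?thesis using assms oriented_mset unfolding slid_def by metis
qed

text \<open>Replacing l by P^-1 l P'^-1 cancels its surroundings at the marked occurrence, and the
  letters of P and P' reappear at the other occurrence of l. The new value of l is the value of P l
  P', and its new ends are the ends of the path P l P'; this moves colourings in both
  directions.\<close>

lemma slide:
  assumes W: "W = \<alpha> @ P @ [l] @ P' @ \<beta>" and l: "fst l \<in> V" and c: "count (symbols W) (fst l) = 2"
    and P: "fst l \<notin> fst ` set P" "fst l \<notin> fst ` set P'"
    and \<theta>': "sgn_of \<theta>' l = ev \<theta> (P @ [l] @ P')" "\<And>x. x \<noteq> fst l \<Longrightarrow> \<theta>' x = \<theta> x"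
  defines "u \<equiv> winv P @ [l] @ winv P'"
  shows "slid V W \<theta> (sub l u \<alpha> @ [l] @ sub l u \<beta>) \<theta>'" (is "slid V W \<theta> ?W \<theta>'")
proof -
  define f where "f = (if snd l then elem l (winv P) (winv P') else elem (letter_inv l) P' P)"
  have af: "aut_on V f" unfolding f_def using l P by (cases "snd l") (simp_all add: aut_on_elem)
  have f1: "f x = gen x" if "x \<noteq> fst l" for x using that by (simp add: f_def elem_def)
  have f2: "sgn_of f l = cls u" by (cases "snd l") (simp_all add: sgn_of_def f_def elem_def u_def group_simps)
  have fP: "ev f P = cls P" "ev f P' = cls P'" using P by (intro ev_avoid[of _ "{fst l}"]; simp add: f1)+
  have cu: "cls u = - cls P + sgn_of gen l - cls P'" unfolding u_def by (simp add: group_simps)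
  have "ev f \<alpha> = cls (sub l u \<alpha>)" "ev f \<beta> = cls (sub l u \<beta>)" by (rule ev_sub[OF f1 f2], assumption)+
  then have "ev f W = cls ?W"
    unfolding W by (simp add: fP f2 cu group_simps)
  moreover have "\<theta> v = lift \<theta>' (f v)" for v
  proof (cases "v = fst l")
    case True
    have eP: "ev \<theta>' P = ev \<theta> P" "ev \<theta>' P' = ev \<theta> P'" using P \<theta>'(2) by (metis ev_cong)+
    have "lift \<theta>' (sgn_of f l) = sgn_of \<theta> l" unfolding f2 cu using \<theta>'(1) by (simp add: eP group_simps)
    then have "sgn_of (\<lambda>x. lift \<theta>' (f x)) l = sgn_of \<theta> l" by (simp add: sgn_of_def split: if_splits)
    then show ?thesis using True by (simp add: sgn_of_def split: if_splits)
  next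
    case False
    then show ?thesis using f1 \<theta>'(2) by simp
  qed
  moreover have "symbols ?W = symbols W"
  proof -
    have mu: "symbols u = add_mset (fst l) (symbols (P @ P'))" unfolding u_def by (simp add: mset_fst_winv[unfolded mset_map])
    have "count (symbols P) (fst l) = 0" "count (symbols P') (fst l) = 0" using P unfolding count_symbols_pos by auto
    then have "count (symbols \<alpha>) (fst l) + count (symbols \<beta>) (fst l) = 1" using c unfolding W by simp
    then have "count (symbols \<alpha>) (fst l) = 1 \<and> count (symbols \<beta>) (fst l) = 0 \<or> count (symbols \<alpha>) (fst l) = 0 \<and> count (symbols \<beta>) (fst l) = 1"
      by arith
    then show ?thesis unfolding W using symbols_sub[OF mu, of \<alpha>] symbols_sub[OF mu, of \<beta>] by (auto simp: ac_simps)
  qed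
  moreover have "mset ?W = mset W" if o: "oriented V W"
  proof -
    have cl: "count (mset W) l = 1" "count (mset W) (letter_inv l) = 1"
    proof -
      have "count (mset W) l + count (mset W) (letter_inv l) = 2"
        using c unfolding count_symbols by (cases l; cases "snd l") (auto simp: letter_inv_def)
      with oriented_letter[OF o l] show "count (mset W) l = 1" "count (mset W) (letter_inv l) = 1" by auto
    qed
    have mu: "mset (winv u) = add_mset (letter_inv l) (mset (P @ P'))" unfolding u_def by (simp add: winv_Cons)
    have n: "l \<notin> set P" "l \<notin> set P'" "letter_inv l \<notin> set P" "letter_inv l \<notin> set P'"
      using P by (metis fst_letter_inv image_eqI)+
    have "count (mset \<alpha>) l = 0" "count (mset \<beta>) l = 0" using cl(1) unfolding W by auto
    then have nl: "l \<notin> set \<alpha>" "l \<notin> set \<beta>" by (metis count_eq_zero_iff set_mset_mset)+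
    have "count (mset P) (letter_inv l) = 0" "count (mset P') (letter_inv l) = 0"
      using n by (metis count_eq_zero_iff set_mset_mset)+
    moreover have "count (mset \<alpha>) (letter_inv l) + count (mset P) (letter_inv l) +
      count (mset P') (letter_inv l) + count (mset \<beta>) (letter_inv l) = 1" using cl(2) unfolding W by simp
    ultimately have "count (mset \<alpha>) (letter_inv l) + count (mset \<beta>) (letter_inv l) = 1" by linarith
    then have one: "repeat_mset (count (mset \<alpha>) (letter_inv l) + count (mset \<beta>) (letter_inv l)) (mset (P @ P')) = mset (P @ P')"
      by simp
    have "mset (sub l u \<alpha>) + mset (sub l u \<beta>) = mset \<alpha> + mset \<beta> +
      repeat_mset (count (mset \<alpha>) (letter_inv l) + count (mset \<beta>) (letter_inv l)) (mset (P @ P'))"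
      unfolding mset_sub[OF mu nl(1)] mset_sub[OF mu nl(2)] repeat_mset_distrib by (simp only: ac_simps)
    then have "mset (sub l u \<alpha>) + mset (sub l u \<beta>) = mset \<alpha> + mset \<beta> + mset (P @ P')" unfolding one .
    then show ?thesis unfolding W by (simp add: ac_simps)
  qed
  moreover have "\<theta>' v = \<theta> v" if "v \<notin> V" for v using that l \<theta>'(2) by metis
  moreover have "has_col V s0 t0 ?W" if "has_col V s0 t0 W" for s0 t0
  proof -
    from that obtain s t b where st: "\<And>x. x \<notin> V \<Longrightarrow> s x = s0 x \<and> t x = t0 x" "path s t b W b" unfolding has_col_def by blast
    then obtain d g where p: "path s t b \<alpha> d" "path s t d P (source s t l)" "path s t (target s t l) P' g" "path s t g \<beta> b"
      unfolding W by auto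
    obtain s' t' where st': "source s' t' l = d" "target s' t' l = g" "\<And>x. x \<noteq> fst l \<Longrightarrow> s' x = s x \<and> t' x = t x"
      by (rule recolour_cases[of l d g s t]) blast
    have "path s' t' d P (source s t l)" "path s' t' (target s t l) P' g"
      by (rule path_cong2[OF p(2)], use P st'(3) in metis) (rule path_cong2[OF p(3)], use P st'(3) in metis)
    then have u: "path s' t' (source s t l) u (target s t l)" unfolding u_def using st'(1,2) by auto
    have "path s' t' b ?W b"
      using path_sub[of l s' s t' t, OF st'(3) u p(1)] path_sub[of l s' s t' t, OF st'(3) u p(4)] st'(1,2) by auto
    moreover have "s' x = s0 x \<and> t' x = t0 x" if "x \<notin> V" for x
      using st(1)[OF that] st'(3)[of x] that l by metis
    ultimately show ?thesis unfolding has_col_def by blast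
  qed
  moreover have "uniq_col V s0 t0 ?W" if U: "uniq_col V s0 t0 W" for s0 t0
  proof -
    \<comment> \<open>Undoing the move on colours: the other occurrence of l, now expanded to P^-1 l
      P'^-1, reveals the old end colours of l.\<close>
    have lowering: "\<exists>s t e f. (\<forall>x. x \<noteq> fst l \<longrightarrow> s x = s' x \<and> t x = t' x) \<and> path s t b W b \<and>
        source s t l = e \<and> target s t l = f \<and> path s' t' (source s' t' l) P e \<and> path s' t' f P' (target s' t' l)"
      if p: "path s' t' b ?W b" for s' t' b
    proof -
      from p have p1: "path s' t' b (sub l u \<alpha>) (source s' t' l)" "path s' t' (target s' t' l) (sub l u \<beta>) b" by auto
      have "count (symbols P) (fst l) = 0" "count (symbols P') (fst l) = 0" using P unfolding count_symbols_pos by auto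
      then have "count (symbols \<alpha>) (fst l) + count (symbols \<beta>) (fst l) = 1" using c unfolding W by simp
      then have "fst l \<in> fst ` set \<alpha> \<or> fst l \<in> fst ` set \<beta>" unfolding count_symbols_pos by linarith
      then obtain e f where u: "path s' t' e u f" using path_sub_occurs[OF p1(1)] path_sub_occurs[OF p1(2)] by blast
      then have PP: "path s' t' (source s' t' l) P e" "path s' t' f P' (target s' t' l)" unfolding u_def by auto
      obtain s t where st: "source s t l = e" "target s t l = f" "\<And>x. x \<noteq> fst l \<Longrightarrow> s x = s' x \<and> t x = t' x"
        by (rule recolour_cases[of l e f s' t']) blast
      have det: "path s' t' d u d' \<Longrightarrow> d = source s t l \<and> d' = target s t l" for d d'
        using path_det[of u s' t' d d' e f] u st(1,2) unfolding u_def by simp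
      have "path s t b \<alpha> (source s' t' l)" "path s t (target s' t' l) \<beta> b"
        using path_sub_rev[of l s' s t' t u, OF _ det] st(3) p1 by metis+
      moreover have "path s t (source s' t' l) P e" "path s t f P' (target s' t' l)"
        by (rule path_cong2[OF PP(1)], use P st(3) in metis) (rule path_cong2[OF PP(2)], use P st(3) in metis)
      ultimately have "path s t b W b" unfolding W using st(1,2) by auto
      then show ?thesis using st PP by blast
    qed
    show ?thesis unfolding uniq_col_def
    proof (intro allI impI ballI)
      fix s1' t1' s2' t2' b1 b2 x
      assume off: "\<forall>x. x \<notin> V \<longrightarrow> s1' x = s0 x \<and> t1' x = t0 x \<and> s2' x = s0 x \<and> t2' x = t0 x"
        and p: "path s1' t1' b1 ?W b1" "path s2' t2' b2 ?W b2" and x: "x \<in> V"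
      obtain s1 t1 e1 f1 where 1: "\<And>x. x \<noteq> fst l \<Longrightarrow> s1 x = s1' x \<and> t1 x = t1' x" "path s1 t1 b1 W b1"
        "source s1 t1 l = e1" "target s1 t1 l = f1" "path s1' t1' (source s1' t1' l) P e1" "path s1' t1' f1 P' (target s1' t1' l)"
        using lowering[OF p(1)] by blast
      obtain s2 t2 e2 f2 where 2: "\<And>x. x \<noteq> fst l \<Longrightarrow> s2 x = s2' x \<and> t2 x = t2' x" "path s2 t2 b2 W b2"
        "source s2 t2 l = e2" "target s2 t2 l = f2" "path s2' t2' (source s2' t2' l) P e2" "path s2' t2' f2 P' (target s2' t2' l)"
        using lowering[OF p(2)] by blast
      have "\<forall>x. x \<notin> V \<longrightarrow> s1 x = s0 x \<and> t1 x = t0 x \<and> s2 x = s0 x \<and> t2 x = t0 x"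
        using off 1(1) 2(1) l by metis
      then have eq: "s1 y = s2 y \<and> t1 y = t2 y" if "y \<in> V" for y
        using U 1(2) 2(2) that unfolding uniq_col_def by blast
      then have ef: "e1 = e2" "f1 = f2" using 1(3,4) 2(3,4) l by (auto simp: source_def target_def)
      have eq': "s1' y = s2' y \<and> t1' y = t2' y" if "y \<noteq> fst l" for y
        using eq[of y] 1(1)[OF that] 2(1)[OF that] off by metis
      have "path s1' t1' (source s2' t2' l) P e1" "path s1' t1' f1 P' (target s2' t2' l)"
        unfolding ef by (rule path_cong2[OF 2(5)], use P eq' in metis) (rule path_cong2[OF 2(6)], use P eq' in metis)
      then have "source s1' t1' l = source s2' t2' l" "target s1' t1' l = target s2' t2' l"
        using 1(5,6) path_end path_winv by metis+
      then show "s1' x = s2' x \<and> t1' x = t2' x"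
        using eq'[of x] by (cases "x = fst l") (auto simp: source_def target_def split: if_splits)
    qed
  qed
  ultimately show ?thesis unfolding slid_def using af by blast
qed

section \<open>Nielsen reduction of a solution to vanishing variables and free parameters\<close>

section \<open>Reduction of parametric solutions\<close>

text \<open>On the variables it remembers of the solution only which of them vanish.\<close>

definition eta :: "'a set \<Rightarrow> ('a \<Rightarrow> 'b) \<Rightarrow> ('a \<Rightarrow> 'b fgrp) \<Rightarrow> 'a \<Rightarrow> 'b fgrp" where
  "eta V \<tau> \<theta> x = (if x \<in> V then if \<theta> x = 0 then 0 else gen (\<tau> x) else \<theta> x)"

text \<open>A constant is a symbol whose label is a single letter or trivial; each variable in V
  owns a parameter that occurs in no label of a constant.\<close>

locale labels =
  fixes V :: "'a set" and \<tau> :: "'a \<Rightarrow> 'b" and lab :: "'a \<Rightarrow> 'b fgrp"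
  assumes finV: "finite V" and inj: "inj_on \<tau> V"
    and lab_len: "\<And>x. x \<notin> V \<Longrightarrow> len (lab x) \<le> 1"
    and fresh: "\<And>x. x \<notin> V \<Longrightarrow> fst ` set (rep (lab x)) \<inter> \<tau> ` V = {}"
begin

text \<open>The substitution for the parameters that recovers the solution from \<open>eta\<close>;
  freshness of the parameters keeps the labels of constants fixed.\<close>

definition spec :: "('a \<Rightarrow> 'b fgrp) \<Rightarrow> 'b \<Rightarrow> 'b fgrp" where
  "spec \<theta> y = (if y \<in> \<tau> ` V then \<theta> (inv_into V \<tau> y) else gen y)"

lemma spec_eta:
  assumes "\<And>x. x \<notin> V \<Longrightarrow> \<theta> x = lab x"
  shows "lift (spec \<theta>) (eta V \<tau> \<theta> x) = \<theta> x"
proof (cases "x \<in> V")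
  case True
  then show ?thesis using inj by (auto simp: eta_def spec_def)
next
  case False
  have "lift (spec \<theta>) (lab x) = ev (spec \<theta>) (rep (lab x))" by (simp add: lift_def)
  also have "\<dots> = cls (rep (lab x))"
    using fresh[OF False] by (intro ev_avoid[of _ "\<tau> ` V"]) (auto simp: spec_def)
  finally show ?thesis using False assms by (simp add: eta_def)
qed

lemma ev_spec_eta:
  assumes "\<And>x. x \<notin> V \<Longrightarrow> \<theta> x = lab x"
  shows "ev \<theta> w = lift (spec \<theta>) (ev (eta V \<tau> \<theta>) w)"
  by (simp add: lift_ev spec_eta[of \<theta>, OF assms])

text \<open>The parity condition excludes that a variable with nontrivial value occurs once inside
  the segment and once beside it, which is what permits a slide across the segment.\<close>

definition balanced :: "('a \<Rightarrow> 'b fgrp) \<Rightarrow> 'a word \<Rightarrow> bool" where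
  "balanced \<theta> Z \<longleftrightarrow> ev (eta V \<tau> \<theta>) Z = 0 \<and> (\<forall>x\<in>V. \<theta> x \<noteq> 0 \<longrightarrow> even (count (symbols Z) x))"

text \<open>A parameter identifies its variable: distinct variables own distinct parameters, and no
  parameter occurs in a label.\<close>

lemma eta_opposite:
  assumes "\<And>x. x \<notin> V \<Longrightarrow> \<theta> x = lab x" "sgn_of (eta V \<tau> \<theta>) m = - sgn_of (eta V \<tau> \<theta>) l" "sgn_of (eta V \<tau> \<theta>) l \<noteq> 0"
    "fst l \<in> V \<or> fst m \<in> V"
  shows "fst l = fst m"
proof -
  have r: "set (map fst (rep (sgn_of g l))) = set (map fst (rep (g (fst l))))" for g :: "'a \<Rightarrow> 'b fgrp" and l
    by (simp add: sgn_of_def rep_uminus)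
  have e: "set (map fst (rep (eta V \<tau> \<theta> (fst l)))) = set (map fst (rep (eta V \<tau> \<theta> (fst m))))"
    using r[of "eta V \<tau> \<theta>" l] r[of "eta V \<tau> \<theta>" m] assms(2) by (simp add: rep_uminus)
  have nz: "eta V \<tau> \<theta> (fst l) \<noteq> 0" "eta V \<tau> \<theta> (fst m) \<noteq> 0" using assms(2,3) by (auto simp: sgn_of_def split: if_splits)
  have v: "set (map fst (rep (eta V \<tau> \<theta> x))) = {\<tau> x}" if "x \<in> V" "eta V \<tau> \<theta> x \<noteq> 0" for x
    using that by (auto simp: eta_def rep_gen split: if_splits)
  have c: "set (map fst (rep (eta V \<tau> \<theta> x))) \<inter> \<tau> ` V = {}" if "x \<notin> V" for x
    using that fresh[OF that] assms(1)[OF that] by (simp add: eta_def)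
  have "fst l \<in> V \<and> fst m \<in> V"
    using assms(4) v[OF _ nz(1)] v[OF _ nz(2)] c[of "fst l"] c[of "fst m"] e by blast
  then show ?thesis using v[OF _ nz(1)] v[OF _ nz(2)] e inj by (metis inj_onD singleton_inject)
qed

text \<open>The letters l are those that survive free cancellation of the values under
  \<open>eta\<close>, and the segments between them are what cancels. Reading from the right, a
  letter joins a segment, starts a block, or cancels against the next surviving letter and fuses two
  segments.\<close>

lemma blocks:
  assumes c: "\<And>x. x \<notin> V \<Longrightarrow> \<theta> x = lab x"
  shows "\<exists>Z bs. W = Z @ concat (map (\<lambda>(l, Z). l # Z) bs) \<and> balanced \<theta> Z \<and> (\<forall>(l, Z)\<in>set bs. balanced \<theta> Z \<and> sgn_of (eta V \<tau> \<theta>) l \<noteq> 0) \<and>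
    successively (\<lambda>p q. sgn_of (eta V \<tau> \<theta>) (fst q) \<noteq> - sgn_of (eta V \<tau> \<theta>) (fst p)) bs"
proof (induction W)
  case Nil
  show ?case by (rule exI[of _ "[]"], rule exI[of _ "[]"]) (simp add: balanced_def)
next
  case (Cons l W)
  then obtain Z bs where IH: "W = Z @ concat (map (\<lambda>(l, Z). l # Z) bs)" "balanced \<theta> Z"
    "\<forall>(l, Z)\<in>set bs. balanced \<theta> Z \<and> sgn_of (eta V \<tau> \<theta>) l \<noteq> 0"
    "successively (\<lambda>p q. sgn_of (eta V \<tau> \<theta>) (fst q) \<noteq> - sgn_of (eta V \<tau> \<theta>) (fst p)) bs" by blast
  show ?case
  proof (cases "sgn_of (eta V \<tau> \<theta>) l = 0")
    case True
    have "fst l \<in> V \<Longrightarrow> \<theta> (fst l) = 0" using True by (auto simp: sgn_of_def eta_def split: if_splits)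
    then have "balanced \<theta> (l # Z)" using IH(2) True by (auto simp: balanced_def)
    then show ?thesis using IH by (intro exI[of _ "l # Z"] exI[of _ bs]) simp
  next
    case nz: False
    show ?thesis
    proof (cases "bs \<noteq> [] \<and> sgn_of (eta V \<tau> \<theta>) (fst (hd bs)) = - sgn_of (eta V \<tau> \<theta>) l")
      case True
      then obtain m Z1 cs where bs: "bs = (m, Z1) # cs" by (cases bs) auto
      have m: "sgn_of (eta V \<tau> \<theta>) m = - sgn_of (eta V \<tau> \<theta>) l" using True bs by simp
      have b1: "balanced \<theta> Z1" using IH(3) bs by auto
      have "balanced \<theta> (l # Z @ m # Z1)"
        unfolding balanced_def
      proof (intro conjI ballI impI)
        show "ev (eta V \<tau> \<theta>) (l # Z @ m # Z1) = 0" using m IH(2) b1 by (simp add: balanced_def)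
        fix x assume x: "x \<in> V" "\<theta> x \<noteq> 0"
        have "even (count (symbols Z) x)" "even (count (symbols Z1) x)" using IH(2) b1 x by (auto simp: balanced_def)
        moreover have "x = fst l \<longleftrightarrow> x = fst m" using eta_opposite[OF c m nz] x by auto
        ultimately show "even (count (symbols (l # Z @ m # Z1)) x)" by auto
      qed
      then show ?thesis using IH bs
        by (intro exI[of _ "l # Z @ m # Z1"] exI[of _ cs]) (auto simp: successively_Cons)
    next
      case False
      then have "successively (\<lambda>p q. sgn_of (eta V \<tau> \<theta>) (fst q) \<noteq> - sgn_of (eta V \<tau> \<theta>) (fst p)) ((l, Z) # bs)"
        using IH(4) by (cases bs) auto
      then show ?thesis using IH nz
        by (intro exI[of _ "[]"] exI[of _ "(l, Z) # bs"]) (auto simp: balanced_def)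
    qed
  qed
qed

definition tlen :: "('a \<Rightarrow> 'b fgrp) \<Rightarrow> nat" where "tlen \<theta> = (\<Sum>x\<in>V. len (\<theta> x))"
definition thalves :: "('b \<times> bool \<Rightarrow> nat) \<Rightarrow> nat \<Rightarrow> ('a \<Rightarrow> 'b fgrp) \<Rightarrow> nat" where
  "thalves cd B \<theta> = (\<Sum>x\<in>V. halves cd B (rep (\<theta> x)))"

lemma update_sums:
  assumes "x \<in> V" "\<And>y. y \<noteq> x \<Longrightarrow> \<theta>' y = \<theta> y"
  shows "len (\<theta>' x) < len (\<theta> x) \<Longrightarrow> tlen \<theta>' < tlen \<theta>" "len (\<theta>' x) = len (\<theta> x) \<Longrightarrow> tlen \<theta>' = tlen \<theta>"
    "halves cd B (rep (\<theta>' x)) < halves cd B (rep (\<theta> x)) \<Longrightarrow> thalves cd B \<theta>' < thalves cd B \<theta>"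
proof -
  have *: "(\<Sum>y\<in>V. h (\<theta>' y)) + h (\<theta> x) = (\<Sum>y\<in>V. h (\<theta> y)) + h (\<theta>' x)" for h :: "'b fgrp \<Rightarrow> nat"
  proof -
    have "(\<Sum>y\<in>V - {x}. h (\<theta>' y)) = (\<Sum>y\<in>V - {x}. h (\<theta> y))" using assms(2) by (intro sum.cong) auto
    then show ?thesis using finV assms(1) by (simp add: sum.remove)
  qed
  show "len (\<theta>' x) < len (\<theta> x) \<Longrightarrow> tlen \<theta>' < tlen \<theta>" "len (\<theta>' x) = len (\<theta> x) \<Longrightarrow> tlen \<theta>' = tlen \<theta>"
    using *[of len] unfolding tlen_def by linarith+
  show "halves cd B (rep (\<theta>' x)) < halves cd B (rep (\<theta> x)) \<Longrightarrow> thalves cd B \<theta>' < thalves cd B \<theta>"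
    using *[of "\<lambda>g. halves cd B (rep g)"] unfolding thalves_def by linarith
qed

lemma slide_value:
  assumes W: "W = \<alpha> @ P @ [l] @ P' @ \<beta>" "fst l \<in> V" "count (symbols W) (fst l) = 2"
    "fst l \<notin> fst ` set P" "fst l \<notin> fst ` set P'" "ev \<theta> (P @ [l] @ P') = g"
  shows "\<exists>W' \<theta>'. slid V W \<theta> W' \<theta>' \<and> (\<forall>y. y \<noteq> fst l \<longrightarrow> \<theta>' y = \<theta> y) \<and> sgn_of \<theta>' l = g"
proof -
  define \<theta>' where "\<theta>' = \<theta>(fst l := (if snd l then g else - g))"
  have g: "sgn_of \<theta>' l = g" by (simp add: \<theta>'_def sgn_of_def)
  have o: "\<And>x. x \<noteq> fst l \<Longrightarrow> \<theta>' x = \<theta> x" by (simp add: \<theta>'_def)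
  have "slid V W \<theta> (sub l (winv P @ [l] @ winv P') \<alpha> @ [l] @ sub l (winv P @ [l] @ winv P') \<beta>) \<theta>'"
    by (rule slide[OF W(1-5)]) (use g W(6) o in auto)
  with g o show ?thesis by blast
qed

text \<open>The balanced segments vanish under the solution, so the surviving letters form a trivial
  product of nontrivial values, and a Nielsen condition fails. A slide repairs the failure: it
  shortens one value, or keeps its length and lowers the tie-breaker.\<close>

lemma reduction_step:
  assumes c: "\<And>x. x \<notin> V \<Longrightarrow> \<theta> x = lab x"
    and cnt: "\<And>x. x \<in> V \<Longrightarrow> count (symbols W) x = 2"
    and sol: "ev \<theta> W = 0" and nsol: "ev (eta V \<tau> \<theta>) W \<noteq> 0"
    and L: "\<And>x. x \<in> V \<Longrightarrow> set (rep (\<theta> x)) \<subseteq> L" "\<And>l. l \<in> L \<Longrightarrow> letter_inv l \<in> L"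
    and cd: "inj_on cd L" "\<And>l. l \<in> L \<Longrightarrow> cd l < B"
  shows "\<exists>W' \<theta>'. slid V W \<theta> W' \<theta>' \<and> (\<forall>x\<in>V. set (rep (\<theta>' x)) \<subseteq> L) \<and>
    (tlen \<theta>' < tlen \<theta> \<or> tlen \<theta>' = tlen \<theta> \<and> thalves cd B \<theta>' < thalves cd B \<theta>)"
proof -
  let ?h = "sgn_of (eta V \<tau> \<theta>)" and ?g = "\<lambda>p. sgn_of \<theta> (fst p)"
  obtain Z bs where W: "W = Z @ concat (map (\<lambda>(l, Z). l # Z) bs)" "balanced \<theta> Z"
    "\<forall>(l, Z)\<in>set bs. balanced \<theta> Z \<and> ?h l \<noteq> 0"
    and succ: "successively (\<lambda>p q. ?h (fst q) \<noteq> - ?h (fst p)) bs"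
    using blocks[OF c] by blast
  have bal0: "ev \<theta> Y = 0" if "balanced \<theta> Y" for Y
    using ev_spec_eta[of \<theta> Y, OF c] that by (simp add: balanced_def)
  have gspec: "sgn_of \<theta> l = lift (spec \<theta>) (?h l)" for l
    using spec_eta[of \<theta>, OF c] by (simp add: sgn_of_def)
  have hz: "sgn_of \<theta> l = 0 \<longleftrightarrow> ?h l = 0" for l
    using c by (auto simp: sgn_of_def eta_def)
  have ne: "bs \<noteq> []" using nsol W(1,2) by (auto simp: balanced_def)
  have evb: "ev f (concat (map (\<lambda>(l, Z). l # Z) cs)) = sum_list (map (\<lambda>p. sgn_of f (fst p)) cs)"
    if "\<And>l Z. (l, Z) \<in> set cs \<Longrightarrow> ev f Z = 0" for f :: "'a \<Rightarrow> 'b fgrp" and cs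
    using that
  proof (induction cs)
    case (Cons p cs)
    obtain l Z where p: "p = (l, Z)" by fastforce
    have "ev f (concat (map (\<lambda>(l, Z). l # Z) cs)) = sum_list (map (\<lambda>p. sgn_of f (fst p)) cs)"
      using Cons.IH Cons.prems by (meson list.set_intros(2))
    moreover have "ev f Z = 0" using Cons.prems p by (meson list.set_intros(1))
    ultimately show ?case by (simp add: p)
  qed simp
  have sum0: "sum_list (map ?g bs) = 0"
    using sol unfolding W(1) using evb[of bs \<theta>] bal0 W(2,3) by fastforce
  have gnz: "?g p \<noteq> 0" if "p \<in> set bs" for p using W(3) that hz by fastforce
  have hs: "?h l = sgn_of \<theta> l" if "fst l \<notin> V" for l
    using that by (simp add: sgn_of_def eta_def)
  have opp: "?h l2 = - ?h l1" if "sgn_of \<theta> l2 = - sgn_of \<theta> l1" "fst l1 \<notin> V" "fst l2 \<notin> V" for l1 l2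
    using that(1) unfolding hs[OF that(2)] hs[OF that(3)] .
  have split2: "\<exists>\<alpha> \<beta>. W = \<alpha> @ [l1] @ Z1 @ [l2] @ \<beta> \<and> balanced \<theta> Z1 \<and> ?h l2 \<noteq> - ?h l1"
    if "bs = xs @ [(l1, Z1), (l2, Z2)] @ ys" for xs l1 Z1 l2 Z2 ys
  proof -
    have "balanced \<theta> Z1" using W(3) that by auto
    moreover have "?h l2 \<noteq> - ?h l1" using succ that by (auto simp: successively_append_iff)
    moreover have "W = (Z @ concat (map (\<lambda>(l, Z). l # Z) xs)) @ [l1] @ Z1 @ [l2] @ (Z2 @ concat (map (\<lambda>(l, Z). l # Z) ys))"
      unfolding W(1) that by simp
    ultimately show ?thesis by blast
  qed
  \<comment> \<open>One of the two occurrences of the variable is beside the segment, and an even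
    number is inside, hence none.\<close>
  have avoid: "fst l \<notin> fst ` set Y" if "W = \<alpha> @ [l1] @ Y @ [l2] @ \<beta>" "balanced \<theta> Y" "l = l1 \<or> l = l2" "fst l \<in> V" "\<theta> (fst l) \<noteq> 0"
    for \<alpha> \<beta> Y l l1 l2
  proof -
    have "symbols W = symbols Y + symbols (\<alpha> @ \<beta>) + {#fst l1, fst l2#}" unfolding that(1) by simp
    moreover have "0 < count {#fst l1, fst l2#} (fst l)" using that(3) by auto
    ultimately have "count (symbols Y) (fst l) < 2" using cnt[OF that(4)] by (simp only: count_union)
    moreover have "even (count (symbols Y) (fst l))" using that(2,4,5) unfolding balanced_def by blast
    ultimately show ?thesis unfolding count_symbols_pos by (metis dvd_imp_le leD not_gr0)
  qed
  \<comment> \<open>A value cannot cancel half of itself against a copy of itself, and adjacent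
    opposite letters are excluded by the choice of blocks.\<close>
  have distinct_vars: "fst l1 \<noteq> fst l2"
    if "rep (sgn_of \<theta> l1) = a @ k" "rep (sgn_of \<theta> l2) = winv k @ b" "length a \<le> length k"
      "?h l2 \<noteq> - ?h l1" "sgn_of \<theta> l1 \<noteq> 0" for l1 l2 a k b
  proof
    assume eq: "fst l1 = fst l2"
    consider "l2 = l1" | "l2 = letter_inv l1" using eq by (cases l1; cases l2) (auto simp: letter_inv_def)
    then show False
    proof cases
      case 1
      have "rep (sgn_of \<theta> l1) \<noteq> []" using that(5) by simp
      then show False using self_cancellation[OF freely_reduced_rep, of "sgn_of \<theta> l1" a k b] that 1 by auto
    qed (use that(4) in simp)
  qed
  have one: "len (sgn_of \<theta> l) \<le> 1" if "fst l \<notin> V" for l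
    using lab_len[OF that] c[OF that] by simp
  have winvL: "set (winv k) \<subseteq> L" if "set k \<subseteq> L" for k
  proof
    fix x assume "x \<in> set (winv k)"
    then obtain y where "y \<in> set k" "x = letter_inv y" by (auto simp: winv_def)
    then show "x \<in> L" using that L(2) by blast
  qed
  have letters: "set (rep (sgn_of \<theta> l)) \<subseteq> L" if "fst l \<in> V" for l
    using L(1)[OF that] by (simp add: sgn_of_def rep_uminus winvL)
  have fin: "\<exists>W' \<theta>'. slid V W \<theta> W' \<theta>' \<and> (\<forall>x\<in>V. set (rep (\<theta>' x)) \<subseteq> L) \<and>
      (tlen \<theta>' < tlen \<theta> \<or> tlen \<theta>' = tlen \<theta> \<and> thalves cd B \<theta>' < thalves cd B \<theta>)"
    if s: "W = \<alpha> @ P @ [l] @ P' @ \<beta>" "fst l \<in> V" "fst l \<notin> fst ` set P" "fst l \<notin> fst ` set P'"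
      "ev \<theta> (P @ [l] @ P') = g" and gL: "set (rep g) \<subseteq> L"
      and lt: "len g < len (sgn_of \<theta> l) \<or> len g = len (sgn_of \<theta> l) \<and> halves cd B (rep g) < halves cd B (rep (sgn_of \<theta> l))"
    for \<alpha> P l P' \<beta> g
  proof -
    obtain W' \<theta>' where 1: "slid V W \<theta> W' \<theta>'" "\<And>y. y \<noteq> fst l \<Longrightarrow> \<theta>' y = \<theta> y" "sgn_of \<theta>' l = g"
      using slide_value[OF s(1,2) cnt[OF s(2)] s(3-5)] by blast
    have h: "halves cd B (rep (sgn_of f l)) = halves cd B (rep (f (fst l)))" for f :: "'a \<Rightarrow> 'b fgrp"
      by (simp add: sgn_of_def rep_uminus)
    have l: "len (sgn_of f l) = len (f (fst l))" for f :: "'a \<Rightarrow> 'b fgrp"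
      by simp
    have "set (rep (\<theta>' x)) \<subseteq> L" if "x \<in> V" for x
    proof (cases "x = fst l")
      case True
      have "\<theta>' (fst l) = g \<or> \<theta>' (fst l) = - g" using 1(3) by (auto simp: sgn_of_def split: if_splits)
      then show ?thesis using True gL winvL[OF gL] by (elim disjE) (simp_all add: rep_uminus)
    next
      case False
      then show ?thesis using 1(2) L(1) that by simp
    qed
    moreover have "tlen \<theta>' < tlen \<theta> \<or> tlen \<theta>' = tlen \<theta> \<and> thalves cd B \<theta>' < thalves cd B \<theta>"
      using lt update_sums[of "fst l" \<theta>' \<theta>, OF s(2) 1(2)] unfolding 1(3)[symmetric] h l by blast
    ultimately show ?thesis using 1(1) by blast
  qed
  have "\<not> ((\<forall>xs p q ys. bs = xs @ [p, q] @ ys \<longrightarrow> 2 * cancelled (?g p) (?g q) \<le> len (?g p) \<and> 2 * cancelled (?g p) (?g q) \<le> len (?g q)) \<and>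
      (\<forall>xs p q r ys. bs = xs @ [p, q, r] @ ys \<longrightarrow> cancelled (?g p) (?g q) + cancelled (?g q) (?g r) < len (?g q)))"
    using nielsen_nonzero[of bs ?g, OF ne gnz] sum0 by blast
  then consider (A) xs p q ys where "bs = xs @ [p, q] @ ys" "\<not> (2 * cancelled (?g p) (?g q) \<le> len (?g p) \<and> 2 * cancelled (?g p) (?g q) \<le> len (?g q))"
    | (B) xs p q r ys where "bs = xs @ [p, q, r] @ ys" "\<not> cancelled (?g p) (?g q) + cancelled (?g q) (?g r) < len (?g q)"
       "\<And>xs p q ys. bs = xs @ [p, q] @ ys \<Longrightarrow> 2 * cancelled (?g p) (?g q) \<le> len (?g p) \<and> 2 * cancelled (?g p) (?g q) \<le> len (?g q)"
    by blast
  then show ?thesis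
  proof cases
    case A
    obtain l1 Z1 l2 Z2 where pq: "p = (l1, Z1)" "q = (l2, Z2)" by fastforce
    obtain \<alpha> \<beta> where s: "W = \<alpha> @ [l1] @ Z1 @ [l2] @ \<beta>" "balanced \<theta> Z1" "?h l2 \<noteq> - ?h l1"
      using split2 A(1) unfolding pq by blast
    obtain a k b where akb: "rep (sgn_of \<theta> l1) = a @ k" "rep (sgn_of \<theta> l2) = winv k @ b"
      "rep (sgn_of \<theta> l1 + sgn_of \<theta> l2) = a @ b" "cancelled (sgn_of \<theta> l1) (sgn_of \<theta> l2) = length k"
      by (rule cancelled_obtain)
    have len: "len (sgn_of \<theta> l1) = length a + length k" "len (sgn_of \<theta> l2) = length k + length b"
      "len (sgn_of \<theta> l1 + sgn_of \<theta> l2) = length a + length b"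
      unfolding len_def using akb by simp_all
    have big: "length a < length k \<or> length b < length k"
      using A(2) unfolding pq using len akb(4) by auto
    have nz: "sgn_of \<theta> l1 \<noteq> 0" "sgn_of \<theta> l2 \<noteq> 0" using gnz[of p] gnz[of q] A(1) pq by auto
    have k: "length k > 0" using big by auto
    \<comment> \<open>If the first value loses more than half, the product is shorter than the
      second value, so the second symbol is to be slid, and conversely. If that symbol is a
      constant, its value is the single cancelled letter and both values cancel completely, so the
      roles may be exchanged; two constants would be opposite under \<open>eta\<close>, which the
      blocks exclude.\<close>
    have cases: "(length a < length k \<and> fst l2 \<in> V) \<or> (length b < length k \<and> fst l1 \<in> V)"
    proof (rule ccontr)
      assume neg: "\<not> ?thesis"
      have "fst l1 \<notin> V \<or> fst l2 \<notin> V" using neg big by blast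
      then have "length a = 0 \<and> length k = 1 \<or> length b = 0 \<and> length k = 1"
        using one[of l1] one[of l2] len k by linarith
      then have "a = [] \<and> b = []" "fst l1 \<notin> V" "fst l2 \<notin> V"
        using neg big one[of l1] one[of l2] len by auto
      then have "sgn_of \<theta> l2 = - sgn_of \<theta> l1"
        using akb by (metis append_Nil append_Nil2 rep_inject rep_uminus)
      then show False using opp[of l2 l1] s(3) \<open>fst l1 \<notin> V\<close> \<open>fst l2 \<notin> V\<close> by blast
    qed
    have dv: "fst l1 \<noteq> fst l2"
    proof (cases "length a \<le> length k")
      case True
      then show ?thesis using distinct_vars[OF akb(1,2)] s(3) nz(1) by blast
    next
      case False
      have "rep (sgn_of \<theta> (letter_inv l2)) = winv b @ k" "rep (sgn_of \<theta> (letter_inv l1)) = winv k @ winv a"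
        using akb(1,2) by (simp_all add: rep_uminus)
      moreover have "?h (letter_inv l1) \<noteq> - ?h (letter_inv l2)" using s(3) by auto
      ultimately show ?thesis
        using distinct_vars[of "letter_inv l2" "winv b" k "letter_inv l1" "winv a"] big False nz by auto
    qed
    have sumL: "set (a @ b) \<subseteq> L" if "fst l1 \<in> V" "fst l2 \<in> V"
      using letters[OF that(1)] letters[OF that(2)] akb(1,2) by auto
    from cases show ?thesis
    proof (elim disjE conjE)
      assume *: "length a < length k" "fst l2 \<in> V"
      have av: "fst l2 \<notin> fst ` set Z1" using avoid[OF s(1,2), of l2] *(2) nz(2) by (auto simp: sgn_of_def split: if_splits)
      have gL: "set (rep (sgn_of \<theta> l1 + sgn_of \<theta> l2)) \<subseteq> L"
      proof (cases "fst l1 \<in> V")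
        case True
        then show ?thesis using sumL *(2) akb(3) by simp
      next
        case False
        then have "a = []" using one[of l1] len k by (cases a) auto
        then show ?thesis using letters[OF *(2)] akb(2,3) by auto
      qed
      show ?thesis
        using s(1) *(2) av dv bal0[OF s(2)] gL len *(1)
        by (intro fin[of \<alpha> "[l1] @ Z1" l2 "[]" \<beta> "sgn_of \<theta> l1 + sgn_of \<theta> l2"]) auto
    next
      assume *: "length b < length k" "fst l1 \<in> V"
      have av: "fst l1 \<notin> fst ` set Z1" using avoid[OF s(1,2), of l1] *(2) nz(1) by (auto simp: sgn_of_def split: if_splits)
      have gL: "set (rep (sgn_of \<theta> l1 + sgn_of \<theta> l2)) \<subseteq> L"
      proof (cases "fst l2 \<in> V")
        case True
        then show ?thesis using sumL *(2) akb(3) by simp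
      next
        case False
        then have "b = []" using one[of l2] len k by (cases b) auto
        then show ?thesis using letters[OF *(2)] akb(1,3) by auto
      qed
      show ?thesis
        using s(1) *(2) av dv bal0[OF s(2)] gL len *(1)
        by (intro fin[of \<alpha> "[]" l1 "Z1 @ [l2]" \<beta> "sgn_of \<theta> l1 + sgn_of \<theta> l2"]) auto
    qed
  next
    case B
    obtain l1 Z1 l2 Z2 l3 Z3 where pqr: "p = (l1, Z1)" "q = (l2, Z2)" "r = (l3, Z3)" by (metis surj_pair)
    have b12: "bs = xs @ [(l1, Z1), (l2, Z2)] @ (r # ys)" and b23: "bs = (xs @ [p]) @ [(l2, Z2), (l3, Z3)] @ ys"
      using B(1) pqr by simp_all
    obtain \<alpha> \<beta> where s: "W = \<alpha> @ [l1] @ Z1 @ [l2] @ \<beta>" "balanced \<theta> Z1" "?h l2 \<noteq> - ?h l1"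
      using split2[OF b12] by blast
    obtain \<alpha>' \<beta>' where s': "W = \<alpha>' @ [l2] @ Z2 @ [l3] @ \<beta>'" "balanced \<theta> Z2" "?h l3 \<noteq> - ?h l2"
      using split2[OF b23] by blast
    obtain a k d where 1: "rep (sgn_of \<theta> l1) = a @ k" "rep (sgn_of \<theta> l2) = winv k @ d"
      "rep (sgn_of \<theta> l1 + sgn_of \<theta> l2) = a @ d" "cancelled (sgn_of \<theta> l1) (sgn_of \<theta> l2) = length k"
      by (rule cancelled_obtain)
    obtain e k' b where 2: "rep (sgn_of \<theta> l2) = e @ k'" "rep (sgn_of \<theta> l3) = winv k' @ b"
      "rep (sgn_of \<theta> l2 + sgn_of \<theta> l3) = e @ b" "cancelled (sgn_of \<theta> l2) (sgn_of \<theta> l3) = length k'"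
      by (rule cancelled_obtain)
    have ln1: "len (sgn_of \<theta> l1) = length a + length k" unfolding len_def 1(1) by simp
    have ln2: "len (sgn_of \<theta> l2) = length k + length d" unfolding len_def 1(2) by simp
    have ln3: "len (sgn_of \<theta> l2) = length e + length k'" unfolding len_def 2(1) by simp
    have ln4: "len (sgn_of \<theta> l3) = length k' + length b" unfolding len_def 2(2) by simp
    note B12 = B(3)[OF b12, unfolded fst_conv 1(4)] and B23 = B(3)[OF b23, unfolded fst_conv 2(4)]
    have N: "2 * length k \<le> length a + length k" "2 * length k \<le> length k + length d"
      "2 * length k' \<le> length e + length k'" "2 * length k' \<le> length k' + length b"
      using B12 B23 unfolding ln4 ln1 by (simp_all only: ln2) (use ln2 ln3 in linarith)+
    have "len (sgn_of \<theta> l2) \<le> length k + length k'"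
      using B(2) unfolding pqr fst_conv 1(4) 2(4) by simp
    \<comment> \<open>With the conditions for two factors intact, a failure for three forces the
      middle value to be k^-1 k' with both halves of equal length.\<close>
    then have kk: "length d = length k'" "length e = length k" "length k = length k'"
      using N ln2 ln3 by linarith+
    then have ed: "e = winv k" "d = k'" using 1(2) 2(1) by (metis append_eq_append_conv winv_simps(5))+
    have nz: "sgn_of \<theta> l1 \<noteq> 0" "sgn_of \<theta> l2 \<noteq> 0" "sgn_of \<theta> l3 \<noteq> 0"
      using gnz[of p] gnz[of q] gnz[of r] B(1) pqr by auto
    have k0: "length k > 0"
    proof (rule ccontr)
      assume "\<not> length k > 0"
      then have "rep (sgn_of \<theta> l2) = []" using 1(2) ed(2) kk by simp
      with nz(2) show False by simp
    qed
    have inV: "fst l1 \<in> V" "fst l2 \<in> V" "fst l3 \<in> V"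
      using one[of l1] one[of l2] one[of l3] 1(1,2) 2(2) N k0 kk by (auto simp: len_def)
    have dv: "fst l1 \<noteq> fst l2"
    proof -
      have "rep (sgn_of \<theta> (letter_inv l2)) = winv k' @ k" "rep (sgn_of \<theta> (letter_inv l1)) = winv k @ winv a"
        using 1(1,2) ed by (simp_all add: rep_uminus)
      moreover have "?h (letter_inv l1) \<noteq> - ?h (letter_inv l2)" using s(3) by auto
      ultimately show ?thesis
        using distinct_vars[of "letter_inv l2" "winv k'" k "letter_inv l1" "winv a"] kk nz by auto
    qed
    have dv': "fst l2 \<noteq> fst l3"
      using distinct_vars[of l2 e k' l3 b] 2 kk s'(3) nz by auto
    have nzv: "\<theta> (fst l1) \<noteq> 0" "\<theta> (fst l3) \<noteq> 0" using nz by (auto simp: sgn_of_def split: if_splits)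
    have B0: "0 < B"
    proof -
      have "set (rep (sgn_of \<theta> l1)) \<subseteq> L" by (rule letters[OF inV(1)])
      then have "set k \<subseteq> L" using 1(1) by auto
      then obtain x where "x \<in> L" using k0 by (cases k) auto
      then show ?thesis using cd(2)[of x] by simp
    qed
    let ?w = "winv k" and ?u = "winv k'"
    have lw: "set ?w \<subseteq> L" "set ?u \<subseteq> L" "set a \<subseteq> L" "set b \<subseteq> L" "set k' \<subseteq> L"
      using letters[OF inV(1)] letters[OF inV(2)] letters[OF inV(3)] 1(1,2) 2(2) ed by auto
    have neq: "rank cd B ?w \<noteq> rank cd B ?u"
    proof
      assume "rank cd B ?w = rank cd B ?u"
      then have "?w = ?u" using rank_inj[OF cd lw(1,2)] kk by simp
      then have "k = k'" by (metis winv_simps(4))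
      have "sgn_of \<theta> l2 = cls (winv k @ k')" using 1(2) ed by (metis cls_rep)
      then have "sgn_of \<theta> l2 = 0" using \<open>k = k'\<close> by simp
      with nz(2) show False by simp
    qed
    \<comment> \<open>The segments k^-1 and k'^-1 differ because the middle value is nontrivial. The
      slide replaces the one of larger rank by the other, at the front of the third value or at the
      front of the inverse of the first.\<close>
    show ?thesis
    proof (cases "rank cd B ?w < rank cd B ?u")
      case True
      have "fst l3 \<notin> fst ` set Z2" using avoid[OF s'(1,2), of l3] inV nzv by auto
      moreover have "halves cd B (?w @ b) < halves cd B (?u @ b)"
        using True B0 N kk by (intro halves_less) auto
      moreover have "rep (sgn_of \<theta> l2 + sgn_of \<theta> l3) = ?w @ b" using 2(3) ed by simp
      ultimately show ?thesis
        using s'(1) inV(3) dv' bal0[OF s'(2)] lw 2(2) kk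
        by (intro fin[of \<alpha>' "[l2] @ Z2" l3 "[]" \<beta>' "sgn_of \<theta> l2 + sgn_of \<theta> l3"]) (auto simp: len_def)
    next
      case False
      then have "rank cd B ?u < rank cd B ?w" using neq by simp
      then have "halves cd B (?u @ winv a) < halves cd B (?w @ winv a)"
        using B0 N kk by (intro halves_less) auto
      then have "halves cd B (a @ k') < halves cd B (a @ k)"
        using halves_winv[of cd B "a @ k'"] halves_winv[of cd B "a @ k"] by simp
      moreover have "rep (sgn_of \<theta> l1 + sgn_of \<theta> l2) = a @ k'" using 1(3) ed by simp
      moreover have "fst l1 \<notin> fst ` set Z1" using avoid[OF s(1,2), of l1] inV nzv by auto
      ultimately show ?thesis
        using s(1) inV(1) dv bal0[OF s(2)] lw 1(1) kk
        by (intro fin[of \<alpha> "[]" l1 "Z1 @ [l2]" \<beta> "sgn_of \<theta> l1 + sgn_of \<theta> l2"]) (auto simp: len_def)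
    qed
  qed
qed

text \<open>The letters of all values stay in the finite set L, so one coding of letters serves the
  whole recursion, and total length with tie-breaker decreases lexicographically.\<close>

theorem reduction:
  assumes "\<And>x. x \<notin> V \<Longrightarrow> \<theta> x = lab x" "\<And>x. x \<in> V \<Longrightarrow> count (symbols W) x = 2" "ev \<theta> W = 0"
  shows "\<exists>W' \<theta>'. slid V W \<theta> W' \<theta>' \<and> ev (eta V \<tau> \<theta>') W' = 0"
proof -
  define L where "L = (\<Union>x\<in>V. set (rep (\<theta> x)) \<union> letter_inv ` set (rep (\<theta> x)))"
  have finL: "finite L" unfolding L_def using finV by auto
  then obtain cd :: "'b \<times> bool \<Rightarrow> nat" where cd: "inj_on cd L"
    using finite_imp_inj_to_nat_seg[OF finL] by auto
  define B where "B = Suc (Max (insert 0 (cd ` L)))"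
  have B: "cd l < B" if "l \<in> L" for l
    using that finL unfolding B_def by (simp add: less_Suc_eq_le)
  have Linv: "letter_inv l \<in> L" if "l \<in> L" for l using that unfolding L_def by auto
  have "\<exists>W' \<theta>'. slid V W \<theta> W' \<theta>' \<and> ev (eta V \<tau> \<theta>') W' = 0"
    if "\<And>x. x \<notin> V \<Longrightarrow> \<theta> x = lab x" "\<And>x. x \<in> V \<Longrightarrow> count (symbols W) x = 2" "ev \<theta> W = 0"
      "\<And>x. x \<in> V \<Longrightarrow> set (rep (\<theta> x)) \<subseteq> L" for W \<theta>
    using that
  proof (induction "(tlen \<theta>, thalves cd B \<theta>)" arbitrary: W \<theta> rule: wf_induct_rule[OF wf_lex_prod[OF wf_less_than wf_less_than]])
    case (1 \<theta> W)
    show ?case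
    proof (cases "ev (eta V \<tau> \<theta>) W = 0")
      case False
      obtain W1 \<theta>1 where s: "slid V W \<theta> W1 \<theta>1" "\<forall>x\<in>V. set (rep (\<theta>1 x)) \<subseteq> L"
        "tlen \<theta>1 < tlen \<theta> \<or> tlen \<theta>1 = tlen \<theta> \<and> thalves cd B \<theta>1 < thalves cd B \<theta>"
        using reduction_step[of \<theta> W L cd B, OF 1(2,3,4) False 1(5) Linv cd B] by blast
      have "\<theta>1 x = lab x" if "x \<notin> V" for x using s(1) 1(2)[OF that] that unfolding slid_def by simp
      moreover have "count (symbols W1) x = 2" if "x \<in> V" for x using s(1) 1(3)[OF that] unfolding slid_def by simp
      moreover have "ev \<theta>1 W1 = 0"
      proof -
        from s(1) obtain f where f: "ev f W = cls W1" "\<And>v. \<theta> v = lift \<theta>1 (f v)" unfolding slid_def by blast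
        have "ev \<theta> W = ev (\<lambda>v. lift \<theta>1 (f v)) W" using f(2) by (intro ev_cong) simp
        also have "\<dots> = lift \<theta>1 (ev f W)" by (rule lift_ev[symmetric])
        finally show ?thesis using f(1) 1(4) by simp
      qed
      moreover have "((tlen \<theta>1, thalves cd B \<theta>1), (tlen \<theta>, thalves cd B \<theta>)) \<in> less_than <*lex*> less_than"
        using s(3) by auto
      ultimately obtain W' \<theta>' where "slid V W1 \<theta>1 W' \<theta>'" "ev (eta V \<tau> \<theta>') W' = 0"
        using 1(1)[of \<theta>1 W1] s(2) by blast
      then show ?thesis using slid_trans[OF s(1)] by blast
    qed (use slid_refl in blast)
  qed
  then show ?thesis using assms by (metis (no_types, lifting) L_def UN_I UnI1 subsetI)
qed

end

section \<open>Coefficients as coloured cycles, and closed paths of constants\<close>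

section \<open>The holes of a coloured word\<close>

abbreviation pos_word :: "'a list \<Rightarrow> 'a word" where "pos_word d \<equiv> map (\<lambda>x. (x, True)) d"

definition signed :: "bool \<Rightarrow> 'a word \<Rightarrow> 'a word" where "signed e w = (if e then w else winv w)"

lemma signed_simps [simp]: "signed True w = w" "signed False w = winv w" "wsum wt (signed e w) = wsum wt w"
  "fst ` set (signed e w) = fst ` set w" "symbols (signed e w) = symbols w"
  using mset_fst_winv[of w] by (auto simp: signed_def)

lemma count_normal: "count (symbols (squares xs @ commutators ps)) x = 2 * count (mset (xs @ map fst ps @ map snd ps)) x"
proof -
  have "count (symbols (squares xs)) x = 2 * count (mset xs) x" by (induction xs) auto
  moreover have "count (symbols (commutators ps)) x = 2 * count (mset (map fst ps @ map snd ps)) x" by (induction ps) auto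
  ultimately show ?thesis by simp
qed

lemma count_flat: "wf_forest V F \<Longrightarrow> x \<in> V \<Longrightarrow> count (symbols (flat F)) x = 2 * count (mset (branch_vars F)) x"
  by (induction F) auto

text \<open>A constant at the front never lies between the two letters of an extracted pair, so it
  marks a starting point that survives all moves.\<close>

lemma ext_hd: "ext V w xs ps zs w' \<Longrightarrow> w = a # r \<Longrightarrow> fst a \<notin> V \<Longrightarrow> \<exists>r'. w' = a # r'"
proof (induction arbitrary: r rule: ext.induct)
  case (ext_square l u p s xs ps zs w')
  then show ?case by (cases u) auto
next
  case (ext_handle l m u r q p s ps zs w')
  then show ?case by (cases u) auto
next
  case (ext_hole l b u s zs w')
  then show ?case by (cases u) auto
qed simp

lemma aut_on_bimult:
  assumes "Z \<subseteq> V" "\<And>v. v \<in> Z \<Longrightarrow> fst ` set (\<alpha> v) \<inter> Z = {}" "\<And>v. v \<in> Z \<Longrightarrow> fst ` set (\<beta> v) \<inter> Z = {}"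
  shows "aut_on V (\<lambda>v. if v \<in> Z then cls (\<alpha> v) + gen v + cls (\<beta> v) else gen v)" (is "aut_on V ?f")
proof (rule aut_onI[where g = "\<lambda>v. if v \<in> Z then - cls (\<alpha> v) + gen v - cls (\<beta> v) else gen v"])
  have c: "ev h w = cls w" if "fst ` set w \<inter> Z = {}" "\<And>v. v \<notin> Z \<Longrightarrow> h v = gen v" for h :: "'a \<Rightarrow> 'a fgrp" and w
    using that by (rule ev_avoid)
  fix x
  show "lift ?f (if x \<in> Z then - cls (\<alpha> x) + gen x - cls (\<beta> x) else gen x) = gen x"
    using c[OF assms(2)[of x], of ?f] c[OF assms(3)[of x], of ?f] by (simp add: group_simps)
  show "lift (\<lambda>v. if v \<in> Z then - cls (\<alpha> v) + gen v - cls (\<beta> v) else gen v) (?f x) = gen x"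
    using c[OF assms(2)[of x], of "\<lambda>v. if v \<in> Z then - cls (\<alpha> v) + gen v - cls (\<beta> v) else gen v"]
      c[OF assms(3)[of x], of "\<lambda>v. if v \<in> Z then - cls (\<alpha> v) + gen v - cls (\<beta> v) else gen v"]
    by (simp add: group_simps)
qed (use assms(1) in auto)

text \<open>Each hole is a cycle of constants, no constant occurring twice, and
  \<open>Col j i\<close> is the vertex at which symbol i of hole j begins. The hole
  \<open>hd ds\<close> will be the coefficient without a conjugator.\<close>

locale holes =
  fixes V :: "'a set" and ds :: "'a list list" and s0 t0 :: "'a \<Rightarrow> colour"
  assumes ne: "\<And>d. d \<in> set ds \<Longrightarrow> d \<noteq> []" and dis: "distinct (concat ds)" and cst: "set (concat ds) \<inter> V = {}"
    and ds0: "ds \<noteq> []"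
    and s0: "\<And>j i. j < length ds \<Longrightarrow> i < length (ds ! j) \<Longrightarrow> s0 (ds ! j ! i) = Col j i"
    and t0: "\<And>j i. j < length ds \<Longrightarrow> i < length (ds ! j) \<Longrightarrow> t0 (ds ! j ! i) = Col j (Suc i mod length (ds ! j))"
begin

lemma symb: "x \<in> set (concat ds) \<longleftrightarrow> (\<exists>j<length ds. \<exists>i<length (ds ! j). x = ds ! j ! i)"
proof
  assume "x \<in> set (concat ds)"
  then obtain d where "d \<in> set ds" "x \<in> set d" by auto
  then show "\<exists>j<length ds. \<exists>i<length (ds ! j). x = ds ! j ! i" by (metis in_set_conv_nth)
next
  assume "\<exists>j<length ds. \<exists>i<length (ds ! j). x = ds ! j ! i"
  then show "x \<in> set (concat ds)" by (metis UN_iff nth_mem set_concat)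
qed

lemma Suc_mod_inj: "i < k \<Longrightarrow> i' < k \<Longrightarrow> Suc i mod k = Suc i' mod k \<Longrightarrow> i = i'"
  by (metis Suc_lessI mod_less mod_self nat.distinct(1) nat.inject)

text \<open>At the vertex behind symbol i there are only two ways on: forwards along the next symbol
  or back along symbol i. Distinctness forbids the second.\<close>

lemma forward:
  assumes "j < length ds" "i < length (ds ! j)" "path s0 t0 (Col j (Suc i mod length (ds ! j))) v c"
    "distinct (ds ! j ! i # map fst v)" "fst ` set v \<subseteq> set (concat ds)"
  shows "v = map (\<lambda>m. (ds ! j ! ((Suc i + m) mod length (ds ! j)), True)) [0..<length v] \<and>
    c = Col j ((Suc i + length v) mod length (ds ! j))"
  using assms(2-)
proof (induction v arbitrary: i)
  case (Cons l v)
  let ?k = "length (ds ! j)"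
  have k: "0 < ?k" using Cons.prems(1) by linarith
  define i1 where "i1 = Suc i mod ?k"
  have i1: "i1 < ?k" unfolding i1_def using k by simp
  obtain j' i' where y: "j' < length ds" "i' < length (ds ! j')" "fst l = ds ! j' ! i'"
    using Cons.prems(4) symb by auto
  have l: "fst l = ds ! j ! i1 \<and> snd l"
  proof (cases "snd l")
    case True
    have "Col j' i' = Col j i1" using Cons.prems(2) True s0[OF y(1,2)] y(3) by (simp add: source_def i1_def)
    then show ?thesis using y True by simp
  next
    case False
    have "t0 (ds ! j' ! i') = Col j i1"
      using Cons.prems(2) False y(3) by (simp add: source_def i1_def)
    then have "Col j' (Suc i' mod length (ds ! j')) = Col j i1" by (rule trans[OF t0[OF y(1,2), symmetric]])
    then have "j' = j" "i' = i" using Suc_mod_inj[of i' ?k i] y(2) Cons.prems(1) unfolding i1_def by auto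
    then show ?thesis using y(3) Cons.prems(3) by auto
  qed
  then have leq: "l = (ds ! j ! i1, True)" by (cases l) auto
  have "v = map (\<lambda>m. (ds ! j ! ((Suc i1 + m) mod ?k), True)) [0..<length v] \<and> c = Col j ((Suc i1 + length v) mod ?k)"
    using Cons.prems(2-4) t0[OF assms(1) i1] unfolding leq by (intro Cons.IH i1) (auto simp: target_def)
  moreover have "(Suc i1 + m) mod ?k = (Suc i + Suc m) mod ?k" for m
    unfolding i1_def by (metis add_Suc add_Suc_right mod_add_left_eq)
  moreover have "(ds ! j ! i1, True) # map (\<lambda>m. (ds ! j ! ((Suc i + Suc m) mod ?k), True)) [0..<length v] =
    map (\<lambda>m. (ds ! j ! ((Suc i + m) mod ?k), True)) [0..<length (l # v)]"
    by (simp add: map_upt_Suc i1_def del: upt_Suc)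
  ultimately show ?case unfolding leq by simp
qed simp

lemma cycle_forward:
  assumes "path s0 t0 b ((x, True) # v) b" "distinct (x # map fst v)" "insert x (fst ` set v) \<subseteq> set (concat ds)"
  shows "\<exists>j<length ds. \<exists>i<length (ds ! j). (x, True) # v = pos_word (rotate i (ds ! j)) \<and> x = ds ! j ! i"
proof -
  obtain j i where x: "j < length ds" "i < length (ds ! j)" "x = ds ! j ! i"
    using assms(3) symb by auto
  let ?k = "length (ds ! j)"
  have b: "b = Col j i" using assms(1) x s0 by simp
  have "path s0 t0 (Col j (Suc i mod ?k)) v (Col j i)" using assms(1) x t0 b by simp
  then have f: "v = map (\<lambda>m. (ds ! j ! ((Suc i + m) mod ?k), True)) [0..<length v]"
    "Col j i = Col j ((Suc i + length v) mod ?k)"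
    using forward[OF x(1,2), of v "Col j i"] assms(2,3) x(3) by auto
  have "(i + Suc (length v)) mod ?k = i mod ?k" using f(2) x(2) by simp
  \<comment> \<open>Closing up makes the number of letters a multiple of the cycle length;
    distinctness then excludes a second turn.\<close>
  then have dv: "?k dvd Suc (length v)" by (metis add_diff_cancel_left' le_add1 mod_eq_dvd_iff_nat)
  have full: "(x, True) # v = map (\<lambda>m. (ds ! j ! ((i + m) mod ?k), True)) [0..<Suc (length v)]"
    using f(1) x by (simp add: map_upt_Suc del: upt_Suc)
  have "\<not> ?k < Suc (length v)"
  proof
    assume lt: "?k < Suc (length v)"
    have "map fst ((x, True) # v) ! ?k = ds ! j ! ((i + ?k) mod ?k)" unfolding full using lt by (simp del: upt_Suc)
    also have "\<dots> = x" using x by simp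
    finally have "map fst ((x, True) # v) ! ?k = map fst ((x, True) # v) ! 0" by simp
    moreover have "0 < ?k" using x(2) by linarith
    ultimately show False using assms(2) lt nth_eq_iff_index_eq[of "map fst ((x, True) # v)" ?k 0] by simp
  qed
  then have "Suc (length v) = ?k" using dv by (metis dvd_imp_le le_antisym linorder_not_less zero_less_Suc)
  then have "(x, True) # v = pos_word (rotate i (ds ! j))"
    unfolding full by (intro nth_equalityI) (auto simp: nth_rotate simp del: upt_Suc)
  then have "i < ?k \<and> (x, True) # v = pos_word (rotate i (ds ! j)) \<and> x = ds ! j ! i" using x(2,3) by simp
  then have "\<exists>i<?k. (x, True) # v = pos_word (rotate i (ds ! j)) \<and> x = ds ! j ! i" by (rule exI)
  note ex = this
  show ?thesis
  proof (rule exI[where x = j], rule conjI)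
    show "j < length ds" by (rule x(1))
    show "\<exists>i<?k. (x, True) # v = pos_word (rotate i (ds ! j)) \<and> x = ds ! j ! i" by (rule ex)
  qed
qed

lemma t0_inj: "x \<in> set (concat ds) \<Longrightarrow> y \<in> set (concat ds) \<Longrightarrow> t0 x = t0 y \<Longrightarrow> x = y"
  unfolding symb using t0 Suc_mod_inj by (metis colour.inject)

text \<open>A closed path of distinct constants cannot leave its hole or turn round in it, so it
  runs around it exactly once. The clause on the head letter will show that in the orientable case
  no coefficient is inverted.\<close>

lemma cycle:
  assumes "path s0 t0 b v b" "distinct (map fst v)" "fst ` set v \<subseteq> set (concat ds)" "v \<noteq> []"
  shows "\<exists>j<length ds. \<exists>i<length (ds ! j). \<exists>e. v = signed e (pos_word (rotate i (ds ! j))) \<and> (snd (hd v) \<longrightarrow> e)"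
proof -
  obtain l v' where v: "v = l # v'" using assms(4) by (cases v) auto
  show ?thesis
  proof (cases "snd l")
    case True
    then have l: "l = (fst l, True)" by (cases l) auto
    have vv: "v = (fst l, True) # v'" using v l by simp
    have "path s0 t0 b ((fst l, True) # v') b" "distinct (fst l # map fst v')" "insert (fst l) (fst ` set v') \<subseteq> set (concat ds)"
      using assms(1-3) vv by simp_all
    from cycle_forward[OF this] obtain j i where j: "j < length ds" "i < length (ds ! j)" "v = pos_word (rotate i (ds ! j))"
      unfolding vv by metis
    then have "v = signed True (pos_word (rotate i (ds ! j))) \<and> (snd (hd v) \<longrightarrow> True)" by simp
    with j(1,2) show ?thesis by metis
  next
    case False
    obtain m u where u: "winv v = m # u" using assms(4) by (metis neq_Nil_conv winv_simps(6))
    have lw: "last (winv v) = letter_inv l" unfolding v by (simp add: winv_Cons)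
    have p: "path s0 t0 b (winv v) b" using assms(1) by simp
    have d: "distinct (map fst (winv v))" using assms(2) by (metis mset_eq_imp_distinct_iff mset_fst_winv)
    have su: "fst ` set (winv v) \<subseteq> set (concat ds)" using assms(3) by simp
    \<comment> \<open>Otherwise \<open>l\<close> and \<open>m\<close>, both read backwards from the
      base colour, would be the same symbol occurring at both ends of the path.\<close>
    have "snd m"
    proof (rule ccontr)
      assume m: "\<not> snd m"
      have "u \<noteq> []" using lw u m False by (auto simp: letter_inv_def)
      have "source s0 t0 m = b" using p u by simp
      moreover have "source s0 t0 l = b" using assms(1) v by simp
      ultimately have "t0 (fst m) = t0 (fst l)" using m False by (simp add: source_def)
      moreover have "fst m \<in> set (concat ds)" "fst l \<in> set (concat ds)" 
      proof -
        show "fst l \<in> set (concat ds)" using assms(3) v by simp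
        show "fst m \<in> set (concat ds)" using su unfolding u by simp
      qed
      ultimately have "fst m = fst l" using t0_inj by blast
      moreover have "fst (last u) = fst l" using lw u \<open>u \<noteq> []\<close> by simp
      ultimately have "fst m \<in> set (map fst u)" using \<open>u \<noteq> []\<close> by (metis last_in_set list.set_map image_eqI)
      then show False using d u by simp
    qed
    then have m: "m = (fst m, True)" by (cases m) auto
    have uu: "winv v = (fst m, True) # u" using u m by simp
    have "path s0 t0 b ((fst m, True) # u) b" "distinct (fst m # map fst u)" "insert (fst m) (fst ` set u) \<subseteq> set (concat ds)"
      using p d su unfolding uu by simp_all
    from cycle_forward[OF this] obtain j i where j: "j < length ds" "i < length (ds ! j)" "winv v = pos_word (rotate i (ds ! j))"
      unfolding uu by metis
    then have "v = winv (pos_word (rotate i (ds ! j)))" by (metis winv_simps(4))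
    then have "v = signed False (pos_word (rotate i (ds ! j)))" by simp
    moreover have "snd (hd v) \<longrightarrow> False" using False v by simp
    ultimately have "v = signed False (pos_word (rotate i (ds ! j))) \<and> (snd (hd v) \<longrightarrow> False)" by (rule conjI)
    with j(1,2) show ?thesis by metis
  qed
qed

lemma path_pos_word: "j < length ds \<Longrightarrow> path s0 t0 (Col j 0) (pos_word (ds ! j)) (Col j 0)"
proof -
  assume j: "j < length ds"
  let ?d = "ds ! j"
  have "path s0 t0 (Col j i) (pos_word (drop i ?d)) (Col j 0)" if "i < length ?d" for i
    using that
  proof (induction "length ?d - i" arbitrary: i)
    case (Suc n)
    have d: "drop i ?d = ?d ! i # drop (Suc i) ?d" using Suc.prems by (simp add: Cons_nth_drop_Suc)
    show ?case
    proof (cases "Suc i < length ?d")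
      case True
      then show ?thesis using Suc.hyps(1)[of "Suc i"] Suc.hyps(2) s0[OF j Suc.prems] t0[OF j Suc.prems] unfolding d by simp
    next
      case False
      then have "Suc i = length ?d" using Suc.prems by simp
      then show ?thesis using s0[OF j Suc.prems] t0[OF j Suc.prems] unfolding d by simp
    qed
  qed simp
  from this[of 0] ne[of ?d] j show ?thesis by simp
qed

lemma path_consts:
  assumes "\<And>x. x \<notin> V \<Longrightarrow> s x = s0 x \<and> t x = t0 x" "fst ` set w \<inter> V = {}"
  shows "path s t b w c \<longleftrightarrow> path s0 t0 b w c"
  using assms by (intro path_cong) blast

lemma pos_word_V: "d \<in> set ds \<Longrightarrow> fst ` set (pos_word d) \<inter> V = {}"
  using cst by (auto simp: image_image)

text \<open>The signs are needed for the normal form that is found anew: extracting squares inverts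
  parts of the word. In the given normal form all of them are positive.\<close>

definition SF :: "'a list \<Rightarrow> ('a \<times> 'a) list \<Rightarrow> 'a list \<Rightarrow> bool list \<Rightarrow> 'a word" where
  "SF xs ps zs es = squares xs @ commutators ps @ conjs (zip zs (map2 (\<lambda>e d. signed e (pos_word d)) (tl es) (tl ds))) @ signed (hd es) (pos_word (hd ds))"

text \<open>All variables are loops at the first vertex of hole 0, except that a conjugator runs
  from there to the first vertex of its own hole.\<close>

lemma SF_has_col:
  assumes "distinct zs" "set zs \<subseteq> V" "set xs \<subseteq> V" "fst ` set ps \<subseteq> V" "snd ` set ps \<subseteq> V" "length zs = length ds - 1"
    "set xs \<inter> set zs = {}" "fst ` set ps \<inter> set zs = {}" "snd ` set ps \<inter> set zs = {}"
  shows "has_col V s0 t0 (SF xs ps zs (replicate (length ds) True))"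
proof -
  define idx where "idx x = (THE j. j < length zs \<and> zs ! j = x)" for x
  have idx: "idx (zs ! j) = j" if "j < length zs" for j
    unfolding idx_def using that assms(1) by (intro the_equality) (auto simp: nth_eq_iff_index_eq)
  define s where "s x = (if x \<in> V then Col 0 0 else s0 x)" for x
  define t where "t x = (if x \<in> set zs then Col (Suc (idx x)) 0 else if x \<in> V then Col 0 0 else t0 x)" for x
  let ?b = "Col 0 0"
  have off: "s x = s0 x \<and> t x = t0 x" if "x \<notin> V" for x using that assms(2) by (auto simp: s_def t_def)
  have sq: "path s t ?b (squares xs) ?b" using assms(3,7) by (induction xs) (auto simp: s_def t_def)
  have cm: "path s t ?b (commutators ps) ?b" using assms(4,5,8,9)
    by (induction ps) (auto simp: s_def t_def)
  have cj: "path s t ?b (conjs qs) ?b"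
    if "\<And>z w. (z, w) \<in> set qs \<Longrightarrow> z \<in> set zs \<and> path s t (t z) w (t z)" for qs
    using that
  proof (induction qs)
    case (Cons q qs)
    obtain z w where q: "q = (z, w)" by fastforce
    have "z \<in> set zs" "path s t (t z) w (t z)" using Cons.prems[of z w] q by auto
    moreover have "s z = ?b" using \<open>z \<in> set zs\<close> assms(2) by (auto simp: s_def)
    moreover have "path s t ?b (conjs qs) ?b" using Cons by auto
    ultimately show ?case by (auto simp: q)
  qed simp
  have pos_word: "path s t (Col j 0) (pos_word (ds ! j)) (Col j 0)" if "j < length ds" for j
    using path_pos_word[OF that] path_consts[of s t, OF off pos_word_V] that by simp
  have "z \<in> set zs \<and> path s t (t z) w (t z)"
    if "(z, w) \<in> set (zip zs (map2 (\<lambda>e d. signed e (pos_word d)) (tl (replicate (length ds) True)) (tl ds)))" for z w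
  proof -
    from that obtain i where i: "i < length zs" "z = zs ! i"
      "w = map2 (\<lambda>e d. signed e (pos_word d)) (tl (replicate (length ds) True)) (tl ds) ! i"
      "i < length (map2 (\<lambda>e d. signed e (pos_word d)) (tl (replicate (length ds) True)) (tl ds))"
      unfolding in_set_zip by auto
    then have "i < length (tl ds)" by simp
    then have "w = pos_word (ds ! Suc i)" using i(3,4) by (simp add: nth_tl)
    moreover have "t z = Col (Suc i) 0" using i(1,2) idx[OF i(1)] by (simp add: t_def)
    ultimately show ?thesis using pos_word[of "Suc i"] i(1,2) assms(6) by auto
  qed
  then have "path s t ?b (conjs (zip zs (map2 (\<lambda>e d. signed e (pos_word d)) (tl (replicate (length ds) True)) (tl ds)))) ?b"
    by (rule cj)
  moreover have "path s t ?b (signed (hd (replicate (length ds) True)) (pos_word (hd ds))) ?b"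
    using pos_word[of 0] ds0 by (cases ds) auto
  ultimately have "path s t ?b (SF xs ps zs (replicate (length ds) True)) ?b"
    unfolding SF_def using sq cm by auto
  then show ?thesis using off unfolding has_col_def by blast
qed

text \<open>The last coefficient is nonempty and fixes the base colour. Squares and commutators
  force their variables to be loops there, and a conjugator has to end at the first vertex of its
  nonempty coefficient.\<close>

lemma SF_uniq_col:
  assumes "V = set xs \<union> fst ` set ps \<union> snd ` set ps \<union> set zs" "length zs = length ds - 1"
  shows "uniq_col V s0 t0 (SF xs ps zs (replicate (length ds) True))"
proof -
  define qs where "qs = zip zs (map pos_word (tl ds))"
  have m2: "map2 (\<lambda>e d. signed e (pos_word d)) (replicate (length ds - 1) True) (tl ds) = map pos_word (tl ds)"
    by (intro nth_equalityI) auto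
  have SF: "SF xs ps zs (replicate (length ds) True) = squares xs @ commutators ps @ conjs qs @ pos_word (hd ds)"
    unfolding SF_def qs_def using ds0 m2 by (cases ds) simp_all
  have forced: "(\<forall>x\<in>set xs \<union> fst ` set ps \<union> snd ` set ps. s x = Col 0 0 \<and> t x = Col 0 0) \<and>
      (\<forall>i<length zs. s (zs ! i) = Col 0 0 \<and> t (zs ! i) = Col (Suc i) 0)"
    if off: "\<And>x. x \<notin> V \<Longrightarrow> s x = s0 x \<and> t x = t0 x" and p: "path s t b (squares xs @ commutators ps @ conjs qs @ pos_word (hd ds)) b" for s t b
  proof -
    have hd0: "hd ds = ds ! 0" "hd ds \<in> set ds" using ds0 by (simp_all add: hd_conv_nth)
    have pos_word: "path s t (Col j 0) (pos_word (ds ! j)) (Col j 0)" if "j < length ds" for j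
      using path_pos_word[OF that] path_consts[of s t, OF off pos_word_V] that by simp
    obtain c d e where q: "path s t b (squares xs) c" "path s t c (commutators ps) d" "path s t d (conjs qs) e" "path s t e (pos_word (hd ds)) b"
      using p by auto
    have "pos_word (hd ds) \<noteq> []" using ne[OF hd0(2)] by simp
    then have e: "e = Col 0 0" "b = Col 0 0" using path_det[OF _ q(4), of "Col 0 0" "Col 0 0"] pos_word[of 0] ds0 hd0 by auto
    have sq: "c = b' \<and> (\<forall>x\<in>set xs. s x = b' \<and> t x = b')" if "path s t b' (squares xs) c" for b' xs
      using that by (induction xs arbitrary: b') fastforce+
    have cm: "d = b' \<and> (\<forall>x\<in>fst ` set ps \<union> snd ` set ps. s x = b' \<and> t x = b')" if "path s t b' (commutators ps) d" for b' ps
      using that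
    proof (induction ps arbitrary: b')
      case (Cons p ps)
      obtain x y where [simp]: "p = (x, y)" by fastforce
      from Cons.prems have h: "t x = b'" "s x = b'" "s y = b'" "t y = b'" "path s t b' (commutators ps) d" by auto
      from Cons.IH[OF h(5)] h(1-4) show ?case by auto
    qed simp
    have c: "c = Col 0 0" "\<forall>x\<in>set xs. s x = Col 0 0 \<and> t x = Col 0 0" using sq[OF q(1)] e by auto
    have d: "d = Col 0 0" "\<forall>x\<in>fst ` set ps \<union> snd ` set ps. s x = Col 0 0 \<and> t x = Col 0 0"
      using cm[OF q(2)] c(1) by auto
    have cj: "s (us ! i) = b' \<and> t (us ! i) = Col (k + i) 0"
      if "path s t b' (conjs (zip us (map pos_word (drop k ds)))) e'" "length us = length ds - k" "i < length us" for us k b' e' i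
      using that
    proof (induction us arbitrary: k b' i)
      case (Cons u us)
      have k: "k < length ds" using Cons.prems(2) by simp
      then have dk: "drop k ds = ds ! k # drop (Suc k) ds" by (simp add: Cons_nth_drop_Suc)
      obtain f where f: "s u = b'" "path s t (t u) (pos_word (ds ! k)) (t u)" "path s t f (conjs (zip us (map pos_word (drop (Suc k) ds)))) e'" "f = s u"
        using Cons.prems(1) unfolding dk by auto
      have "pos_word (ds ! k) \<noteq> []" using ne[of "ds ! k"] k by simp
      then have "t u = Col k 0" using path_det[OF _ f(2) pos_word[OF k]] by simp
      moreover have "s (us ! i') = b' \<and> t (us ! i') = Col (Suc k + i') 0" if "i' < length us" for i'
        using Cons.IH[of f "Suc k" i'] f(1,3,4) Cons.prems(2) that by simp
      ultimately show ?case using f(1) Cons.prems(3) by (cases i) auto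
    qed simp
    have "s (zs ! i) = d \<and> t (zs ! i) = Col (1 + i) 0" if "i < length zs" for i
      using cj[of d zs 1 e i] q(3) assms(2) that unfolding qs_def by (simp add: drop_Suc)
    then show ?thesis using c(2) d by auto
  qed
  show ?thesis unfolding uniq_col_def SF
  proof (intro allI impI ballI)
    fix s1 t1 s2 t2 b1 b2 x
    assume off: "\<forall>x. x \<notin> V \<longrightarrow> s1 x = s0 x \<and> t1 x = t0 x \<and> s2 x = s0 x \<and> t2 x = t0 x"
      and p: "path s1 t1 b1 (squares xs @ commutators ps @ conjs qs @ pos_word (hd ds)) b1"
        "path s2 t2 b2 (squares xs @ commutators ps @ conjs qs @ pos_word (hd ds)) b2" and x: "x \<in> V"
    note 1 = forced[of s1 t1 b1, OF _ p(1)] and 2 = forced[of s2 t2 b2, OF _ p(2)]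
    have "x \<in> set xs \<union> fst ` set ps \<union> snd ` set ps \<or> (\<exists>i<length zs. x = zs ! i)"
      using x unfolding assms(1) by (auto simp: in_set_conv_nth)
    then show "s1 x = s2 x \<and> t1 x = t2 x" using 1 2 off by (elim disjE exE conjE) simp_all
  qed
qed

end

section \<open>Return to a normal form that has the prescribed coefficients\<close>

section \<open>The normal form of a coloured word\<close>

lemma distinct_concat_shared:
  "distinct (concat (map h xs)) \<Longrightarrow> p \<in> set xs \<Longrightarrow> q \<in> set xs \<Longrightarrow> y \<in> set (h p) \<Longrightarrow> y \<in> set (h q) \<Longrightarrow> p = q"
  by (induction xs) auto

lemma ext_oriented_letters: "ext V w xs ps zs w' \<Longrightarrow> xs = [] \<Longrightarrow> zs = [] \<Longrightarrow> set w' \<subseteq> set w"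
  by (induction rule: ext.induct) auto

lemma lift_conj_word:
  assumes "\<And>x. x \<in> fst ` set w \<Longrightarrow> h x = c + gen x - c"
  shows "ev h w = c + cls w - c"
  using assms
proof (induction w)
  case (Cons l w)
  then have "ev h w = c + cls w - c" "h (fst l) = c + gen (fst l) - c" by auto
  then show ?case by (simp add: sgn_of_def group_simps)
qed simp

lemma image_mset_filter_fst: "image_mset fst (filter_mset (\<lambda>l. fst l \<notin> V) M) = filter_mset (\<lambda>x. x \<notin> V) (image_mset fst M)"
  by (induction M) auto

lemma wsum_snds: "wsum wt (concat (map snd bs)) = (\<Sum>(l, v)\<leftarrow>bs. wsum wt v)"
  by (induction bs) auto

lemma squares_letters: "fst ` set (squares xs) = set xs"
  by (induction xs) auto

lemma commutators_letters: "fst ` set (commutators ps) = fst ` set ps \<union> snd ` set ps"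
proof (induction ps)
  case (Cons p ps)
  then show ?case by (cases p) (simp add: image_Un, blast)
qed simp

context holes
begin

text \<open>The root level and the branches of the forest are closed paths of constants and
  nonempty, so each is one hole up to rotation and inversion, and each hole is met once. The
  branches are pulled out in the order of \<open>ds\<close>, and conjugators absorb their rotations.
  That W begins with the first symbol of \<open>hd ds\<close> decides which hole remains without a
  conjugator.\<close>

theorem normal_form:
  assumes cV: "\<And>x. x \<in> V \<Longrightarrow> count (symbols W) x = 2" and cC: "\<And>x. x \<notin> V \<Longrightarrow> count (symbols W) x = count (mset (concat ds)) x"
    and col: "has_col V s0 t0 W" "uniq_col V s0 t0 W" and hd: "W = a # W1" "fst a = hd (hd ds)"
  shows "\<exists>xs ps zs es f g. distinct (xs @ map fst ps @ map snd ps @ zs) \<and> V = set (xs @ map fst ps @ map snd ps @ zs) \<and>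
    length zs = length ds - 1 \<and> length es = length ds \<and> (xs = [] \<longleftrightarrow> oriented V W) \<and>
    (oriented V W \<longrightarrow> (\<forall>l\<in>set W. fst l \<notin> V \<longrightarrow> snd l) \<longrightarrow> es = replicate (length ds) True) \<and>
    aut_on V f \<and> ev f (SF xs ps zs es) = g + cls W - g \<and>
    (\<forall>v\<in>V. \<exists>k. f v = cls k \<and> (\<forall>wt. (\<forall>x. x \<notin> V \<longrightarrow> wt x \<le> 1) \<longrightarrow>
       wsum wt k \<le> (if v \<in> set zs then 3 * wsum wt W + 1 else 2 * wsum wt W + 2)))"
proof -
  let ?m = "length ds"
  have quad: "quad V W" using cV by (simp add: quad_def)
  obtain xs ps F where ext: "ext V W xs ps [] (flat F)" and wf: "wf_forest V F" and xo: "xs = [] \<longleftrightarrow> oriented V W"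
    using ext_forest_exists[OF quad] by blast
  obtain f1 where f1: "reducing V W (moved_vars xs ps []) (squares xs @ commutators ps) (flat F) (2 * (length xs + 2 * length ps)) f1"
    using ext_reducing[OF ext quad] by auto
  note r1 = reducingD[OF f1]
  have M: "symbols W = symbols (squares xs @ commutators ps) + symbols (flat F)" using ext_symbols[OF ext] by simp
  have EV: "moved_vars xs ps [] \<subseteq> V" using ext_vars[OF ext] by blast
  have all: "count (mset (xs @ map fst ps @ map snd ps @ branch_vars F)) x = 1" if "x \<in> V" for x
  proof -
    have "count (symbols W) x = 2 * count (mset (xs @ map fst ps @ map snd ps)) x + 2 * count (mset (branch_vars F)) x"
      unfolding M using count_normal[of xs ps x] count_flat[OF wf that] by simp
    then show ?thesis using cV[OF that] by simp
  qed
  have sub: "set (xs @ map fst ps @ map snd ps @ branch_vars F) \<subseteq> V" using EV branch_vars_V[OF wf] by (auto simp: moved_vars_def)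
  have distA: "distinct (xs @ map fst ps @ map snd ps @ branch_vars F)"
  proof -
    define ys where "ys = xs @ map fst ps @ map snd ps @ branch_vars F"
    have 1: "count (mset ys) x = 1" if "x \<in> V" for x using all[OF that] unfolding ys_def .
    have 2: "set ys \<subseteq> V" using sub unfolding ys_def .
    have "count (mset ys) x = (if x \<in> set ys then 1 else 0)" for x
    proof (cases "x \<in> set ys")
      case False
      then have "count (mset ys) x = 0" by (metis count_eq_zero_iff set_mset_mset)
      with False show ?thesis by simp
    qed (use 1 2 in auto)
    then show ?thesis unfolding distinct_count_atmost_1 ys_def by blast
  qed
  have setA: "V = set (xs @ map fst ps @ map snd ps @ branch_vars F)"
  proof
    show "V \<subseteq> set (xs @ map fst ps @ map snd ps @ branch_vars F)"
    proof
      fix x assume "x \<in> V"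
      from all[OF this] have "x \<in># mset (xs @ map fst ps @ map snd ps @ branch_vars F)" by (simp only: count_greater_zero_iff[symmetric])
      then show "x \<in> set (xs @ map fst ps @ map snd ps @ branch_vars F)" by (simp only: set_mset_mset)
    qed
  qed (rule sub)
  have bd: "distinct (branch_vars F)" and be: "set (branch_vars F) \<inter> moved_vars xs ps [] = {}"
    using distA by (auto simp: moved_vars_def)
  have dl: "distinct (map fst (branches F))"
    using bd by (auto simp: distinct_map inj_on_def)
  have SW: "symbols (level F @ concat (map snd (branches F))) = mset (concat ds)"
  proof (rule multiset_eqI)
    fix x
    have e: "mset (level F @ concat (map snd (branches F))) = filter_mset (\<lambda>l. fst l \<notin> V) (mset (flat F))" by (rule mset_levels[OF wf])
    have "symbols (level F @ concat (map snd (branches F))) = image_mset fst (filter_mset (\<lambda>l. fst l \<notin> V) (mset (flat F)))"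
      unfolding mset_map e ..
    also have "\<dots> = filter_mset (\<lambda>x. x \<notin> V) (symbols (flat F))" unfolding mset_map by (rule image_mset_filter_fst)
    finally have c: "count (symbols (level F @ concat (map snd (branches F)))) x = (if x \<in> V then 0 else count (symbols (flat F)) x)" by simp
    show "count (symbols (level F @ concat (map snd (branches F)))) x = count (mset (concat ds)) x"
    proof (cases "x \<in> V")
      case True
      then have "x \<notin> set (concat ds)" using cst by blast
      then have "count (mset (concat ds)) x = 0" by (metis count_eq_zero_iff set_mset_mset)
      then show ?thesis using c True by simp
    next
      case False
      have "x \<notin> set (xs @ map fst ps @ map snd ps)" using False sub by auto
      then have "count (mset (xs @ map fst ps @ map snd ps)) x = 0" by (metis count_eq_zero_iff set_mset_mset)
      then have "count (symbols (squares xs @ commutators ps)) x = 0" using count_normal[of xs ps x] by simp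
      then have "count (symbols (flat F)) x = count (symbols W) x" unfolding M by simp
      then show ?thesis using c False cC[OF False] by simp
    qed
  qed
  define h where "h p = map fst (snd p)" for p :: "('a \<times> bool) \<times> 'a word"
  have mapc: "map fst (concat (map snd (branches F))) = concat (map h (branches F))"
    by (simp add: map_concat h_def[abs_def] comp_def)
  have dlev: "distinct (map fst (level F) @ concat (map h (branches F)))"
    using SW dis by (metis map_append mapc mset_eq_imp_distinct_iff)
  have slev: "fst ` set (level F) \<union> (\<Union>p\<in>set (branches F). set (h p)) = set (concat ds)"
    using arg_cong[OF SW, of set_mset] by (simp add: h_def image_Un image_UN)
  obtain s t b where st: "\<And>x. x \<notin> V \<Longrightarrow> s x = s0 x \<and> t x = t0 x" "path s t b W b"
    using col(1) unfolding has_col_def by blast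
  have pF: "path s t b (flat F) b" by (rule ext_path[OF ext refl st(2)])
  note FP = forest_path[OF pF]
  \<comment> \<open>An empty hole would admit a second colouring: its inner colour can be changed to
    any other colour z, and the change extends to the original word.\<close>
  have nonempty: "v \<noteq> []" if lv: "(l, v) \<in> set (branches F)" for l v
  proof
    assume "v = []"
    define z where "z = (if target s t l = Col 0 0 then Col 0 1 else Col 0 0)"
    obtain s1 t1 where 1: "\<And>x. x \<notin> set (branch_vars F) \<Longrightarrow> s1 x = s x \<and> t1 x = t x" "path s1 t1 b (flat F) b" "target s1 t1 l = z"
      using forest_recolor[OF wf bd pF, of l z] lv \<open>v = []\<close> by blast
    obtain s2 t2 where 2: "\<And>x. x \<notin> moved_vars xs ps [] \<Longrightarrow> s2 x = s1 x \<and> t2 x = t1 x" "path s2 t2 b W b"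
      using ext_path_extend[OF ext refl quad 1(2)] by blast
    have off: "s2 x = s0 x \<and> t2 x = t0 x" if "x \<notin> V" for x
    proof -
      have "x \<notin> moved_vars xs ps []" "x \<notin> set (branch_vars F)" using that EV branch_vars_V[OF wf] by blast+
      then show ?thesis using 1(1)[of x] 2(1)[of x] st(1)[OF that] by simp
    qed
    have lb: "fst l \<in> set (branch_vars F)" using lv by force
    then have lV: "fst l \<in> V" using branch_vars_V[OF wf] by blast
    have "s x = s2 x \<and> t x = t2 x" if "x \<in> V" for x
      using col(2)[unfolded uniq_col_def, rule_format, of s t s2 t2 b b x] st off 2(2) that by blast
    then have "target s t l = target s2 t2 l" using lV by (simp add: target_def)
    moreover have "fst l \<notin> moved_vars xs ps []" using lb be by blast
    then have "target s2 t2 l = target s1 t1 l" using 2(1)[of "fst l"] by (simp add: target_def)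
    ultimately show False using 1(3) unfolding z_def by (simp split: if_splits)
  qed
  have levV: "fst ` set (level F) \<inter> V = {}" by (rule level_vars[OF wf])
  have pos: "snd x" if "oriented V W" "\<forall>l\<in>set W. fst l \<notin> V \<longrightarrow> snd l" "x \<in> set (level F @ concat (map snd (branches F)))" for x
  proof -
    have "x \<in># filter_mset (\<lambda>l. fst l \<notin> V) (mset (flat F))"
      using that(3) unfolding mset_levels[OF wf, symmetric] by (simp only: set_mset_mset)
    then have "x \<in> set (flat F)" "fst x \<notin> V" by auto
    moreover have "set (flat F) \<subseteq> set W" using ext_oriented_letters[OF ext] xo that(1) by simp
    ultimately show ?thesis using that(2) by blast
  qed
  have cyc: "\<exists>j<?m. \<exists>i<length (ds ! j). \<exists>e. v = signed e (pos_word (rotate i (ds ! j))) \<and> (snd (hd v) \<longrightarrow> e)"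
    if "path s t c v c" "fst ` set v \<inter> V = {}" "distinct (map fst v)" "fst ` set v \<subseteq> set (concat ds)" "v \<noteq> []" for c v
    using that by (intro cycle) (simp_all add: path_consts[of s t, OF st(1)])
  have brcyc: "\<exists>j<?m. \<exists>i<length (ds ! j). \<exists>e. v = signed e (pos_word (rotate i (ds ! j))) \<and> (snd (hd v) \<longrightarrow> e)"
    if lv: "(l, v) \<in> set (branches F)" for l v
  proof (rule cyc)
    show "path s t (target s t l) v (target s t l)" using FP lv by blast
    show "fst ` set v \<inter> V = {}" by (rule branches_consts[OF wf lv])
    show "distinct (map fst v)" using dlev lv by (auto simp: distinct_concat_iff h_def)
    show "fst ` set v \<subseteq> set (concat ds)" 
    proof -
      have "fst ` set v = set (h (l, v))" by (simp add: h_def)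
      also have "\<dots> \<subseteq> (\<Union>p\<in>set (branches F). set (h p))" by (rule UN_upper[OF lv])
      finally show ?thesis using slev by blast
    qed
    show "v \<noteq> []" by (rule nonempty[OF lv])
  qed
  have sgnset: "fst ` set (signed e (pos_word (rotate i d))) = set d" for e i and d :: "'a list"
    by (simp add: image_image)
  have djeq: "j = j'" if "j < ?m" "j' < ?m" "x \<in> set (ds ! j)" "x \<in> set (ds ! j')" for j j' x
    using that s0 by (metis colour.inject in_set_conv_nth)
  have aV: "fst a \<notin> V"
  proof -
    have "hd (hd ds) \<in> set (concat ds)" using ds0 ne[of "hd ds"] by (metis UN_I hd_in_set set_concat)
    then show ?thesis using hd(2) cst by auto
  qed
  obtain r' where "flat F = a # r'" using ext_hd[OF ext hd(1) aV] by blast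
  then obtain F' where F': "level F = a # level F'" using wf aV by (cases F) auto
  have hds: "hd ds = ds ! 0" using ds0 by (simp add: hd_conv_nth)
  have m0: "0 < ?m" using ds0 by simp
  have "\<exists>j<?m. \<exists>i<length (ds ! j). \<exists>e. level F = signed e (pos_word (rotate i (ds ! j))) \<and> (snd (hd (level F)) \<longrightarrow> e)"
  proof (rule cyc)
    show "path s t b (level F) b" using FP by blast
    show "distinct (map fst (level F))" using dlev by simp
    show "fst ` set (level F) \<subseteq> set (concat ds)" using slev by blast
  qed (use levV F' in auto)
  then obtain j0 i0 e0 where root0: "j0 < ?m" "i0 < length (ds ! j0)" "level F = signed e0 (pos_word (rotate i0 (ds ! j0)))" "snd (hd (level F)) \<longrightarrow> e0"
    by blast
  have "hd (ds ! 0) \<in> set (ds ! 0)" using ne[of "ds ! 0"] m0 by simp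
  moreover have "hd (ds ! 0) \<in> set (ds ! j0)" using F' hd(2) hds sgnset[of e0 i0 "ds ! j0"] root0(3) by (metis image_eqI list.set_intros(1))
  ultimately have j0: "j0 = 0" using djeq[of 0 j0] root0(1) m0 by blast
  note root = root0[unfolded j0]
  define r0 where "r0 = pos_word (take i0 (ds ! 0))"
  \<comment> \<open>The root starts with the first symbol of its cycle. Read forwards, it is
    therefore not rotated; read backwards, that symbol is the last of the rotated cycle, so the
    rotation is by one, or by zero for length 1. Hence the correction \<open>r0\<close> has at most
    one letter.\<close>
  have i01: "i0 \<le> 1"
  proof (cases e0)
    case True
    have "fst (hd (level F)) = rotate i0 (ds ! 0) ! 0" using root(2,3) True by (cases "rotate i0 (ds ! 0)") auto
    then have "ds ! 0 ! 0 = ds ! 0 ! i0" using root(2) F' hd(2) hds ne[of "ds ! 0"] m0 by (simp add: nth_rotate hd_conv_nth)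
    moreover have "distinct (ds ! 0)" using dis m0 by (auto simp: distinct_concat_iff)
    ultimately have "i0 = 0" using root(2) by (metis gr_implies_not0 neq0_conv nth_eq_iff_index_eq)
    then show ?thesis by simp
  next
    case False
    let ?d = "ds ! 0" and ?k = "length (ds ! 0)"
    have k: "0 < ?k" using root(2) by linarith
    have "fst (hd (level F)) = last (rotate i0 ?d)" using root(3) False k
      by (cases "rotate i0 ?d" rule: rev_cases) (auto simp: winv_Cons)
    also have "\<dots> = rotate i0 ?d ! (?k - 1)" using k by (simp add: last_conv_nth)
    also have "\<dots> = ?d ! ((i0 + (?k - 1)) mod ?k)" using k by (simp add: nth_rotate)
    finally have "?d ! 0 = ?d ! ((i0 + (?k - 1)) mod ?k)" using F' hd(2) hds k by (metis hd_conv_nth length_greater_0_conv list.sel(1))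
    moreover have "distinct ?d" using dis m0 by (auto simp: distinct_concat_iff)
    ultimately have "(i0 + (?k - 1)) mod ?k = 0" using k by (metis mod_less_divisor nth_eq_iff_index_eq)
    then show ?thesis using root(2) k by (cases i0) (auto simp: mod_if split: if_splits)
  qed
  \<comment> \<open>For every hole but the first, the branch that reads it together with rotation
    and sign. The implication makes the choice total in j.\<close>
  have "\<forall>j. \<exists>q. 0 < j \<and> j < ?m \<longrightarrow> fst q \<in> set (branches F) \<and> fst (snd q) < length (ds ! j) \<and>
      snd (fst q) = signed (snd (snd q)) (pos_word (rotate (fst (snd q)) (ds ! j))) \<and> (snd (hd (snd (fst q))) \<longrightarrow> snd (snd q))"
  proof
    fix j
    show "\<exists>q. 0 < j \<and> j < ?m \<longrightarrow> fst q \<in> set (branches F) \<and> fst (snd q) < length (ds ! j) \<and>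
      snd (fst q) = signed (snd (snd q)) (pos_word (rotate (fst (snd q)) (ds ! j))) \<and> (snd (hd (snd (fst q))) \<longrightarrow> snd (snd q))"
    proof (cases "0 < j \<and> j < ?m")
      case True
      have x: "hd (ds ! j) \<in> set (ds ! j)" using ne[of "ds ! j"] True by simp
      then have "hd (ds ! j) \<in> set (concat ds)" using True by (metis UN_I nth_mem set_concat)
      moreover have "hd (ds ! j) \<notin> fst ` set (level F)"
        unfolding root(3) sgnset using djeq[of j 0 "hd (ds ! j)"] x True m0 by auto
      ultimately obtain p where p: "p \<in> set (branches F)" "hd (ds ! j) \<in> set (h p)" using slev by blast
      obtain l v where lv: "p = (l, v)" by fastforce
      obtain j' i e where j': "j' < ?m" "i < length (ds ! j')" "v = signed e (pos_word (rotate i (ds ! j')))" "snd (hd v) \<longrightarrow> e"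
        using brcyc p(1) unfolding lv by blast
      have "hd (ds ! j) \<in> set (ds ! j')" using p(2) sgnset[of e i "ds ! j'"] j'(3) unfolding lv h_def by auto
      then have "j' = j" using djeq[of j j'] x True j'(1) by blast
      then show ?thesis using j' p(1) unfolding lv by (intro exI[of _ "((l, v), i, e)"]) auto
    qed blast
  qed
  then obtain Q where Q: "\<And>j. 0 < j \<Longrightarrow> j < ?m \<Longrightarrow> fst (Q j) \<in> set (branches F) \<and> fst (snd (Q j)) < length (ds ! j) \<and>
      snd (fst (Q j)) = signed (snd (snd (Q j))) (pos_word (rotate (fst (snd (Q j))) (ds ! j))) \<and> (snd (hd (snd (fst (Q j)))) \<longrightarrow> snd (snd (Q j)))"
    by metis
  define L where "L j = fst (fst (Q j))" for j
  define LV where "LV j = snd (fst (Q j))" for j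
  define I where "I j = fst (snd (Q j))" for j
  define E where "E j = snd (snd (Q j))" for j
  have Q1: "(L j, LV j) \<in> set (branches F)" "I j < length (ds ! j)" "LV j = signed (E j) (pos_word (rotate (I j) (ds ! j)))" "snd (hd (LV j)) \<longrightarrow> E j"
    if "0 < j" "j < ?m" for j
    using Q[OF that] unfolding L_def LV_def I_def E_def prod.collapse by blast+
  define js where "js = [1..<?m]"
  have js: "0 < j \<and> j < ?m" if "j \<in> set js" for j using that unfolding js_def by auto
  have Linj: "j = j'" if "0 < j" "j < ?m" "0 < j'" "j' < ?m" "L j = L j'" for j j'
  proof -
    have "LV j = LV j'" using Q1(1)[OF that(1,2)] Q1(1)[OF that(3,4)] dl that(5) by (metis eq_key_imp_eq_value)
    then have "set (ds ! j) = set (ds ! j')" using Q1(3)[OF that(1,2)] Q1(3)[OF that(3,4)] sgnset by metis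
    moreover have "hd (ds ! j) \<in> set (ds ! j)" using ne[of "ds ! j"] that by simp
    ultimately show ?thesis using djeq[of j j'] that by blast
  qed
  define os where "os = map L js"
  have dos: "distinct os" unfolding os_def distinct_map using Linj js by (auto simp: js_def inj_on_def)
  have sos: "set os = fst ` set (branches F)"
  proof
    show "set os \<subseteq> fst ` set (branches F)" 
    proof
      fix l assume "l \<in> set os"
      then obtain j where "j \<in> set js" "l = L j" unfolding os_def by auto
      then show "l \<in> fst ` set (branches F)" using Q1(1)[of j] js[of j] by force
    qed
    show "fst ` set (branches F) \<subseteq> set os"
    proof
      fix l assume "l \<in> fst ` set (branches F)"
      then obtain v where lv: "(l, v) \<in> set (branches F)" by auto
      obtain j i e where j: "j < ?m" "v = signed e (pos_word (rotate i (ds ! j)))" using brcyc[OF lv] by blast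
      have x: "hd (ds ! j) \<in> set (ds ! j)" using ne[of "ds ! j"] j(1) by simp
      then have xv: "hd (ds ! j) \<in> set (h (l, v))" using sgnset[of e i "ds ! j"] j(2) unfolding h_def by auto
      have "j \<noteq> 0"
      proof
        assume "j = 0"
        then have "hd (ds ! j) \<in> set (map fst (level F))" using x sgnset[of e0 i0 "ds ! 0"] unfolding root(3) by simp
        moreover have "hd (ds ! j) \<in> set (concat (map h (branches F)))" using xv lv by auto
        ultimately show False using dlev by auto
      qed
      then have q: "(L j, LV j) \<in> set (branches F)" "hd (ds ! j) \<in> set (h (L j, LV j))"
        using Q1(1,3)[of j] j(1) x sgnset[of "E j" "I j" "ds ! j"] by (auto simp: h_def)
      have "(l, v) = (L j, LV j)"
        by (rule distinct_concat_shared[of h "branches F", OF _ lv q(1) xv q(2)]) (use dlev in simp)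
      then show "l \<in> set os" using \<open>j \<noteq> 0\<close> j(1) unfolding os_def js_def by auto
    qed
  qed
  obtain f2 where f2: "aut_on V f2" "\<And>x. x \<notin> set (branch_vars F) \<Longrightarrow> f2 x = gen x"
    "ev f2 (conjs (map (\<lambda>l. (fst l, the (map_of (branches F) l))) os) @ level F) = cls (flat F)"
    "\<And>x. x \<in> set (branch_vars F) \<Longrightarrow> \<exists>k. f2 x = cls k \<and> fst ` set k \<subseteq> fst ` set (flat F) \<and> (\<forall>wt. wsum wt k \<le> wsum wt (flat F) + (\<Sum>(l, v)\<leftarrow>branches F. wsum wt v))"
    using forest_order[OF wf bd dos sos] by blast
  have mo: "the (map_of (branches F) (L j)) = LV j" if "j \<in> set js" for j
    using Q1(1)[of j] js[OF that] dl by simp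
  have conj_eq: "conjs (map (\<lambda>l. (fst l, the (map_of (branches F) l))) os) = conjs (map (\<lambda>j. (fst (L j), LV j)) js)"
    unfolding os_def map_map comp_def by (rule arg_cong[of _ _ conjs], rule map_cong) (simp_all add: mo)
  define zs where "zs = map (\<lambda>j. fst (L j)) js"
  have lz: "length zs = ?m - 1" by (simp add: zs_def js_def)
  have szs: "set zs = set (branch_vars F)"
  proof -
    have "set zs = fst ` set os" by (simp add: zs_def os_def image_image)
    also have "\<dots> = set (branch_vars F)" unfolding sos by (simp add: image_image)
    finally show ?thesis .
  qed
  have lb: "length (branch_vars F) = ?m - 1"
  proof -
    have "length os = length (branches F)" using dos sos dl by (metis distinct_card length_map list.set_map)
    then show ?thesis by (simp add: os_def js_def)
  qed
  have dzs: "distinct zs" using szs lz lb bd by (metis card_distinct distinct_card)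
  define es where "es = e0 # map E js"
  define f3 where "f3 v = lift f1 (f2 v)" for v
  have af3: "aut_on V f3" unfolding f3_def by (rule aut_on_comp[OF r1(1) f2(1)])
  have f3e: "ev f3 w = lift f1 (ev f2 w)" for w unfolding f3_def by (rule lift_ev[symmetric])
  have f3W: "ev f3 ((squares xs @ commutators ps) @ conjs (map (\<lambda>j. (fst (L j), LV j)) js) @ level F) = cls W"
  proof -
    have "ev f2 (squares xs @ commutators ps) = cls (squares xs @ commutators ps)"
    proof (rule ev_avoid[of _ "set (branch_vars F)"])
      have "fst ` set (squares xs @ commutators ps) \<subseteq> moved_vars xs ps []"
      proof -
        have "fst ` set (squares xs) \<subseteq> set xs" by (simp add: squares_letters)
        moreover have "fst ` set (commutators ps) \<subseteq> fst ` set ps \<union> snd ` set ps" by (simp add: commutators_letters)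
        ultimately show ?thesis unfolding moved_vars_def by (auto simp: image_Un)
      qed
      then show "fst ` set (squares xs @ commutators ps) \<inter> set (branch_vars F) = {}" using be by blast
    qed (rule f2(2))
    moreover have "lift f1 (cls w) = ev f1 w" for w by (simp add: lift_ev)
    ultimately have "lift f1 (ev f2 ((squares xs @ commutators ps) @ conjs (map (\<lambda>j. (fst (L j), LV j)) js) @ level F)) = ev f1 ((squares xs @ commutators ps) @ flat F)"
      using f2(3) unfolding conj_eq ev_append[of f2 "squares xs @ commutators ps"] by (simp add: add.assoc)
    then show ?thesis using r1(4) unfolding f3e by simp
  qed
  \<comment> \<open>The rotation prefix of the hole that belongs to a conjugator, and the empty word
    for all other symbols.\<close>
  define R where "R v = (case map_of (zip zs (map (\<lambda>j. pos_word (take (I j) (ds ! j))) js)) v of None \<Rightarrow> [] | Some r \<Rightarrow> r)" for v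
  have R: "R (fst (L j)) = pos_word (take (I j) (ds ! j))" if "j \<in> set js" for j
  proof -
    have "zip zs (map (\<lambda>j. pos_word (take (I j) (ds ! j))) js) = map (\<lambda>j. (fst (L j), pos_word (take (I j) (ds ! j)))) js"
      unfolding zs_def by (simp add: zip_map_map zip_same_conv_map)
    moreover have "map_of (map (\<lambda>j. (fst (L j), pos_word (take (I j) (ds ! j)))) js) (fst (L j)) = Some (pos_word (take (I j) (ds ! j)))"
      using that dzs unfolding zs_def by (intro map_of_is_SomeI) (auto simp: comp_def)
    ultimately show ?thesis unfolding R_def by simp
  qed
  have pwV: "fst ` set (pos_word (take i (ds ! j))) \<inter> V = {}" if "j < ?m" for i j
    using pos_word_V[of "ds ! j"] that by (auto dest: in_set_takeD simp: image_image)
  have Rsub: "R v = [] \<or> (\<exists>j\<in>set js. R v = pos_word (take (I j) (ds ! j)))" for v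
  proof (cases "map_of (zip zs (map (\<lambda>j. pos_word (take (I j) (ds ! j))) js)) v")
    case (Some r)
    then have "r \<in> set (map (\<lambda>j. pos_word (take (I j) (ds ! j))) js)" by (meson map_of_SomeD set_zip_rightD)
    then show ?thesis using Some unfolding R_def by auto
  qed (simp add: R_def)
  have RV: "fst ` set (R v) \<inter> V = {}" for v 
  proof -
    consider "R v = []" | j where "j \<in> set js" "R v = pos_word (take (I j) (ds ! j))" using Rsub[of v] by blast
    then show ?thesis
    proof cases
      case 2
      then show ?thesis using pwV[of j "I j"] js[of j] by simp
    qed simp
  qed
  have r0V: "fst ` set r0 \<inter> V = {}" unfolding r0_def by (rule pwV[OF m0])
  \<comment> \<open>A rotated cycle is r^-1 d r, and its conjugator absorbs r on the right. The root
    has no conjugator, so its rotation is undone by conjugating the whole word with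
    \<open>r0\<close>, whence \<open>r0\<close> on the left of every variable.\<close>
  define e6 where "e6 v = (if v \<in> V then cls r0 + gen v + cls (if v \<in> set zs then winv (R v) else winv r0) else gen v)" for v
  have ae6: "aut_on V e6" unfolding e6_def by (rule aut_on_bimult) (use RV r0V in auto)
  define f6 where "f6 v = lift f3 (e6 v)" for v
  have af6: "aut_on V f6" unfolding f6_def by (rule aut_on_comp[OF af3 ae6])
  have f6e: "ev f6 w = lift f3 (ev e6 w)" for w unfolding f6_def by (rule lift_ev[symmetric])
  have cst3: "ev f3 w = cls w" "ev e6 w = cls w" if "fst ` set w \<inter> V = {}" for w
    using that aut_on_fix[OF af3] aut_on_fix[OF ae6] by (auto intro!: ev_avoid[of _ V])
  have rotcls: "cls (signed e (pos_word (rotate i d))) = - cls (pos_word (take i d)) + cls (signed e (pos_word d)) + cls (pos_word (take i d))"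
    if "i < length d" for e i and d :: "'a list"
  proof -
    have "pos_word (rotate i d) = pos_word (drop i d) @ pos_word (take i d)" using that by (simp add: rotate_drop_take)
    moreover have "pos_word d = pos_word (take i d) @ pos_word (drop i d)" by (simp flip: map_append)
    ultimately show ?thesis by (cases e) (simp_all add: group_simps)
  qed
  have e6z: "e6 (fst (L j)) = cls r0 + gen (fst (L j)) - cls (pos_word (take (I j) (ds ! j)))" if "j \<in> set js" for j
  proof -
    have z: "fst (L j) \<in> set zs" using that unfolding zs_def by simp
    then have "fst (L j) \<in> V" using szs sub by auto
    with z show ?thesis by (simp add: e6_def R[OF that] add.assoc)
  qed
  have e6conj: "ev e6 (conjs (map (\<lambda>j. (fst (L j), signed (E j) (pos_word (ds ! j)))) ks)) =
      cls r0 + cls (conjs (map (\<lambda>j. (fst (L j), LV j)) ks)) - cls r0" if "set ks \<subseteq> set js" for ks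
    using that
  proof (induction ks)
    case (Cons j ks)
    have j: "j \<in> set js" "0 < j" "j < ?m" using Cons.prems js by auto
    have "ev e6 (signed (E j) (pos_word (ds ! j))) = cls (signed (E j) (pos_word (ds ! j)))"
      using pos_word_V[of "ds ! j"] j(3) by (intro cst3) simp
    moreover have "cls (LV j) = - cls (pos_word (take (I j) (ds ! j))) + cls (signed (E j) (pos_word (ds ! j))) + cls (pos_word (take (I j) (ds ! j)))"
      unfolding Q1(3)[OF j(2,3)] by (rule rotcls[OF Q1(2)[OF j(2,3)]])
    ultimately show ?case using Cons e6z[OF j(1)] by (simp add: group_simps)
  qed simp
  have SFeq: "SF xs ps zs es = (squares xs @ commutators ps) @ conjs (map (\<lambda>j. (fst (L j), signed (E j) (pos_word (ds ! j)))) js) @ signed e0 (pos_word (ds ! 0))"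
  proof -
    have "zip zs (map2 (\<lambda>e d. signed e (pos_word d)) (tl es) (tl ds)) = map (\<lambda>j. (fst (L j), signed (E j) (pos_word (ds ! j)))) js"
      by (intro nth_equalityI) (auto simp: zs_def es_def js_def nth_tl)
    then show ?thesis unfolding SF_def by (simp add: es_def hds)
  qed
  define P where "P = squares xs @ commutators ps"
  have "ev e6 P = cls r0 + cls P - cls r0" unfolding P_def
  proof (rule lift_conj_word)
    fix x assume x: "x \<in> fst ` set (squares xs @ commutators ps)"
    have "fst ` set (squares xs) \<subseteq> set xs" by (simp add: squares_letters)
    moreover have "fst ` set (commutators ps) \<subseteq> fst ` set ps \<union> snd ` set ps" by (simp add: commutators_letters)
    ultimately have "x \<in> moved_vars xs ps []" using x unfolding moved_vars_def by (auto simp: image_Un)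
    then have "x \<in> V" "x \<notin> set zs" using EV be szs by blast+
    then show "e6 x = cls r0 + gen x - cls r0" by (simp add: e6_def add.assoc)
  qed
  moreover have "ev e6 (signed e0 (pos_word (ds ! 0))) = cls r0 + cls (level F) - cls r0"
    using cst3(2)[of "signed e0 (pos_word (ds ! 0))"] pos_word_V[of "ds ! 0"] m0 rotcls[OF root(2), of e0] unfolding root(3) r0_def
    by (simp add: group_simps)
  ultimately have "ev e6 (SF xs ps zs es) = cls r0 + cls (P @ conjs (map (\<lambda>j. (fst (L j), LV j)) js) @ level F) - cls r0"
    unfolding SFeq P_def[symmetric] using e6conj[of js] by (simp add: group_simps)
  then have f6W: "ev f6 (SF xs ps zs es) = cls r0 + cls W - cls r0"
    unfolding f6e P_def using f3W cst3(1)[OF r0V] by simp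
  \<comment> \<open>A conjugator costs once the weight of W for the forest, once for the inserted
    levels, once for the rotation prefix, and 1 for \<open>r0\<close>. The other variables cost
    twice that weight for the extraction and two copies of \<open>r0\<close>.\<close>
  have bounds: "\<exists>k. f6 v = cls k \<and> (\<forall>wt. (\<forall>x. x \<notin> V \<longrightarrow> wt x \<le> 1) \<longrightarrow>
       wsum wt k \<le> (if v \<in> set zs then 3 * wsum wt W + 1 else 2 * wsum wt W + 2))" if v: "v \<in> V" for v
  proof -
    have wr0: "wsum wt r0 \<le> 1" if "\<forall>x. x \<notin> V \<longrightarrow> wt x \<le> 1" for wt
    proof (cases i0)
      case (Suc i)
      then have "i0 = 1" using i01 by simp
      moreover obtain y d where "ds ! 0 = y # d" using ne[OF nth_mem[OF m0]] by (cases "ds ! 0") auto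
      ultimately have "r0 = [(y, True)]" "y \<notin> V" using r0V unfolding r0_def by auto
      then show ?thesis using that by simp
    qed (simp add: r0_def)
    have mW: "wsum wt (flat F) \<le> wsum wt W" for wt unfolding wsum_symbols M by simp
    have mF: "(\<Sum>(l, v)\<leftarrow>branches F. wsum wt v) \<le> wsum wt (flat F)" for wt
    proof -
      have "wsum wt (concat (map snd (branches F))) = (\<Sum>(l, v)\<leftarrow>branches F. wsum wt v)" by (rule wsum_snds)
      moreover have "wsum wt (concat (map snd (branches F))) \<le> wsum wt (flat F)"
      proof -
        have "mset (concat (map snd (branches F))) \<subseteq># mset (flat F)"
          using mset_levels[OF wf] by (metis mset_append mset_subset_eq_add_right multiset_filter_subset subset_mset.order_trans)
        then obtain X where X: "mset (flat F) = mset (concat (map snd (branches F))) + X" by (metis subset_mset.less_eqE)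
        then have "symbols (flat F) = symbols (concat (map snd (branches F))) + image_mset fst X" unfolding mset_map by simp
        then show ?thesis unfolding wsum_symbols by simp
      qed
      ultimately show ?thesis by simp
    qed
    have mR: "wsum wt (R v) \<le> wsum wt W" for wt
    proof -
      have "wsum wt (pos_word (take i (ds ! j))) \<le> wsum wt W" if j: "j < ?m" for i j
      proof -
        have "symbols (pos_word (concat ds)) \<subseteq># symbols W"
        proof (rule mset_subset_eqI)
          fix x
          have "count (mset (concat ds)) x \<le> count (symbols W) x"
          proof (cases "x \<in> V")
            case True
            then have "x \<notin> set (concat ds)" using cst by blast
            then have "count (mset (concat ds)) x = 0" by (metis count_eq_zero_iff set_mset_mset)
            then show ?thesis by (simp only: le0)
          next
            case False
            then show ?thesis using cC[OF False] by simp
          qed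
          then show "count (symbols (pos_word (concat ds))) x \<le> count (symbols W) x" by (simp add: comp_def)
        qed
        then have 1: "wsum wt (pos_word (concat ds)) \<le> wsum wt W" unfolding wsum_symbols
          by (metis image_mset_union le_add1 subset_mset.add_diff_inverse sum_mset.union)
        have "concat ds = concat (take j ds) @ (take i (ds ! j) @ drop i (ds ! j)) @ concat (drop (Suc j) ds)"
          using j by (metis append_take_drop_id concat.simps(2) concat_append id_take_nth_drop)
        then have "wsum wt (pos_word (concat ds)) = wsum wt (pos_word (concat (take j ds))) +
          (wsum wt (pos_word (take i (ds ! j))) + wsum wt (pos_word (drop i (ds ! j)))) + wsum wt (pos_word (concat (drop (Suc j) ds)))"
        by (simp del: append_take_drop_id)
      then have "wsum wt (pos_word (take i (ds ! j))) \<le> wsum wt (pos_word (concat ds))" by linarith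
        with 1 show ?thesis by simp
      qed
      then show ?thesis using Rsub[of v] js by fastforce
    qed
    show ?thesis
    proof (cases "v \<in> set zs")
      case True
      then have vb: "v \<in> set (branch_vars F)" using szs by simp
      obtain k where k: "f2 v = cls k" "fst ` set k \<subseteq> fst ` set (flat F)" "\<And>wt. wsum wt k \<le> wsum wt (flat F) + (\<Sum>(l, v)\<leftarrow>branches F. wsum wt v)"
        using f2(4)[OF vb] by blast
      have "ev f1 k = cls k"
      proof (rule ev_avoid[of _ "moved_vars xs ps []"])
        have "fst ` set (flat F) \<inter> V = set (branch_vars F)" by (rule forest_vars[OF wf])
        then show "fst ` set k \<inter> moved_vars xs ps [] = {}" using k(2) be EV by blast
      qed (rule r1(3))
      then have "f3 v = cls k" unfolding f3_def k(1) by simp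
      then have "f6 v = cls (r0 @ k @ winv (R v))" unfolding f6_def e6_def using True v cst3(1)[OF r0V] cst3(1)[OF RV] by (simp add: add.assoc)
      moreover have "wsum wt (r0 @ k @ winv (R v)) \<le> 3 * wsum wt W + 1" if "\<forall>x. x \<notin> V \<longrightarrow> wt x \<le> 1" for wt
        using wr0[OF that] k(3)[of wt] mW[of wt] mF[of wt] mR[of wt] by simp
      ultimately show ?thesis using True by (simp only: if_True) blast
    next
      case False
      then have vb: "v \<notin> set (branch_vars F)" using szs by simp
      then have "v \<in> moved_vars xs ps []" using v setA by (auto simp: moved_vars_def)
      from r1(5)[OF this] obtain k where k: "f1 v = cls k" "\<And>wt. wsum wt k \<le> 2 * wsum wt W" by blast
      have "f3 v = cls k" unfolding f3_def f2(2)[OF vb] using k(1) by simp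
      then have "f6 v = cls (r0 @ k @ winv r0)" unfolding f6_def e6_def using False v cst3(1)[OF r0V] by (simp add: add.assoc)
      moreover have "wsum wt (r0 @ k @ winv r0) \<le> 2 * wsum wt W + 2" if "\<forall>x. x \<notin> V \<longrightarrow> wt x \<le> 1" for wt
        using wr0[OF that] k(2)[of wt] by simp
      ultimately show ?thesis using False by (simp only: if_False) blast
    qed
  qed
  have distZ: "distinct (xs @ map fst ps @ map snd ps @ zs)" using distA dzs szs by auto
  have setZ: "V = set (xs @ map fst ps @ map snd ps @ zs)" using setA szs by simp
  \<comment> \<open>Without squares no letter is inverted, so the coefficient letters stay positive
    and no hole can be read backwards.\<close>
  have oriE: "es = replicate ?m True" if o: "oriented V W" "\<forall>l\<in>set W. fst l \<notin> V \<longrightarrow> snd l"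
  proof -
    have "e0" using root(4) pos[OF o, of "hd (level F)"] F' by simp
    moreover have "E j" if "j \<in> set js" for j
    proof -
      have "LV j \<noteq> []" using nonempty Q1(1)[of j] js[OF that] by blast
      then have "hd (LV j) \<in> set (concat (map snd (branches F)))" using Q1(1)[of j] js[OF that] by force
      then have "snd (hd (LV j))" using pos[OF o] by simp
      then show ?thesis using Q1(4)[of j] js[OF that] by blast
    qed
    ultimately have "es = map (\<lambda>j. True) (0 # js)" unfolding es_def by simp
    moreover have "length (0 # js) = ?m" using m0 by (simp add: js_def)
    ultimately show ?thesis by (simp only: map_replicate_const)
  qed
  have "length es = ?m" using m0 by (simp add: es_def js_def)
  then show ?thesis
    using distZ setZ lz xo oriE af6 f6W bounds
    apply -
    apply (rule exI[where x = xs])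
    apply (rule exI[where x = ps])
    apply (rule exI[where x = zs])
    apply (rule exI[where x = es])
    apply (rule exI[where x = f6])
    apply (rule exI[where x = "cls r0"])
    apply (intro conjI impI ballI)
    by (assumption | blast)+
qed

end

section \<open>Permuting variables, changing signs, and trading handles for squares\<close>

section \<open>Comparing normal forms\<close>

text \<open>Automorphisms are given by words rather than group elements here: the weight of an
  unreduced composite is computed exactly in \<open>wsum_word_subst\<close> by giving each symbol
  the weight of its value. Bounds quantified over all weights therefore compose.\<close>

definition word_subst :: "('a \<Rightarrow> 'b word) \<Rightarrow> 'a word \<Rightarrow> 'b word" where
  "word_subst K w = concat (map (\<lambda>l. signed (snd l) (K (fst l))) w)"

abbreviation cls_of :: "('a \<Rightarrow> 'b word) \<Rightarrow> 'a \<Rightarrow> 'b fgrp" where "cls_of K \<equiv> (\<lambda>v. cls (K v))"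

lemma word_subst_simps [simp]:
  "word_subst K [] = []" "word_subst K (l # w) = signed (snd l) (K (fst l)) @ word_subst K w" "word_subst K (u @ v) = word_subst K u @ word_subst K v"
  by (auto simp: word_subst_def)

lemma cls_signed: "cls (signed e w) = (if e then cls w else - cls w)"
  by (cases e) auto

lemma cls_word_subst: "cls (word_subst K w) = ev (cls_of K) w"
  by (induction w) (auto simp: cls_signed sgn_of_def)

lemma wsum_word_subst: "wsum wt (word_subst K w) = wsum (\<lambda>y. wsum wt (K y)) w"
  by (induction w) auto

lemma wsum_cong: "(\<And>x. x \<in> fst ` set w \<Longrightarrow> wt x = wt' x) \<Longrightarrow> wsum wt w = wsum wt' w"
  by (induction w) auto

lemma ev_cls_of_word_subst: "ev (cls_of (\<lambda>v. word_subst K (K' v))) w = lift (cls_of K) (ev (cls_of K') w)"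
  by (simp add: cls_word_subst lift_ev)

lemma aut_on_word_subst: "aut_on V (cls_of K) \<Longrightarrow> aut_on V (cls_of K') \<Longrightarrow> aut_on V (cls_of (\<lambda>v. word_subst K (K' v)))"
  using aut_on_comp[of V "cls_of K" "cls_of K'"] by (simp add: cls_word_subst)

lemma ev_cls_of_avoid: "(\<And>v. v \<in> fst ` set w \<Longrightarrow> K v = [(v, True)]) \<Longrightarrow> ev (cls_of K) w = cls w"
  by (rule ev_cong) simp

definition bimult_word :: "'a set \<Rightarrow> ('a \<Rightarrow> 'a word) \<Rightarrow> ('a \<Rightarrow> 'a word) \<Rightarrow> 'a \<Rightarrow> 'a word" where
  "bimult_word Z \<alpha> \<beta> v = (if v \<in> Z then \<alpha> v @ [(v, True)] @ \<beta> v else [(v, True)])"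

lemma aut_on_bimult_word:
  assumes "Z \<subseteq> V" "\<And>v. v \<in> Z \<Longrightarrow> fst ` set (\<alpha> v) \<inter> Z = {}" "\<And>v. v \<in> Z \<Longrightarrow> fst ` set (\<beta> v) \<inter> Z = {}"
  shows "aut_on V (cls_of (bimult_word Z \<alpha> \<beta>))"
proof -
  have "cls_of (bimult_word Z \<alpha> \<beta>) = (\<lambda>v. if v \<in> Z then cls (\<alpha> v) + gen v + cls (\<beta> v) else gen v)"
    by (rule ext) (simp add: bimult_word_def add.assoc)
  then show ?thesis using aut_on_bimult[OF assms] by simp
qed

lemma bimult_word_out: "v \<notin> Z \<Longrightarrow> bimult_word Z \<alpha> \<beta> v = [(v, True)]"
  by (simp add: bimult_word_def)

lemma conjs_letters: "fst ` set (conjs qs) = fst ` set qs \<union> (\<Union>q\<in>set qs. fst ` set (snd q))"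
proof (induction qs)
  case (Cons q qs)
  then show ?case by (cases q) (simp add: image_Un, blast)
qed simp

text \<open>If the sign is kept, z goes to a^2 z. If it is reversed, put \<beta> = z w^-1 z^-1; then
  a to a \<beta> and z to a \<beta> z send z w z^-1 a^2 to a \<beta> \<beta>^-1 a \<beta>, which is
  a^2 z w^-1 z^-1. The pivot a occurs once in its own value, so its length grows additively along
  the list.\<close>

lemma flip:
  assumes "distinct (map fst qs)" "a \<notin> fst ` set qs" "a \<in> V" "fst ` set qs \<subseteq> V"
    "\<And>q. q \<in> set qs \<Longrightarrow> fst ` set (fst (snd q)) \<inter> V = {}"
  shows "\<exists>K. aut_on V (cls_of K) \<and> (\<forall>v. v \<notin> insert a (fst ` set qs) \<longrightarrow> K v = [(v, True)]) \<and>
    ev (cls_of K) (conjs (map (\<lambda>q. (fst q, fst (snd q))) qs) @ [(a, True), (a, True)]) =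
      cls ([(a, True), (a, True)] @ conjs (map (\<lambda>q. (fst q, signed (snd (snd q)) (fst (snd q)))) qs)) \<and>
    (\<forall>wt. wsum wt (K a) \<le> wt a + (\<Sum>q\<leftarrow>qs. 2 * wt (fst q) + wsum wt (fst (snd q))) \<and>
      (\<forall>z\<in>fst ` set qs. wsum wt (K z) \<le> wt z + 2 * (wt a + (\<Sum>q\<leftarrow>qs. 2 * wt (fst q) + wsum wt (fst (snd q))))))"
  using assms
proof (induction qs rule: rev_induct)
  case Nil
  show ?case by (rule exI[where x = "\<lambda>v. [(v, True)]"]) simp
next
  case (snoc q qs)
  obtain z w e where q: "q = (z, w, e)" by (cases q)
  let ?S = "\<lambda>wt. \<Sum>q\<leftarrow>qs. 2 * wt (fst q) + wsum wt (fst (snd q))"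
  have za: "z \<noteq> a" "z \<in> V" "z \<notin> fst ` set qs" "a \<notin> fst ` set qs" "fst ` set w \<inter> V = {}"
    using snoc.prems(1,2,4) snoc.prems(5)[of q] q by auto
  have "\<exists>K. aut_on V (cls_of K) \<and> (\<forall>v. v \<notin> insert a (fst ` set qs) \<longrightarrow> K v = [(v, True)]) \<and>
    ev (cls_of K) (conjs (map (\<lambda>q. (fst q, fst (snd q))) qs) @ [(a, True), (a, True)]) =
      cls ([(a, True), (a, True)] @ conjs (map (\<lambda>q. (fst q, signed (snd (snd q)) (fst (snd q)))) qs)) \<and>
    (\<forall>wt. wsum wt (K a) \<le> wt a + ?S wt \<and> (\<forall>z\<in>fst ` set qs. wsum wt (K z) \<le> wt z + 2 * (wt a + ?S wt)))"
    by (rule snoc.IH) (use snoc.prems in auto)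
  then obtain K where K: "aut_on V (cls_of K)" "\<And>v. v \<notin> insert a (fst ` set qs) \<Longrightarrow> K v = [(v, True)]"
    "ev (cls_of K) (conjs (map (\<lambda>q. (fst q, fst (snd q))) qs) @ [(a, True), (a, True)]) =
      cls ([(a, True), (a, True)] @ conjs (map (\<lambda>q. (fst q, signed (snd (snd q)) (fst (snd q)))) qs))"
    "\<And>wt. wsum wt (K a) \<le> wt a + ?S wt" "\<And>wt z. z \<in> fst ` set qs \<Longrightarrow> wsum wt (K z) \<le> wt z + 2 * (wt a + ?S wt)"
    by blast
  define \<beta> where "\<beta> = [(z, True)] @ winv w @ [(z, False)]"
  define C where "C = (if e then bimult_word {z} (\<lambda>_. [(a, True), (a, True)]) (\<lambda>_. [])
    else (\<lambda>v. word_subst (bimult_word {a} (\<lambda>_. []) (\<lambda>_. \<beta>)) (bimult_word {z} (\<lambda>_. [(a, True)]) (\<lambda>_. []) v)))"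
  have aw: "a \<notin> fst ` set w" "z \<notin> fst ` set w" using za snoc.prems(3) by blast+
  have aC: "aut_on V (cls_of C)"
  proof (cases e)
    case True
    show ?thesis unfolding C_def using True za by (simp, intro aut_on_bimult_word) auto
  next
    case False
    have "aut_on V (cls_of (bimult_word {a} (\<lambda>_. []) (\<lambda>_. \<beta>)))"
      using snoc.prems(3) za(1) aw fst_set_winv[of w] unfolding \<beta>_def by (intro aut_on_bimult_word) (simp_all add: image_Un)
    moreover have "aut_on V (cls_of (bimult_word {z} (\<lambda>_. [(a, True)]) (\<lambda>_. [])))"
      using za by (intro aut_on_bimult_word) auto
    ultimately show ?thesis unfolding C_def using False by (simp only: if_False aut_on_word_subst)
  qed
  have Co: "C v = [(v, True)]" if "v \<noteq> a" "v \<noteq> z" for v using that by (simp add: C_def bimult_word_def)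
  have Cz: "C z = (if e then [(a, True), (a, True), (z, True)] else [(a, True)] @ \<beta> @ [(z, True)])"
    using za by (simp add: C_def bimult_word_def)
  have Ca: "C a = (if e then [(a, True)] else [(a, True)] @ \<beta>)" using za by (simp add: C_def bimult_word_def)
  have Cw: "ev (cls_of C) u = cls u" if "a \<notin> fst ` set u" "z \<notin> fst ` set u" for u
    by (rule ev_cls_of_avoid) (metis Co that)
  have qV: "fst ` set qs \<subseteq> V" using snoc.prems(4) by simp
  have KW: "K y = [(y, True)]" if "y \<in> fst ` set w" for y using that aw za qV by (intro K(2)) blast
  have Kw: "ev (cls_of K) w = cls w" by (rule ev_cls_of_avoid) (rule KW)
  define K' where "K' = (\<lambda>v. word_subst K (C v))"
  have Kz: "K z = [(z, True)]" using K(2)[of z] za by blast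
  let ?M = "conjs (map (\<lambda>q. (fst q, fst (snd q))) qs)" and ?a = "[(a, True), (a, True)]"
  have "fst ` set ?M \<subseteq> fst ` set qs \<union> (\<Union>q\<in>set qs. fst ` set (fst (snd q)))" unfolding conjs_letters by (simp add: image_image)
  moreover have "a \<notin> (\<Union>q\<in>set qs. fst ` set (fst (snd q)))" "z \<notin> (\<Union>q\<in>set qs. fst ` set (fst (snd q)))"
    using snoc.prems(3,5) za(2) by fastforce+
  ultimately have M: "ev (cls_of C) ?M = cls ?M" using za by (intro Cw) blast+
  have "ev (cls_of C) ([(z, True)] @ w @ [(z, False)] @ ?a) = cls (?a @ [(z, True)] @ signed e w @ [(z, False)])"
    using Cw[OF aw] by (cases e) (simp_all add: Cz Ca \<beta>_def group_simps)
  then have 1: "ev (cls_of C) (?M @ [(z, True)] @ w @ [(z, False)] @ ?a) = cls ((?M @ ?a) @ [(z, True)] @ signed e w @ [(z, False)])"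
    using M by (simp add: add.assoc)
  have "ev (cls_of K') (?M @ [(z, True)] @ w @ [(z, False)] @ ?a) = lift (cls_of K) (cls ((?M @ ?a) @ [(z, True)] @ signed e w @ [(z, False)]))"
    unfolding K'_def ev_cls_of_word_subst 1 ..
  also have "\<dots> = ev (cls_of K) (?M @ ?a) + ev (cls_of K) ([(z, True)] @ signed e w @ [(z, False)])" by (simp add: add.assoc)
  also have "ev (cls_of K) ([(z, True)] @ signed e w @ [(z, False)]) = cls ([(z, True)] @ signed e w @ [(z, False)])"
    using Kw Kz by (cases e) simp_all
  finally have E: "ev (cls_of K') (conjs (map (\<lambda>q. (fst q, fst (snd q))) (qs @ [q])) @ ?a) =
      cls (?a @ conjs (map (\<lambda>q. (fst q, signed (snd (snd q)) (fst (snd q)))) (qs @ [q])))"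
    unfolding K(3) q by (simp add: add.assoc)
  have Kws: "wsum (\<lambda>y. wsum wt (K y)) w = wsum wt w" for wt
    by (rule wsum_cong) (simp add: KW)
  have S: "(\<Sum>q\<leftarrow>qs @ [q]. 2 * wt (fst q) + wsum wt (fst (snd q))) = ?S wt + 2 * wt z + wsum wt w" for wt
    using q by simp
  have "wsum wt (K' a) \<le> wt a + (?S wt + 2 * wt z + wsum wt w)" for wt
    using K(4)[of wt] by (cases e) (simp_all add: K'_def Ca wsum_word_subst \<beta>_def Kz Kws)
  moreover have "wsum wt (K' y) \<le> wt y + 2 * (wt a + (?S wt + 2 * wt z + wsum wt w))" if "y \<in> fst ` set (qs @ [q])" for wt y
  proof (cases "y = z")
    case True
    show ?thesis unfolding True using K(4)[of wt] by (cases e) (simp_all add: K'_def Cz wsum_word_subst \<beta>_def Kz Kws)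
  next
    case False
    then have y: "y \<in> fst ` set qs" "y \<noteq> a" using that za q by auto
    then show ?thesis using K(5)[OF y(1), of wt] Co[OF y(2) False] by (simp add: K'_def)
  qed
  moreover have "K' v = [(v, True)]" if "v \<notin> insert a (fst ` set (qs @ [q]))" for v
    using that q K(2)[of v] Co[of v] by (auto simp: K'_def)
  moreover have "aut_on V (cls_of K')" unfolding K'_def by (rule aut_on_word_subst[OF K(1) aC])
  ultimately show ?case unfolding S using E
    by (intro exI[of _ K'] conjI) blast+
qed

lemma conjs_left:
  assumes "\<And>z b. (z, b) \<in> set qs \<Longrightarrow> h z = c + gen z \<and> ev h b = cls b"
  shows "ev h (conjs qs) = c + cls (conjs qs) - c"
  using assms
proof (induction qs)
  case (Cons q qs)
  obtain z b where q: "q = (z, b)" by (cases q)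
  have "h z = c + gen z" "ev h b = cls b" using Cons.prems[of z b] q by auto
  moreover have "ev h (conjs qs) = c + cls (conjs qs) - c" by (rule Cons.IH) (use Cons.prems in auto)
  ultimately show ?case unfolding q by (simp add: group_simps)
qed simp

text \<open>An even list of squares regarded as pairs, each of which can become a handle.\<close>

definition flat2 :: "('a \<times> 'a) list \<Rightarrow> 'a list" where "flat2 qs = concat (map (\<lambda>q. [fst q, snd q]) qs)"

lemma flat2_simps [simp]: "flat2 [] = []" "flat2 (q # qs) = fst q # snd q # flat2 qs"
  by (auto simp: flat2_def)

lemma length_flat2 [simp]: "length (flat2 qs) = 2 * length qs"
  by (induction qs) auto

lemma mset_flat2: "mset (flat2 qs) = mset (map fst qs @ map snd qs)"
  by (induction qs) auto

lemma even_flat2: "even (length l) \<Longrightarrow> \<exists>qs. l = flat2 qs"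
proof (induction l rule: induct_list012)
  case (3 x y zs)
  then obtain qs where "zs = flat2 qs" by auto
  then have "x # y # zs = flat2 ((x, y) # qs)" by simp
  then show ?case by blast
qed (auto intro: exI[of _ "[]"])

text \<open>Next to a square a handle can be traded for two squares: \<open>a\<^sup>2 [b, c]\<close> and \<open>b\<^sup>2 c\<^sup>2 a\<^sup>2\<close>
  are equivalent.\<close>

definition handle_to_squares :: "'a \<Rightarrow> 'a \<Rightarrow> 'a \<Rightarrow> 'a \<Rightarrow> 'a word" where
  "handle_to_squares a b c v = (if v = a then [(b, True), (c, True), (a, True)]
    else if v = b then [(a, False), (b, True), (c, True), (a, True)]
    else if v = c then [(a, False), (c, True), (a, True), (a, True)] else [(v, True)])"

definition squares_to_handle :: "'a \<Rightarrow> 'a \<Rightarrow> 'a \<Rightarrow> 'a \<Rightarrow> 'a word" where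
  "squares_to_handle a b c v = (if v = a then [(a, True), (b, False)]
    else if v = b then [(a, True), (a, True), (b, False), (c, False), (b, True), (a, False)]
    else if v = c then [(a, True), (b, False), (c, True), (b, True), (a, False), (b, True), (a, False)] else [(v, True)])"

lemma handle_squares_inverse:
  assumes "distinct [a, b, c]"
  shows "lift (cls_of (handle_to_squares a b c)) (cls (squares_to_handle a b c x)) = gen x" "lift (cls_of (squares_to_handle a b c)) (cls (handle_to_squares a b c x)) = gen x"
  using assms by (auto simp: handle_to_squares_def squares_to_handle_def group_simps)

lemma aut_on_trade:
  assumes "distinct [a, b, c]" "{a, b, c} \<subseteq> V"
  shows "aut_on V (cls_of (handle_to_squares a b c))" "aut_on V (cls_of (squares_to_handle a b c))"
proof -
  have o: "cls (handle_to_squares a b c x) = gen x" "cls (squares_to_handle a b c x) = gen x" if "x \<notin> V" for x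
    using that assms(2) by (auto simp: handle_to_squares_def squares_to_handle_def)
  show "aut_on V (cls_of (handle_to_squares a b c))" by (rule aut_onI[where g = "cls_of (squares_to_handle a b c)"]) (erule o | rule handle_squares_inverse[OF assms(1)])+
  show "aut_on V (cls_of (squares_to_handle a b c))" by (rule aut_onI[where g = "cls_of (handle_to_squares a b c)"]) (erule o | rule handle_squares_inverse[OF assms(1)])+
qed

text \<open>All trades share the pivot a. Each trade adds its two variables once to the value of the
  pivot, and the values of b and c contain the pivot at most three times, which gives the factor
  3.\<close>

lemma handles_to_squares:
  assumes "distinct (a # flat2 qs)" "set (a # flat2 qs) \<subseteq> V"
  shows "\<exists>K. aut_on V (cls_of K) \<and> (\<forall>v. v \<notin> set (a # flat2 qs) \<longrightarrow> K v = [(v, True)]) \<and>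
    ev (cls_of K) ([(a, True), (a, True)] @ commutators qs) = cls (squares (flat2 qs @ [a])) \<and>
    (\<forall>wt. wsum wt (K a) \<le> sum_list (map wt (a # flat2 qs)) \<and>
      (\<forall>v\<in>set (flat2 qs). wsum wt (K v) \<le> 3 * sum_list (map wt (a # flat2 qs))))"
  using assms
proof (induction qs)
  case Nil
  show ?case by (rule exI[where x = "\<lambda>v. [(v, True)]"]) simp
next
  case (Cons q qs)
  obtain b c where q: "q = (b, c)" by (cases q)
  have d: "distinct [a, b, c]" "{a, b, c} \<subseteq> V" "b \<notin> set (a # flat2 qs)" "c \<notin> set (a # flat2 qs)" "a \<notin> set (flat2 qs)"
    using Cons.prems q by auto
  obtain K where K: "aut_on V (cls_of K)" "\<And>v. v \<notin> set (a # flat2 qs) \<Longrightarrow> K v = [(v, True)]"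
    "ev (cls_of K) ([(a, True), (a, True)] @ commutators qs) = cls (squares (flat2 qs @ [a]))"
    "\<And>wt. wsum wt (K a) \<le> sum_list (map wt (a # flat2 qs))"
    "\<And>wt v. v \<in> set (flat2 qs) \<Longrightarrow> wsum wt (K v) \<le> 3 * sum_list (map wt (a # flat2 qs))"
    using Cons.IH Cons.prems by auto
  define K' where "K' = (\<lambda>v. word_subst K (handle_to_squares a b c v))"
  have Kbc: "K b = [(b, True)]" "K c = [(c, True)]" using K(2) d by blast+
  have ab: "a \<noteq> b" "a \<noteq> c" "b \<noteq> c" using d(1) by auto
  have "set (flat2 qs) = fst ` set qs \<union> snd ` set qs" using arg_cong[OF mset_flat2[of qs], of set_mset] by simp
  then have cq: "ev (cls_of (handle_to_squares a b c)) (commutators qs) = cls (commutators qs)"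
    using d by (intro ev_cls_of_avoid) (auto simp: commutators_letters handle_to_squares_def)
  have "ev (cls_of (handle_to_squares a b c)) ([(a, True), (a, True)] @ commutators (q # qs)) =
      cls ([(b, True), (b, True), (c, True), (c, True)] @ [(a, True), (a, True)] @ commutators qs)"
    using cq ab unfolding q by (simp add: handle_to_squares_def group_simps)
  then have "ev (cls_of K') ([(a, True), (a, True)] @ commutators (q # qs)) =
      ev (cls_of K) [(b, True), (b, True), (c, True), (c, True)] + ev (cls_of K) ([(a, True), (a, True)] @ commutators qs)"
    unfolding K'_def ev_cls_of_word_subst by (simp add: add.assoc)
  then have "ev (cls_of K') ([(a, True), (a, True)] @ commutators (q # qs)) = cls (squares (flat2 (q # qs) @ [a]))"
    unfolding K(3) q by (simp add: Kbc add.assoc)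
  moreover have "aut_on V (cls_of K')" unfolding K'_def by (rule aut_on_word_subst[OF K(1) aut_on_trade(1)[OF d(1,2)]])
  moreover have "K' v = [(v, True)]" if "v \<notin> set (a # flat2 (q # qs))" for v
    using that K(2)[of v] q by (simp add: K'_def handle_to_squares_def)
  moreover have "wsum wt (K' a) \<le> sum_list (map wt (a # flat2 (q # qs)))" for wt
    using K(4)[of wt] q ab by (simp add: K'_def handle_to_squares_def wsum_word_subst Kbc)
  moreover have "wsum wt (K' v) \<le> 3 * sum_list (map wt (a # flat2 (q # qs)))" if v: "v \<in> set (flat2 (q # qs))" for wt v
  proof -
    consider "v = b" | "v = c" | "v \<in> set (flat2 qs)" "v \<noteq> a" "v \<noteq> b" "v \<noteq> c" using v d q by auto
    then show ?thesis
    proof cases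
      case 1
      then show ?thesis using K(4)[of wt] q ab by (simp add: K'_def handle_to_squares_def wsum_word_subst Kbc)
    next
      case 2
      then show ?thesis using K(4)[of wt] q ab by (simp add: K'_def handle_to_squares_def wsum_word_subst Kbc)
    next
      case 3
      then show ?thesis using K(5)[OF 3(1), of wt] q by (simp add: K'_def handle_to_squares_def)
    qed
  qed
  ultimately show ?case by (intro exI[of _ K'] conjI) blast+
qed

text \<open>The inverse trades are composed in the opposite order, so the induction hypothesis is
  applied to the weight pulled back along one trade. There the pivot weighs as much as a and b
  together, which the sum over all variables still covers.\<close>

lemma squares_to_handles:
  assumes "distinct (a # flat2 qs)" "set (a # flat2 qs) \<subseteq> V"
  shows "\<exists>K. aut_on V (cls_of K) \<and> (\<forall>v. v \<notin> set (a # flat2 qs) \<longrightarrow> K v = [(v, True)]) \<and>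
    ev (cls_of K) (squares (flat2 qs @ [a])) = cls ([(a, True), (a, True)] @ commutators qs) \<and>
    (\<forall>wt. wsum wt (K a) \<le> sum_list (map wt (a # flat2 qs)) \<and>
      (\<forall>v\<in>set (flat2 qs). wsum wt (K v) \<le> 3 * sum_list (map wt (a # flat2 qs))))"
  using assms
proof (induction qs)
  case Nil
  show ?case by (rule exI[where x = "\<lambda>v. [(v, True)]"]) simp
next
  case (Cons q qs)
  obtain b c where q: "q = (b, c)" by (cases q)
  have d: "distinct [a, b, c]" "{a, b, c} \<subseteq> V" "b \<notin> set (a # flat2 qs)" "c \<notin> set (a # flat2 qs)" "a \<notin> set (flat2 qs)"
    using Cons.prems q by auto
  obtain K where K: "aut_on V (cls_of K)" "\<And>v. v \<notin> set (a # flat2 qs) \<Longrightarrow> K v = [(v, True)]"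
    "ev (cls_of K) (squares (flat2 qs @ [a])) = cls ([(a, True), (a, True)] @ commutators qs)"
    "\<And>wt. wsum wt (K a) \<le> sum_list (map wt (a # flat2 qs))"
    "\<And>wt v. v \<in> set (flat2 qs) \<Longrightarrow> wsum wt (K v) \<le> 3 * sum_list (map wt (a # flat2 qs))"
    using Cons.IH Cons.prems by auto
  define K' where "K' = (\<lambda>v. word_subst (squares_to_handle a b c) (K v))"
  have Kbc: "K b = [(b, True)]" "K c = [(c, True)]" using K(2) d by blast+
  have ab: "a \<noteq> b" "a \<noteq> c" "b \<noteq> c" using d(1) by auto
  have "set (flat2 qs) = fst ` set qs \<union> snd ` set qs" using arg_cong[OF mset_flat2[of qs], of set_mset] by simp
  then have cq: "ev (cls_of (squares_to_handle a b c)) (commutators qs) = cls (commutators qs)"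
    using d by (intro ev_cls_of_avoid) (auto simp: commutators_letters squares_to_handle_def)
  have "ev (cls_of K) (squares (flat2 (q # qs) @ [a])) =
      cls ([(b, True), (b, True), (c, True), (c, True)] @ [(a, True), (a, True)] @ commutators qs)"
    using K(3) unfolding q by (simp add: Kbc add.assoc)
  then have "ev (cls_of K') (squares (flat2 (q # qs) @ [a])) =
      ev (cls_of (squares_to_handle a b c)) ([(b, True), (b, True), (c, True), (c, True)] @ [(a, True), (a, True)] @ commutators qs)"
    unfolding K'_def ev_cls_of_word_subst by simp
  also have "\<dots> = cls ([(a, True), (a, True)] @ commutators (q # qs))"
    using cq ab unfolding q by (simp add: squares_to_handle_def group_simps)
  finally have "ev (cls_of K') (squares (flat2 (q # qs) @ [a])) = cls ([(a, True), (a, True)] @ commutators (q # qs))" .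
  moreover have "aut_on V (cls_of K')" unfolding K'_def by (rule aut_on_word_subst[OF aut_on_trade(2)[OF d(1,2)] K(1)])
  moreover have "K' v = [(v, True)]" if "v \<notin> set (a # flat2 (q # qs))" for v
    using that K(2)[of v] q by (simp add: K'_def squares_to_handle_def)
  moreover have cm: "map (\<lambda>y. wsum wt (squares_to_handle a b c y)) (flat2 qs) = map wt (flat2 qs)" for wt
    using d by (intro map_cong) (auto simp: squares_to_handle_def)
  moreover have ca: "wsum wt (squares_to_handle a b c a) = wt a + wt b" for wt by (simp add: squares_to_handle_def)
  have "wsum wt (K' a) \<le> sum_list (map wt (a # flat2 (q # qs)))" for wt
    using K(4)[of "\<lambda>y. wsum wt (squares_to_handle a b c y)"] q unfolding K'_def wsum_word_subst by (simp add: cm ca)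
  moreover have "wsum wt (K' v) \<le> 3 * sum_list (map wt (a # flat2 (q # qs)))" if v: "v \<in> set (flat2 (q # qs))" for wt v
  proof -
    consider "v = b" | "v = c" | "v \<in> set (flat2 qs)" using v q by auto
    then show ?thesis
    proof cases
      case 1
      then show ?thesis using q ab by (simp add: K'_def wsum_word_subst Kbc) (simp add: squares_to_handle_def)
    next
      case 2
      then show ?thesis using q ab by (simp add: K'_def wsum_word_subst Kbc) (simp add: squares_to_handle_def)
    next
      case 3
      then show ?thesis using K(5)[OF 3, of "\<lambda>y. wsum wt (squares_to_handle a b c y)"] q unfolding K'_def wsum_word_subst by (simp add: cm ca)
    qed
  qed
  ultimately show ?case by (intro exI[of _ K'] conjI) blast+
qed

lemma sum_list_le_const: "(\<And>v. v \<in> set l \<Longrightarrow> wt v \<le> b) \<Longrightarrow> sum_list (map wt l) \<le> length l * (b::nat)"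
  by (induction l) (auto simp: add_mono)

text \<open>The number of squares plus twice the number of handles agrees, so the surplus squares
  come in pairs. Then d trades touch 2d + 1 variables, and the bound counts only these, so that it
  can be added to the number of conjugators without exceeding the number of variables.\<close>

lemma convert:
  assumes dist: "distinct (xs @ map fst ps @ map snd ps)" and V: "set (xs @ map fst ps @ map snd ps) \<subseteq> V"
    and ne: "xs \<noteq> []" and len: "length xs + 2 * length ps = Suc k + 2 * l"
  shows "\<exists>xs1 a ps1 d K. aut_on V (cls_of K) \<and> (\<forall>v. v \<notin> set (xs @ map fst ps @ map snd ps) \<longrightarrow> K v = [(v, True)]) \<and>
    length xs1 = k \<and> length ps1 = l \<and> mset (xs1 @ a # map fst ps1 @ map snd ps1) = mset (xs @ map fst ps @ map snd ps) \<and>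
    ev (cls_of K) (squares (xs1 @ [a]) @ commutators ps1) = cls (squares xs @ commutators ps) \<and>
    2 * d + 1 \<le> length (xs @ map fst ps @ map snd ps) \<and>
    (\<forall>wt b. (\<forall>v\<in>set (xs @ map fst ps @ map snd ps). wt v \<le> b) \<longrightarrow> wsum wt (K a) \<le> (2 * d + 1) * b \<and>
      (\<forall>v\<in>set (xs @ map fst ps @ map snd ps). wsum wt (K v) \<le> 3 * ((2 * d + 1) * b)))"
proof -
  obtain ys a where xs: "xs = ys @ [a]" using ne by (cases xs rule: rev_cases) auto
  define U where "U = xs @ map fst ps @ map snd ps"
  have bnd: "wsum wt (K a) \<le> (2 * length qs + 1) * b \<and> (\<forall>v\<in>set U. wsum wt (K v) \<le> 3 * ((2 * length qs + 1) * b))"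
    if K: "\<And>v. v \<notin> set (a # flat2 qs) \<Longrightarrow> K v = [(v, True)]" "\<And>wt. wsum wt (K a) \<le> sum_list (map wt (a # flat2 qs))"
      "\<And>wt v. v \<in> set (flat2 qs) \<Longrightarrow> wsum wt (K v) \<le> 3 * sum_list (map wt (a # flat2 qs))"
      and b: "\<forall>v\<in>set U. wt v \<le> b" and q: "set (a # flat2 qs) \<subseteq> set U" for K and qs :: "('a \<times> 'a) list" and wt :: "'a \<Rightarrow> nat" and b
  proof -
    have "sum_list (map wt (a # flat2 qs)) \<le> length (a # flat2 qs) * b" using b q by (intro sum_list_le_const) blast
    then have s: "sum_list (map wt (a # flat2 qs)) \<le> (2 * length qs + 1) * b" by simp
    have "wsum wt (K v) \<le> 3 * ((2 * length qs + 1) * b)" if "v \<in> set U" for v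
    proof -
      consider "v = a" | "v \<in> set (flat2 qs)" | "v \<notin> set (a # flat2 qs)" by auto
      then show ?thesis
      proof cases
        case 1
        show ?thesis unfolding 1 using K(2)[of wt] s by linarith
      next
        case 2
        then show ?thesis using K(3)[OF 2, of wt] s by linarith
      next
        case 3
        have "b \<le> (2 * length qs + 1) * b" by simp
        then show ?thesis using K(1)[OF 3] b that by fastforce
      qed
    qed
    then show ?thesis using K(2)[of wt] s by (auto intro: order_trans)
  qed
  \<comment> \<open>If the given form has at least the wanted number of squares, the surplus is
    paired into handles; otherwise handles are turned into squares.\<close>
  show ?thesis
  proof (cases "k \<le> length ys")
    case True
    have "even (length (drop k ys))" using len True xs by simp presburger
    then obtain qs where qs: "drop k ys = flat2 qs" using even_flat2 by blast
    define xs1 where "xs1 = take k ys"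
    have ys: "ys = xs1 @ flat2 qs" unfolding xs1_def qs[symmetric] by simp
    have l1: "length xs1 = k" using True by (simp add: xs1_def)
    have lq: "length (qs @ ps) = l" using len xs ys l1 by simp
    have dq: "distinct (a # flat2 qs)" "set (a # flat2 qs) \<subseteq> V" using dist V xs ys by auto
    obtain K where K: "aut_on V (cls_of K)" "\<And>v. v \<notin> set (a # flat2 qs) \<Longrightarrow> K v = [(v, True)]"
      "ev (cls_of K) ([(a, True), (a, True)] @ commutators qs) = cls (squares (flat2 qs @ [a]))"
      "\<And>wt. wsum wt (K a) \<le> sum_list (map wt (a # flat2 qs))"
      "\<And>wt v. v \<in> set (flat2 qs) \<Longrightarrow> wsum wt (K v) \<le> 3 * sum_list (map wt (a # flat2 qs))"
      using handles_to_squares[OF dq] by blast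
    have sU: "set (a # flat2 qs) \<subseteq> set U" unfolding U_def xs ys by auto
    have m: "mset (xs1 @ a # map fst (qs @ ps) @ map snd (qs @ ps)) = mset U"
      unfolding U_def xs ys using mset_flat2[of qs] by simp
    have A: "ev (cls_of K) (squares xs1) = cls (squares xs1)" "ev (cls_of K) (commutators ps) = cls (commutators ps)"
    proof -
      have "set xs1 \<inter> set (a # flat2 qs) = {}" "(fst ` set ps \<union> snd ` set ps) \<inter> set (a # flat2 qs) = {}"
        using dist unfolding xs ys by auto
      moreover have "ev (cls_of K) w = cls w" if "fst ` set w \<inter> set (a # flat2 qs) = {}" for w
        by (rule ev_cls_of_avoid, rule K(2)) (use that in blast)
      note this[of "squares xs1", unfolded squares_letters] this[of "commutators ps", unfolded commutators_letters]
      ultimately show "ev (cls_of K) (squares xs1) = cls (squares xs1)" "ev (cls_of K) (commutators ps) = cls (commutators ps)"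
        by blast+
    qed
    have "ev (cls_of K) (squares (xs1 @ [a]) @ commutators (qs @ ps)) = ev (cls_of K) (squares xs1) +
        ev (cls_of K) ([(a, True), (a, True)] @ commutators qs) + ev (cls_of K) (commutators ps)" by (simp add: add.assoc)
    also have "\<dots> = cls (squares xs @ commutators ps)" unfolding A K(3) xs ys by (simp add: add.assoc)
    finally have e: "ev (cls_of K) (squares (xs1 @ [a]) @ commutators (qs @ ps)) = cls (squares xs @ commutators ps)" .
    have d: "2 * length qs + 1 \<le> length U" unfolding U_def xs ys by simp
    have f: "K v = [(v, True)]" if "v \<notin> set U" for v using K(2) sU that by blast
    show ?thesis unfolding U_def[symmetric]
      apply (rule exI[where x = xs1], rule exI[where x = a], rule exI[where x = "qs @ ps"], rule exI[where x = "length qs"], rule exI[where x = K])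
      using K(1) f l1 lq m e d bnd[OF K(2,4,5) _ sU] by blast
  next
    case False
    define j where "j = (k - length ys) div 2"
    have j: "k = length ys + 2 * j" "length ps = j + l" using len xs False unfolding j_def by simp_all presburger+
    define qs where "qs = take j ps"
    define ps1 where "ps1 = drop j ps"
    have ps: "ps = qs @ ps1" by (simp add: qs_def ps1_def)
    have lq: "length qs = j" "length ps1 = l" using j by (simp_all add: qs_def ps1_def)
    have sf: "set (flat2 qs) = fst ` set qs \<union> snd ` set qs" using arg_cong[OF mset_flat2[of qs], of set_mset] by simp
    have "distinct (map fst qs @ map snd qs)" using dist unfolding ps by auto
    then have "distinct (flat2 qs)" using mset_eq_imp_distinct_iff[OF mset_flat2[of qs]] by simp
    then have dq: "distinct (a # flat2 qs)" "set (a # flat2 qs) \<subseteq> V" using dist V sf unfolding xs ps by auto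
    obtain K where K: "aut_on V (cls_of K)" "\<And>v. v \<notin> set (a # flat2 qs) \<Longrightarrow> K v = [(v, True)]"
      "ev (cls_of K) (squares (flat2 qs @ [a])) = cls ([(a, True), (a, True)] @ commutators qs)"
      "\<And>wt. wsum wt (K a) \<le> sum_list (map wt (a # flat2 qs))"
      "\<And>wt v. v \<in> set (flat2 qs) \<Longrightarrow> wsum wt (K v) \<le> 3 * sum_list (map wt (a # flat2 qs))"
      using squares_to_handles[OF dq] by blast
    have sU: "set (a # flat2 qs) \<subseteq> set U" unfolding U_def xs ps using sf by auto
    have m: "mset ((ys @ flat2 qs) @ a # map fst ps1 @ map snd ps1) = mset U"
      unfolding U_def xs ps using mset_flat2[of qs] by simp
    have A: "ev (cls_of K) (squares ys) = cls (squares ys)" "ev (cls_of K) (commutators ps1) = cls (commutators ps1)"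
    proof -
      have "set ys \<inter> set (a # flat2 qs) = {}" "(fst ` set ps1 \<union> snd ` set ps1) \<inter> set (a # flat2 qs) = {}"
      proof -
        have "distinct ((ys @ flat2 qs) @ a # map fst ps1 @ map snd ps1)"
          using mset_eq_imp_distinct_iff[OF m] dist unfolding U_def by blast
        then show "set ys \<inter> set (a # flat2 qs) = {}" "(fst ` set ps1 \<union> snd ` set ps1) \<inter> set (a # flat2 qs) = {}"
          by auto
      qed
      moreover have "ev (cls_of K) w = cls w" if "fst ` set w \<inter> set (a # flat2 qs) = {}" for w
        by (rule ev_cls_of_avoid, rule K(2)) (use that in blast)
      note this[of "squares ys", unfolded squares_letters] this[of "commutators ps1", unfolded commutators_letters]
      ultimately show "ev (cls_of K) (squares ys) = cls (squares ys)" "ev (cls_of K) (commutators ps1) = cls (commutators ps1)"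
        by blast+
    qed
    have "ev (cls_of K) (squares ((ys @ flat2 qs) @ [a]) @ commutators ps1) = ev (cls_of K) (squares ys) +
        ev (cls_of K) (squares (flat2 qs @ [a])) + ev (cls_of K) (commutators ps1)" by (simp add: add.assoc)
    also have "\<dots> = cls (squares xs @ commutators ps)" unfolding A K(3) xs ps by (simp add: add.assoc)
    finally have e: "ev (cls_of K) (squares ((ys @ flat2 qs) @ [a]) @ commutators ps1) = cls (squares xs @ commutators ps)" .
    have d: "2 * length qs + 1 \<le> length U" unfolding U_def xs ps by simp
    have f: "K v = [(v, True)]" if "v \<notin> set U" for v using K(2) sU that by blast
    have lk: "length (ys @ flat2 qs) = k" using j lq by simp
    show ?thesis unfolding U_def[symmetric]
      apply (rule exI[where x = "ys @ flat2 qs"], rule exI[where x = a], rule exI[where x = ps1], rule exI[where x = "length qs"], rule exI[where x = K])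
      using K(1) f lk lq(2) m e d bnd[OF K(2,4,5) _ sU] by blast
  qed
qed

lemma perm_exists:
  assumes "distinct l" "distinct l'" "set l = V" "set l' = V"
  shows "\<exists>p. map p l = l' \<and> (\<forall>v. v \<notin> V \<longrightarrow> p v = v) \<and> (\<forall>v\<in>V. p v \<in> V) \<and> aut_on V (cls_of (\<lambda>v. [(p v, True)]))"
proof -
  have len: "length l = length l'" using assms by (metis distinct_card)
  define p where "p v = (case map_of (zip l l') v of None \<Rightarrow> v | Some y \<Rightarrow> y)" for v
  have pl: "map p l = l'"
  proof (rule nth_equalityI)
    fix i assume "i < length (map p l)"
    then have i: "i < length l" by simp
    then have "map_of (zip l l') (l ! i) = Some (l' ! i)" using len assms(1) by (simp add: map_of_zip_nth)
    then show "map p l ! i = l' ! i" using i by (simp add: p_def)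
  qed (simp add: len)
  have off: "p v = v" if "v \<notin> V" for v
    using that assms(3) len unfolding p_def by (metis map_of_zip_is_None option.simps(4))
  have im: "p ` V = V" using arg_cong[OF pl, of set] assms(3,4) by simp
  then have "inj_on p V" using assms(3) by (metis List.finite_set eq_card_imp_inj_on)
  then have "aut_on V (\<lambda>x. if x \<in> V then gen (p x) else gen x)" using im by (intro aut_on_perm) (simp add: bij_betw_def)
  moreover have "(\<lambda>x. if x \<in> V then gen (p x) else gen x) = cls_of (\<lambda>v. [(p v, True)])" by (rule ext) (simp add: off)
  ultimately show ?thesis using pl off im by auto
qed

lemma squares_perm: "ev (cls_of (\<lambda>v. [(p v, True)])) (squares xs) = cls (squares (map p xs))"
  by (induction xs) auto

lemma commutators_perm: "ev (cls_of (\<lambda>v. [(p v, True)])) (commutators ps) = cls (commutators (map (map_prod p p) ps))"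
  by (induction ps) auto

lemma conjs_perm:
  "(\<And>b. b \<in> set bs \<Longrightarrow> ev (cls_of (\<lambda>v. [(p v, True)])) b = cls b) \<Longrightarrow> length zs = length bs \<Longrightarrow>
   ev (cls_of (\<lambda>v. [(p v, True)])) (conjs (zip zs bs)) = cls (conjs (zip (map p zs) bs))"
proof (induction bs arbitrary: zs)
  case (Cons b bs)
  then obtain z zs' where "zs = z # zs'" by (cases zs) auto
  then show ?case using Cons by simp
qed simp

lemma pairs_eqI: "map fst qs = map fst rs \<Longrightarrow> map snd qs = map snd rs \<Longrightarrow> qs = rs"
  by (metis zip_map_fst_snd)

context holes
begin

lemma SF_perm:
  assumes "\<And>v. v \<notin> V \<Longrightarrow> p v = v" "length zs = length ds - 1" "length es = length ds"
  shows "ev (cls_of (\<lambda>v. [(p v, True)])) (SF xs ps zs es) = cls (SF (map p xs) (map (map_prod p p) ps) (map p zs) es)"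
proof -
  let ?h = "cls_of (\<lambda>v. [(p v, True)])"
  have fx: "ev ?h (signed e (pos_word d)) = cls (signed e (pos_word d))" if "d \<in> set ds" for e d
  proof (rule ev_cls_of_avoid)
    fix v assume "v \<in> fst ` set (signed e (pos_word d))"
    then have "v \<notin> V" using pos_word_V[OF that] by auto
    then show "[(p v, True)] = [(v, True)]" using assms(1) by simp
  qed
  have "ev ?h (conjs (zip zs (map2 (\<lambda>e d. signed e (pos_word d)) (tl es) (tl ds)))) =
      cls (conjs (zip (map p zs) (map2 (\<lambda>e d. signed e (pos_word d)) (tl es) (tl ds))))"
  proof (rule conjs_perm)
    fix b assume "b \<in> set (map2 (\<lambda>e d. signed e (pos_word d)) (tl es) (tl ds))"
    then obtain e d where "b = signed e (pos_word d)" "d \<in> set (tl ds)" by (auto dest: set_zip_rightD)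
    then show "ev ?h b = cls b" using fx list.set_sel(2)[OF ds0] by blast
  qed (use assms in simp)
  note c = this
  show ?thesis unfolding SF_def ev_append squares_perm commutators_perm c fx[OF hd_in_set[OF ds0]] ..
qed

lemma qs_sum:
  "length zs = length D \<Longrightarrow> length E = length D \<Longrightarrow>
   (\<Sum>q\<leftarrow>zip zs (zip (map pos_word D) E). 2 * wt (fst q) + wsum wt (fst (snd q))) = (\<Sum>z\<leftarrow>zs. 2 * wt z) + wsum wt (pos_word (concat D))"
proof (induction D arbitrary: zs E)
  case (Cons d D)
  then obtain z zs' e E' where "zs = z # zs'" "E = e # E'" by (metis Suc_length_conv)
  then show ?case using Cons by simp
qed simp

text \<open>The signs of the coefficients can be changed at will at the cost of moving the pivot square
  through the word.\<close>

lemma reflect: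
  assumes dist: "distinct (xs @ a # map fst ps @ map snd ps @ zs)" and V: "V = set (xs @ a # map fst ps @ map snd ps @ zs)"
    and lz: "length zs = length ds - 1" and le: "length es = length ds"
  shows "\<exists>K g. aut_on V (cls_of K) \<and> ev (cls_of K) (SF (a # xs) ps zs (replicate (length ds) True)) = g + cls (SF (xs @ [a]) ps zs es) - g \<and>
    (\<forall>v\<in>V. \<forall>wt. wsum wt (K v) \<le> (let AA = wt a + (\<Sum>z\<leftarrow>zs. 2 * wt z) + wsum wt (pos_word (concat ds)) in
       if v \<in> set zs then wt v + 3 * AA else wt v + 4 * wt a + 2 * AA))"
proof -
  define X H c0 e0 where "X = squares xs" and "H = commutators ps" and "c0 = pos_word (hd ds)" and "e0 = hd es"
  define u where "u = [(a, True), (a, True)]"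
  define qs where "qs = zip zs (zip (map pos_word (tl ds)) (tl es))"
  define Z where "Z = conjs (map (\<lambda>q. (fst q, fst (snd q))) qs)"
  define Z' where "Z' = conjs (map (\<lambda>q. (fst q, signed (snd (snd q)) (fst (snd q)))) qs)"
  have Zl: "map (\<lambda>q. (fst q, fst (snd q))) qs = zip zs (map2 (\<lambda>e d. signed e (pos_word d)) (tl (replicate (length ds) True)) (tl ds))"
    unfolding qs_def using lz le by (intro nth_equalityI) (auto simp: nth_tl)
  have Zl': "map (\<lambda>q. (fst q, signed (snd (snd q)) (fst (snd q)))) qs = zip zs (map2 (\<lambda>e d. signed e (pos_word d)) (tl es) (tl ds))"
    unfolding qs_def using lz le by (intro nth_equalityI) (auto simp: nth_tl)
  have SF1: "SF (a # xs) ps zs (replicate (length ds) True) = u @ X @ H @ Z @ c0"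
    unfolding SF_def Zl[symmetric] X_def H_def Z_def c0_def u_def using ds0 by simp
  have SF2: "SF (xs @ [a]) ps zs es = X @ u @ H @ Z' @ signed e0 c0"
    unfolding SF_def Zl'[symmetric] X_def H_def Z'_def c0_def u_def e0_def by simp
  have mf: "map fst qs = zs" using lz le by (simp add: qs_def)
  have sq: "fst ` set qs = set zs" using arg_cong[OF mf, of set] by simp
  have cs: "fst ` set (fst (snd q)) \<inter> V = {}" if q: "q \<in> set qs" for q
  proof -
    have "fst (snd q) \<in> set (map pos_word (tl ds))" using q unfolding qs_def by (metis prod.collapse set_zip_leftD set_zip_rightD)
    then obtain d where "d \<in> set ds" "fst (snd q) = pos_word d" using list.set_sel(2)[OF ds0] by auto
    then show ?thesis using pos_word_V by simp
  qed
  have c0V: "fst ` set c0 \<inter> V = {}" unfolding c0_def using ds0 by (intro pos_word_V) simp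
  define hv where "hv = fst ` set ps \<union> snd ` set ps"
  have aV: "a \<in> V" and az: "a \<notin> set zs" and ah: "a \<notin> hv" and ax: "a \<notin> set xs" and hx: "hv \<inter> set xs = {}" and hz: "hv \<inter> set zs = {}"
    and xz: "set xs \<inter> set zs = {}" and zV: "set zs \<subseteq> V" and hV: "hv \<subseteq> V" and xV: "set xs \<subseteq> V"
    using dist V by (auto simp: hv_def)
  have lX: "fst ` set X = set xs" and lH: "fst ` set H = hv" unfolding X_def H_def hv_def by (simp_all add: squares_letters commutators_letters)
  have lZ: "fst ` set Z \<subseteq> set zs \<union> - V" "fst ` set Z' \<subseteq> set zs \<union> - V"
    unfolding Z_def Z'_def conjs_letters by (simp_all add: image_image sq) (use cs in blast)+
  have lu: "fst ` set u = {a}" by (simp add: u_def)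
  have lc: "fst ` set (signed e c0) \<subseteq> - V" for e using c0V by auto
  \<comment> \<open>Takes the pivot square leftwards through all conjugates and sets their
    signs.\<close>
  obtain F where F: "aut_on V (cls_of F)" "\<And>v. v \<notin> insert a (set zs) \<Longrightarrow> F v = [(v, True)]" "ev (cls_of F) (Z @ u) = cls (u @ Z')"
    "\<And>wt. wsum wt (F a) \<le> wt a + (\<Sum>q\<leftarrow>qs. 2 * wt (fst q) + wsum wt (fst (snd q)))"
    "\<And>wt z. z \<in> set zs \<Longrightarrow> wsum wt (F z) \<le> wt z + 2 * (wt a + (\<Sum>q\<leftarrow>qs. 2 * wt (fst q) + wsum wt (fst (snd q))))"
  proof -
    have "distinct (map fst qs)" "a \<notin> fst ` set qs" "fst ` set qs \<subseteq> V" using dist mf sq az zV by auto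
    from flip[OF this(1,2) aV this(3) cs] show ?thesis using that unfolding Z_def Z'_def u_def sq by blast
  qed
  \<comment> \<open>Conjugating the handle variables by the square takes the pivot past the
    handles.\<close>
  define P where "P = bimult_word hv (\<lambda>_. u) (\<lambda>_. winv u)"
  have aP: "aut_on V (cls_of P)" unfolding P_def using hV ah lu fst_set_winv[of u] by (intro aut_on_bimult_word) auto
  \<comment> \<open>Up to conjugacy the pivot goes from the front of a^2 w c0 to the place before
    c0. To keep the sign, a goes to c0^-1 a c0. To reverse it, conjugating w by a leaves a w a c0,
    and then a to a c0^-1 gives a c0^-1 w a, a conjugate of w a^2 c0^-1. A conjugator is multiplied
    only on the left, because its coefficient is constant.\<close>
  define E1 where "E1 = bimult_word {a} (\<lambda>_. []) (\<lambda>_. winv c0)"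
  define E2 where "E2 = bimult_word (V - {a}) (\<lambda>_. [(a, False)]) (\<lambda>v. if v \<in> set zs then [] else [(a, True)])"
  define E where "E = (if e0 then bimult_word {a} (\<lambda>_. winv c0) (\<lambda>_. c0) else (\<lambda>v. word_subst E1 (E2 v)))"
  have ac: "a \<notin> fst ` set c0" using c0V aV by blast
  have aE: "aut_on V (cls_of E)"
  proof (cases e0)
    case True
    have "aut_on V (cls_of (bimult_word {a} (\<lambda>_. winv c0) (\<lambda>_. c0)))" using aV ac fst_set_winv[of c0] by (intro aut_on_bimult_word) auto
    then show ?thesis unfolding E_def using True by simp
  next
    case False
    have "aut_on V (cls_of E1)" unfolding E1_def using aV ac fst_set_winv[of c0] by (intro aut_on_bimult_word) auto
    moreover have "aut_on V (cls_of E2)" unfolding E2_def by (intro aut_on_bimult_word) auto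
    ultimately show ?thesis unfolding E_def using False by (simp only: if_False aut_on_word_subst)
  qed
  have "\<exists>g. ev (cls_of E) (u @ X @ H @ Z @ c0) = g + cls (X @ H @ Z @ u @ signed e0 c0) - g"
  proof (cases e0)
    case True
    have E: "E = bimult_word {a} (\<lambda>_. winv c0) (\<lambda>_. c0)" unfolding E_def using True by simp
    have "ev (cls_of E) (X @ H @ Z @ c0) = cls (X @ H @ Z @ c0)"
    proof (rule ev_cls_of_avoid)
      fix v assume "v \<in> fst ` set (X @ H @ Z @ c0)"
      then have "v \<noteq> a" using lX lH lZ(1) ax ah az ac aV by (auto simp: image_Un)
      then show "E v = [(v, True)]" unfolding E by (simp add: bimult_word_def)
    qed
    moreover have "ev (cls_of E) u = - cls c0 + cls u + cls c0" unfolding E u_def by (simp add: bimult_word_def group_simps)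
    ultimately have "ev (cls_of E) (u @ X @ H @ Z @ c0) = (- cls c0 + cls u + cls c0) + cls (X @ H @ Z @ u @ signed e0 c0) - (- cls c0 + cls u + cls c0)"
      using True by (simp add: group_simps)
    then show ?thesis by blast
  next
    case False
    have Ev: "ev (cls_of E) w = lift (cls_of E1) (ev (cls_of E2) w)" for w unfolding E_def using False by (simp add: ev_cls_of_word_subst)
    have XH: "ev (cls_of E2) (X @ H) = - gen a + cls (X @ H) - (- gen a)"
    proof (rule lift_conj_word)
      fix v assume "v \<in> fst ` set (X @ H)"
      then have "v \<in> V - {a}" "v \<notin> set zs" using lX lH xV hV ax ah xz hz by (auto simp: image_Un)
      then show "cls (E2 v) = - gen a + gen v - - gen a" unfolding E2_def by (simp add: bimult_word_def group_simps)
    qed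
    have ZZ: "ev (cls_of E2) Z = - gen a + cls Z - (- gen a)"
      unfolding Z_def
    proof (rule conjs_left)
      fix z b assume "(z, b) \<in> set (map (\<lambda>q. (fst q, fst (snd q))) qs)"
      then obtain q where q: "q \<in> set qs" "z = fst q" "b = fst (snd q)" by auto
      then have "z \<in> set zs" using sq by auto
      then have "cls (E2 z) = - gen a + gen z" using zV az unfolding E2_def by (auto simp: bimult_word_def)
      moreover have "ev (cls_of E2) b = cls b" using cs[OF q(1)] q(3) unfolding E2_def by (intro ev_cls_of_avoid bimult_word_out) blast
      ultimately show "cls (E2 z) = - gen a + gen z \<and> ev (cls_of E2) b = cls b" by blast
    qed
    have uu: "ev (cls_of E2) u = cls u" "ev (cls_of E2) c0 = cls c0" using c0V lu unfolding E2_def by (auto intro!: ev_cls_of_avoid bimult_word_out)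
    have av: "ev (cls_of E1) w = cls w" if "a \<notin> fst ` set w" for w
      by (rule ev_cls_of_avoid) (use that in \<open>auto simp: E1_def bimult_word_def\<close>)
    have "a \<notin> fst ` set (X @ H)" "a \<notin> fst ` set Z" using lX lH lZ(1) ax ah az aV by (simp_all add: image_Un) blast
    note ea = av[OF this(1)] av[OF this(2)] av[OF ac]
    have e1: "ev (cls_of E1) (X @ H) = cls (X @ H)" "ev (cls_of E1) Z = cls Z" "ev (cls_of E1) c0 = cls c0" "cls (E1 a) = gen a - cls c0"
      by (rule ea)+ (simp add: E1_def bimult_word_def)
    have "ev (cls_of E) (u @ X @ H @ Z @ c0) = lift (cls_of E1) (ev (cls_of E2) u + ev (cls_of E2) (X @ H) + ev (cls_of E2) Z + ev (cls_of E2) c0)"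
      unfolding Ev by (simp add: add.assoc)
    also have "\<dots> = lift (cls_of E1) (gen a + cls (X @ H) + cls Z + gen a + cls c0)"
      unfolding XH ZZ uu by (simp add: u_def group_simps)
    also have "\<dots> = cls (E1 a) + ev (cls_of E1) (X @ H) + ev (cls_of E1) Z + cls (E1 a) + ev (cls_of E1) c0"
      by (simp only: lift_plus lift_gen lift_cls)
    also have "\<dots> = (gen a - cls c0) + cls (X @ H @ Z @ u @ signed e0 c0) - (gen a - cls c0)"
      unfolding e1 using False by (simp add: u_def group_simps)
    finally show ?thesis by blast
  qed
  then obtain g1 where g1: "ev (cls_of E) (u @ X @ H @ Z @ c0) = g1 + cls (X @ H @ Z @ u @ signed e0 c0) - g1" by blast
  define K where "K = (\<lambda>v. word_subst P (word_subst F (E v)))"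
  have KE: "ev (cls_of K) w = lift (cls_of P) (lift (cls_of F) (ev (cls_of E) w))" for w
    unfolding K_def by (simp add: ev_cls_of_word_subst)
  have FX: "ev (cls_of F) X = cls X" "ev (cls_of F) H = cls H" "ev (cls_of F) (signed e0 c0) = cls (signed e0 c0)"
  proof -
    have Fa: "ev (cls_of F) w = cls w" if "fst ` set w \<inter> insert a (set zs) = {}" for w
      by (rule ev_cls_of_avoid, rule F(2)) (use that in blast)
    show "ev (cls_of F) X = cls X" by (rule Fa) (use lX ax xz in blast)
    show "ev (cls_of F) H = cls H" by (rule Fa) (use lH ah hz in blast)
    show "ev (cls_of F) (signed e0 c0) = cls (signed e0 c0)" by (rule Fa) (use lc[of e0] aV zV in blast)
  qed
  have PX: "ev (cls_of P) X = cls X" "ev (cls_of P) u = cls u" "ev (cls_of P) Z' = cls Z'" "ev (cls_of P) (signed e0 c0) = cls (signed e0 c0)"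
  proof -
    have Pa: "ev (cls_of P) w = cls w" if "fst ` set w \<inter> hv = {}" for w
      unfolding P_def by (rule ev_cls_of_avoid, rule bimult_word_out) (use that in blast)
    show "ev (cls_of P) X = cls X" by (rule Pa) (use lX hx in blast)
    show "ev (cls_of P) u = cls u" by (rule Pa) (simp add: lu ah)
    show "ev (cls_of P) Z' = cls Z'" by (rule Pa) (use lZ(2) hz hV in blast)
    show "ev (cls_of P) (signed e0 c0) = cls (signed e0 c0)" by (rule Pa) (use lc[of e0] hV in blast)
  qed
  have PH: "ev (cls_of P) H = cls u + cls H - cls u"
  proof (rule lift_conj_word)
    fix v assume "v \<in> fst ` set H"
    then show "cls (P v) = cls u + gen v - cls u" unfolding P_def using lH by (simp add: bimult_word_def add.assoc)
  qed
  have "lift (cls_of F) (cls (X @ H @ Z @ u @ signed e0 c0)) = ev (cls_of F) X + ev (cls_of F) H + ev (cls_of F) (Z @ u) + ev (cls_of F) (signed e0 c0)"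
    by (simp add: add.assoc)
  also have "\<dots> = cls X + cls H + cls (u @ Z') + cls (signed e0 c0)" unfolding F(3) FX ..
  finally have "lift (cls_of P) (lift (cls_of F) (cls (X @ H @ Z @ u @ signed e0 c0))) =
      ev (cls_of P) X + ev (cls_of P) H + (ev (cls_of P) u + ev (cls_of P) Z') + ev (cls_of P) (signed e0 c0)"
    by (simp only: lift_plus lift_cls ev_append)
  also have "\<dots> = cls (SF (xs @ [a]) ps zs es)" unfolding PX PH SF2 by (simp add: group_simps)
  finally have "ev (cls_of K) (SF (a # xs) ps zs (replicate (length ds) True)) =
      lift (cls_of P) (lift (cls_of F) g1) + cls (SF (xs @ [a]) ps zs es) - lift (cls_of P) (lift (cls_of F) g1)"
    unfolding KE SF1 g1 by simp
  moreover have "aut_on V (cls_of K)" unfolding K_def by (rule aut_on_word_subst[OF aP aut_on_word_subst[OF F(1) aE]])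
  moreover have "wsum wt (K v) \<le> (let AA = wt a + (\<Sum>z\<leftarrow>zs. 2 * wt z) + wsum wt (pos_word (concat ds)) in
       if v \<in> set zs then wt v + 3 * AA else wt v + 4 * wt a + 2 * AA)" if v: "v \<in> V" for v wt
  proof -
    define A0 where "A0 = wt a + (\<Sum>z\<leftarrow>zs. 2 * wt z) + wsum wt (pos_word (concat (tl ds)))"
    define AA where "AA = wt a + (\<Sum>z\<leftarrow>zs. 2 * wt z) + wsum wt (pos_word (concat ds))"
    have "concat ds = hd ds @ concat (tl ds)" using ds0 by (cases ds) auto
    then have AA: "AA = A0 + wsum wt c0" unfolding AA_def A0_def c0_def by simp
    define wP where "wP y = wsum wt (P y)" for y
    have wP: "wP y = (if y \<in> hv then wt y + 4 * wt a else wt y)" for y unfolding wP_def P_def bimult_word_def u_def by simp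
    have tld: "fst ` set (pos_word (concat (tl ds))) \<inter> V = {}" using cst list.set_sel(2)[OF ds0] by (auto simp: image_image)
    have S: "wP a + (\<Sum>q\<leftarrow>qs. 2 * wP (fst q) + wsum wP (fst (snd q))) = A0"
    proof -
      have "(\<Sum>q\<leftarrow>qs. 2 * wP (fst q) + wsum wP (fst (snd q))) = (\<Sum>z\<leftarrow>zs. 2 * wP z) + wsum wP (pos_word (concat (tl ds)))"
        unfolding qs_def using lz le by (intro qs_sum) simp_all
      moreover have "map (\<lambda>z. 2 * wP z) zs = map (\<lambda>z. 2 * wt z) zs" using hz wP by (intro map_cong) auto
      moreover have "wsum wP (pos_word (concat (tl ds))) = wsum wt (pos_word (concat (tl ds)))"
      proof (rule wsum_cong)
        fix y assume "y \<in> fst ` set (pos_word (concat (tl ds)))"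
        then have "y \<notin> hv" using tld hV by blast
        then show "wP y = wt y" by (simp add: wP)
      qed
      moreover have "wP a = wt a" using ah wP by simp
      ultimately show ?thesis unfolding A0_def by (simp only: add.assoc)
    qed
    define wF where "wF y = wsum wP (F y)" for y
    have wFa: "wF a \<le> A0" unfolding wF_def using F(4)[of wP] S by simp
    have wFz: "wF z \<le> wt z + 2 * A0" if "z \<in> set zs" for z
      using F(5)[OF that, of wP] S wP[of z] hz that unfolding wF_def by (auto split: if_splits)
    have wFo: "wF y \<le> wt y + 4 * wt a" if "y \<noteq> a" "y \<notin> set zs" for y
      using F(2)[of y] that wP[of y] unfolding wF_def by simp
    have wFc: "wsum wF c0 = wsum wt c0"
    proof (rule wsum_cong)
      fix y assume "y \<in> fst ` set c0"
      then have "y \<notin> V" using c0V by blast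
      then have "y \<notin> hv" "y \<notin> insert a (set zs)" using hV aV zV by blast+
      then show "wF y = wt y" unfolding wF_def using F(2)[of y] by (simp add: wP)
    qed
    have wK: "wsum wt (K v) = wsum wF (E v)"
      unfolding K_def wsum_word_subst wF_def wP_def ..
    have wE1: "wsum wF (word_subst E1 [(a, s)]) = wF a + wsum wt c0" for s by (simp add: E1_def bimult_word_def wFc)
    have wE1o: "wsum wF (word_subst E1 [(y, s)]) = wF y" if "y \<noteq> a" for y s using that by (simp add: E1_def bimult_word_def)
    have "wsum wF (E v) \<le> (if v \<in> set zs then wt v + 3 * AA else wt v + 4 * wt a + 2 * AA)"
    proof (cases "v = a")
      case True
      have "wsum wF (E v) \<le> wF a + 2 * wsum wt c0"
        unfolding True E_def by (cases e0) (simp_all add: bimult_word_def E1_def E2_def wFc)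
      then show ?thesis using wFa az True AA by simp
    next
      case va: False
      show ?thesis
      proof (cases "v \<in> set zs")
        case True
        have "wsum wF (E v) \<le> wF v + wF a + wsum wt c0"
          using va v True unfolding E_def by (cases e0) (simp_all add: bimult_word_def E1_def E2_def wFc)
        then show ?thesis using wFa wFz[OF True] True AA by simp
      next
        case False
        have "wsum wF (E v) \<le> wF v + 2 * wF a + 2 * wsum wt c0"
          using va v False unfolding E_def by (cases e0) (simp_all add: bimult_word_def E1_def E2_def wFc)
        then show ?thesis using wFa wFo[OF va False] False AA by simp
      qed
    qed
    then show ?thesis unfolding wK Let_def AA_def .
  qed
  ultimately show ?thesis by blast
qed

text \<open>Without squares the numbers of handles agree and all signs are positive, so a
  permutation of the variables suffices. With squares, trading equalizes the numbers, the reflection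
  sets the signs, and a permutation matches the variables.\<close>

theorem compare:
  assumes dS: "distinct (xsS @ map fst psS @ map snd psS @ zsS)" "V = set (xsS @ map fst psS @ map snd psS @ zsS)"
    and lS: "length zsS = length ds - 1"
    and dF: "distinct (xs @ map fst ps @ map snd ps @ zs)" "V = set (xs @ map fst ps @ map snd ps @ zs)"
    and lF: "length zs = length ds - 1" "length es = length ds"
    and o: "xsS = [] \<longleftrightarrow> xs = []" "xs = [] \<Longrightarrow> es = replicate (length ds) True"
    and K: "aut_on V (cls_of K)" "ev (cls_of K) (SF xs ps zs es) = g + c - g" "\<And>v. v \<notin> V \<Longrightarrow> K v = [(v, True)]"
    and B: "\<And>v. v \<in> V \<Longrightarrow> wsum wt (K v) \<le> (if v \<in> set zs then 4 * N else 3 * N)" "wsum wt (pos_word (concat ds)) \<le> N"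
  shows "\<exists>K' g'. aut_on V (cls_of K') \<and> ev (cls_of K') (SF xsS psS zsS (replicate (length ds) True)) = g' + c - g' \<and>
    (\<forall>v\<in>V. wsum wt (K' v) \<le> (if xsS = [] then 4 * N else 35 * card V * N))"
proof -
  have cS: "card V = length xsS + 2 * length psS + length zsS" using distinct_card[OF dS(1)] dS(2) by simp
  have cF: "card V = length xs + 2 * length ps + length zs" using distinct_card[OF dF(1)] dF(2) by simp
  have pm: "\<exists>p. map p xsS = xs' \<and> map (map_prod p p) psS = ps' \<and> map p zsS = zs \<and> (\<forall>v. v \<notin> V \<longrightarrow> p v = v) \<and> (\<forall>v\<in>V. p v \<in> V) \<and>
      aut_on V (cls_of (\<lambda>v. [(p v, True)]))"
    if A: "distinct (xs' @ map fst ps' @ map snd ps' @ zs)" "V = set (xs' @ map fst ps' @ map snd ps' @ zs)"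
      "length xsS = length xs'" "length psS = length ps'" for xs' ps'
  proof -
    obtain p where p: "map p (xsS @ map fst psS @ map snd psS @ zsS) = xs' @ map fst ps' @ map snd ps' @ zs"
      "\<forall>v. v \<notin> V \<longrightarrow> p v = v" "\<forall>v\<in>V. p v \<in> V" "aut_on V (cls_of (\<lambda>v. [(p v, True)]))"
      using perm_exists[OF dS(1) A(1) dS(2)[symmetric] A(2)[symmetric]] by blast
    then have "map p xsS = xs' \<and> map p (map fst psS) = map fst ps' \<and> map p (map snd psS) = map snd ps' \<and> map p zsS = zs"
      using A(3,4) by (simp add: append_eq_append_conv)
    moreover from this have "map (map_prod p p) psS = ps'" by (intro pairs_eqI) (simp_all add: comp_def)
    ultimately show ?thesis using p by blast
  qed
  show ?thesis
  proof (cases "xsS = []")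
    case True
    then have x: "xs = []" "es = replicate (length ds) True" using o by auto
    then have "length psS = length ps" using cS cF lS lF True by simp
    then obtain p where p: "map p xsS = xs" "map (map_prod p p) psS = ps" "map p zsS = zs" "\<And>v. v \<notin> V \<Longrightarrow> p v = v" "\<And>v. v \<in> V \<Longrightarrow> p v \<in> V"
      "aut_on V (cls_of (\<lambda>v. [(p v, True)]))"
      using pm[OF dF] True x(1) by auto
    define K' where "K' = (\<lambda>v. word_subst K [(p v, True)])"
    have "aut_on V (cls_of K')" unfolding K'_def by (rule aut_on_word_subst[OF K(1) p(6)])
    moreover have "ev (cls_of K') (SF xsS psS zsS (replicate (length ds) True)) = g + c - g"
      using SF_perm[OF p(4) lS, of "replicate (length ds) True" xsS psS] K(2) unfolding K'_def ev_cls_of_word_subst p(1-3) x(2) by simp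
    moreover have "wsum wt (K' v) \<le> 4 * N" if "v \<in> V" for v
      using B(1)[OF p(5)[OF that]] unfolding K'_def by (simp split: if_splits)
    ultimately show ?thesis using True by auto
  next
    case False
    then have ne: "xs \<noteq> []" using o by simp
    have dF': "distinct (xs @ map fst ps @ map snd ps)" "set (xs @ map fst ps @ map snd ps) \<subseteq> V" using dF by auto
    have "length xs + 2 * length ps = Suc (length xsS - 1) + 2 * length psS" using cS cF lS lF False by (cases xsS) auto
    from convert[OF dF' ne this] obtain xs1 a ps1 d Kc where C: "aut_on V (cls_of Kc)"
      "\<forall>v. v \<notin> set (xs @ map fst ps @ map snd ps) \<longrightarrow> Kc v = [(v, True)]"
      "length xs1 = length xsS - 1" "length ps1 = length psS"
      "mset (xs1 @ a # map fst ps1 @ map snd ps1) = mset (xs @ map fst ps @ map snd ps)"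
      "ev (cls_of Kc) (squares (xs1 @ [a]) @ commutators ps1) = cls (squares xs @ commutators ps)"
      "2 * d + 1 \<le> length (xs @ map fst ps @ map snd ps)"
      "\<forall>wt b. (\<forall>v\<in>set (xs @ map fst ps @ map snd ps). wt v \<le> b) \<longrightarrow> wsum wt (Kc a) \<le> (2 * d + 1) * b \<and>
        (\<forall>v\<in>set (xs @ map fst ps @ map snd ps). wsum wt (Kc v) \<le> 3 * ((2 * d + 1) * b))"
      by (elim exE conjE) (rule that; assumption)
    have C2: "Kc v = [(v, True)]" if "v \<notin> set (xs @ map fst ps @ map snd ps)" for v using C(2) that by blast
    have C8: "wsum wt (Kc a) \<le> (2 * d + 1) * b \<and> (\<forall>v\<in>set (xs @ map fst ps @ map snd ps). wsum wt (Kc v) \<le> 3 * ((2 * d + 1) * b))"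
      if "\<forall>v\<in>set (xs @ map fst ps @ map snd ps). wt v \<le> b" for wt b using C(8) that by blast
    have m: "mset (xs1 @ a # map fst ps1 @ map snd ps1 @ zs) = mset (xs @ map fst ps @ map snd ps @ zs)" using C(5) by simp
    have d1: "distinct (xs1 @ a # map fst ps1 @ map snd ps1 @ zs)" using mset_eq_imp_distinct_iff[OF m] dF(1) by blast
    have V1: "V = set (xs1 @ a # map fst ps1 @ map snd ps1 @ zs)" using mset_eq_setD[OF m] dF(2) by blast
    obtain KT gT where T: "aut_on V (cls_of KT)"
      "ev (cls_of KT) (SF (a # xs1) ps1 zs (replicate (length ds) True)) = gT + cls (SF (xs1 @ [a]) ps1 zs es) - gT"
      "\<And>v wt. v \<in> V \<Longrightarrow> wsum wt (KT v) \<le> (let AA = wt a + (\<Sum>z\<leftarrow>zs. 2 * wt z) + wsum wt (pos_word (concat ds)) in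
       if v \<in> set zs then wt v + 3 * AA else wt v + 4 * wt a + 2 * AA)"
      using reflect[OF d1 V1 lF] by blast
    have "distinct ((a # xs1) @ map fst ps1 @ map snd ps1 @ zs)" "V = set ((a # xs1) @ map fst ps1 @ map snd ps1 @ zs)" using d1 V1 by auto
    from pm[OF this] obtain p where p: "map p xsS = a # xs1" "map (map_prod p p) psS = ps1" "map p zsS = zs" "\<And>v. v \<notin> V \<Longrightarrow> p v = v" "\<And>v. v \<in> V \<Longrightarrow> p v \<in> V"
      "aut_on V (cls_of (\<lambda>v. [(p v, True)]))"
      using C(3,4) False by (cases xsS) auto
    define K' where "K' = (\<lambda>v. word_subst K (word_subst Kc (word_subst KT [(p v, True)])))"
    have "aut_on V (cls_of K')" unfolding K'_def
      by (rule aut_on_word_subst[OF K(1) aut_on_word_subst[OF C(1) aut_on_word_subst[OF T(1) p(6)]]])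
    moreover have "\<exists>g'. ev (cls_of K') (SF xsS psS zsS (replicate (length ds) True)) = g' + c - g'"
    proof -
      define R where "R = conjs (zip zs (map2 (\<lambda>e d. signed e (pos_word d)) (tl es) (tl ds))) @ signed (hd es) (pos_word (hd ds))"
      have S: "SF ys rs zs es = (squares ys @ commutators rs) @ R" for ys rs unfolding SF_def R_def by simp
      have "ev (cls_of Kc) R = cls R"
      proof (rule ev_cls_of_avoid, rule C2)
        fix v assume v: "v \<in> fst ` set R"
        have "fst ` set R \<subseteq> set zs \<union> - V"
        proof
          fix y assume "y \<in> fst ` set R"
          then consider "y \<in> fst ` set (signed (hd es) (pos_word (hd ds)))" | "y \<in> fst ` set (zip zs (map2 (\<lambda>e d. signed e (pos_word d)) (tl es) (tl ds)))"
            | q where "q \<in> set (zip zs (map2 (\<lambda>e d. signed e (pos_word d)) (tl es) (tl ds)))" "y \<in> fst ` set (snd q)"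
            unfolding R_def set_append image_Un conjs_letters by blast
          then show "y \<in> set zs \<union> - V"
          proof cases
            case 1
            then show ?thesis using pos_word_V[of "hd ds"] ds0 by auto
          next
            case 2
            then show ?thesis by (auto dest: set_zip_leftD)
          next
            case 3
            from 3(1) have "snd q \<in> set (map2 (\<lambda>e d. signed e (pos_word d)) (tl es) (tl ds))" by (metis prod.collapse set_zip_rightD)
            then obtain e d where ed: "snd q = signed e (pos_word d)" "d \<in> set (tl ds)" by (auto dest: set_zip_rightD)
            then show ?thesis using 3(2) pos_word_V[of d] list.set_sel(2)[OF ds0] by auto
          qed
        qed
        then show "v \<notin> set (xs @ map fst ps @ map snd ps)" using v dF by auto
      qed
      then have Kc: "ev (cls_of Kc) (SF (xs1 @ [a]) ps1 zs es) = cls (SF xs ps zs es)" using C(6) unfolding S ev_append[of _ _ R] by simp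
      have "ev (cls_of K') (SF xsS psS zsS (replicate (length ds) True)) = lift (cls_of K) (lift (cls_of Kc) (ev (cls_of KT) (SF (a # xs1) ps1 zs (replicate (length ds) True))))"
        using SF_perm[OF p(4) lS, of "replicate (length ds) True" xsS psS] unfolding K'_def ev_cls_of_word_subst p(1-3) by simp
      also have "\<dots> = (lift (cls_of K) (lift (cls_of Kc) gT) + g) + c - (lift (cls_of K) (lift (cls_of Kc) gT) + g)"
        unfolding T(2) using K(2) Kc by (simp add: group_simps)
      finally show ?thesis by blast
    qed
    moreover have "wsum wt (K' v) \<le> 35 * card V * N" if v: "v \<in> V" for v
    proof -
      define b where "b y = wsum wt (K y)" for y
      define w1 where "w1 y = wsum b (Kc y)" for y
      \<comment> \<open>x measures the variables touched by trades and y the conjugators; together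
        they are at most \<open>card V * N\<close>.\<close>
      define x where "x = (2 * d + 1) * N"
      define y where "y = length zs * N"
      have U: "set (xs @ map fst ps @ map snd ps) \<inter> set zs = {}" using dF(1) by auto
      have b3: "\<forall>v\<in>set (xs @ map fst ps @ map snd ps). b v \<le> 3 * N"
      proof
      fix v assume v: "v \<in> set (xs @ map fst ps @ map snd ps)"
      then have "v \<notin> set zs" "v \<in> V" using U dF'(2) by blast+
      then show "b v \<le> 3 * N" using B(1)[of v] unfolding b_def by simp
    qed
      have bc: "b v = wt v" if "v \<notin> V" for v using K(3)[OF that] by (simp add: b_def)
      have w1a: "w1 a \<le> 3 * x" using C8[OF b3] unfolding w1_def x_def by (simp add: algebra_simps)
      have w1u: "w1 v \<le> 9 * x" if "v \<in> set (xs @ map fst ps @ map snd ps)" for v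
        using C8[OF b3] that unfolding w1_def x_def by (simp add: algebra_simps)
      have w1o: "w1 v = b v" if "v \<notin> set (xs @ map fst ps @ map snd ps)" for v unfolding w1_def C2[OF that] by simp
      have w1z: "w1 z \<le> 4 * N" if z: "z \<in> set zs" for z
      proof -
        have "z \<notin> set (xs @ map fst ps @ map snd ps)" "z \<in> V" using z U dF(2) by auto
        from w1o[OF this(1)] B(1)[OF this(2)] z show ?thesis unfolding b_def by simp
      qed
      have w1c: "w1 v = wt v" if v: "v \<notin> V" for v
      proof -
        have "v \<notin> set (xs @ map fst ps @ map snd ps)" using v dF'(2) by blast
        from w1o[OF this] bc[OF v] show ?thesis by (rule trans)
      qed
      have "(\<Sum>z\<leftarrow>zs. 2 * w1 z) \<le> length zs * (8 * N)" using w1z by (intro sum_list_le_const) fastforce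
      moreover have "wsum w1 (pos_word (concat ds)) = wsum wt (pos_word (concat ds))"
      proof (rule wsum_cong)
        fix y assume "y \<in> fst ` set (pos_word (concat ds))"
        then have "y \<notin> V" using cst by (auto simp: image_image)
        then show "w1 y = wt y" by (rule w1c)
      qed
      ultimately have AA: "w1 a + (\<Sum>z\<leftarrow>zs. 2 * w1 z) + wsum w1 (pos_word (concat ds)) \<le> 3 * x + 8 * y + N"
        using w1a B(2) unfolding y_def by simp
      have Nx: "N \<le> x" unfolding x_def by simp
      have "2 * d + 1 + length zs \<le> card V" using C(7) cF by simp
      then have "(2 * d + 1 + length zs) * N \<le> card V * N" by (rule mult_right_mono) simp
      then have xy: "x + y \<le> card V * N" unfolding x_def y_def by (simp add: algebra_simps)
      have "wsum wt (K' v) = wsum w1 (KT (p v))" unfolding K'_def wsum_word_subst w1_def b_def by simp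
      \<comment> \<open>By \<open>T(3)\<close> a conjugator has weight at most 4N + 3(3x + 8y + N),
        any other variable at most 9x + 12x + 2(3x + 8y + N). As N is at most x, this is at most 16x
        + 24y and 29x + 16y.\<close>
      also have "\<dots> \<le> 35 * (card V * N)"
      proof (cases "p v \<in> set zs")
        case True
        then show ?thesis using T(3)[OF p(5)[OF v], of w1] AA w1z[OF True] Nx xy by (simp add: Let_def)
      next
        case False
        then have "p v \<in> set (xs @ map fst ps @ map snd ps)" using p(5)[OF v] dF(2) by auto
        then show ?thesis using T(3)[OF p(5)[OF v], of w1] AA w1u[of "p v"] w1a Nx xy False by (simp add: Let_def)
      qed
      finally show ?thesis by (simp add: mult.assoc)
    qed
    ultimately show ?thesis using False by auto
  qed
qed

end

section \<open>From normal forms to parametric solutions of bounded length\<close>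

section \<open>Parametric solutions of bounded length\<close>

abbreviation letters :: "'a fgrp \<Rightarrow> 'a set" where "letters g \<equiv> fst ` set (rep g)"

lemma letters_simps [simp]: "letters (gen x) = {x}" "letters (- g) = letters g"
  by (simp_all add: rep_gen rep_uminus)

lemma letters_plus: "letters (g + h) \<subseteq> letters g \<union> letters h"
  unfolding rep_plus by (rule letters_foldr)

lemma letters_ev: "letters (ev h w) \<subseteq> (\<Union>x\<in>fst ` set w. letters (h x))"
proof (induction w)
  case (Cons l w)
  have 1: "letters (ev h (l # w)) \<subseteq> letters (sgn_of h l) \<union> letters (ev h w)" unfolding ev.simps by (rule letters_plus)
  have 2: "letters (sgn_of h l) = letters (h (fst l))" by (simp add: sgn_of_def)
  show ?case using order_trans[OF 1[unfolded 2] Un_mono[OF subset_refl Cons.IH]]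
    by (simp only: list.set(2) image_insert Union_insert)
qed simp

lemma letters_lift: "letters (lift h g) \<subseteq> (\<Union>x\<in>letters g. letters (h x))"
  unfolding lift_def by (rule letters_ev)

text \<open>Generalization expressed on generators. C stands for the constants of the word and U for
  the chosen parameters; confining \<eta> to these two alphabets, which are finite in the
  application, is what later makes the set of basic solutions finite. Y limits the letters that
  \<omega> may produce.\<close>

definition generalizable :: "'a set \<Rightarrow> 'a set \<Rightarrow> 'a set \<Rightarrow> 'a set \<Rightarrow> 'a word \<Rightarrow> nat \<Rightarrow> ('a \<Rightarrow> 'a fgrp) \<Rightarrow> bool" where
  "generalizable V C U Y Q B \<theta> \<longleftrightarrow> (\<exists>\<phi> \<eta> \<omega>. aut_on V \<phi> \<and> (\<forall>v\<in>V. letters (\<phi> v) \<subseteq> V \<union> C) \<and>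
     (\<exists>g. letters g \<subseteq> V \<union> C \<and> ev \<phi> Q = g + cls Q - g) \<and>
     (\<forall>x. x \<notin> V \<longrightarrow> \<eta> x = gen x) \<and> ev \<eta> Q = 0 \<and> (\<forall>v\<in>V. len (\<eta> v) \<le> B \<and> letters (\<eta> v) \<subseteq> U \<union> C) \<and>
     (\<forall>y. y \<notin> U \<longrightarrow> \<omega> y = gen y) \<and> (\<forall>y\<in>U. letters (\<omega> y) \<subseteq> Y) \<and> (\<forall>v\<in>V. \<theta> v = lift \<omega> (lift \<eta> (\<phi> v))))"

lemma ev_int:
  fixes \<chi> :: "'a \<Rightarrow> int"
  assumes "finite U" "fst ` set w \<subseteq> U"
  shows "ev \<chi> w = (\<Sum>x\<in>U. \<chi> x * (int (count (mset w) (x, True)) - int (count (mset w) (x, False))))"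
  using assms(2)
proof (induction w)
  case (Cons l w)
  obtain y b where l: "l = (y, b)" by (cases l)
  have y: "y \<in> U" using Cons.prems l by simp
  have "\<chi> x * (int (count (mset (l # w)) (x, True)) - int (count (mset (l # w)) (x, False))) =
      (if x = y then sgn_of \<chi> l else 0) + \<chi> x * (int (count (mset w) (x, True)) - int (count (mset w) (x, False)))" for x
    unfolding l by (cases b; cases "x = y") (simp_all add: algebra_simps del: diff_conv_add_uminus)
  then show ?case using Cons y assms(1) by (simp add: sum.distrib)
qed simp

text \<open>Orientability is invariant because a word is orientable iff it vanishes under every
  homomorphism to the integers that kills the constants.\<close>

lemma oriented_aut:
  assumes f: "aut_on V f" "ev f w = cls w'" and o: "oriented V w'" and q: "\<And>x. x \<in> V \<Longrightarrow> count (symbols w) x = 2"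
  shows "oriented V w"
proof (rule ccontr)
  assume "\<not> oriented V w"
  then obtain x where x: "x \<in> V" "count (mset w) (x, True) \<noteq> count (mset w) (x, False) \<or> \<not> count (mset w) (x, True) \<le> 1"
    unfolding oriented_def by blast
  have ne: "count (mset w) (x, True) \<noteq> count (mset w) (x, False)" using x q[OF x(1)] unfolding count_symbols by auto
  define \<chi> where "\<chi> y = (if y = x then 1 else 0 :: int)" for y
  obtain g where g: "aut_on V g" "\<And>a. lift g (lift f a) = a" using aut_on_inverse[OF f(1)] by metis
  have "ev \<chi> w = (\<Sum>y\<in>insert x (fst ` set w). \<chi> y * (int (count (mset w) (y, True)) - int (count (mset w) (y, False))))"
    by (rule ev_int) auto
  also have "\<dots> = (\<Sum>y\<in>insert x (fst ` set w). if y = x then int (count (mset w) (y, True)) - int (count (mset w) (y, False)) else 0)"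
    by (rule sum.cong) (simp_all add: \<chi>_def)
  also have "\<dots> = int (count (mset w) (x, True)) - int (count (mset w) (x, False))" by (subst sum.delta) auto
  finally have 1: "ev \<chi> w \<noteq> 0" using ne by simp
  define \<chi>' where "\<chi>' y = lift \<chi> (g y)" for y
  have "\<chi>' y = 0" if "y \<notin> V" for y
    using aut_on_fix[OF g(1) that] that x(1) unfolding \<chi>'_def by (auto simp: \<chi>_def)
  then have z: "\<chi>' y * (int (count (mset w') (y, True)) - int (count (mset w') (y, False))) = 0" for y
    using o unfolding oriented_def by (cases "y \<in> V") auto
  have "ev \<chi>' w' = (\<Sum>y\<in>fst ` set w'. \<chi>' y * (int (count (mset w') (y, True)) - int (count (mset w') (y, False))))"
    by (rule ev_int) auto
  then have "ev \<chi>' w' = 0" by (simp only: z sum.neutral_const)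
  moreover have "ev \<chi>' w' = lift \<chi> (ev g w')" unfolding \<chi>'_def by (simp add: lift_ev)
  moreover have "ev g w' = cls w" using g(2)[of "cls w"] f(2) by simp
  ultimately show False using 1 by simp
qed

lemma has_col_rotate: "has_col V s0 t0 (u @ v) \<Longrightarrow> has_col V s0 t0 (v @ u)"
  unfolding has_col_def by (metis path_append)

lemma uniq_col_rotate: "uniq_col V s0 t0 (u @ v) \<Longrightarrow> uniq_col V s0 t0 (v @ u)"
proof -
  assume u: "uniq_col V s0 t0 (u @ v)"
  show ?thesis unfolding uniq_col_def
  proof (intro allI impI)
    fix s1 t1 s2 t2 b1 b2
    assume a: "\<forall>x. x \<notin> V \<longrightarrow> s1 x = s0 x \<and> t1 x = t0 x \<and> s2 x = s0 x \<and> t2 x = t0 x"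
      "path s1 t1 b1 (v @ u) b1" "path s2 t2 b2 (v @ u) b2"
    from a(2) obtain c1 where "path s1 t1 c1 (u @ v) c1" by auto
    moreover from a(3) obtain c2 where "path s2 t2 c2 (u @ v) c2" by auto
    ultimately show "\<forall>x\<in>V. s1 x = s2 x \<and> t1 x = t2 x" using u a(1) unfolding uniq_col_def by blast
  qed
qed

lemma symbols_squares: "symbols (squares xs) = mset xs + mset xs"
  by (induction xs) auto

lemma symbols_commutators: "symbols (commutators ps) = mset (map fst ps @ map snd ps) + mset (map fst ps @ map snd ps)"
  by (induction ps) auto

lemma symbols_conjs_pos_word: "length zs = length D \<Longrightarrow> symbols (conjs (zip zs (map pos_word D))) = mset zs + mset zs + mset (concat D)"
proof (induction D arbitrary: zs)
  case (Cons d D)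
  then obtain z zs' where "zs = z # zs'" by (cases zs) auto
  then show ?case using Cons by (simp add: comp_def)
qed simp

lemma count_commutators: "count (mset (commutators ps)) (x, b) = count (mset (map fst ps @ map snd ps)) x"
  by (induction ps) auto

lemma count_conjs_pos_word:
  "length zs = length D \<Longrightarrow> (\<And>d. d \<in> set D \<Longrightarrow> x \<notin> set d) \<Longrightarrow>
   count (mset (conjs (zip zs (map pos_word D)))) (x, b) = count (mset zs) x"
proof (induction D arbitrary: zs)
  case (Cons d D)
  then obtain z zs' where zs: "zs = z # zs'" by (cases zs) auto
  have "(x, b) \<notin> set (pos_word d)" using Cons.prems(2)[of d] by auto
  then have "count (mset (pos_word d)) (x, b) = 0" by (metis count_eq_zero_iff set_mset_mset)
  moreover have "count (mset (conjs (zip zs' (map pos_word D)))) (x, b) = count (mset zs') x"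
    using Cons.IH[of zs'] Cons.prems zs by simp
  ultimately show ?case unfolding zs by (cases b) simp_all
qed simp

context holes
begin

lemma SF_True: "SF xs ps zs (replicate (length ds) True) = squares xs @ commutators ps @ conjs (zip zs (map pos_word (tl ds))) @ pos_word (hd ds)"
proof -
  have "map2 (\<lambda>e d. signed e (pos_word d)) (replicate (length ds - 1) True) (tl ds) = map pos_word (tl ds)"
    by (intro nth_equalityI) auto
  then show ?thesis unfolding SF_def using ds0 by (cases ds) simp_all
qed

lemma SF_symbols:
  assumes "length zs = length ds - 1"
  shows "symbols (SF xs ps zs (replicate (length ds) True)) =
    mset (xs @ map fst ps @ map snd ps @ zs) + mset (xs @ map fst ps @ map snd ps @ zs) + mset (concat ds)"
proof -
  have "concat ds = hd ds @ concat (tl ds)" using ds0 by (cases ds) auto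
  moreover have "symbols (conjs (zip zs (map pos_word (tl ds)))) = mset zs + mset zs + mset (concat (tl ds))"
    by (rule symbols_conjs_pos_word) (use assms in simp)
  moreover have "symbols (pos_word (hd ds)) = mset (hd ds)" by (simp add: comp_def)
  ultimately show ?thesis unfolding SF_True map_append mset_append symbols_squares symbols_commutators
    by (simp add: ac_simps)
qed

lemma SF_oriented:
  assumes "distinct (map fst ps @ map snd ps @ zs)" "V = set (map fst ps @ map snd ps @ zs)" "length zs = length ds - 1"
  shows "oriented V (SF [] ps zs (replicate (length ds) True))"
proof -
  have "count (mset (SF [] ps zs (replicate (length ds) True))) (x, b) = 1" if x: "x \<in> V" for x b
  proof -
    have nd: "x \<notin> set d" if "d \<in> set ds" for d using that x cst by auto
    then have "(x, b) \<notin> set (pos_word (hd ds))" using ds0 by auto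
    then have "count (mset (pos_word (hd ds))) (x, b) = 0" by (metis count_eq_zero_iff set_mset_mset)
    moreover have "count (mset (conjs (zip zs (map pos_word (tl ds))))) (x, b) = count (mset zs) x"
      by (rule count_conjs_pos_word) (use assms(3) nd list.set_sel(2)[OF ds0] in auto)
    moreover have "count (mset (map fst ps @ map snd ps @ zs)) x = 1"
      using assms(1,2) x by (metis count_mset_0_iff distinct_count_atmost_1)
    ultimately show ?thesis unfolding SF_True by (simp add: count_commutators)
  qed
  then show ?thesis unfolding oriented_def by simp
qed

lemma SF_not_oriented: "xs \<noteq> [] \<Longrightarrow> set xs \<subseteq> V \<Longrightarrow> \<not> oriented V (SF xs ps zs es)"
proof
  assume a: "xs \<noteq> []" "set xs \<subseteq> V" "oriented V (SF xs ps zs es)"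
  then obtain x xs' where x: "xs = x # xs'" by (cases xs) auto
  have "2 \<le> count (mset (SF xs ps zs es)) (x, True)" unfolding x SF_def by simp
  moreover have "count (mset (SF xs ps zs es)) (x, True) \<le> 1" using a x unfolding oriented_def by auto
  ultimately show False by linarith
qed

lemma SF_positive:
  assumes "fst ` set ps \<union> snd ` set ps \<subseteq> V" "set zs \<subseteq> V" "set xs \<subseteq> V"
    and l: "l \<in> set (SF xs ps zs (replicate (length ds) True))" "fst l \<notin> V"
  shows "snd l"
proof -
  have "fst ` set (squares xs) \<subseteq> V" "fst ` set (commutators ps) \<subseteq> V"
    using assms(1,3) by (simp_all add: squares_letters commutators_letters)
  then have nin: "l \<notin> set (squares xs)" "l \<notin> set (commutators ps)" using l(2) by blast+
  have cj: "snd l" if "l \<in> set (conjs qs)" "fst ` set qs \<subseteq> V" "\<And>q m. q \<in> set qs \<Longrightarrow> m \<in> set (snd q) \<Longrightarrow> snd m" for qs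
    using that
  proof (induction qs)
    case (Cons q qs)
    obtain z b where q: "q = (z, b)" by (cases q)
    have "l \<in> set b \<or> l \<in> set (conjs qs)" using Cons.prems(1,2) l(2) unfolding q by auto
    then show ?case
    proof
      assume "l \<in> set b"
      then show ?thesis using Cons.prems(3)[of q l] q by simp
    next
      assume "l \<in> set (conjs qs)"
      then show ?thesis using Cons.IH Cons.prems by (metis image_subset_iff list.set_intros(2))
    qed
  qed simp
  have "snd l" if "l \<in> set (conjs (zip zs (map pos_word (tl ds))))"
  proof -
    have "fst ` set (zip zs (map pos_word (tl ds))) \<subseteq> V" using assms(2) by (auto dest: set_zip_leftD)
    moreover have "snd m" if "q \<in> set (zip zs (map pos_word (tl ds)))" "m \<in> set (snd q)" for q m
    proof -
      have "snd q \<in> set (map pos_word (tl ds))" using that(1) by (metis prod.collapse set_zip_rightD)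
      then show ?thesis using that(2) by auto
    qed
    ultimately show ?thesis using cj that by blast
  qed
  then show ?thesis using l(1) nin unfolding SF_True by auto
qed

end

text \<open>Every occurrence of a coefficient letter is replaced by a symbol of its own, \<open>Inr (j, i)\<close> for the
  \<open>i\<close>-th letter of the \<open>j\<close>-th coefficient; an empty coefficient gets one symbol with trivial label.\<close>

locale normal_word =
  fixes V :: "'a set" and xs ps and zcs :: "('a \<times> 'a word) list" and c0 :: "'a word"
  assumes dist: "distinct (xs @ map fst ps @ map snd ps @ map fst zcs)"
    and V: "V = set (xs @ map fst ps @ map snd ps @ map fst zcs)"
    and cfree: "\<And>b. b \<in> insert c0 (snd ` set zcs) \<Longrightarrow> fst ` set b \<inter> V = {}"
begin

definition bs :: "'a word list" where "bs = c0 # map snd zcs"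
definition C :: "'a set" where "C = (\<Union>b\<in>set bs. fst ` set b)"
definition S :: "'a word" where "S = squares xs @ commutators ps @ conjs zcs @ c0"
definition kk :: "nat \<Rightarrow> nat" where "kk j = max 1 (length (bs ! j))"
definition dd :: "nat \<Rightarrow> ('a + nat \<times> nat) list" where "dd j = map (\<lambda>i. Inr (j, i)) [0..<kk j]"
definition ds :: "('a + nat \<times> nat) list list" where "ds = map dd [0..<length bs]"
definition s0 :: "'a + nat \<times> nat \<Rightarrow> colour" where "s0 x = (case x of Inl _ \<Rightarrow> Col 0 0 | Inr (j, i) \<Rightarrow> Col j i)"
definition t0 :: "'a + nat \<times> nat \<Rightarrow> colour" where "t0 x = (case x of Inl _ \<Rightarrow> Col 0 0 | Inr (j, i) \<Rightarrow> Col j (Suc i mod kk j))"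
definition VD :: "('a + nat \<times> nat) set" where "VD = Inl ` V"
definition lab :: "'a + nat \<times> nat \<Rightarrow> 'a fgrp" where
  "lab x = (case x of Inl _ \<Rightarrow> 0 | Inr (j, i) \<Rightarrow> if j < length bs \<and> i < length (bs ! j) then sgn_of gen (bs ! j ! i) else 0)"
text \<open>The way back from symbols to letters; the symbol that stands for an empty coefficient
  disappears.\<close>

definition Lam :: "'a + nat \<times> nat \<Rightarrow> 'a fgrp" where
  "Lam x = (case x of Inl v \<Rightarrow> if v \<in> V then gen v else 0 | Inr _ \<Rightarrow> lab x)"
text \<open>A constant weighs as much as its label, so the symbol of an empty coefficient is free
  and the symbol word weighs as much as the normal form is long.\<close>

definition wt :: "'a + nat \<times> nat \<Rightarrow> nat" where "wt x = (case x of Inl _ \<Rightarrow> 1 | Inr _ \<Rightarrow> len (lab x))"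
definition N :: nat where "N = 2 * card V + sum_list (map length bs)"

lemma distinct_Inr: "distinct (concat (map (\<lambda>j. map (\<lambda>i. Inr (j, i)) [0..<k j]) [0..<m]))"
  by (induction m) (auto simp: distinct_map inj_on_def)

sublocale holes VD ds s0 t0
proof
  show "distinct (concat ds)" unfolding ds_def dd_def[abs_def] by (rule distinct_Inr)
  show "d \<noteq> []" if "d \<in> set ds" for d using that by (auto simp: ds_def dd_def kk_def)
  show "s0 (ds ! j ! i) = Col j i" "t0 (ds ! j ! i) = Col j (Suc i mod length (ds ! j))" if "j < length ds" "i < length (ds ! j)" for j i
    using that by (simp_all add: ds_def dd_def s0_def t0_def)
qed (auto simp: ds_def dd_def VD_def bs_def)

definition SD :: "('a + nat \<times> nat) word" where
  "SD = SF (map Inl xs) (map (map_prod Inl Inl) ps) (map (\<lambda>q. Inl (fst q)) zcs) (replicate (length ds) True)"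

lemma lds: "length ds = Suc (length zcs)" by (simp add: ds_def bs_def)

lemma lists_D: "map Inl xs @ map fst (map (map_prod Inl Inl) ps) @ map snd (map (map_prod Inl Inl) ps) @ map (\<lambda>q. Inl (fst q)) zcs =
    map Inl (xs @ map fst ps @ map snd ps @ map fst zcs)"
  by (simp add: comp_def)

lemma dist_D: "distinct (map Inl xs @ map fst (map (map_prod Inl Inl) ps) @ map snd (map (map_prod Inl Inl) ps) @ map (\<lambda>q. Inl (fst q)) zcs)"
  unfolding lists_D distinct_map using dist by simp

lemma set_D: "VD = set (map Inl xs @ map fst (map (map_prod Inl Inl) ps) @ map snd (map (map_prod Inl Inl) ps) @ map (\<lambda>q. Inl (fst q)) zcs)"
  proof -
  have "Inl ` V = Inl ` set (xs @ map fst ps @ map snd ps @ map fst zcs)" by (rule arg_cong[OF V])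
  then show ?thesis unfolding lists_D set_map VD_def .
qed

lemma subV: "set xs \<subseteq> V" "fst ` set ps \<union> snd ` set ps \<subseteq> V" "fst ` set zcs \<subseteq> V"
proof -
  have "V = set xs \<union> fst ` set ps \<union> snd ` set ps \<union> fst ` set zcs" by (subst V) (simp add: Un_assoc)
  then show "set xs \<subseteq> V" "fst ` set ps \<union> snd ` set ps \<subseteq> V" "fst ` set zcs \<subseteq> V" by blast+
qed

lemma ev_take: "n \<le> length (bs ! j) \<Longrightarrow> j < length bs \<Longrightarrow> ev Lam (pos_word (map (\<lambda>i. Inr (j, i)) [0..<n])) = cls (take n (bs ! j))"
  by (induction n) (simp_all add: Lam_def lab_def take_Suc_conv_app_nth)

lemma wsum_take: "n \<le> length (bs ! j) \<Longrightarrow> j < length bs \<Longrightarrow> wsum wt (pos_word (map (\<lambda>i. Inr (j, i)) [0..<n])) = n"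
  by (induction n) (simp_all add: wt_def lab_def)

lemma dd_ev: "j < length bs \<Longrightarrow> ev Lam (pos_word (dd j)) = cls (bs ! j)"
  using ev_take[of "length (bs ! j)" j] by (cases "bs ! j = []") (simp_all add: dd_def kk_def Lam_def lab_def max_def Suc_le_eq)

lemma dd_wsum: "j < length bs \<Longrightarrow> wsum wt (pos_word (dd j)) = length (bs ! j)"
  using wsum_take[of "length (bs ! j)" j] by (cases "bs ! j = []") (simp_all add: dd_def kk_def wt_def lab_def max_def Suc_le_eq)

lemma ds_wsum: "wsum wt (pos_word (concat ds)) = sum_list (map length bs)"
proof -
  have "wsum wt (pos_word (concat (map dd js))) = sum_list (map (\<lambda>j. length (bs ! j)) js)" if "set js \<subseteq> {..<length bs}" for js
    using that by (induction js) (simp_all add: dd_wsum)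
  from this[of "[0..<length bs]"] have "wsum wt (pos_word (concat ds)) = sum_list (map (\<lambda>j. length (bs ! j)) [0..<length bs])"
    unfolding ds_def by (simp add: atLeast0LessThan)
  also have "map (\<lambda>j. length (bs ! j)) [0..<length bs] = map length bs" by (rule nth_equalityI) simp_all
  finally show ?thesis .
qed

lemma SD_symbols: "symbols SD = mset (map Inl (xs @ map fst ps @ map snd ps @ map fst zcs)) + mset (map Inl (xs @ map fst ps @ map snd ps @ map fst zcs)) + mset (concat ds)"
proof -
  have "length (map (\<lambda>q. Inl (fst q)) zcs) = length ds - 1" by (simp add: lds)
  from SF_symbols[OF this, of "map Inl xs" "map (map_prod Inl Inl) ps"] show ?thesis unfolding SD_def lists_D .
qed

lemma SD_wsum: "wsum wt SD = N"
proof -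
  have "wsum wt SD = 2 * sum_list (map wt (map Inl (xs @ map fst ps @ map snd ps @ map fst zcs))) + sum_mset (image_mset wt (mset (concat ds)))"
    unfolding wsum_symbols SD_symbols by (simp add: sum_mset_sum_list flip: mset_map)
  also have "sum_mset (image_mset wt (mset (concat ds))) = wsum wt (pos_word (concat ds))"
    unfolding wsum_symbols by (simp add: comp_def)
  also have "map wt (map Inl (xs @ map fst ps @ map snd ps @ map fst zcs)) = map (\<lambda>_. 1) (xs @ map fst ps @ map snd ps @ map fst zcs)"
    by (simp add: wt_def)
  also have "sum_list \<dots> = card V"
  proof -
    have "sum_list (map (\<lambda>_. 1 :: nat) l) = length l" for l :: "'a list" by (induction l) auto
    moreover have "card V = length (xs @ map fst ps @ map snd ps @ map fst zcs)" by (subst V) (rule distinct_card[OF dist])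
    ultimately show ?thesis by (simp only:)
  qed
  finally show ?thesis unfolding ds_wsum N_def .
qed

lemma SD_ev: "ev Lam SD = cls S"
proof -
  have sq: "ev Lam (squares (map Inl ys)) = cls (squares ys)" if "set ys \<subseteq> V" for ys
    using that by (induction ys) (simp_all add: Lam_def)
  have cm: "ev Lam (commutators (map (map_prod Inl Inl) qs)) = cls (commutators qs)" if "fst ` set qs \<union> snd ` set qs \<subseteq> V" for qs
    using that by (induction qs) (auto simp: Lam_def)
  have cj: "ev Lam (conjs (zip (map (\<lambda>q. Inl (fst q)) qs) (map pos_word D))) = cls (conjs qs)"
    if "length D = length qs" "\<And>i. i < length qs \<Longrightarrow> ev Lam (pos_word (D ! i)) = cls (snd (qs ! i))" "fst ` set qs \<subseteq> V" for D qs
    using that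
  proof (induction qs arbitrary: D)
    case (Cons q qs)
    obtain z b where q: "q = (z, b)" by (cases q)
    obtain d D' where D: "D = d # D'" using Cons.prems(1) by (cases D) auto
    have "ev Lam (pos_word d) = cls b" using Cons.prems(2)[of 0] D q by simp
    moreover have "ev Lam (conjs (zip (map (\<lambda>q. Inl (fst q)) qs) (map pos_word D'))) = cls (conjs qs)"
      using Cons.prems(1,3) Cons.prems(2)[of "Suc _"] D by (intro Cons.IH) auto
    moreover have "Lam (Inl z) = gen z" using Cons.prems(3) q by (simp add: Lam_def)
    ultimately show ?case unfolding D q by simp
  qed simp
  have "ev Lam (conjs (zip (map (\<lambda>q. Inl (fst q)) zcs) (map pos_word (tl ds)))) = cls (conjs zcs)"
  proof (rule cj)
    fix i assume i: "i < length zcs"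
    then have "tl ds ! i = dd (Suc i)" by (simp add: ds_def nth_tl bs_def del: upt_Suc)
    moreover have "bs ! Suc i = snd (zcs ! i)" using i by (simp add: bs_def)
    ultimately show "ev Lam (pos_word (tl ds ! i)) = cls (snd (zcs ! i))" using dd_ev[of "Suc i"] i by (simp add: bs_def)
  qed (simp_all add: lds subV)
  moreover have "ev Lam (pos_word (hd ds)) = cls c0"
  proof -
    have "hd ds = dd 0" using ds0 by (simp add: hd_conv_nth ds_def)
    then show ?thesis using dd_ev[of 0] by (simp add: bs_def)
  qed
  ultimately show ?thesis unfolding SD_def SF_True S_def using sq[OF subV(1)] cm[OF subV(2)] by simp
qed

lemma lab_letters: "letters (lab x) \<subseteq> C"
proof (cases x)
  case (Inr p)
  obtain j i where p: "p = (j, i)" by (cases p)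
  show ?thesis
  proof (cases "j < length bs \<and> i < length (bs ! j)")
    case True
    then have "bs ! j ! i \<in> set (bs ! j)" "bs ! j \<in> set bs" by auto
    then have "fst (bs ! j ! i) \<in> C" unfolding C_def by blast
    moreover have "letters (sgn_of gen l) = {fst l}" for l :: "'a \<times> bool" by (simp add: sgn_of_def)
    ultimately show ?thesis using True Inr p by (simp add: lab_def)
  qed (auto simp: Inr p lab_def)
qed (simp add: lab_def)

lemma lab_len1: "len (lab x) \<le> 1"
  by (auto simp: lab_def split: sum.splits)

lemma CV: "C \<inter> V = {}"
  using cfree unfolding C_def bs_def by auto

lemma lab_fix: "(\<And>x. x \<notin> V \<Longrightarrow> h x = gen x) \<Longrightarrow> lift h (lab x) = lab x"
proof -
  assume h: "\<And>x. x \<notin> V \<Longrightarrow> h x = gen x"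
  have "ev h (rep (lab x)) = cls (rep (lab x))" by (rule ev_avoid[of _ V]) (use lab_letters[of x] CV h in blast)+
  then show ?thesis by (simp add: lift_def)
qed

text \<open>On symbols the solution is \<open>f1\<close>, then \<open>ED\<close>, then \<omega>.
  Inserting \<open>K'\<close> and its inverse \<open>ki\<close> splits it into \<phi>
  (\<open>f1\<close>, then \<open>ki\<close>), which fixes the word up to conjugacy, and \<eta>
  (\<open>K'\<close>, then \<open>ED\<close>), which is short. Both descend to letters along
  \<open>Lam\<close>.\<close>

theorem parametrize:
  assumes \<theta>: "\<And>x. x \<notin> V \<Longrightarrow> \<theta> x = gen x" "ev \<theta> S = 0" and \<tau>: "inj_on \<tau> V" "\<tau> ` V \<inter> C = {}"
    and Y: "\<And>v. v \<in> V \<Longrightarrow> letters (\<theta> v) \<subseteq> Y" "C \<subseteq> Y"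
  shows "generalizable V C (\<tau> ` V) Y S (if xs = [] then 4 * N else 35 * card V * N) \<theta>"
proof -
  define \<tau>' where "\<tau>' x = \<tau> (projl x)" for x :: "'a + nat \<times> nat"
  have im: "\<tau>' ` VD = \<tau> ` V" by (simp add: \<tau>'_def VD_def image_image)
  have fV: "finite V" unfolding V by simp
  interpret labels VD \<tau>' lab
  proof
    show "inj_on \<tau>' VD" using \<tau>(1) by (auto simp: inj_on_def \<tau>'_def VD_def)
    show "letters (lab x) \<inter> \<tau>' ` VD = {}" for x using lab_letters[of x] \<tau>(2) unfolding im by blast
  qed (use fV lab_len1 in \<open>auto simp: VD_def\<close>)
  define th where "th x = lift \<theta> (Lam x)" for x
  have thc: "th x = lab x" if "x \<notin> VD" for x
  proof (cases x)
    case (Inl v)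
    then show ?thesis using that by (auto simp: th_def Lam_def lab_def VD_def)
  next
    case (Inr p)
    then show ?thesis using lab_fix[OF \<theta>(1), of x] by (simp add: th_def Lam_def)
  qed
  have cnt: "count (symbols SD) x = 2" if "x \<in> VD" for x
  proof -
    let ?l = "map Inl (xs @ map fst ps @ map snd ps @ map fst zcs)"
    have "x \<in> set ?l" using that set_D unfolding lists_D by simp
    moreover have "distinct ?l" using dist_D unfolding lists_D .
    ultimately have "count (mset ?l) x = 1" by (metis distinct_count_atmost_1)
    moreover have "x \<notin> set (concat ds)" using that cst by blast
    then have "count (mset (concat ds)) x = 0" by (metis count_eq_zero_iff set_mset_mset)
    ultimately show ?thesis unfolding SD_symbols by (simp only: count_union)
  qed
  have "ev th SD = lift \<theta> (ev Lam SD)" unfolding th_def[abs_def] by (rule lift_ev[symmetric])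
  then have "ev th SD = 0" using \<theta>(2) unfolding SD_ev by simp
  from reduction[OF thc cnt this] obtain W' \<theta>' where W': "slid VD SD th W' \<theta>'" "ev (eta VD \<tau>' \<theta>') W' = 0" by blast
  obtain f1 where f1: "aut_on VD f1" "ev f1 SD = cls W'" "\<And>v. th v = lift \<theta>' (f1 v)" and sl: "symbols W' = symbols SD"
    "oriented VD SD \<Longrightarrow> mset W' = mset SD" "\<And>v. v \<notin> VD \<Longrightarrow> \<theta>' v = th v" "\<And>s0 t0. has_col VD s0 t0 SD \<Longrightarrow> has_col VD s0 t0 W'"
    "\<And>s0 t0. uniq_col VD s0 t0 SD \<Longrightarrow> uniq_col VD s0 t0 W'"
    using W'(1) unfolding slid_def by blast
  have \<theta>'c: "\<theta>' x = lab x" if "x \<notin> VD" for x using sl(3)[OF that] thc[OF that] by simp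
  have lz: "length (map (\<lambda>q. Inl (fst q)) zcs) = length ds - 1" by (simp add: lds)
  have subs: "set (map Inl xs) \<subseteq> VD" "fst ` set (map (map_prod Inl Inl) ps) \<subseteq> VD" "snd ` set (map (map_prod Inl Inl) ps) \<subseteq> VD"
    "set (map (\<lambda>q. Inl (fst q)) zcs) \<subseteq> VD" by (subst set_D, unfold set_append set_map, blast)+
  have hc: "has_col VD s0 t0 W'"
  proof (rule sl(4))
    have "distinct (map (\<lambda>q. Inl (fst q)) zcs)" "set (map Inl xs) \<inter> set (map (\<lambda>q. Inl (fst q)) zcs) = {}"
      "set (map fst (map (map_prod Inl Inl) ps)) \<inter> set (map (\<lambda>q. Inl (fst q)) zcs) = {}"
      "set (map snd (map (map_prod Inl Inl) ps)) \<inter> set (map (\<lambda>q. Inl (fst q)) zcs) = {}"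
      using dist_D unfolding distinct_append set_append by blast+
    then show "has_col VD s0 t0 SD" unfolding SD_def using subs lz by (intro SF_has_col) (simp_all add: image_image)
  qed
  have uc: "uniq_col VD s0 t0 W'"
    by (rule sl(5), unfold SD_def, rule SF_uniq_col[OF _ lz]) (subst set_D, simp add: Un_assoc image_image)
  define a0 where "a0 = hd (hd ds)"
  have a0: "a0 \<in> set (concat ds)" unfolding a0_def using ds0 ne[of "hd ds"] by (metis UN_I hd_in_set set_concat)
  have "a0 \<in># symbols W'" unfolding sl(1) SD_symbols using a0 by simp
  then obtain l where l: "l \<in> set W'" "fst l = a0" by auto
  then obtain u r where ur: "W' = u @ l # r" by (meson split_list)
  \<comment> \<open>Rotated to begin with the first symbol of the first hole, as
    \<open>normal_form\<close> requires; colourings and the conjugacy class do not notice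
    this.\<close>
  define W2 where "W2 = l # r @ u"
  have mW2: "mset W2 = mset W'" unfolding W2_def ur by simp
  have cW2: "cls W2 = - cls u + cls W' + cls u" unfolding W2_def ur by (simp add: group_simps)
  have sW2: "symbols W2 = symbols SD" unfolding mset_map mW2 using sl(1) by simp
  have c2V: "count (symbols W2) x = 2" if "x \<in> VD" for x unfolding sW2 by (rule cnt[OF that])
  have c2C: "count (symbols W2) x = count (mset (concat ds)) x" if "x \<notin> VD" for x
  proof -
    have "x \<notin> set (map Inl (xs @ map fst ps @ map snd ps @ map fst zcs))" using that set_D unfolding lists_D by simp
    then have "count (mset (map Inl (xs @ map fst ps @ map snd ps @ map fst zcs))) x = 0" by (metis count_eq_zero_iff set_mset_mset)
    then show ?thesis unfolding sW2 SD_symbols by (simp only: count_union)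
  qed
  have col2: "has_col VD s0 t0 W2" "uniq_col VD s0 t0 W2"
    using has_col_rotate[of VD s0 t0 u "l # r"] uniq_col_rotate[of VD s0 t0 u "l # r"] hc uc unfolding ur W2_def by simp_all
  \<comment> \<open>Orientability passes to the new word because slides only permute the letters of
    an oriented word, and back by the homomorphisms to the integers.\<close>
  have o2: "oriented VD W2 \<longleftrightarrow> xs = []"
  proof
    assume "oriented VD W2"
    then have "oriented VD W'" using oriented_mset[OF mW2] by simp
    from oriented_aut[OF f1(1,2) this cnt] have "oriented VD SD" .
    then show "xs = []" using SF_not_oriented[of "map Inl xs"] subs(1) unfolding SD_def by blast
  next
    assume x: "xs = []"
    have "oriented VD SD" unfolding SD_def unfolding x list.map
      by (rule SF_oriented[OF _ _ lz]) (use dist_D set_D x in simp_all)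
    then have "mset W2 = mset SD" using mW2 sl(2) by simp
    then show "oriented VD W2" using oriented_mset \<open>oriented VD SD\<close> by blast
  qed
  have pos2: "\<forall>l\<in>set W2. fst l \<notin> VD \<longrightarrow> snd l" if o: "oriented VD W2"
  proof (intro ballI impI)
    fix l assume l: "l \<in> set W2" "fst l \<notin> VD"
    have x: "xs = []" using o o2 by simp
    have "oriented VD SD" unfolding SD_def unfolding x list.map
      by (rule SF_oriented[OF _ _ lz]) (use dist_D set_D x in simp_all)
    then have "mset W2 = mset SD" using mW2 sl(2) by simp
    then have "l \<in> set SD" using l(1) by (metis set_mset_mset)
    then show "snd l" using SF_positive[of "map (map_prod Inl Inl) ps" "map (\<lambda>q. Inl (fst q)) zcs" "map Inl xs" l] l(2) subs
      unfolding SD_def by blast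
  qed
  have hl: "fst l = hd (hd ds)" using l(2) unfolding a0_def .
  have "\<exists>xs' ps' zs' es f g. (distinct (xs' @ map fst ps' @ map snd ps' @ zs')) \<and>
      (VD = set (xs' @ map fst ps' @ map snd ps' @ zs')) \<and>
      (length zs' = length ds - 1) \<and>
      (length es = length ds) \<and>
      (xs' = [] \<longleftrightarrow> oriented VD W2) \<and>
      (oriented VD W2 \<longrightarrow> (\<forall>l\<in>set W2. fst l \<notin> VD \<longrightarrow> snd l) \<longrightarrow> es = replicate (length ds) True) \<and>
      (aut_on VD f) \<and>
      (ev f (SF xs' ps' zs' es) = g + cls W2 - g) \<and>
      (\<forall>v\<in>VD. \<exists>k. f v = cls k \<and> (\<forall>wt. (\<forall>x. x \<notin> VD \<longrightarrow> wt x \<le> 1) \<longrightarrow>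
       wsum wt k \<le> (if v \<in> set zs' then 3 * wsum wt W2 + 1 else 2 * wsum wt W2 + 2)))"
    by (rule normal_form[OF _ _ col2 W2_def hl]) (erule c2V c2C)+
  then obtain xs' ps' zs' es f g where nf: "distinct (xs' @ map fst ps' @ map snd ps' @ zs')" "VD = set (xs' @ map fst ps' @ map snd ps' @ zs')"
    "length zs' = length ds - 1" "length es = length ds" "xs' = [] \<longleftrightarrow> oriented VD W2"
    "oriented VD W2 \<longrightarrow> (\<forall>l\<in>set W2. fst l \<notin> VD \<longrightarrow> snd l) \<longrightarrow> es = replicate (length ds) True"
    "aut_on VD f" "ev f (SF xs' ps' zs' es) = g + cls W2 - g"
    "\<forall>v\<in>VD. \<exists>k. f v = cls k \<and> (\<forall>wt. (\<forall>x. x \<notin> VD \<longrightarrow> wt x \<le> 1) \<longrightarrow>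
       wsum wt k \<le> (if v \<in> set zs' then 3 * wsum wt W2 + 1 else 2 * wsum wt W2 + 2))"
    by (elim exE conjE) (rule that; assumption)
  have wt1: "wt x \<le> 1" for x using lab_len1[of x] by (cases x) (simp_all add: wt_def)
  have NW: "wsum wt W2 = N" using SD_wsum unfolding wsum_symbols sW2 .
  \<comment> \<open>With 2 at most N, the bounds 3N + 1 and 2N + 2 become 4N and 3N.\<close>
  have N2: "2 \<le> N" if "V \<noteq> {}" 
  proof -
    have "0 < card V" using that fV by (simp add: card_gt_0_iff)
    then show ?thesis unfolding N_def by linarith
  qed
  have "\<exists>K. \<forall>v\<in>VD. f v = cls (K v) \<and> wsum wt (K v) \<le> (if v \<in> set zs' then 3 * N + 1 else 2 * N + 2)"
  proof -
    have "\<exists>k. f v = cls k \<and> wsum wt k \<le> (if v \<in> set zs' then 3 * N + 1 else 2 * N + 2)" if v: "v \<in> VD" for v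
    proof -
      obtain k where k: "f v = cls k" "(\<forall>x. x \<notin> VD \<longrightarrow> wt x \<le> 1) \<longrightarrow>
         wsum wt k \<le> (if v \<in> set zs' then 3 * wsum wt W2 + 1 else 2 * wsum wt W2 + 2)"
        using nf(9) v by blast
      have "wsum wt k \<le> (if v \<in> set zs' then 3 * N + 1 else 2 * N + 2)" using k(2) wt1 unfolding NW by blast
      then show ?thesis using k(1) by blast
    qed
    then show ?thesis by (intro bchoice) blast
  qed
  then obtain K0 where K0: "\<And>v. v \<in> VD \<Longrightarrow> f v = cls (K0 v)" "\<And>v. v \<in> VD \<Longrightarrow> wsum wt (K0 v) \<le> (if v \<in> set zs' then 3 * N + 1 else 2 * N + 2)"
    by blast
  define K where "K v = (if v \<in> VD then K0 v else [(v, True)])" for v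
  have fK: "f = cls_of K" by (rule ext) (simp add: K_def K0(1) aut_on_fix[OF nf(7)])
  have KB: "wsum wt (K v) \<le> (if v \<in> set zs' then 4 * N else 3 * N)" if v: "v \<in> VD" for v
  proof -
    have "V \<noteq> {}" using v unfolding VD_def by blast
    then show ?thesis using K0(2)[OF v] N2 v by (auto simp: K_def)
  qed
  have dsN: "wsum wt (pos_word (concat ds)) \<le> N" unfolding ds_wsum N_def by simp
  obtain K' g' where K': "aut_on VD (cls_of K')" "ev (cls_of K') SD = g' + cls W2 - g'"
    "\<And>v. v \<in> VD \<Longrightarrow> wsum wt (K' v) \<le> (if xs = [] then 4 * N else 35 * card V * N)"
  proof -
    have cV: "card VD = card V" unfolding VD_def by (simp add: card_image)
    have "\<exists>K' g'. aut_on VD (cls_of K') \<and> ev (cls_of K') SD = g' + cls W2 - g' \<and>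
      (\<forall>v\<in>VD. wsum wt (K' v) \<le> (if map Inl xs = ([] :: ('a + nat \<times> nat) list) then 4 * N else 35 * card VD * N))"
      unfolding SD_def
    proof (rule compare[OF dist_D set_D lz nf(1,2,3,4)])
      show "map Inl xs = ([] :: ('a + nat \<times> nat) list) \<longleftrightarrow> xs' = []" using nf(5) o2 by simp
      show "es = replicate (length ds) True" if "xs' = []" using nf(5,6) that pos2 by blast
      show "aut_on VD (cls_of K)" "ev (cls_of K) (SF xs' ps' zs' es) = g + cls W2 - g" using nf(7,8) unfolding fK by blast+
    qed (use KB dsN in \<open>auto simp: K_def\<close>)
    then show ?thesis using that unfolding cV by auto
  qed
  obtain ki where ki: "aut_on VD ki" "\<And>a. lift (cls_of K') (lift ki a) = a" "\<And>a. lift ki (lift (cls_of K') a) = a"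
    using aut_on_inverse[OF K'(1)] by blast
  define Ph where "Ph x = lift ki (f1 x)" for x
  have aPh: "aut_on VD Ph" unfolding Ph_def by (rule aut_on_comp[OF ki(1) f1(1)])
  obtain Pi where Pi: "aut_on VD Pi" "\<And>a. lift Ph (lift Pi a) = a" "\<And>a. lift Pi (lift Ph a) = a"
    using aut_on_inverse[OF aPh] by blast
  \<comment> \<open>An automorphism that fixes the constant symbols descends along
    \<open>Lam\<close>, since \<open>Lam\<close> sends the variable symbols to the generators in V
    and all others to elements without variables.\<close>
  define pr where "pr P v = (if v \<in> V then lift Lam (P (Inl v)) else gen v)" for P :: "'a + nat \<times> nat \<Rightarrow> ('a + nat \<times> nat) fgrp" and v
  have pr: "lift (pr P) (Lam x) = lift Lam (P x)" if P: "aut_on VD P" for P x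
  proof (cases x)
    case (Inl v)
    show ?thesis
    proof (cases "v \<in> V")
      case False
      then have "P x = gen x" using Inl by (intro aut_on_fix[OF P]) (auto simp: VD_def)
      then show ?thesis using False Inl by (simp add: Lam_def)
    qed (simp add: Inl Lam_def pr_def)
  next
    case (Inr p)
    then have "P x = gen x" by (intro aut_on_fix[OF P]) (auto simp: VD_def)
    moreover have "lift (pr P) (lab x) = lab x" by (rule lab_fix) (simp add: pr_def)
    ultimately show ?thesis using Inr by (simp add: Lam_def)
  qed
  have prl: "lift (pr P) (lift Lam y) = lift Lam (lift P y)" if "aut_on VD P" for P y
    unfolding lift_lift pr[OF that] ..
  have prinv: "lift (pr P) (pr P' v) = gen v" if "aut_on VD P" "\<And>a. lift P (lift P' a) = a" for P P' v
  proof (cases "v \<in> V")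
    case True
    have "lift P (P' (Inl v)) = gen (Inl v)" using that(2)[of "gen (Inl v)"] by simp
    then show ?thesis using True prl[OF that(1)] by (simp add: pr_def Lam_def)
  qed (simp add: pr_def)
  define \<phi> where "\<phi> = pr Ph"
  have a\<phi>: "aut_on V \<phi>"
  proof (rule aut_onI[where g = "pr Pi"])
    show "lift \<phi> (pr Pi x) = gen x" "lift (pr Pi) (\<phi> x) = gen x" for x
      unfolding \<phi>_def using prinv[OF aPh Pi(2)] prinv[OF Pi(1,3)] by blast+
  qed (simp_all add: \<phi>_def pr_def)
  have Lam_letters: "letters (Lam x) \<subseteq> V \<union> C" for x
    using lab_letters[of x] by (cases x) (auto simp: Lam_def)
  have ll: "letters (lift Lam y) \<subseteq> V \<union> C" for y using letters_lift[of Lam y] Lam_letters by blast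
  have \<phi>l: "letters (\<phi> v) \<subseteq> V \<union> C" if "v \<in> V" for v using ll that by (simp add: \<phi>_def pr_def)
  have "lift ki (cls W2) = - lift ki g' + cls SD + lift ki g'"
  proof -
    have "cls SD = lift ki (g' + cls W2 - g')" using ki(3)[of "cls SD"] K'(2) by simp
    then show ?thesis by (simp add: group_simps)
  qed
  moreover have "cls W' = cls u + cls W2 - cls u" unfolding cW2 by (simp add: group_simps)
  moreover have "ev Ph SD = lift ki (cls W')" unfolding Ph_def[abs_def] f1(2)[symmetric] by (rule lift_ev[symmetric])
  ultimately have PhSD: "ev Ph SD = (lift ki (cls u) - lift ki g') + cls SD - (lift ki (cls u) - lift ki g')"
    by (simp add: group_simps)
  have "ev \<phi> S = lift \<phi> (lift Lam (cls SD))" using SD_ev by simp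
  also have "\<dots> = lift Lam (ev Ph SD)" unfolding \<phi>_def prl[OF aPh] by simp
  finally have \<phi>S: "ev \<phi> S = lift Lam (lift ki (cls u) - lift ki g') + cls S - lift Lam (lift ki (cls u) - lift ki g')"
    unfolding PhSD by (simp add: SD_ev)
  define ED where "ED = eta VD \<tau>' \<theta>'"
  define \<eta> where "\<eta> v = (if v \<in> V then ev ED (K' (Inl v)) else gen v)" for v
  have \<eta>L: "lift \<eta> (Lam x) = lift ED (cls (K' x))" for x
  proof (cases "x \<in> VD")
    case False
    then have "cls (K' x) = gen x" by (rule aut_on_fix[OF K'(1)])
    moreover have "ED x = lab x" using False \<theta>'c by (simp add: ED_def eta_def)
    moreover have "lift \<eta> (lab x) = lab x" by (rule lab_fix) (simp add: \<eta>_def)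
    moreover have "Lam x = lab x" using False by (cases x) (auto simp: Lam_def lab_def VD_def)
    ultimately show ?thesis by simp
  qed (auto simp: Lam_def VD_def \<eta>_def)
  have \<eta>LL: "lift \<eta> (lift Lam y) = lift ED (lift (cls_of K') y)" for y
    by (simp add: lift_lift \<eta>L)
  have "ev \<eta> S = lift \<eta> (lift Lam (cls SD))" using SD_ev by simp
  also have "\<dots> = lift ED (ev (cls_of K') SD)" unfolding \<eta>LL by simp
  finally have "ev \<eta> S = lift ED g' + ev ED W2 - lift ED g'" unfolding K'(2) by simp
  moreover have "ev ED W2 = 0"
  proof -
    have "lift ED (cls W2) = - ev ED u + ev ED W' + ev ED u" unfolding cW2 by simp
    then show ?thesis using W'(2) unfolding ED_def by simp
  qed
  ultimately have \<eta>S: "ev \<eta> S = 0" by simp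
  have lenE: "len (ED x) \<le> wt x" for x
  proof (cases "x \<in> VD")
    case True
    then show ?thesis by (auto simp: ED_def eta_def VD_def wt_def)
  next
    case False
    then show ?thesis using \<theta>'c[OF False] by (cases x) (simp_all add: ED_def eta_def wt_def lab_def)
  qed
  have \<eta>B: "len (\<eta> v) \<le> (if xs = [] then 4 * N else 35 * card V * N)" if v: "v \<in> V" for v
  proof -
    have "len (\<eta> v) \<le> wsum (\<lambda>x. len (ED x)) (K' (Inl v))" using v len_ev[of ED] by (simp add: \<eta>_def wsum_def)
    also have "\<dots> \<le> wsum wt (K' (Inl v))" unfolding wsum_def using lenE by (intro sum_list_mono) blast
    also have "\<dots> \<le> (if xs = [] then 4 * N else 35 * card V * N)" using v by (intro K'(3)) (simp add: VD_def)
    finally show ?thesis .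
  qed
  have EDl: "letters (ED x) \<subseteq> \<tau> ` V \<union> C" for x
  proof (cases "x \<in> VD")
    case True
    then show ?thesis using im by (auto simp: ED_def eta_def)
  next
    case False
    then show ?thesis using \<theta>'c[OF False] lab_letters[of x] by (auto simp: ED_def eta_def)
  qed
  have \<eta>l: "letters (\<eta> v) \<subseteq> \<tau> ` V \<union> C" if "v \<in> V" for v using letters_ev[of ED "K' (Inl v)"] EDl that by (simp add: \<eta>_def) blast
  define \<omega> where "\<omega> = spec \<theta>'"
  have \<omega>o: "\<omega> y = gen y" if "y \<notin> \<tau> ` V" for y using that unfolding \<omega>_def spec_def im by simp
  have thY: "letters (th x) \<subseteq> Y" for x
  proof (cases "x \<in> VD")
    case True
    then obtain v where "x = Inl v" "v \<in> V" by (auto simp: VD_def)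
    then show ?thesis using Y(1)[of v] by (simp add: th_def Lam_def)
  next
    case False
    then show ?thesis using thc[OF False] lab_letters[of x] Y(2) by simp
  qed
  \<comment> \<open>The values of \<theta>' arise from those of \<theta> and the labels by the
    inverse of the moves, so they contain no new letters.\<close>
  have \<theta>'Y: "letters (\<theta>' x) \<subseteq> Y" for x
  proof -
    obtain f1i where "\<And>a. lift f1 (lift f1i a) = a" using aut_on_inverse[OF f1(1)] by metis
    then have "lift f1 (f1i x) = gen x" by (metis lift_gen)
    then have "\<theta>' x = lift \<theta>' (lift f1 (f1i x))" by simp
    also have "\<dots> = lift th (f1i x)" unfolding lift_lift f1(3)[symmetric] ..
    finally show ?thesis using letters_lift[of th "f1i x"] thY by auto
  qed
  have \<omega>Y: "letters (\<omega> y) \<subseteq> Y" if "y \<in> \<tau> ` V" for y using that \<theta>'Y unfolding \<omega>_def spec_def im by simp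
  have fin: "\<theta> v = lift \<omega> (lift \<eta> (\<phi> v))" if v: "v \<in> V" for v
  proof -
    have "lift \<eta> (\<phi> v) = lift ED (lift (cls_of K') (Ph (Inl v)))" using v \<eta>LL by (simp add: \<phi>_def pr_def)
    also have "\<dots> = lift ED (f1 (Inl v))" unfolding Ph_def ki(2) ..
    finally have "lift \<omega> (lift \<eta> (\<phi> v)) = lift \<omega> (lift ED (f1 (Inl v)))" by simp
    also have "\<dots> = lift \<theta>' (f1 (Inl v))"
    proof -
      have "lift (spec \<theta>') (eta VD \<tau>' \<theta>' x) = \<theta>' x" for x by (rule spec_eta) (rule \<theta>'c)
      then show ?thesis unfolding lift_lift \<omega>_def ED_def by simp
    qed
    also have "\<dots> = th (Inl v)" by (rule f1(3)[symmetric])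
    also have "\<dots> = \<theta> v" using v by (simp add: th_def Lam_def)
    finally show ?thesis by simp
  qed
  have A: "\<forall>v\<in>V. letters (\<phi> v) \<subseteq> V \<union> C" "\<exists>g. letters g \<subseteq> V \<union> C \<and> ev \<phi> S = g + cls S - g" "\<forall>x. x \<notin> V \<longrightarrow> \<eta> x = gen x"
    "\<forall>v\<in>V. len (\<eta> v) \<le> (if xs = [] then 4 * N else 35 * card V * N) \<and> letters (\<eta> v) \<subseteq> \<tau> ` V \<union> C"
    "\<forall>y. y \<notin> \<tau> ` V \<longrightarrow> \<omega> y = gen y" "\<forall>y\<in>\<tau> ` V. letters (\<omega> y) \<subseteq> Y" "\<forall>v\<in>V. \<theta> v = lift \<omega> (lift \<eta> (\<phi> v))"
  proof -
    show "\<forall>v\<in>V. letters (\<phi> v) \<subseteq> V \<union> C" by (rule ballI) (rule \<phi>l)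
    show "\<exists>g. letters g \<subseteq> V \<union> C \<and> ev \<phi> S = g + cls S - g" by (rule exI, rule conjI[OF ll \<phi>S])
    show "\<forall>x. x \<notin> V \<longrightarrow> \<eta> x = gen x" by (simp add: \<eta>_def)
    show "\<forall>v\<in>V. len (\<eta> v) \<le> (if xs = [] then 4 * N else 35 * card V * N) \<and> letters (\<eta> v) \<subseteq> \<tau> ` V \<union> C"
      by (rule ballI) (rule conjI[OF \<eta>B \<eta>l])
    show "\<forall>y. y \<notin> \<tau> ` V \<longrightarrow> \<omega> y = gen y" by (intro allI impI) (rule \<omega>o)
    show "\<forall>y\<in>\<tau> ` V. letters (\<omega> y) \<subseteq> Y" by (rule ballI) (rule \<omega>Y)
    show "\<forall>v\<in>V. \<theta> v = lift \<omega> (lift \<eta> (\<phi> v))" by (rule ballI) (rule fin)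
  qed
  show ?thesis unfolding generalizable_def
    by (rule exI[where x = \<phi>], rule exI[where x = \<eta>], rule exI[where x = \<omega>], intro conjI; fact a\<phi> \<eta>S A)
qed

end

lemma len_ev_split:
  assumes "\<And>x. x \<in> V \<Longrightarrow> len (h x) \<le> B" "\<And>x. x \<notin> V \<Longrightarrow> len (h x) \<le> 1"
  shows "len (ev h w) \<le> vcount V w * B + ccount V w"
proof -
  have "sum_list (map (\<lambda>l. len (h (fst l))) w) \<le> vcount V w * B + ccount V w"
  proof (induction w)
    case (Cons l w)
    then show ?case using assms(1)[of "fst l"] assms(2)[of "fst l"] by (cases "fst l \<in> V") simp_all
  qed simp
  then show ?thesis using len_ev[of h w] by simp
qed

lemma generalizableE:
  assumes "generalizable V C U Y Q B \<theta>"
  obtains \<phi> \<eta> \<omega> g where "aut_on V \<phi>" "\<forall>v\<in>V. letters (\<phi> v) \<subseteq> V \<union> C"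
     "\<forall>x. x \<notin> V \<longrightarrow> \<eta> x = gen x" "ev \<eta> Q = 0" "\<forall>v\<in>V. len (\<eta> v) \<le> B \<and> letters (\<eta> v) \<subseteq> U \<union> C"
     "\<forall>y. y \<notin> U \<longrightarrow> \<omega> y = gen y" "\<forall>y\<in>U. letters (\<omega> y) \<subseteq> Y" "\<forall>v\<in>V. \<theta> v = lift \<omega> (lift \<eta> (\<phi> v))"
     "letters g \<subseteq> V \<union> C" "ev \<phi> Q = g + cls Q - g"
  using assms unfolding generalizable_def by (elim exE conjE) (rule that; assumption)

lemma generalizable_mono: "generalizable V C U Y Q B \<theta> \<Longrightarrow> (V \<noteq> {} \<Longrightarrow> B \<le> B') \<Longrightarrow> generalizable V C U Y Q B' \<theta>"
proof -
  assume g: "generalizable V C U Y Q B \<theta>" and b: "V \<noteq> {} \<Longrightarrow> B \<le> B'"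
  obtain \<phi> \<eta> \<omega> g where G: "aut_on V \<phi>" "\<forall>v\<in>V. letters (\<phi> v) \<subseteq> V \<union> C"
     "\<forall>x. x \<notin> V \<longrightarrow> \<eta> x = gen x" "ev \<eta> Q = 0" "\<forall>v\<in>V. len (\<eta> v) \<le> B \<and> letters (\<eta> v) \<subseteq> U \<union> C"
     "\<forall>y. y \<notin> U \<longrightarrow> \<omega> y = gen y" "\<forall>y\<in>U. letters (\<omega> y) \<subseteq> Y" "\<forall>v\<in>V. \<theta> v = lift \<omega> (lift \<eta> (\<phi> v))"
     "letters g \<subseteq> V \<union> C" "ev \<phi> Q = g + cls Q - g"
    by (rule generalizableE[OF g])
  have 3: "\<exists>g. letters g \<subseteq> V \<union> C \<and> ev \<phi> Q = g + cls Q - g" using G(9,10) by blast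
  have 6: "\<forall>v\<in>V. len (\<eta> v) \<le> B' \<and> letters (\<eta> v) \<subseteq> U \<union> C"
  proof
    fix v assume v: "v \<in> V"
    then have "B \<le> B'" using b by blast
    then show "len (\<eta> v) \<le> B' \<and> letters (\<eta> v) \<subseteq> U \<union> C" using bspec[OF G(5) v] by linarith
  qed
  show ?thesis unfolding generalizable_def
    by (rule exI[where x = \<phi>], rule exI[where x = \<eta>], rule exI[where x = \<omega>], intro conjI; fact G(1,2) 3 G(3,4) 6 G(6-8))
qed

lemma ccount_wsum: "ccount V w = wsum (\<lambda>x. if x \<in> V then 0 else 1) w"
  by (induction w) auto

lemma ccount_symbols: "symbols u = symbols v \<Longrightarrow> ccount V u = ccount V v"
  unfolding ccount_wsum wsum_symbols by simp

lemma ccount_V: "fst ` set w \<subseteq> V \<Longrightarrow> ccount V w = 0"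
  by (induction w) auto

lemma ccount_const: "fst ` set w \<inter> V = {} \<Longrightarrow> ccount V w = length w" "fst ` set w \<inter> V = {} \<Longrightarrow> vcount V w = 0"
  by (induction w) auto

lemma symbols_conjs: "symbols (conjs zs) = mset (map fst zs) + mset (map fst zs) + symbols (concat (map snd zs))"
  by (induction zs) auto

context normal_word
begin

lemma S_ccount: "ccount V S = sum_list (map length bs)"
proof -
  have G: "ccount V (conjs qs) = sum_list (map length (map snd qs))" if "fst ` set qs \<subseteq> V" "\<And>b. b \<in> snd ` set qs \<Longrightarrow> fst ` set b \<inter> V = {}" for qs
    using that
  proof (induction qs)
    case (Cons q qs)
    obtain z b where q: "q = (z, b)" by (cases q)
    have "fst ` set b \<inter> V = {}" using Cons.prems(2)[of b] q by simp
    moreover have "ccount V (conjs qs) = sum_list (map length (map snd qs))" by (rule Cons.IH) (use Cons.prems in auto)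
    ultimately show ?case using Cons.prems(1) q by (simp add: ccount_const)
  qed simp
  have "ccount V (conjs zcs) = sum_list (map length (map snd zcs))" by (rule G[OF subV(3)]) (rule cfree, blast)
  moreover have "ccount V (squares xs) = 0" "ccount V (commutators ps) = 0"
    by (rule ccount_V, simp only: squares_letters commutators_letters subV)+
  moreover have "ccount V c0 = length c0" using cfree[of c0] by (simp add: ccount_const)
  ultimately show ?thesis by (simp add: S_def bs_def)
qed

lemma S_letters: "fst ` set S = V \<union> C"
proof -
  have "V = set xs \<union> fst ` set ps \<union> snd ` set ps \<union> fst ` set zcs" by (subst V) (simp add: Un_assoc)
  moreover have "fst ` set S = set xs \<union> (fst ` set ps \<union> snd ` set ps) \<union> (fst ` set zcs \<union> (\<Union>q\<in>set zcs. fst ` set (snd q))) \<union> fst ` set c0"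
    by (simp only: S_def set_append image_Un squares_letters commutators_letters conjs_letters Un_assoc)
  moreover have "C = fst ` set c0 \<union> (\<Union>q\<in>set zcs. fst ` set (snd q))" by (simp add: C_def bs_def)
  ultimately show ?thesis by (simp only: Un_ac)
qed

text \<open>If e carries S to Q, then conjugating \<phi> by e and composing \<eta> with the inverse
  of e turns a generalization for S into one for Q. The price is the inverse of e, counted in
  variables, each with a long value, and constants, each of length 1.\<close>

theorem transfer:
  assumes e: "aut_on V e" "ev e S = cls Q" "\<And>v. v \<in> V \<Longrightarrow> letters (e v) \<subseteq> V \<union> C"
    and k: "\<And>v. v \<in> V \<Longrightarrow> \<exists>k. ev e k = gen v \<and> fst ` set k \<subseteq> V \<union> C \<and> vcount V k \<le> p \<and> ccount V k \<le> q"
    and \<theta>: "\<And>x. x \<notin> V \<Longrightarrow> \<theta> x = gen x" "ev \<theta> Q = 0" and \<tau>: "inj_on \<tau> V" "\<tau> ` V \<inter> C = {}"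
    and Y: "\<And>v. v \<in> V \<Longrightarrow> letters (\<theta> v) \<subseteq> Y" "C \<subseteq> Y"
  shows "generalizable V C (\<tau> ` V) Y Q (p * (if xs = [] then 4 * N else 35 * card V * N) + q) \<theta>"
proof -
  define B where "B = (if xs = [] then 4 * N else 35 * card V * N)"
  define \<theta>S where "\<theta>S x = lift \<theta> (e x)" for x
  have 1: "\<theta>S x = gen x" if "x \<notin> V" for x using aut_on_fix[OF e(1) that] \<theta>(1)[OF that] by (simp add: \<theta>S_def)
  have "ev \<theta>S S = lift \<theta> (ev e S)" unfolding \<theta>S_def[abs_def] by (rule lift_ev[symmetric])
  then have 2: "ev \<theta>S S = 0" using e(2) \<theta>(2) by simp
  have \<theta>Y: "letters (\<theta> x) \<subseteq> Y" if x: "x \<in> V \<union> C" for x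
  proof (cases "x \<in> V")
    case False
    then show ?thesis using \<theta>(1)[OF False] x Y(2) by auto
  qed (rule Y(1))
  have 3: "letters (\<theta>S v) \<subseteq> Y" if "v \<in> V" for v
  proof -
    have "(\<Union>x\<in>letters (e v). letters (\<theta> x)) \<subseteq> Y" using e(3)[OF that] \<theta>Y by blast
    then show ?thesis using letters_lift[of \<theta> "e v"] unfolding \<theta>S_def by (rule subset_trans[rotated])
  qed
  have "generalizable V C (\<tau> ` V) Y S B \<theta>S" unfolding B_def
    by (rule parametrize[OF _ 2 \<tau> _ Y(2)]) (erule 1 3)+
  then obtain \<phi>S \<eta>S \<omega> g where G: "aut_on V \<phi>S" "\<forall>v\<in>V. letters (\<phi>S v) \<subseteq> V \<union> C"
     "\<forall>x. x \<notin> V \<longrightarrow> \<eta>S x = gen x" "ev \<eta>S S = 0" "\<forall>v\<in>V. len (\<eta>S v) \<le> B \<and> letters (\<eta>S v) \<subseteq> \<tau> ` V \<union> C"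
     "\<forall>y. y \<notin> \<tau> ` V \<longrightarrow> \<omega> y = gen y" "\<forall>y\<in>\<tau> ` V. letters (\<omega> y) \<subseteq> Y" "\<forall>v\<in>V. \<theta>S v = lift \<omega> (lift \<eta>S (\<phi>S v))"
     "letters g \<subseteq> V \<union> C" "ev \<phi>S S = g + cls S - g"
    by (rule generalizableE)
  obtain ei where ei: "aut_on V ei" "\<And>a. lift e (lift ei a) = a" "\<And>a. lift ei (lift e a) = a"
    using aut_on_inverse[OF e(1)] by blast
  have eik: "\<exists>k. ei v = cls k \<and> fst ` set k \<subseteq> V \<union> C \<and> vcount V k \<le> p \<and> ccount V k \<le> q" if v: "v \<in> V" for v
  proof -
    obtain k where k: "ev e k = gen v" "fst ` set k \<subseteq> V \<union> C" "vcount V k \<le> p" "ccount V k \<le> q" using assms(4)[OF v] by blast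
    have "cls k = lift ei (lift e (cls k))" using ei(3)[of "cls k"] by simp
    also have "\<dots> = ei v" using k(1) by simp
    finally show ?thesis using k(2-4) by metis
  qed
  define \<phi> where "\<phi> v = lift e (lift \<phi>S (ei v))" for v
  define \<eta> where "\<eta> v = lift \<eta>S (ei v)" for v
  have eQ: "lift ei (cls Q) = cls S" using ei(3)[of "cls S"] e(2) by simp
  have comp\<eta>: "lift \<eta> y = lift \<eta>S (lift ei y)" for y unfolding \<eta>_def by (simp add: lift_lift)
  have comp\<phi>: "lift \<phi> y = lift e (lift \<phi>S (lift ei y))" for y unfolding \<phi>_def by (simp add: lift_lift)
  have VCl: "letters (lift h y) \<subseteq> V \<union> C" if "\<And>v. v \<in> V \<Longrightarrow> letters (h v) \<subseteq> V \<union> C" "\<And>v. v \<notin> V \<Longrightarrow> h v = gen v" "letters y \<subseteq> V \<union> C" for h :: "'a \<Rightarrow> 'a fgrp" and y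
  proof -
    have "letters (h x) \<subseteq> V \<union> C" if "x \<in> V \<union> C" for x
    proof (cases "x \<in> V")
      case False
      then show ?thesis using \<open>\<And>v. v \<notin> V \<Longrightarrow> h v = gen v\<close> that by simp
    qed (use that \<open>\<And>v. v \<in> V \<Longrightarrow> letters (h v) \<subseteq> V \<union> C\<close> in blast)
    then have "(\<Union>x\<in>letters y. letters (h x)) \<subseteq> V \<union> C" using that(3) by blast
    then show ?thesis using letters_lift[of h y] by (rule subset_trans[rotated])
  qed
  have A1: "aut_on V \<phi>" unfolding \<phi>_def by (rule aut_on_comp[OF e(1) aut_on_comp[OF G(1) ei(1)]])
  have A2: "\<forall>v\<in>V. letters (\<phi> v) \<subseteq> V \<union> C"
  proof
    fix v assume v: "v \<in> V"
    obtain k where k: "ei v = cls k" "fst ` set k \<subseteq> V \<union> C" using eik[OF v] by blast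
    have "letters (ei v) \<subseteq> V \<union> C" unfolding k(1) using cls_letters[of k] k(2) by (rule subset_trans)
    then show "letters (\<phi> v) \<subseteq> V \<union> C" unfolding \<phi>_def
      by (intro VCl e(3) aut_on_fix[OF e(1)] bspec[OF G(2)] aut_on_fix[OF G(1)])
  qed
  have A3: "\<exists>g. letters g \<subseteq> V \<union> C \<and> ev \<phi> Q = g + cls Q - g"
  proof -
    note g = G(9,10)
    have "ev \<phi> Q = lift \<phi> (cls Q)" by simp
    also have "\<dots> = lift e (ev \<phi>S S)" unfolding comp\<phi> eQ by simp
    also have "\<dots> = lift e g + cls Q - lift e g" unfolding g(2) using e(2) by simp
    finally have "ev \<phi> Q = lift e g + cls Q - lift e g" .
    moreover have "letters (lift e g) \<subseteq> V \<union> C" by (intro VCl e(3) aut_on_fix[OF e(1)] g(1))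
    ultimately show ?thesis by blast
  qed
  have A4: "\<forall>x. x \<notin> V \<longrightarrow> \<eta> x = gen x" using aut_on_fix[OF ei(1)] G(3) by (simp add: \<eta>_def)
  have "ev \<eta> Q = lift \<eta> (cls Q)" by simp
  also have "\<dots> = 0" unfolding comp\<eta> eQ using G(4) by simp
  finally have A5: "ev \<eta> Q = 0" .
  have A6: "\<forall>v\<in>V. len (\<eta> v) \<le> p * B + q \<and> letters (\<eta> v) \<subseteq> \<tau> ` V \<union> C"
  proof
    fix v assume v: "v \<in> V"
    obtain k where k: "ei v = cls k" "fst ` set k \<subseteq> V \<union> C" "vcount V k \<le> p" "ccount V k \<le> q" using eik[OF v] by blast
    have \<eta>v: "\<eta> v = ev \<eta>S k" by (simp add: \<eta>_def k(1))
    have "len (\<eta> v) \<le> vcount V k * B + ccount V k" unfolding \<eta>v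
      by (rule len_ev_split) (use G(3,5) in simp_all)
    also have "\<dots> \<le> p * B + q" using k(3,4) by (intro add_mono mult_le_mono1)
    finally have "len (\<eta> v) \<le> p * B + q" .
    moreover have "letters (\<eta>S x) \<subseteq> \<tau> ` V \<union> C" if "x \<in> V \<union> C" for x
    proof (cases "x \<in> V")
      case False
      then show ?thesis using G(3) that by simp
    qed (use G(5) in blast)
    then have "(\<Union>x\<in>fst ` set k. letters (\<eta>S x)) \<subseteq> \<tau> ` V \<union> C" using k(2) by blast
    then have "letters (\<eta> v) \<subseteq> \<tau> ` V \<union> C" unfolding \<eta>v using letters_ev[of \<eta>S k] by (rule subset_trans[rotated])
    ultimately show "len (\<eta> v) \<le> p * B + q \<and> letters (\<eta> v) \<subseteq> \<tau> ` V \<union> C" by blast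
  qed
  have A9: "\<forall>v\<in>V. \<theta> v = lift \<omega> (lift \<eta> (\<phi> v))"
  proof
    fix v assume v: "v \<in> V"
    obtain k where k: "ei v = cls k" "fst ` set k \<subseteq> V \<union> C" using eik[OF v] by blast
    have h: "lift \<omega> (lift \<eta>S (\<phi>S x)) = \<theta>S x" if x: "x \<in> V \<union> C" for x
    proof (cases "x \<in> V")
      case False
      then have "x \<notin> \<tau> ` V" using x \<tau>(2) by blast
      then show ?thesis using False aut_on_fix[OF G(1) False] G(3,6) 1[OF False] by simp
    qed (use G(8) in simp)
    have "lift \<eta> (\<phi> v) = lift \<eta>S (lift \<phi>S (ei v))" unfolding comp\<eta> \<phi>_def ei(3) ..
    then have "lift \<omega> (lift \<eta> (\<phi> v)) = ev (\<lambda>x. lift \<omega> (lift \<eta>S (\<phi>S x))) k" by (simp add: k(1) lift_ev)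
    also have "\<dots> = ev \<theta>S k" by (rule ev_cong, rule h) (use k(2) in blast)
    also have "\<dots> = lift \<theta> (lift e (ei v))" unfolding k(1) \<theta>S_def by (simp add: lift_ev)
    also have "lift e (ei v) = gen v" using ei(2)[of "gen v"] by simp
    finally show "\<theta> v = lift \<omega> (lift \<eta> (\<phi> v))" by simp
  qed
  show ?thesis unfolding generalizable_def B_def[symmetric]
    by (rule exI[where x = \<phi>], rule exI[where x = \<eta>], rule exI[where x = \<omega>], intro conjI; fact A1 A2 A3 A4 A5 A6 G(6,7) A9)
qed

end

text \<open>A variable of Q is, up to sign, the quotient of two neighbouring prefixes, and the
  inverse of f turns a prefix into a word with at most 2n variables and c constants. Hence p = 4n
  and q = 2c in \<open>transfer\<close>; with N = c + 2n the totals 16nN + 2c and 140n^2 N + 2c stay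
  below the stated bounds.\<close>

theorem generalizable_general:
  fixes Q :: "'a word"
  assumes fin: "finite V" and q: "\<And>x. x \<in> V \<Longrightarrow> count (symbols Q) x = 2"
    and \<theta>: "\<And>x. x \<notin> V \<Longrightarrow> \<theta> x = gen x" "ev \<theta> Q = 0" and \<tau>: "inj_on \<tau> V" "\<tau> ` V \<inter> (fst ` set Q - V) = {}"
    and Y: "\<And>v. v \<in> V \<Longrightarrow> letters (\<theta> v) \<subseteq> Y" "fst ` set Q - V \<subseteq> Y"
  shows "generalizable V (fst ` set Q - V) (\<tau> ` V) Y Q
    (if oriented V Q then 40 * card V * (ccount V Q + 2 * card V) else 150 * card V ^ 2 * (ccount V Q + 2 * card V)) \<theta>"
proof -
  have quad: "quad V Q" using q by (simp add: quad_def)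
  obtain xs ps zs b where ext: "ext V Q xs ps zs b" and b: "fst ` set b \<inter> V = {}" and xo: "xs = [] \<longleftrightarrow> oriented V Q"
    using ext_full_exists[OF quad] by blast
  obtain f where f: "reducing V Q (moved_vars xs ps zs) (squares xs @ commutators ps @ conjs zs) b (2 * (length xs + 2 * length ps + length zs)) f"
    using ext_reducing[OF ext quad] by blast
  note r = reducingD[OF f]
  define vs where "vs = xs @ map fst ps @ map snd ps @ map fst zs"
  have M: "symbols Q = mset vs + mset vs + symbols (concat (map snd zs) @ b)"
    unfolding ext_symbols[OF ext] vs_def map_append mset_append symbols_squares symbols_commutators symbols_conjs by (simp add: ac_simps)
  have zc: "fst ` set c \<inter> V = {}" if c: "c \<in> insert b (snd ` set zs)" for c
  proof (cases "c = b")
    case False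
    then obtain z where "(z, c) \<in> set zs" using c by auto
    then show ?thesis by (rule ext_hole_consts[OF ext])
  qed (use b in simp)
  have ze: "count (symbols (concat (map snd zs) @ b)) x = 0" if "x \<in> V" for x
  proof -
    have "x \<notin> fst ` set (concat (map snd zs) @ b)" 
    proof -
      have "fst ` set (snd z) \<inter> V = {}" if "z \<in> set zs" for z using zc[of "snd z"] that by blast
      then have "\<forall>z\<in>set zs. V \<inter> fst ` set (snd z) = {}" by blast
      then have "(\<Union>z\<in>set zs. fst ` set (snd z)) \<inter> V = {}" by (subst Int_commute) (simp only: Int_UN_distrib SUP_bot_conv)
      moreover have "fst ` set (concat (map snd zs) @ b) = (\<Union>z\<in>set zs. fst ` set (snd z)) \<union> fst ` set b"
        by (simp add: image_Un image_UN)
      ultimately have "fst ` set (concat (map snd zs) @ b) \<inter> V = {}" using b by (simp only: Int_Un_distrib2 Un_empty simp_thms)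
      then show ?thesis using that by (meson disjoint_iff)
    qed
    then show ?thesis using count_symbols_pos[of x "concat (map snd zs) @ b"] by linarith
  qed
  have c1: "count (mset vs) x = 1" if "x \<in> V" for x using q[OF that] ze[OF that] unfolding M count_union by linarith
  have sub: "set vs \<subseteq> V" using ext_vars[OF ext] unfolding vs_def moved_vars_def by auto
  have "count (mset vs) x = (if x \<in> set vs then 1 else 0)" for x
  proof (cases "x \<in> set vs")
    case False
    then have "count (mset vs) x = 0" by (metis count_eq_zero_iff set_mset_mset)
    with False show ?thesis by simp
  qed (use c1 sub in auto)
  then have dvs: "distinct vs" unfolding distinct_count_atmost_1 by blast
  have Vvs: "V = set vs"
  proof
    show "V \<subseteq> set vs"
    proof
      fix x assume "x \<in> V"
      from c1[OF this] have "x \<in># mset vs" by (simp only: count_greater_zero_iff[symmetric])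
      then show "x \<in> set vs" by (simp only: set_mset_mset)
    qed
  qed (rule sub)
  interpret normal_word V xs ps zs b
    by unfold_locales (use dvs Vvs zc in \<open>simp_all only: vs_def\<close>)
  have msS: "symbols S = symbols Q" unfolding S_def ext_symbols[OF ext] by simp
  have SQ: "fst ` set S = fst ` set Q" using arg_cong[OF msS, of set_mset] by simp
  have C: "fst ` set Q - V = C" using S_letters CV unfolding SQ by blast
  have cN: "N = 2 * card V + ccount V Q" unfolding N_def S_ccount[symmetric] ccount_symbols[OF msS] ..
  have lvs: "length xs + 2 * length ps + length zs = card V"
  proof -
    have "card V = length vs" by (subst Vvs) (rule distinct_card[OF dvs])
    then show ?thesis by (simp add: vs_def)
  qed
  have Ev: "moved_vars xs ps zs = V" by (subst Vvs) (auto simp: moved_vars_def vs_def)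
  have bC: "fst ` set b \<subseteq> C" unfolding C_def bs_def by auto
  have QVC: "fst ` set Q = V \<union> C" using S_letters unfolding SQ .
  have "generalizable V C (\<tau> ` V) Y Q ((4 * card V) * (if xs = [] then 4 * N else 35 * card V * N) + 2 * ccount V Q) \<theta>"
  proof (rule transfer)
    show "aut_on V f" by (rule r(1))
    show "ev f S = cls Q" using r(4) unfolding S_def by simp
    show "letters (f v) \<subseteq> V \<union> C" if v: "v \<in> V" for v
    proof -
      obtain k where k: "f v = cls k" "fst ` set k \<subseteq> fst ` set Q" using r(5)[of v] v Ev by blast
      show ?thesis using subset_trans[OF cls_letters k(2)] unfolding k(1) QVC .
    qed
    show "\<exists>k. ev f k = gen v \<and> fst ` set k \<subseteq> V \<union> C \<and> vcount V k \<le> 4 * card V \<and> ccount V k \<le> 2 * ccount V Q" if v: "v \<in> V" for v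
    proof -
      have pre: "\<exists>u. cls P = ev f u \<and> fst ` set u \<subseteq> V \<union> C \<and> vcount V u \<le> 2 * card V \<and> ccount V u \<le> ccount V Q" if PQ: "Q = P @ R" for P R
      proof -
        obtain s p q where s: "b = p @ q" "cls P = ev f (s @ p)" "fst ` set s \<subseteq> moved_vars xs ps zs \<union> (fst ` set Q - V)"
          "vcount V s \<le> 2 * (length xs + 2 * length ps + length zs)" "ccount V s + ccount V b \<le> ccount V Q"
          using r(6)[OF PQ] by blast
        have "fst ` set p \<subseteq> C" using bC unfolding s(1) by auto
        moreover have "vcount V p = 0" using b unfolding s(1) by (intro ccount_const(2)) auto
        moreover have "ccount V s + ccount V p \<le> ccount V Q" using s(5) unfolding s(1) by simp
        moreover have "fst ` set s \<subseteq> V \<union> C" using s(3) unfolding Ev C by blast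
        ultimately show ?thesis using s(2,4) unfolding lvs by (intro exI[of _ "s @ p"]) (simp add: image_Un, blast)
      qed
      have "v \<in> fst ` set Q" using v QVC by blast
      then obtain l where l: "l \<in> set Q" "fst l = v" by auto
      then obtain P R where PR: "Q = P @ l # R" by (meson split_list)
      obtain u1 where u1: "cls P = ev f u1" "fst ` set u1 \<subseteq> V \<union> C" "vcount V u1 \<le> 2 * card V" "ccount V u1 \<le> ccount V Q"
        using pre[OF PR] by blast
      have "Q = (P @ [l]) @ R" using PR by simp
      from pre[OF this] obtain u2 where u2: "cls (P @ [l]) = ev f u2" "fst ` set u2 \<subseteq> V \<union> C" "vcount V u2 \<le> 2 * card V" "ccount V u2 \<le> ccount V Q"
        by blast
      have "sgn_of gen l = - cls P + cls (P @ [l])" by simp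
      then have sg: "sgn_of gen l = - ev f u1 + ev f u2" unfolding u1(1) u2(1) .
      define k where "k = (if snd l then winv u1 @ u2 else winv u2 @ u1)"
      have "ev f k = gen v"
      proof (cases "snd l")
        case False
        then have "- gen v = - ev f u1 + ev f u2" using sg l(2) by (simp add: sgn_of_def)
        then have "gen v = - (- ev f u1 + ev f u2)" by (metis minus_minus)
        then show ?thesis using False by (simp add: k_def minus_add)
      qed (use sg l(2) in \<open>simp add: k_def sgn_of_def\<close>)
      moreover have "fst ` set k \<subseteq> V \<union> C" using u1(2) u2(2) fst_set_winv unfolding k_def by (simp add: image_Un)
      moreover have "vcount V k \<le> 4 * card V" "ccount V k \<le> 2 * ccount V Q" using u1(3,4) u2(3,4) by (simp_all add: k_def)
      ultimately show ?thesis by blast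
    qed
  qed (use \<theta> \<tau> Y in \<open>simp_all only: C\<close>)
  then show ?thesis unfolding C
  proof (rule generalizable_mono)
    assume "V \<noteq> {}"
    then have n: "1 \<le> card V" using fin by (simp add: Suc_le_eq card_gt_0_iff)
    have NN: "ccount V Q + 2 * card V = N" unfolding cN by simp
    have cc: "2 * ccount V Q \<le> 2 * N" unfolding cN by simp
    have nN: "N \<le> card V * N" using n by simp
    then have nnN: "N \<le> card V * (card V * N)" using n by (metis mult_le_mono1 nat_mult_1 order_trans)
    show "4 * card V * (if xs = [] then 4 * N else 35 * card V * N) + 2 * ccount V Q
      \<le> (if oriented V Q then 40 * card V * (ccount V Q + 2 * card V) else 150 * (card V)\<^sup>2 * (ccount V Q + 2 * card V))"
    proof -
      define M where "M = card V * N"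
      define L where "L = card V * M"
      have E: "4 * card V * (4 * N) = 16 * M" "4 * card V * (35 * card V * N) = 140 * L" "40 * card V * N = 40 * M" "150 * (card V)\<^sup>2 * N = 150 * L"
        by (simp_all add: M_def L_def power2_eq_square mult.assoc)
      have "N \<le> M" "N \<le> L" unfolding M_def L_def by (fact nN nnN)+
      then have i: "4 * card V * (4 * N) + 2 * ccount V Q \<le> 40 * card V * N"
        "4 * card V * (35 * card V * N) + 2 * ccount V Q \<le> 150 * (card V)\<^sup>2 * N" using cc E by linarith+
      show ?thesis unfolding NN xo[symmetric]
      proof (cases "xs = []")
        case True
        show "4 * card V * (if xs = [] then 4 * N else 35 * card V * N) + 2 * ccount V Q \<le> (if xs = [] then 40 * card V * N else 150 * (card V)\<^sup>2 * N)"
          unfolding if_P[OF True] by (rule i(1))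
      next
        case False
        show "4 * card V * (if xs = [] then 4 * N else 35 * card V * N) + 2 * ccount V Q \<le> (if xs = [] then 40 * card V * N else 150 * (card V)\<^sup>2 * N)"
          unfolding if_not_P[OF False] by (rule i(2))
      qed
    qed
  qed
qed

text \<open>Only the coefficient part differs in shape from that of S. Sending z to c1 z^-1 turns z
  b z^-1 into c1 z^-1 b z c1^-1, neighbouring copies of c1 cancel, and the last coefficient moves to
  the front. The inverse sends z to z^-1 c1, so p = 1 and q is the length of c1, which is at most
  N.\<close>

theorem generalizable_standard:
  assumes nw: "normal_word V xs ps zcs c1" and Q: "Q = squares xs @ commutators ps @ coeff_part c1 zcs"
    and \<theta>: "\<And>x. x \<notin> V \<Longrightarrow> \<theta> x = gen x" "ev \<theta> Q = 0" and \<tau>: "inj_on \<tau> V" "\<tau> ` V \<inter> (fst ` set Q - V) = {}"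
    and Y: "\<And>v. v \<in> V \<Longrightarrow> letters (\<theta> v) \<subseteq> Y" "fst ` set Q - V \<subseteq> Y"
  shows "generalizable V (fst ` set Q - V) (\<tau> ` V) Y Q
    (if xs = [] then 8 * (ccount V Q + 2 * card V) else 36 * card V * (ccount V Q + 2 * card V)) \<theta>"
proof -
  interpret normal_word V xs ps zcs c1 by (rule nw)
  define Z where "Z = fst ` set zcs"
  have mc: "symbols (coeff_part c1 qs) = symbols (conjs qs @ c1)" for qs
    by (induction qs) (auto simp: coeff_part_def ac_simps)
  have msS: "symbols S = symbols Q" unfolding S_def Q map_append mset_append mc by (simp add: ac_simps)
  have SQ: "fst ` set S = fst ` set Q" using arg_cong[OF msS, of set_mset] by simp
  have C: "fst ` set Q - V = C" using S_letters CV unfolding SQ by blast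
  have cN: "N = 2 * card V + ccount V Q" unfolding N_def S_ccount[symmetric] ccount_symbols[OF msS] ..
  have c1V: "fst ` set c1 \<inter> V = {}" using cfree by simp
  have ZV: "Z \<subseteq> V" unfolding Z_def by (rule subV(3))
  define e where "e v = (if v \<in> Z then cls c1 - gen v else gen v)" for v
  have ec: "ev e w = cls w" if "fst ` set w \<inter> V = {}" for w
    by (rule ev_avoid[of _ Z]) (use that ZV in \<open>auto simp: e_def\<close>)
  have ae: "aut_on V e"
  proof (rule aut_onI[where g = "\<lambda>v. if v \<in> Z then - gen v + cls c1 else gen v"])
    have "ev (\<lambda>v. if v \<in> Z then - gen v + cls c1 else gen v) c1 = cls c1"
      by (rule ev_avoid[of _ Z]) (use c1V ZV in auto)
    then show "lift (\<lambda>v. if v \<in> Z then - gen v + cls c1 else gen v) (e x) = gen x" for x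
      by (simp add: e_def group_simps)
    show "lift e (if x \<in> Z then - gen x + cls c1 else gen x) = gen x" for x
      using ec[OF c1V] by (simp add: e_def group_simps)
  qed (use ZV in \<open>auto simp: e_def\<close>)
  have cj: "ev e (conjs qs) = cls c1 + cls (concat (map (\<lambda>(z, c). [(z, False)] @ c @ [(z, True)]) qs)) - cls c1" if "set qs \<subseteq> set zcs" for qs
    using that
  proof (induction qs)
    case (Cons q qs)
    obtain z b where q: "q = (z, b)" by (cases q)
    have zb: "z \<in> Z" "fst ` set b \<inter> V = {}" using Cons.prems q cfree[of b] unfolding Z_def by force+
    have IH: "ev e (conjs qs) = cls c1 + cls (concat (map (\<lambda>(z, c). [(z, False)] @ c @ [(z, True)]) qs)) - cls c1"
      by (rule Cons.IH) (use Cons.prems in simp)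
    have "e z = cls c1 - gen z" using zb(1) by (simp add: e_def)
    then show ?case using ec[OF zb(2)] IH unfolding q by (simp add: group_simps)
  qed simp
  have dZ: "(set xs \<union> (fst ` set ps \<union> snd ` set ps)) \<inter> Z = {}" using dist unfolding Z_def by auto
  have eS: "ev e S = cls Q"
  proof -
    have "ev e (squares xs) = cls (squares xs)" "ev e (commutators ps) = cls (commutators ps)"
      by (rule ev_avoid[of _ Z], use dZ in \<open>unfold squares_letters commutators_letters, blast\<close>, simp add: e_def)+
    then show ?thesis using cj[OF subset_refl] ec[OF c1V] unfolding S_def Q coeff_part_def by (simp add: group_simps)
  qed
  have c1C: "fst ` set c1 \<subseteq> C" unfolding C_def bs_def by auto
  have "generalizable V C (\<tau> ` V) Y Q (1 * (if xs = [] then 4 * N else 35 * card V * N) + length c1) \<theta>"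
  proof (rule transfer[OF ae eS])
    show "letters (e v) \<subseteq> V \<union> C" if v: "v \<in> V" for v
    proof (cases "v \<in> Z")
      case True
      then have "e v = cls (c1 @ [(v, False)])" by (simp add: e_def)
      then show ?thesis using cls_letters[of "c1 @ [(v, False)]"] v c1C by auto
    qed (use v in \<open>auto simp: e_def\<close>)
    show "\<exists>k. ev e k = gen v \<and> fst ` set k \<subseteq> V \<union> C \<and> vcount V k \<le> 1 \<and> ccount V k \<le> length c1" if v: "v \<in> V" for v
    proof (cases "v \<in> Z")
      case True
      have "ev e ([(v, False)] @ c1) = gen v" using True ec[OF c1V] by (simp add: e_def group_simps)
      then show ?thesis using v c1C ccount_const[OF c1V] by (intro exI[of _ "[(v, False)] @ c1"]) auto
    qed (use v in \<open>intro exI[of _ "[(v, True)]"], auto simp: e_def\<close>)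
  qed (use \<theta> \<tau> Y in \<open>simp_all only: C\<close>)
  then show ?thesis unfolding C
  proof (rule generalizable_mono)
    have "length c1 \<le> sum_list (map length bs)" by (simp add: bs_def)
    then have lc: "length c1 \<le> N" unfolding N_def by simp
    assume "V \<noteq> {}"
    then have n: "1 \<le> card V" using V by (metis List.finite_set Suc_le_eq One_nat_def card_gt_0_iff)
    have NN: "ccount V Q + 2 * card V = N" unfolding cN by simp
    have "N \<le> card V * N" using n by simp
    then have i: "1 * (4 * N) + length c1 \<le> 8 * N" "1 * (35 * card V * N) + length c1 \<le> 36 * card V * N"
      using lc unfolding mult.assoc by linarith+
    show "1 * (if xs = [] then 4 * N else 35 * card V * N) + length c1
      \<le> (if xs = [] then 8 * (ccount V Q + 2 * card V) else 36 * card V * (ccount V Q + 2 * card V))"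
      unfolding NN
    proof (cases "xs = []")
      case True
      show "1 * (if xs = [] then 4 * N else 35 * card V * N) + length c1 \<le> (if xs = [] then 8 * N else 36 * card V * N)"
        unfolding if_P[OF True] by (rule i(1))
    next
      case False
      show "1 * (if xs = [] then 4 * N else 35 * card V * N) + length c1 \<le> (if xs = [] then 8 * N else 36 * card V * N)"
        unfolding if_not_P[OF False] by (rule i(2))
    qed
  qed
qed

section \<open>Translation to homomorphisms on carriers, and the finite set of basic
  solutions\<close>

section \<open>Homomorphisms between free groups\<close>

lemma in_free_group: "w \<in> carrier (free_group Y) \<longleftrightarrow> freely_reduced w \<and> fst ` set w \<subseteq> Y"
  by (simp add: free_group_def)

lemma rep_in: "rep a \<in> carrier (free_group Y) \<longleftrightarrow> letters a \<subseteq> Y"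
  by (simp add: in_free_group)

lemma rep_cls_in: "w \<in> carrier (free_group Y) \<Longrightarrow> rep (cls w) = w"
  by (simp add: in_free_group rep_cls)

lemma mult_rep: "rep a \<otimes>\<^bsub>free_group Y\<^esub> rep b = rep (a + b)"
  by (simp add: free_group_def rep_plus)

lemma one_free_group: "\<one>\<^bsub>free_group Y\<^esub> = []"
  by (simp add: free_group_def)

lemma inv_rep: "letters a \<subseteq> Y \<Longrightarrow> inv\<^bsub>free_group Y\<^esub> (rep a) = rep (- a)"
  by (rule group.inv_equality[OF group_free_group]) (simp_all add: mult_rep one_free_group in_free_group)

text \<open>Restricted to the carrier, because homomorphisms are compared as extensional
  functions.\<close>

definition word_hom :: "'a set \<Rightarrow> ('a \<Rightarrow> 'a fgrp) \<Rightarrow> 'a word \<Rightarrow> 'a word" where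
  "word_hom Y h = (\<lambda>w \<in> carrier (free_group Y). rep (ev h w))"

lemma word_hom_in: "w \<in> carrier (free_group Y) \<Longrightarrow> word_hom Y h w = rep (ev h w)"
  by (simp add: word_hom_def)

lemma letters_ev_in: "fst ` set w \<subseteq> Y \<Longrightarrow> (\<And>y. y \<in> Y \<Longrightarrow> letters (h y) \<subseteq> Z) \<Longrightarrow> letters (ev h w) \<subseteq> Z"
proof -
  assume "fst ` set w \<subseteq> Y" "\<And>y. y \<in> Y \<Longrightarrow> letters (h y) \<subseteq> Z"
  then have "(\<Union>x\<in>fst ` set w. letters (h x)) \<subseteq> Z" by blast
  then show ?thesis using letters_ev[of h w] by (rule subset_trans[rotated])
qed

lemma letters_lift_in: "letters a \<subseteq> Y \<Longrightarrow> (\<And>y. y \<in> Y \<Longrightarrow> letters (h y) \<subseteq> Z) \<Longrightarrow> letters (lift h a) \<subseteq> Z"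
  unfolding lift_def by (rule letters_ev_in)

lemma word_hom_hom:
  assumes "A \<subseteq> Y" "\<And>a. a \<in> A \<Longrightarrow> h a = gen a" "\<And>y. y \<in> Y \<Longrightarrow> letters (h y) \<subseteq> Z"
  shows "word_hom Y h \<in> FA_homs A Y Z"
proof -
  have "word_hom Y h \<in> hom (free_group Y) (free_group Z)"
  proof (rule homI)
    fix u assume u: "u \<in> carrier (free_group Y)"
    then show "word_hom Y h u \<in> carrier (free_group Z)" using letters_ev_in[of u Y h Z] assms(3) by (simp add: word_hom_in rep_in in_free_group)
    fix v assume v: "v \<in> carrier (free_group Y)"
    have "u \<otimes>\<^bsub>free_group Y\<^esub> v \<in> carrier (free_group Y)"
      by (rule monoid.m_closed[OF group.is_monoid[OF group_free_group] u v])
    then show "word_hom Y h (u \<otimes>\<^bsub>free_group Y\<^esub> v) = word_hom Y h u \<otimes>\<^bsub>free_group Z\<^esub> word_hom Y h v"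
      using u v by (simp add: word_hom_in mult_rep) (simp add: free_group_def ev_foldr_cons_red)
  qed
  moreover have "word_hom Y h w = w" if w: "w \<in> carrier (free_group A)" for w
  proof -
    have "ev h w = cls w" by (rule ev_cong) (use w assms(2) in \<open>auto simp: in_free_group\<close>)
    moreover have "w \<in> carrier (free_group Y)" using w assms(1) by (auto simp: in_free_group)
    ultimately show ?thesis using rep_cls_in[OF w] by (simp add: word_hom_in)
  qed
  ultimately show ?thesis by (simp add: FA_homs_def word_hom_def)
qed

text \<open>A homomorphism is determined by its values on one-letter words. Outside Y the generator
  map is the identity, as the results on generators expect.\<close>

lemma homs_word_hom:
  assumes \<theta>: "\<theta> \<in> FA_homs A Y Z" and A: "A \<subseteq> Y"
  obtains h where "\<theta> = word_hom Y h" "\<And>a. a \<in> A \<Longrightarrow> h a = gen a" "\<And>y. y \<in> Y \<Longrightarrow> letters (h y) \<subseteq> Z" "\<And>y. y \<notin> Y \<Longrightarrow> h y = gen y"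
proof -
  define h where "h y = (if y \<in> Y then Fg (\<theta> [(y, True)]) else gen y)" for y
  define H where "H w = Fg (\<theta> w)" for w
  have hom: "\<theta> \<in> hom (free_group Y) (free_group Z)" and ext: "\<theta> \<in> extensional (carrier (free_group Y))"
    and fx: "\<And>w. w \<in> carrier (free_group A) \<Longrightarrow> \<theta> w = w" using \<theta> by (auto simp: FA_homs_def)
  have cl: "\<theta> w \<in> carrier (free_group Z)" if "w \<in> carrier (free_group Y)" for w using hom that by (auto simp: hom_def)
  have rH: "rep (H w) = \<theta> w" if "w \<in> carrier (free_group Y)" for w
    using cl[OF that] by (simp add: H_def rep_Fg in_free_group)
  have Hp: "H (foldr cons_red u v) = H u + H v" if u: "u \<in> carrier (free_group Y)" and v: "v \<in> carrier (free_group Y)" for u v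
  proof -
    have "\<theta> (foldr cons_red u v) = foldr cons_red (\<theta> u) (\<theta> v)"
      using hom_mult[OF hom u v] by (simp add: free_group_def)
    then show ?thesis using rH[OF u] rH[OF v] by (simp add: H_def[of "foldr cons_red u v"] plus_fgrp_def)
  qed
  have ltr: "[l] \<in> carrier (free_group Y)" if "fst l \<in> Y" for l using that by (simp add: in_free_group freely_reduced_def)
  have nil: "[] \<in> carrier (free_group Y)" by (simp add: in_free_group)
  have "H [] + 0 = H [] + H []" using Hp[OF nil nil] by simp
  then have H0: "H [] = 0" by (metis add_left_cancel)
  have HT: "H [(y, True)] = h y" if "y \<in> Y" for y using that by (simp add: H_def h_def)
  have HF: "H [(y, False)] = - h y" if "y \<in> Y" for y
  proof -
    have "h y + H [(y, False)] = 0"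
      using Hp[OF ltr[of "(y, True)"] ltr[of "(y, False)"]] that H0 HT[OF that] by (simp add: letter_inv_def)
    then show ?thesis by (metis minus_unique)
  qed
  have Hl: "H [l] = sgn_of h l" if "fst l \<in> Y" for l
    using that HT HF by (cases l; cases "snd l") auto
  have Hev: "H w = ev h w" if "w \<in> carrier (free_group Y)" for w
    using that
  proof (induction w)
    case (Cons l w)
    have l: "fst l \<in> Y" and w: "w \<in> carrier (free_group Y)"
      using Cons.prems by (auto simp: in_free_group dest: freely_reduced_ConsD)
    have "foldr cons_red [l] w = [l] @ w" by (rule foldr_cons_red_reduced) (use Cons.prems in \<open>simp add: in_free_group\<close>)
    then show ?case using Hp[OF ltr[OF l] w] Hl[OF l] Cons.IH[OF w] by simp
  qed (simp add: H0)
  have "\<theta> = word_hom Y h"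
  proof (rule extensionalityI[OF ext])
    show "word_hom Y h \<in> extensional (carrier (free_group Y))" by (simp add: word_hom_def)
    show "\<theta> w = word_hom Y h w" if "w \<in> carrier (free_group Y)" for w
      using rH[OF that] Hev[OF that] that by (simp add: word_hom_in)
  qed
  moreover have "h a = gen a" if "a \<in> A" for a
  proof -
    have "[(a, True)] \<in> carrier (free_group A)" using that by (simp add: in_free_group freely_reduced_def)
    from fx[OF this] show ?thesis using that A by (auto simp: h_def gen_def)
  qed
  moreover have "letters (h y) \<subseteq> Z" if "y \<in> Y" for y
    using cl[OF ltr[of "(y, True)"]] rH[OF ltr[of "(y, True)"]] HT[OF that] that by (simp add: in_free_group)
  ultimately show ?thesis using that by (simp add: h_def)
qed

lemma word_hom_comp:
  assumes "\<And>y. y \<in> Y \<Longrightarrow> letters (\<phi> y) \<subseteq> Y" "\<And>y. y \<in> Y \<Longrightarrow> letters (\<eta> y) \<subseteq> W"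
  shows "comp3 Y (word_hom Y \<phi>) (word_hom Y \<eta>) (word_hom W \<omega>) = word_hom Y (\<lambda>v. lift \<omega> (lift \<eta> (\<phi> v)))"
proof -
  have "word_hom W \<omega> (word_hom Y \<eta> (word_hom Y \<phi> w)) = rep (ev (\<lambda>v. lift \<omega> (lift \<eta> (\<phi> v))) w)" if w: "w \<in> carrier (free_group Y)" for w
  proof -
    have 1: "rep (ev \<phi> w) \<in> carrier (free_group Y)" using letters_ev_in[of w Y \<phi> Y] assms(1) w by (simp add: in_free_group)
    have 2: "rep (lift \<eta> (ev \<phi> w)) \<in> carrier (free_group W)" using letters_lift_in[of "ev \<phi> w" Y \<eta> W] assms(2) 1 by (simp add: in_free_group)
    have "word_hom W \<omega> (word_hom Y \<eta> (word_hom Y \<phi> w)) = rep (lift \<omega> (lift \<eta> (ev \<phi> w)))"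
      using w 1 2 by (simp add: word_hom_in lift_def[symmetric])
    then show ?thesis by (simp add: lift_ev)
  qed
  then show ?thesis unfolding comp3_def word_hom_def[of Y "\<lambda>v. lift \<omega> (lift \<eta> (\<phi> v))"] by (intro restrict_ext)
qed

text \<open>The inverse supplied by \<open>aut_on\<close> is not known to keep the carrier
  invariant. Following it by the retraction \<pi>, which kills all symbols outside the alphabet,
  makes it an inverse on the carrier.\<close>

lemma word_hom_aut:
  assumes a: "aut_on V \<phi>" and d: "A \<inter> V = {}" and l: "\<And>v. v \<in> V \<Longrightarrow> letters (\<phi> v) \<subseteq> A \<union> V"
  shows "word_hom (A \<union> V) \<phi> \<in> FA_auts A (A \<union> V)"
proof -
  let ?Y = "A \<union> V"
  obtain g where g: "aut_on V g" "\<And>a. lift \<phi> (lift g a) = a" "\<And>a. lift g (lift \<phi> a) = a"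
    using aut_on_inverse[OF a] by blast
  have pA: "\<phi> x = gen x" if "x \<in> A" for x using that d by (intro aut_on_fix[OF a]) blast
  have pl: "letters (\<phi> y) \<subseteq> ?Y" if "y \<in> ?Y" for y using that l pA by (cases "y \<in> V") auto
  define \<pi> where "\<pi> x = (if x \<in> ?Y then gen x else 0)" for x
  have \<pi>: "lift \<pi> b = b" if "letters b \<subseteq> ?Y" for b
  proof -
    have "ev \<pi> (rep b) = cls (rep b)" by (rule ev_cong) (use that in \<open>auto simp: \<pi>_def\<close>)
    then show ?thesis by (simp add: lift_def)
  qed
  have \<pi>l: "letters (lift \<pi> b) \<subseteq> ?Y" for b by (rule letters_lift_in[of b UNIV]) (auto simp: \<pi>_def)
  define g' where "g' x = lift \<pi> (g x)" for x
  have comm: "lift \<phi> (lift \<pi> b) = lift \<pi> (lift \<phi> b)" for b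
  proof -
    have "lift \<phi> (\<pi> z) = lift \<pi> (\<phi> z)" for z
    proof (cases "z \<in> ?Y")
      case True
      then show ?thesis using \<pi>[OF pl[OF True]] by (simp add: \<pi>_def)
    next
      case False
      then show ?thesis using aut_on_fix[OF a, of z] by (simp add: \<pi>_def)
    qed
    then show ?thesis by (simp add: lift_lift)
  qed
  have g1: "lift g' (\<phi> x) = gen x" if "x \<in> ?Y" for x
  proof -
    have "lift g (\<phi> x) = gen x" using g(3)[of "gen x"] by simp
    moreover have "lift g' (\<phi> x) = lift \<pi> (lift g (\<phi> x))" unfolding g'_def by (simp add: lift_lift)
    ultimately show ?thesis using that by (simp add: \<pi>_def)
  qed
  have g2: "lift \<phi> (g' x) = gen x" if "x \<in> ?Y" for x
  proof -
    have "lift \<phi> (g x) = gen x" using g(2)[of "gen x"] by simp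
    then show ?thesis using that unfolding g'_def comm by (simp add: \<pi>_def)
  qed
  have h: "word_hom ?Y \<phi> \<in> FA_homs A ?Y ?Y" by (rule word_hom_hom) (use pA pl in auto)
  have bij: "bij_betw (word_hom ?Y \<phi>) (carrier (free_group ?Y)) (carrier (free_group ?Y))"
  proof (rule bij_betw_byWitness[where f' = "word_hom ?Y g'"])
    have c1: "rep (ev \<phi> w) \<in> carrier (free_group ?Y)" if "w \<in> carrier (free_group ?Y)" for w
      using letters_ev_in[of w ?Y \<phi> ?Y] pl that unfolding rep_in by (simp add: in_free_group)
    have c2: "rep (ev g' w) \<in> carrier (free_group ?Y)" for w
      unfolding rep_in
    proof (rule letters_ev_in[of w UNIV])
      show "letters (g' y) \<subseteq> ?Y" for y unfolding g'_def by (rule \<pi>l)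
    qed simp
    show "\<forall>w\<in>carrier (free_group ?Y). word_hom ?Y g' (word_hom ?Y \<phi> w) = w"
    proof
      fix w assume w: "w \<in> carrier (free_group ?Y)"
      have "word_hom ?Y g' (word_hom ?Y \<phi> w) = rep (lift g' (ev \<phi> w))" using w c1[OF w] by (simp add: word_hom_in lift_def)
      also have "lift g' (ev \<phi> w) = cls w" unfolding lift_ev by (rule ev_cong, rule g1) (use w in \<open>auto simp: in_free_group\<close>)
      finally show "word_hom ?Y g' (word_hom ?Y \<phi> w) = w" using rep_cls_in[OF w] by simp
    qed
    show "\<forall>w\<in>carrier (free_group ?Y). word_hom ?Y \<phi> (word_hom ?Y g' w) = w"
    proof
      fix w assume w: "w \<in> carrier (free_group ?Y)"
      have "word_hom ?Y \<phi> (word_hom ?Y g' w) = rep (lift \<phi> (ev g' w))" using w c2[of w] by (simp add: word_hom_in lift_def)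
      also have "lift \<phi> (ev g' w) = cls w" unfolding lift_ev by (rule ev_cong, rule g2) (use w in \<open>auto simp: in_free_group\<close>)
      finally show "word_hom ?Y \<phi> (word_hom ?Y g' w) = w" using rep_cls_in[OF w] by simp
    qed
    show "word_hom ?Y \<phi> ` carrier (free_group ?Y) \<subseteq> carrier (free_group ?Y)" using c1 by (auto simp: word_hom_in)
    show "word_hom ?Y g' ` carrier (free_group ?Y) \<subseteq> carrier (free_group ?Y)" using c2 by (auto simp: word_hom_in)
  qed
  show ?thesis using h bij unfolding FA_auts_def FA_homs_def auto_def Bij_def by simp
qed

lemma auts_homs: "\<phi> \<in> FA_auts A Y \<Longrightarrow> \<phi> \<in> FA_homs A Y Y"
  by (simp add: FA_auts_def FA_homs_def auto_def Bij_def)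

lemma conjugate_inI:
  assumes "Q \<in> carrier (free_group Y)" "letters g \<subseteq> Y"
  shows "conjugate_in (free_group Y) (rep (g + cls Q - g)) Q"
  unfolding conjugate_in_def
proof (rule bexI[where x = "rep (- g)"])
  have "inv\<^bsub>free_group Y\<^esub> rep (- g) \<otimes>\<^bsub>free_group Y\<^esub> Q \<otimes>\<^bsub>free_group Y\<^esub> rep (- g) =
      rep (- (- g)) \<otimes>\<^bsub>free_group Y\<^esub> rep (cls Q) \<otimes>\<^bsub>free_group Y\<^esub> rep (- g)"
    using assms by (simp only: inv_rep letters_simps rep_cls_in)
  then show "rep (g + cls Q - g) = inv\<^bsub>free_group Y\<^esub> rep (- g) \<otimes>\<^bsub>free_group Y\<^esub> Q \<otimes>\<^bsub>free_group Y\<^esub> rep (- g)"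
    by (simp add: mult_rep)
qed (use assms(2) in \<open>simp add: rep_in\<close>)

lemma conjugate_inD:
  assumes "Q \<in> carrier (free_group Y)" "conjugate_in (free_group Y) (rep a) Q"
  obtains g where "a = g + cls Q - g"
proof -
  obtain g where g: "g \<in> carrier (free_group Y)" "rep a = inv\<^bsub>free_group Y\<^esub> g \<otimes>\<^bsub>free_group Y\<^esub> Q \<otimes>\<^bsub>free_group Y\<^esub> g"
    using assms(2) unfolding conjugate_in_def by blast
  have gg: "rep (cls g) = g" and QQ: "rep (cls Q) = Q" by (rule rep_cls_in, fact)+
  have l: "letters (cls g) \<subseteq> Y" using g(1) unfolding gg by (simp add: in_free_group)
  have "rep a = inv\<^bsub>free_group Y\<^esub> (rep (cls g)) \<otimes>\<^bsub>free_group Y\<^esub> rep (cls Q) \<otimes>\<^bsub>free_group Y\<^esub> rep (cls g)"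
    unfolding gg QQ by (rule g(2))
  then have "rep a = rep (- cls g + cls Q + cls g)" unfolding inv_rep[OF l] mult_rep .
  then have "a = (- cls g) + cls Q - (- cls g)" by (simp add: rep_inject)
  then show ?thesis by (rule that)
qed

theorem bounded_solutions:
  fixes A X T :: "'s set"
  assumes AX: "A \<inter> X = {}" and AT: "A \<inter> T = {}" and XT: "X \<inter> T = {}" and Q: "Q \<in> carrier (free_group (A \<union> X))"
    and V: "V = Vars X Q" and \<tau>: "\<tau> ` V \<subseteq> T"
    and G: "\<And>\<theta>. (\<And>x. x \<notin> V \<Longrightarrow> \<theta> x = gen x) \<Longrightarrow> ev \<theta> Q = 0 \<Longrightarrow> (\<And>v. v \<in> V \<Longrightarrow> letters (\<theta> v) \<subseteq> A \<union> T) \<Longrightarrow>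
      generalizable V (fst ` set Q - V) (\<tau> ` V) (A \<union> T) Q B \<theta>"
  shows "(\<forall>\<theta> \<in> param_solutions A X T Q. \<exists>\<eta>. is_generalization A X T Q \<eta> \<theta> \<and> bounded_on_vars X Q B \<eta>) \<and>
    (\<exists>Bs. finite Bs \<and> basic_param_solutions A X T Q Bs \<and> (\<forall>\<eta> \<in> Bs. bounded_on_vars X Q B \<eta>))"
proof -
  define Y where "Y = A \<union> V"
  define C where "C = fst ` set Q - V"
  define U where "U = \<tau> ` V"
  have Vf: "finite V" unfolding V Vars_def by simp
  have VX: "V \<subseteq> X" unfolding V Vars_def by blast
  have AV: "A \<inter> V = {}" using AX VX by blast
  have CA: "C \<subseteq> A" using Q unfolding C_def V Vars_def in_free_group by blast
  have QY: "Q \<in> carrier (free_group Y)" using Q CA unfolding C_def Y_def in_free_group by blast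
  have UT: "U \<subseteq> T" using \<tau> unfolding U_def .
  have AY: "A \<subseteq> Y" unfolding Y_def by blast
  have AVX: "A \<union> Vars X Q = Y" unfolding Y_def V ..
  have one: "\<one>\<^bsub>free_group Z\<^esub> = ([] :: 's word)" for Z by (rule one_free_group)
  have inV: "[(v, True)] \<in> carrier (free_group Y)" if "v \<in> V" for v using that by (simp add: in_free_group freely_reduced_def Y_def)
  \<comment> \<open>All bounded parametric solutions over a finite alphabet at once. A homomorphism
    that fixes A is determined by its values on V, so this set is finite.\<close>
  define E where "E = {\<eta> \<in> param_solutions A X T Q. bounded_on_vars X Q B \<eta> \<and> (\<forall>v\<in>V. fst ` set (\<eta> [(v, True)]) \<subseteq> U \<union> C)}"
  have main: "\<exists>\<eta>\<in>E. \<exists>\<phi>\<in>Stab A X Q. \<exists>\<omega>. (\<forall>a\<in>A. \<omega> a = gen a) \<and> (\<forall>y\<in>A \<union> T. letters (\<omega> y) \<subseteq> A \<union> T) \<and> \<theta> = comp3 Y \<phi> \<eta> (word_hom (A \<union> T) \<omega>)"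
    if \<theta>: "\<theta> \<in> param_solutions A X T Q" for \<theta>
  proof -
    have \<theta>h: "\<theta> \<in> FA_homs A Y (A \<union> T)" and \<theta>Q: "\<theta> Q = []" using \<theta> unfolding param_solutions_def AVX one by auto
    obtain h where h: "\<theta> = word_hom Y h" "\<And>a. a \<in> A \<Longrightarrow> h a = gen a" "\<And>y. y \<in> Y \<Longrightarrow> letters (h y) \<subseteq> A \<union> T" "\<And>y. y \<notin> Y \<Longrightarrow> h y = gen y"
      using homs_word_hom[OF \<theta>h AY] by blast
    have hV: "h x = gen x" if "x \<notin> V" for x using h(2,4) that unfolding Y_def by blast
    have hQ: "ev h Q = 0" using \<theta>Q unfolding h(1) word_hom_in[OF QY] by simp
    have "generalizable V C U (A \<union> T) Q B h" unfolding C_def U_def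
      by (rule G[OF hV hQ h(3)]) (simp_all add: Y_def)
    then obtain \<phi> \<eta> \<omega> g where g: "aut_on V \<phi>" "\<forall>v\<in>V. letters (\<phi> v) \<subseteq> V \<union> C"
     "\<forall>x. x \<notin> V \<longrightarrow> \<eta> x = gen x" "ev \<eta> Q = 0" "\<forall>v\<in>V. len (\<eta> v) \<le> B \<and> letters (\<eta> v) \<subseteq> U \<union> C"
     "\<forall>y. y \<notin> U \<longrightarrow> \<omega> y = gen y" "\<forall>y\<in>U. letters (\<omega> y) \<subseteq> A \<union> T" "\<forall>v\<in>V. h v = lift \<omega> (lift \<eta> (\<phi> v))"
     "letters g \<subseteq> V \<union> C" "ev \<phi> Q = g + cls Q - g" by (rule generalizableE)
    have \<phi>A: "\<phi> a = gen a" if "a \<in> A" for a using that AV by (intro aut_on_fix[OF g(1)]) blast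
    have \<phi>l: "letters (\<phi> y) \<subseteq> Y" if "y \<in> Y" for y
    proof (cases "y \<in> V")
      case True
      then show ?thesis using g(2) CA unfolding Y_def by blast
    next
      case False
      then show ?thesis using that \<phi>A[of y] unfolding Y_def by simp
    qed
    have \<eta>A: "\<eta> a = gen a" if "a \<in> A" for a using that AV g(3) by blast
    have \<eta>l: "letters (\<eta> y) \<subseteq> A \<union> T" if "y \<in> Y" for y
    proof (cases "y \<in> V")
      case True
      then have "letters (\<eta> y) \<subseteq> U \<union> C" using g(5) by blast
      then show ?thesis using CA UT by blast
    next
      case False
      then show ?thesis using that \<eta>A[of y] unfolding Y_def by simp
    qed
    have \<omega>A: "\<omega> a = gen a" if "a \<in> A" for a
    proof -
      have "a \<notin> U" using that UT AT by blast
      then show ?thesis using g(6) by blast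
    qed
    have \<omega>l: "letters (\<omega> y) \<subseteq> A \<union> T" if "y \<in> A \<union> T" for y
    proof (cases "y \<in> U")
      case False
      then have "\<omega> y = gen y" using g(6) by blast
      then show ?thesis using that by simp
    qed (use g(7) in blast)
    have S: "word_hom Y \<phi> \<in> Stab A X Q"
    proof -
      have "word_hom Y \<phi> \<in> FA_auts A Y" unfolding Y_def by (rule word_hom_aut[OF g(1) AV]) (use \<phi>l Y_def in blast)
      moreover have "letters g \<subseteq> Y" using g(9) CA unfolding Y_def by blast
      then have "conjugate_in (free_group Y) (word_hom Y \<phi> Q) Q" unfolding word_hom_in[OF QY] g(10) by (rule conjugate_inI[OF QY])
      ultimately show ?thesis unfolding Stab_def AVX by blast
    qed
    have P: "word_hom Y \<eta> \<in> param_solutions A X T Q" unfolding param_solutions_def AVX one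
      using word_hom_hom[OF AY \<eta>A \<eta>l] g(4) by (simp add: word_hom_in[OF QY])
    have eqv: "word_hom Y \<eta> [(v, True)] = rep (\<eta> v)" if "v \<in> V" for v using inV[OF that] by (simp add: word_hom_in)
    have "word_hom Y \<eta> \<in> E" unfolding E_def bounded_on_vars_def V[symmetric] using P g(5) eqv by (simp add: len_def)
    moreover have "\<theta> = comp3 Y (word_hom Y \<phi>) (word_hom Y \<eta>) (word_hom (A \<union> T) \<omega>)"
    proof -
      have "h v = lift \<omega> (lift \<eta> (\<phi> v))" if "v \<in> Y" for v
      proof (cases "v \<in> V")
        case False
        then have "v \<in> A" using that unfolding Y_def by blast
        then show ?thesis using h(2) \<phi>A \<eta>A \<omega>A by simp
      qed (use g(8) in blast)
      then have "ev h w = ev (\<lambda>v. lift \<omega> (lift \<eta> (\<phi> v))) w" if "w \<in> carrier (free_group Y)" for w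
        using that by (intro ev_cong) (auto simp: in_free_group)
      then have "word_hom Y h = word_hom Y (\<lambda>v. lift \<omega> (lift \<eta> (\<phi> v)))" unfolding word_hom_def by (intro restrict_ext) simp
      moreover have "comp3 Y (word_hom Y \<phi>) (word_hom Y \<eta>) (word_hom (A \<union> T) \<omega>) = word_hom Y (\<lambda>v. lift \<omega> (lift \<eta> (\<phi> v)))"
        by (rule word_hom_comp) (erule \<phi>l \<eta>l)+
      ultimately show ?thesis unfolding h(1) by simp
    qed
    ultimately show ?thesis using S \<omega>A \<omega>l by blast
  qed
  have homsub: "FA_homs A Y A \<subseteq> FA_homs A Y (A \<union> T)"
  proof
    fix \<alpha> assume "\<alpha> \<in> FA_homs A Y A"
    then obtain h where h: "\<alpha> = word_hom Y h" "\<And>a. a \<in> A \<Longrightarrow> h a = gen a" "\<And>y. y \<in> Y \<Longrightarrow> letters (h y) \<subseteq> A"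
      using homs_word_hom[OF _ AY] by metis
    show "\<alpha> \<in> FA_homs A Y (A \<union> T)" unfolding h(1) by (rule word_hom_hom[OF AY h(2)]) (use h(3) in blast)+
  qed
  have gen: "\<exists>\<eta>. is_generalization A X T Q \<eta> \<theta> \<and> bounded_on_vars X Q B \<eta>" if \<theta>: "\<theta> \<in> param_solutions A X T Q" for \<theta>
  proof -
    obtain \<eta> \<phi> \<omega> where m: "\<eta> \<in> E" "\<phi> \<in> Stab A X Q" "\<And>a. a \<in> A \<Longrightarrow> \<omega> a = gen a" "\<And>y. y \<in> A \<union> T \<Longrightarrow> letters (\<omega> y) \<subseteq> A \<union> T"
      "\<theta> = comp3 Y \<phi> \<eta> (word_hom (A \<union> T) \<omega>)" using main[OF \<theta>] by blast
    have "word_hom (A \<union> T) \<omega> \<in> FA_homs A (A \<union> T) (A \<union> T)" by (rule word_hom_hom[OF _ m(3,4)]) auto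
    then show ?thesis using m(1,2,5) \<theta> unfolding is_generalization_def AVX E_def by blast
  qed
  have "finite E"
  proof -
    define F where "F \<eta> = restrict (\<lambda>v. \<eta> [(v, True)]) V" for \<eta> :: "'s word \<Rightarrow> 's word"
    define L where "L = {w :: 's word. set w \<subseteq> (U \<union> C) \<times> UNIV \<and> length w \<le> B}"
    have "finite ((U \<union> C) \<times> (UNIV :: bool set))" using Vf unfolding U_def C_def by simp
    then have "finite L" unfolding L_def by (rule finite_lists_length_le)
    then have "finite (V \<rightarrow>\<^sub>E L)" using Vf by (intro finite_PiE)
    moreover have "F ` E \<subseteq> V \<rightarrow>\<^sub>E L"
    proof
      fix k assume "k \<in> F ` E"
      then obtain \<eta> where e: "\<eta> \<in> E" "k = F \<eta>" by blast
      have "\<eta> [(v, True)] \<in> L" if "v \<in> V" for v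
      proof -
        have 1: "length (\<eta> [(v, True)]) \<le> B" using e(1) that unfolding E_def bounded_on_vars_def V[symmetric] by blast
        have "fst ` set (\<eta> [(v, True)]) \<subseteq> U \<union> C" using e(1) that unfolding E_def by blast
        then have "set (\<eta> [(v, True)]) \<subseteq> (U \<union> C) \<times> UNIV" by (auto simp: subset_iff image_iff)
        then show ?thesis using 1 unfolding L_def by blast
      qed
      then show "k \<in> V \<rightarrow>\<^sub>E L" unfolding e(2) F_def by auto
    qed
    moreover have "inj_on F E"
    proof (rule inj_onI)
      fix \<eta>1 \<eta>2 assume e: "\<eta>1 \<in> E" "\<eta>2 \<in> E" "F \<eta>1 = F \<eta>2"
      have H: "\<eta>1 \<in> FA_homs A Y (A \<union> T)" "\<eta>2 \<in> FA_homs A Y (A \<union> T)" using e(1,2) unfolding E_def param_solutions_def AVX by blast+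
      obtain h1 where h1: "\<eta>1 = word_hom Y h1" "\<And>a. a \<in> A \<Longrightarrow> h1 a = gen a" using homs_word_hom[OF H(1) AY] by metis
      obtain h2 where h2: "\<eta>2 = word_hom Y h2" "\<And>a. a \<in> A \<Longrightarrow> h2 a = gen a" using homs_word_hom[OF H(2) AY] by metis
      have "h1 v = h2 v" if v: "v \<in> Y" for v
      proof (cases "v \<in> V")
        case True
        have "\<eta>1 [(v, True)] = \<eta>2 [(v, True)]" using fun_cong[OF e(3), of v] True unfolding F_def by simp
        then show ?thesis unfolding h1(1) h2(1) using inV[OF True] by (simp add: word_hom_in rep_inject)
      next
        case False
        then show ?thesis using v h1(2) h2(2) unfolding Y_def by simp
      qed
      then have "ev h1 w = ev h2 w" if "w \<in> carrier (free_group Y)" for w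
        using that by (intro ev_cong) (auto simp: in_free_group)
      then show "\<eta>1 = \<eta>2" unfolding h1(1) h2(1) word_hom_def by (intro restrict_ext) simp
    qed
    ultimately show ?thesis by (meson finite_imageD finite_subset)
  qed
  moreover have "basic_param_solutions A X T Q E"
    unfolding basic_param_solutions_def
  proof (intro conjI subset_antisym subsetI)
    fix \<alpha> assume "\<alpha> \<in> solutions A X Q"
    then have \<alpha>: "\<alpha> \<in> FA_homs A Y A" "\<alpha> Q = []" unfolding solutions_def AVX one by auto
    then have "\<alpha> \<in> param_solutions A X T Q" using homsub unfolding param_solutions_def AVX one by blast
    from main[OF this] obtain \<eta> \<phi> \<omega> where m: "\<eta> \<in> E" "\<phi> \<in> Stab A X Q" "\<And>a. a \<in> A \<Longrightarrow> \<omega> a = gen a" "\<And>y. y \<in> A \<union> T \<Longrightarrow> letters (\<omega> y) \<subseteq> A \<union> T"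
      "\<alpha> = comp3 Y \<phi> \<eta> (word_hom (A \<union> T) \<omega>)" by blast
    \<comment> \<open>A solution is in particular a parametric solution, but the \<omega> found for
      it may produce parameters. Deleting them afterwards changes nothing, because the values of
      \<alpha> contain no parameters.\<close>
    define \<kappa> where "\<kappa> y = (if y \<in> A then gen y else 0)" for y :: 's
    define \<omega>' where "\<omega>' y = lift \<kappa> (\<omega> y)" for y
    have "letters (lift \<kappa> a) \<subseteq> A" for a by (rule letters_lift_in[of a UNIV]) (auto simp: \<kappa>_def)
    then have O: "word_hom (A \<union> T) \<omega>' \<in> FA_homs A (A \<union> T) A"
      by (intro word_hom_hom) (auto simp: \<omega>'_def m(3) \<kappa>_def)
    have "word_hom (A \<union> T) \<omega> (\<eta> (\<phi> w)) = word_hom (A \<union> T) \<omega>' (\<eta> (\<phi> w))" if w: "w \<in> carrier (free_group Y)" for w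
    proof -
      have "\<phi> \<in> hom (free_group Y) (free_group Y)" using m(2) auts_homs unfolding Stab_def AVX FA_homs_def by blast
      moreover have "\<eta> \<in> hom (free_group Y) (free_group (A \<union> T))" using m(1) unfolding E_def param_solutions_def AVX FA_homs_def by blast
      ultimately have u: "\<eta> (\<phi> w) \<in> carrier (free_group (A \<union> T))" using w by (meson hom_in_carrier)
      have "\<alpha> w = rep (ev \<omega> (\<eta> (\<phi> w)))" using w u unfolding m(5) comp3_def by (simp add: word_hom_in)
      moreover have "\<alpha> w \<in> carrier (free_group A)" using \<alpha>(1) w unfolding FA_homs_def by (auto intro: hom_in_carrier)
      ultimately have "letters (ev \<omega> (\<eta> (\<phi> w))) \<subseteq> A" by (simp add: in_free_group)
      then have "ev \<kappa> (rep (ev \<omega> (\<eta> (\<phi> w)))) = cls (rep (ev \<omega> (\<eta> (\<phi> w))))" by (intro ev_cong) (auto simp: \<kappa>_def)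
      then have "lift \<kappa> (ev \<omega> (\<eta> (\<phi> w))) = ev \<omega> (\<eta> (\<phi> w))" by (simp add: lift_def)
      then have "ev \<omega>' (\<eta> (\<phi> w)) = ev \<omega> (\<eta> (\<phi> w))" unfolding \<omega>'_def by (simp add: lift_ev)
      then show ?thesis using u by (simp add: word_hom_in)
    qed
    then have "\<alpha> = comp3 Y \<phi> \<eta> (word_hom (A \<union> T) \<omega>')" unfolding m(5) comp3_def by (intro restrict_ext)
    then show "\<alpha> \<in> (\<Union>\<eta>\<in>E. Sol A X T Q \<eta>)" using m(1,2) O unfolding Sol_def AVX by blast
  next
    fix \<alpha> assume "\<alpha> \<in> (\<Union>\<eta>\<in>E. Sol A X T Q \<eta>)"
    then obtain \<eta> \<phi> \<omega> where m: "\<eta> \<in> E" "\<phi> \<in> Stab A X Q" "\<omega> \<in> FA_homs A (A \<union> T) A" "\<alpha> = comp3 Y \<phi> \<eta> \<omega>"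
      unfolding Sol_def AVX by blast
    have \<phi>: "\<phi> \<in> FA_homs A Y Y" "conjugate_in (free_group Y) (\<phi> Q) Q" using m(2) auts_homs unfolding Stab_def AVX by blast+
    have \<eta>: "\<eta> \<in> FA_homs A Y (A \<union> T)" "\<eta> Q = []" using m(1) unfolding E_def param_solutions_def AVX one by blast+
    obtain p where p: "\<phi> = word_hom Y p" "\<And>a. a \<in> A \<Longrightarrow> p a = gen a" "\<And>y. y \<in> Y \<Longrightarrow> letters (p y) \<subseteq> Y" using homs_word_hom[OF \<phi>(1) AY] by metis
    obtain e where e: "\<eta> = word_hom Y e" "\<And>a. a \<in> A \<Longrightarrow> e a = gen a" "\<And>y. y \<in> Y \<Longrightarrow> letters (e y) \<subseteq> A \<union> T" using homs_word_hom[OF \<eta>(1) AY] by metis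
    obtain q where q: "\<omega> = word_hom (A \<union> T) q" "\<And>a. a \<in> A \<Longrightarrow> q a = gen a" "\<And>y. y \<in> A \<union> T \<Longrightarrow> letters (q y) \<subseteq> A"
      using homs_word_hom[OF m(3)] by (metis Un_upper1)
    have \<alpha>: "\<alpha> = word_hom Y (\<lambda>v. lift q (lift e (p v)))" unfolding m(4) p(1) e(1) q(1) by (rule word_hom_comp[OF p(3) e(3)])
    have "\<alpha> \<in> FA_homs A Y A" unfolding \<alpha>
    proof (rule word_hom_hom[OF AY])
      show "lift q (lift e (p a)) = gen a" if "a \<in> A" for a using that p(2) e(2) q(2) by simp
      show "letters (lift q (lift e (p y))) \<subseteq> A" if "y \<in> Y" for y
        by (rule letters_lift_in[OF letters_lift_in[OF p(3)[OF that] e(3)] q(3)])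
    qed
    moreover have "\<alpha> Q = []"
    proof -
      obtain g where g: "ev p Q = g + cls Q - g"
        using conjugate_inD[OF QY] \<phi>(2) unfolding p(1) word_hom_in[OF QY] by metis
      have "ev e Q = 0" using \<eta>(2) unfolding e(1) word_hom_in[OF QY] by simp
      then have "lift e (ev p Q) = 0" unfolding g by simp
      then have "ev (\<lambda>v. lift q (lift e (p v))) Q = 0" by (simp flip: lift_ev)
      then show ?thesis unfolding \<alpha> word_hom_in[OF QY] by simp
    qed
    ultimately show "\<alpha> \<in> solutions A X Q" unfolding solutions_def AVX one by blast
  qed (simp add: E_def)
  ultimately show ?thesis using gen by (auto simp: E_def)
qed

theorem theorem1p2:
  fixes A X T :: "'s set" and Q :: "'s word"
  assumes "A \<inter> X = {}" and "A \<inter> T = {}" and "X \<inter> T = {}"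
    and "countable X" and "infinite X" and "infinite T"
    and "quadratic_word A X Q"
  defines "n \<equiv> nvars X Q" and "c \<equiv> coeff_length A Q"
  defines "general_bound \<equiv>
      (if orientable X Q then 40 * n * (c + 2 * n) else 150 * n ^ 2 * (c + 2 * n))"
  shows
    "(\<forall>\<theta> \<in> param_solutions A X T Q. \<exists>\<eta>.
        is_generalization A X T Q \<eta> \<theta> \<and> bounded_on_vars X Q general_bound \<eta>) \<and>
     (standard_orientable A X Q \<longrightarrow>
       (\<forall>\<theta> \<in> param_solutions A X T Q. \<exists>\<eta>.
          is_generalization A X T Q \<eta> \<theta> \<and> bounded_on_vars X Q (8 * (c + 2 * n)) \<eta>)) \<and>
     (semistandard_nonorientable A X Q \<longrightarrow>
       (\<forall>\<theta> \<in> param_solutions A X T Q. \<exists>\<eta>.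
          is_generalization A X T Q \<eta> \<theta> \<and> bounded_on_vars X Q (36 * n * (c + 2 * n)) \<eta>)) \<and>
     (\<exists>B. finite B \<and> basic_param_solutions A X T Q B \<and>
          (\<forall>\<eta> \<in> B. bounded_on_vars X Q general_bound \<eta>)) \<and>
     (standard_orientable A X Q \<longrightarrow>
       (\<exists>B. finite B \<and> basic_param_solutions A X T Q B \<and>
            (\<forall>\<eta> \<in> B. bounded_on_vars X Q (8 * (c + 2 * n)) \<eta>))) \<and>
     (semistandard_nonorientable A X Q \<longrightarrow>
       (\<exists>B. finite B \<and> basic_param_solutions A X T Q B \<and>
            (\<forall>\<eta> \<in> B. bounded_on_vars X Q (36 * n * (c + 2 * n)) \<eta>)))"
proof -
  define V where "V = Vars X Q"
  have Q: "Q \<in> carrier (free_group (A \<union> X))" and q: "\<And>x. x \<in> V \<Longrightarrow> count_list Q (x, True) + count_list Q (x, False) = 2"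
    using assms(7) unfolding quadratic_word_def V_def by auto
  have Vf: "finite V" unfolding V_def Vars_def by simp
  have VX: "V \<subseteq> X" unfolding V_def Vars_def by blast
  have cnt: "count (symbols Q) x = 2" if "x \<in> V" for x using q[OF that] unfolding count_symbols unfolding count_mset .
  \<comment> \<open>One parameter for each variable; this is where T being infinite enters.\<close>
  obtain \<tau> where \<tau>: "inj_on \<tau> V" "\<tau> ` V \<subseteq> T"
  proof -
    obtain W where "W \<subseteq> T" "finite W" "card W = card V" using infinite_arbitrarily_large[OF assms(6)] by metis
    then show ?thesis using Vf that by (metis bij_betw_def finite_same_card_bij)
  qed
  have CA: "fst ` set Q - V \<subseteq> A" using Q unfolding in_free_group V_def Vars_def by blast
  have \<tau>C: "\<tau> ` V \<inter> (fst ` set Q - V) = {}" using \<tau>(2) CA assms(2) by blast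
  have CY: "fst ` set Q - V \<subseteq> A \<union> T" using CA by blast
  have n: "n = card V" by (simp add: n_def nvars_def V_def)
  have c: "c = ccount V Q"
  proof -
    have "fst l \<in> A \<longleftrightarrow> fst l \<notin> V" if "l \<in> set Q" for l
    proof -
      have "fst l \<in> A \<union> X" "fst l \<in> fst ` set Q" using Q that unfolding in_free_group by blast+
      then show ?thesis using CA VX assms(1) by blast
    qed
    then have "filter (\<lambda>l. fst l \<in> A) Q = filter (\<lambda>l. fst l \<notin> V) Q" by (intro filter_cong) auto
    then show ?thesis unfolding c_def coeff_length_def ccount_def by simp
  qed
  have o: "orientable X Q \<longleftrightarrow> oriented V Q"
  proof -
    have "count_list Q (x, True) = 1 \<and> count_list Q (x, False) = 1 \<longleftrightarrow>
        count_list Q (x, True) = count_list Q (x, False) \<and> count_list Q (x, True) \<le> 1" if "x \<in> V" for x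
      using q[OF that] by arith
    then show ?thesis unfolding orientable_def oriented_def V_def[symmetric] count_mset by blast
  qed
  note bs = bounded_solutions[OF assms(1-3) Q V_def \<tau>(2)]
  have gb: "general_bound = (if oriented V Q then 40 * card V * (ccount V Q + 2 * card V) else 150 * card V ^ 2 * (ccount V Q + 2 * card V))"
    unfolding general_bound_def o n c ..
  have 1: "(\<forall>\<theta> \<in> param_solutions A X T Q. \<exists>\<eta>. is_generalization A X T Q \<eta> \<theta> \<and> bounded_on_vars X Q general_bound \<eta>) \<and>
    (\<exists>Bs. finite Bs \<and> basic_param_solutions A X T Q Bs \<and> (\<forall>\<eta> \<in> Bs. bounded_on_vars X Q general_bound \<eta>))"
  proof (rule bs)
    fix \<theta> :: "'s \<Rightarrow> 's fgrp"
    assume "\<And>x. x \<notin> V \<Longrightarrow> \<theta> x = gen x" "ev \<theta> Q = 0" "\<And>v. v \<in> V \<Longrightarrow> letters (\<theta> v) \<subseteq> A \<union> T"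
    then show "generalizable V (fst ` set Q - V) (\<tau> ` V) (A \<union> T) Q general_bound \<theta>"
      unfolding gb by (intro generalizable_general Vf cnt \<tau>(1) \<tau>C CY)
  qed
  \<comment> \<open>All standard shapes at once: an empty \<open>xs\<close> is the orientable
    case.\<close>
  have std: "(\<forall>\<theta> \<in> param_solutions A X T Q. \<exists>\<eta>. is_generalization A X T Q \<eta> \<theta> \<and> bounded_on_vars X Q B \<eta>) \<and>
    (\<exists>Bs. finite Bs \<and> basic_param_solutions A X T Q Bs \<and> (\<forall>\<eta> \<in> Bs. bounded_on_vars X Q B \<eta>))"
    if d: "distinct (xs @ map fst ps @ map snd ps @ map fst zcs)" "set (xs @ map fst ps @ map snd ps @ map fst zcs) \<subseteq> X"
      and k: "\<And>b. b \<in> insert c1 (snd ` set zcs) \<Longrightarrow> fst ` set b \<subseteq> A"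
      and Qe: "Q = squares xs @ commutators ps @ coeff_part c1 zcs"
      and B: "B = (if xs = [] then 8 * (c + 2 * n) else 36 * n * (c + 2 * n))" for xs ps zcs c1 B
  proof (rule bs)
    have lc: "fst ` set (coeff_part c1 zs) = fst ` set c1 \<union> fst ` set zs \<union> (\<Union>b\<in>snd ` set zs. fst ` set b)" for zs
    proof (induction zs)
      case (Cons z zs)
      obtain y b where z: "z = (y, b)" by (cases z)
      have "fst ` set (coeff_part c1 (z # zs)) = fst ` set (coeff_part c1 zs) \<union> insert y (fst ` set b)"
        unfolding z by (simp add: coeff_part_def image_Un) blast
      then show ?case unfolding Cons.IH z by simp blast
    qed (simp add: coeff_part_def)
    have lQ: "fst ` set Q = set (xs @ map fst ps @ map snd ps @ map fst zcs) \<union> (\<Union>b\<in>insert c1 (snd ` set zcs). fst ` set b)"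
      unfolding Qe set_append image_Un squares_letters commutators_letters lc set_map by blast
    have kA: "(\<Union>b\<in>insert c1 (snd ` set zcs). fst ` set b) \<inter> X = {}" using k assms(1) by blast
    have Ve: "V = set (xs @ map fst ps @ map snd ps @ map fst zcs)"
      unfolding V_def Vars_def lQ using d(2) kA by blast
    have nw: "normal_word V xs ps zcs c1"
    proof
      show "fst ` set b \<inter> V = {}" if "b \<in> insert c1 (snd ` set zcs)" for b using k[OF that] VX assms(1) by blast
    qed (use d(1) Ve in simp_all)
    fix \<theta> :: "'s \<Rightarrow> 's fgrp"
    assume "\<And>x. x \<notin> V \<Longrightarrow> \<theta> x = gen x" "ev \<theta> Q = 0" "\<And>v. v \<in> V \<Longrightarrow> letters (\<theta> v) \<subseteq> A \<union> T"
    then show "generalizable V (fst ` set Q - V) (\<tau> ` V) (A \<union> T) Q B \<theta>"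
      unfolding B n c by (intro generalizable_standard[OF nw Qe] \<tau>(1) \<tau>C CY)
  qed
  have nc: "fst ` set b \<subseteq> A" if "nontrivial_coeff A b" for b
    using that unfolding nontrivial_coeff_def in_free_group by blast
  have 2: "(\<forall>\<theta> \<in> param_solutions A X T Q. \<exists>\<eta>. is_generalization A X T Q \<eta> \<theta> \<and> bounded_on_vars X Q (8 * (c + 2 * n)) \<eta>) \<and>
    (\<exists>Bs. finite Bs \<and> basic_param_solutions A X T Q Bs \<and> (\<forall>\<eta> \<in> Bs. bounded_on_vars X Q (8 * (c + 2 * n)) \<eta>))"
    if s: "standard_orientable A X Q"
    using s unfolding standard_orientable_def
  proof (elim disjE exE conjE)
    fix ps assume "distinct (map fst ps @ map snd ps)" "set (map fst ps @ map snd ps) \<subseteq> X" "Q = commutators ps"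
    \<comment> \<open>A word without coefficients is the case of an empty first coefficient and no
      conjugates.\<close>
    then show ?thesis by (intro std[of "[]" ps "[]" "[]"]) (simp_all add: coeff_part_def)
  next
    fix ps c1 zcs assume "distinct (map fst ps @ map snd ps @ map fst zcs)" "set (map fst ps @ map snd ps @ map fst zcs) \<subseteq> X"
      "\<forall>c\<in>insert c1 (snd ` set zcs). nontrivial_coeff A c" "Q = commutators ps @ coeff_part c1 zcs"
    note a = this
    have kk: "fst ` set b \<subseteq> A" if "b \<in> insert c1 (snd ` set zcs)" for b using nc that a by blast
    show ?thesis by (rule std[of "[]" ps zcs c1, OF _ _ kk]) (use a in simp_all)
  qed
  have 3: "(\<forall>\<theta> \<in> param_solutions A X T Q. \<exists>\<eta>. is_generalization A X T Q \<eta> \<theta> \<and> bounded_on_vars X Q (36 * n * (c + 2 * n)) \<eta>) \<and>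
    (\<exists>Bs. finite Bs \<and> basic_param_solutions A X T Q Bs \<and> (\<forall>\<eta> \<in> Bs. bounded_on_vars X Q (36 * n * (c + 2 * n)) \<eta>))"
    if s: "semistandard_nonorientable A X Q"
    using s unfolding semistandard_nonorientable_def
  proof (elim disjE exE conjE)
    fix xs ps assume "xs \<noteq> []" "distinct (xs @ map fst ps @ map snd ps)" "set (xs @ map fst ps @ map snd ps) \<subseteq> X" "Q = squares xs @ commutators ps"
    then show ?thesis by (intro std[of xs ps "[]" "[]"]) (simp_all add: coeff_part_def)
  next
    fix xs ps c1 zcs assume "xs \<noteq> []" "distinct (xs @ map fst ps @ map snd ps @ map fst zcs)" "set (xs @ map fst ps @ map snd ps @ map fst zcs) \<subseteq> X"
      "\<forall>c\<in>insert c1 (snd ` set zcs). nontrivial_coeff A c" "Q = squares xs @ commutators ps @ coeff_part c1 zcs"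
    note a = this
    have kk: "fst ` set b \<subseteq> A" if "b \<in> insert c1 (snd ` set zcs)" for b using nc that a by blast
    show ?thesis by (rule std[of xs ps zcs c1, OF _ _ kk]) (use a in simp_all)
  qed
  show ?thesis using 1 2 3 by blast
qed

end
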